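(* Let $f:\mathbb R\to\mathbb R$ be a $C^\infty$ function such that $f$ and all its derivatives have moderate growth, and let $\{B_t,t\ge0\}$ be a fractional Brownian motion with Hurst parameter $H=1/10$. For $t\ge0$ and integers $n\ge2$ define $$S_n^S(t)=\sum_{j=0}^{\lfloor nt\rfloor-1}\frac16\left(f'(B_{j/n})+4f'\!\left(\tfrac{B_{j/n}+B_{(j+1)/n}}{2}\right)+f'(B_{(j+1)/n})\right)\left(B_{(j+1)/n}-B_{j/n}\right).$$ Then, as $n\to\infty$, $$\left(B_t,S_n^S(t)\right)\xrightarrow{\ \mathcal L\ }\left(B_t,\ f(B_t)-f(0)+\frac{\beta}{2^5\cdot 90}\int_0^tf^{(5)}(B_s)\,dW_s\right),$$ where $W=\{W_t,t\ge0\}$ is a standard Brownian motion independent of $B$, and $\beta=\sqrt{5!\,2^{-5}\kappa_5+75\kappa_3}$ with $$\kappa_5=\sum_{p\in\mathbb Z}\left(|p+1|^{1/5}-2|p|^{1/5}+|p-1|^{1/5}\right)^5,\qquad \kappa_3=\sum_{p\in\mathbb Z}\left(|p+1|^{1/5}-2|p|^{1/5}+|p-1|^{1/5}\right)^3.$$ Consequently, writing $\int_0^tf'(B_s)\,d^SB_s$ for the weak limit of $S_n^S(t)$, one has $f(B_t)\stackrel{\mathcal L}{=}f(0)+\int_0^tf'(B_s)\,d^SB_s-\frac{\beta}{2880}\int_0^tf^{(5)}(B_s)\,dW_s$.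
   Context: Fractional Brownian motion with Hurst parameter $H$: centered Gaussian process with $E[B_sB_t]=\frac12(s^{2H}+t^{2H}-|t-s|^{2H})$. A function $g$ has moderate growth if $|g(x)|\le Ae^{B|x|^\alpha}$ for some constants $A,B$ and $\alpha<2$. Note $2^5\cdot 90=2880$. *)

theory Defs
  imports "HOL-Probability.Probability"
begin

definition smooth_real :: "(real \<Rightarrow> real) \<Rightarrow> bool" where
  "smooth_real f \<longleftrightarrow> (\<forall>k x. ((deriv ^^ k) f) differentiable (at x))"

definition moderate_growth :: "(real \<Rightarrow> real) \<Rightarrow> bool" where
  "moderate_growth g \<longleftrightarrow>
     (\<exists>A B \<alpha>::real. \<alpha> < 2 \<and> (\<forall>x. \<bar>g x\<bar> \<le> A * exp (B * \<bar>x\<bar> powr \<alpha>)))"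

definition centered_gaussian :: "'a measure \<Rightarrow> ('a \<Rightarrow> real) \<Rightarrow> real \<Rightarrow> bool" where
  "centered_gaussian M X v \<longleftrightarrow>
     (if v = 0 then (AE \<omega> in M. X \<omega> = 0)
      else v > 0 \<and> distributed M lborel X (\<lambda>x. ennreal (normal_density 0 (sqrt v) x)))"

text \<open>Fractional Brownian motion with Hurst parameter H on [0,\<infinity>):
  centered Gaussian process (every finite linear combination is centered
  Gaussian with the variance given by the covariance) with continuous paths.
  For H = 1/2 this is standard Brownian motion.\<close>
definition fbm_cov :: "real \<Rightarrow> real \<Rightarrow> real \<Rightarrow> real" where
  "fbm_cov H s t = (s powr (2*H) + t powr (2*H) - \<bar>t - s\<bar> powr (2*H)) / 2"

definition fbm :: "real \<Rightarrow> 'a measure \<Rightarrow> (real \<Rightarrow> 'a \<Rightarrow> real) \<Rightarrow> bool" where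
  "fbm H M B \<longleftrightarrow> prob_space M \<and>
     (\<forall>t\<ge>0. B t \<in> borel_measurable M) \<and>
     (\<forall>\<omega>\<in>space M. continuous_on {0..} (\<lambda>t. B t \<omega>)) \<and>
     (\<forall>(n::nat) (ts::nat \<Rightarrow> real) (c::nat \<Rightarrow> real). (\<forall>i<n. ts i \<ge> 0) \<longrightarrow>
        centered_gaussian M (\<lambda>\<omega>. \<Sum>i<n. c i * B (ts i) \<omega>)
          (\<Sum>i<n. \<Sum>j<n. c i * c j * fbm_cov H (ts i) (ts j)))"

definition indep_processes :: "'a measure \<Rightarrow> (real \<Rightarrow> 'a \<Rightarrow> real) \<Rightarrow> (real \<Rightarrow> 'a \<Rightarrow> real) \<Rightarrow> bool" where
  "indep_processes M X Y \<longleftrightarrow>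
     prob_space.indep_var M (Pi\<^sub>M {0..} (\<lambda>_. borel)) (\<lambda>\<omega>. \<lambda>t\<in>{0..}. X t \<omega>)
                            (Pi\<^sub>M {0..} (\<lambda>_. borel)) (\<lambda>\<omega>. \<lambda>t\<in>{0..}. Y t \<omega>)"

definition conv_in_prob :: "'a measure \<Rightarrow> (nat \<Rightarrow> 'a \<Rightarrow> real) \<Rightarrow> ('a \<Rightarrow> real) \<Rightarrow> bool" where
  "conv_in_prob M X Y \<longleftrightarrow>
     (\<forall>\<epsilon>>0. (\<lambda>m. measure M {\<omega>\<in>space M. \<bar>X m \<omega> - Y \<omega>\<bar> > \<epsilon>}) \<longlonglongrightarrow> 0)"

text \<open>Ito integral \<open>\<integral>_0^t g(s) dW_s\<close> of a continuous adapted integrand, characterised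
  as the limit in probability of the left-point Riemann sums along uniform partitions.\<close>
definition is_ito_integral :: "'a measure \<Rightarrow> (real \<Rightarrow> 'a \<Rightarrow> real) \<Rightarrow> (real \<Rightarrow> 'a \<Rightarrow> real)
                                 \<Rightarrow> real \<Rightarrow> ('a \<Rightarrow> real) \<Rightarrow> bool" where
  "is_ito_integral M g W t I \<longleftrightarrow> I \<in> borel_measurable M \<and>
     conv_in_prob M
       (\<lambda>m \<omega>. \<Sum>i<m. g (real i * t / real m) \<omega> *
                     (W (real (Suc i) * t / real m) \<omega> - W (real i * t / real m) \<omega>)) I"

definition conv_in_law :: "'a measure \<Rightarrow> (nat \<Rightarrow> 'a \<Rightarrow> 'b::topological_space) \<Rightarrow> ('a \<Rightarrow> 'b) \<Rightarrow> bool" where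
  "conv_in_law M X Y \<longleftrightarrow>
     (\<forall>h::'b \<Rightarrow> real. continuous_on UNIV h \<and> bounded (range h) \<longrightarrow>
        (\<lambda>n. prob_space.expectation M (\<lambda>\<omega>. h (X n \<omega>)))
          \<longlonglongrightarrow> prob_space.expectation M (\<lambda>\<omega>. h (Y \<omega>)))"

definition simpson_sum :: "(real \<Rightarrow> real) \<Rightarrow> (real \<Rightarrow> 'a \<Rightarrow> real) \<Rightarrow> nat \<Rightarrow> real \<Rightarrow> 'a \<Rightarrow> real" where
  "simpson_sum f B n t \<omega> =
     (\<Sum>j<nat \<lfloor>real n * t\<rfloor>.
        (1/6) * (deriv f (B (real j / real n) \<omega>)
                 + 4 * deriv f ((B (real j / real n) \<omega> + B (real (Suc j) / real n) \<omega>) / 2)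
                 + deriv f (B (real (Suc j) / real n) \<omega>))
        * (B (real (Suc j) / real n) \<omega> - B (real j / real n) \<omega>))"

definition rho10 :: "int \<Rightarrow> real" where
  "rho10 p = \<bar>real_of_int (p+1)\<bar> powr (1/5) - 2 * \<bar>real_of_int p\<bar> powr (1/5)
             + \<bar>real_of_int (p-1)\<bar> powr (1/5)"

definition kappa5 :: real where "kappa5 = (\<Sum>\<^sub>\<infinity>p\<in>(UNIV::int set). (rho10 p) ^ 5)"
definition kappa3 :: real where "kappa3 = (\<Sum>\<^sub>\<infinity>p\<in>(UNIV::int set). (rho10 p) ^ 3)"

definition beta10 :: real where
  "beta10 = sqrt (fact 5 * (1 / 2^5) * kappa5 + 75 * kappa3)"

end

theory Submission
  imports Defs
begin

text \<open>
  Put \<open>s = n powr (-1/10)\<close> and let \<open>\<xi>\<^sub>j\<close> be the normalised increments of \<open>B\<close> over the grid of mesh \<open>1/n\<close>,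
  with midpoint values \<open>m\<^sub>j\<close>. Taylor expansion at the midpoints turns the Simpson sum minus the increment of \<open>f\<close>
  into \<open>s\<^sup>5/2880\<close> times the sum of \<open>f\<^sup>5(m\<^sub>j) \<xi>\<^sub>j\<^sup>5\<close> (\<open>f\<^sup>5\<close> the fifth derivative), plus terms of orders 7, 9 and 11.
  Integrating by parts on the Gaussian variables \<open>\<xi>\<^sub>j\<close> bounds weighted sums of Hermite polynomials in \<open>L\<^sup>2\<close>. This removes
  the terms of orders 7 and 9, and it allows the weights \<open>f\<^sup>5(m\<^sub>j)\<close> to be frozen along a coarse partition of \<open>m\<close> points, once \<open>x\<^sup>5\<close>
  is replaced by \<open>p(x) = x\<^sup>5 - 15 x = H\<^sub>5(x) + 10 H\<^sub>3(x)\<close>; the linear part \<open>15 x\<close> contributes nothing because its sum telescopes.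
  With frozen weights one is left with a continuous functional of \<open>B\<close> and \<open>V\<^sub>n(u) = s\<^sup>5 \<Sum>\<^sub>j p(\<xi>\<^sub>j)\<close>, \<open>j < n u\<close>.

  Another integration by parts shows that \<open>\<psi>(\<theta>) = E exp(i (A + \<theta> F))\<close>, with \<open>A\<close> linear in \<open>B\<close> and \<open>F\<close> linear in \<open>V\<^sub>n\<close>, satisfies
  \<open>\<psi>' = - \<theta> v \<psi> + o(1)\<close>, where \<open>v\<close> tends to the variance of the corresponding combination of \<open>\<beta> W\<close>. Hence \<open>(B, V\<^sub>n)\<close> converges
  to \<open>(B, \<beta> W)\<close>. Letting first \<open>n\<close> and then \<open>m\<close> tend to infinity, the Riemann sums become the Ito integral.
  Throughout, \<open>f\<close> may be replaced by a function with bounded derivatives that agrees with it on a large interval, since the paths of \<open>B\<close>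
  stay in such an interval with probability close to one.
\<close>

section \<open>Bounded functionals and characteristic functions\<close>

text \<open>The Hurst parameter is critical: as \<open>sn n ^ 10 = 1 / n\<close>, the sum of n
  weakly correlated terms of order 5 has second moment of order one. Orders 7 and 9 have spare
  powers of \<open>sn n\<close>, but only cancellation makes them effective: in absolute value, n
  terms of order \<open>sn n ^ 9\<close> still diverge, and absolute bounds work from order 11 on.
  The obstacle is the Hermite component of degree 1. The covariances of one value of B with the
  normalised increments add up to order \<open>1 / sn n\<close>, a loss that is affordable at orders
  7 and 9 but not at order 5. There the midpoint expansion of the fourth derivative of f writes the
  linear component as \<open>sn n ^ 4\<close> times an increment of that derivative, plus terms of
  orders 7 and 9. Midpoints matter: the covariance of an increment with the mean of its own
  endpoints telescopes, unlike that with one endpoint. Two increments have covariance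
  \<open>rho10 / 2\<close>, so their Hermite polynomials of degree q have covariance q! times its
  q-th power. With p = H5 + 10 H3 this yields the constants 5! / 2^5 and 10^2 * 3! / 2^3 =
  75.\<close>

inductive trig_sum :: "'i set \<Rightarrow> (('i \<Rightarrow> real) \<Rightarrow> real) \<Rightarrow> bool" for I where
  cosine: "trig_sum I (\<lambda>x. c * cos ((\<Sum>i\<in>I. u i * x i) + d))"
| add: "trig_sum I f \<Longrightarrow> trig_sum I g \<Longrightarrow> trig_sum I (\<lambda>x. f x + g x)"

text \<open>The product formula for cosines keeps the class closed under multiplication, so it is an
  algebra, as Stone-Weierstrass requires. Its expectations are nevertheless read off from
  characteristic functions.\<close>

lemma trig_sum_cosine_mult:
  assumes "trig_sum I g"
  shows "trig_sum I (\<lambda>x. c * cos ((\<Sum>i\<in>I. u i * x i) + d) * g x)"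
  using assms
proof (induction rule: trig_sum.induct)
  case (cosine c' u' d')
  have "(\<lambda>x. c * cos ((\<Sum>i\<in>I. u i * x i) + d) * (c' * cos ((\<Sum>i\<in>I. u' i * x i) + d')))
     = (\<lambda>x. c*c'/2 * cos ((\<Sum>i\<in>I. (u i - u' i) * x i) + (d-d')) + c*c'/2 * cos ((\<Sum>i\<in>I. (u i + u' i) * x i) + (d+d')))"
  proof
    fix x
    have "cos ((\<Sum>i\<in>I. u i * x i) + d) * cos ((\<Sum>i\<in>I. u' i * x i) + d') =
      (cos (((\<Sum>i\<in>I. u i * x i) + d) - ((\<Sum>i\<in>I. u' i * x i) + d')) + cos (((\<Sum>i\<in>I. u i * x i) + d) + ((\<Sum>i\<in>I. u' i * x i) + d')))/2"
      by (rule cos_times_cos)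
    moreover have "((\<Sum>i\<in>I. u i * x i) + d) - ((\<Sum>i\<in>I. u' i * x i) + d') = (\<Sum>i\<in>I. (u i - u' i) * x i) + (d-d')"
      by (simp add: algebra_simps sum_subtractf)
    moreover have "((\<Sum>i\<in>I. u i * x i) + d) + ((\<Sum>i\<in>I. u' i * x i) + d') = (\<Sum>i\<in>I. (u i + u' i) * x i) + (d+d')"
      by (simp add: algebra_simps sum.distrib)
    ultimately show "c * cos ((\<Sum>i\<in>I. u i * x i) + d) * (c' * cos ((\<Sum>i\<in>I. u' i * x i) + d'))
       = c*c'/2 * cos ((\<Sum>i\<in>I. (u i - u' i) * x i) + (d-d')) + c*c'/2 * cos ((\<Sum>i\<in>I. (u i + u' i) * x i) + (d+d'))"
      by (simp add: field_simps)
  qed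
  then show ?case by (simp only:) (intro trig_sum.intros)
next
  case (add f g)
  then show ?case by (auto simp: algebra_simps dest: trig_sum.add)
qed

lemma trig_sum_mult: "trig_sum I f \<Longrightarrow> trig_sum I g \<Longrightarrow> trig_sum I (\<lambda>x. f x * g x)"
proof (induction rule: trig_sum.induct)
  case (cosine c u d)
  then show ?case by (rule trig_sum_cosine_mult)
next
  case (add f1 f2)
  then show ?case by (auto simp: algebra_simps dest: trig_sum.add)
qed

lemma trig_sum_const: "trig_sum I (\<lambda>_. c)"
  using trig_sum.cosine[of I c "\<lambda>_. 0" 0] by simp

text \<open>A phase shift by pi/2 makes the sine an instance of the only generator. These sines of
  rescaled coordinates are what separates points in \<open>trig_sum_approx\<close>.\<close>

lemma trig_sum_sin:
  assumes "finite I" "i \<in> I"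
  shows "trig_sum I (\<lambda>x. sin (x i / L))"
proof -
  have "(\<Sum>j\<in>I. (if j = i then 1/L else 0) * x j) = x i / L" for x :: "'a \<Rightarrow> real"
    using assms by (simp add: if_distrib[of "\<lambda>z. z * _"] sum.delta cong: if_cong)
  moreover have "1 * cos (y + (-pi/2)) = sin y" for y :: real
    by (simp add: cos_diff)
  ultimately have "(\<lambda>x::'a \<Rightarrow> real. sin (x i / L)) = (\<lambda>x. 1 * cos ((\<Sum>j\<in>I. (if j = i then 1/L else 0) * x j) + (-pi/2)))"
    by (simp only:)
  then show ?thesis by (simp only: trig_sum.cosine)
qed

lemma trig_sum_measurable:
  assumes "trig_sum I T" "\<And>i. i \<in> I \<Longrightarrow> X i \<in> borel_measurable M"
  shows "(\<lambda>\<omega>. T (\<lambda>i. X i \<omega>)) \<in> borel_measurable M"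
  using assms(1)
proof (induction rule: trig_sum.induct)
  case (cosine c u d)
  note assms(2)[measurable]
  show ?case by measurable
qed auto

lemma trig_sum_integrable:
  assumes "trig_sum I T" "\<And>i. i \<in> I \<Longrightarrow> X i \<in> borel_measurable M" "prob_space M"
  shows "integrable M (\<lambda>\<omega>. T (\<lambda>i. X i \<omega>))"
proof -
  interpret prob_space M by fact
  have "\<exists>K. \<forall>x. \<bar>T x\<bar> \<le> K"
    using assms(1)
  proof (induction rule: trig_sum.induct)
    case (cosine c u d)
    then show ?case
      by (intro exI[of _ "\<bar>c\<bar>"]) (simp add: abs_mult mult_left_le)
  next
    case (add f g)
    then obtain K K' where "\<forall>x. \<bar>f x\<bar> \<le> K" "\<forall>x. \<bar>g x\<bar> \<le> K'" by blast
    then show ?case by (intro exI[of _ "K+K'"]) (metis abs_triangle_ineq add_mono order_trans)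
  qed
  then obtain K where "\<forall>x. \<bar>T x\<bar> \<le> K" ..
  then show ?thesis using trig_sum_measurable[OF assms(1,2)]
    by (intro integrable_const_bound[where B=K]) auto
qed

text \<open>Each generator is the real part of a rotated exponential, so its expectation is a fixed
  real-linear function of the joint characteristic function at one frequency.\<close>

lemma trig_sum_convergence:
  assumes "trig_sum I T"
    and p: "\<And>n. prob_space (Mn n)" "prob_space M"
    and m: "\<And>n i. i \<in> I \<Longrightarrow> Xn n i \<in> borel_measurable (Mn n)" "\<And>i. i \<in> I \<Longrightarrow> X i \<in> borel_measurable M"
    and conv: "\<And>u. (\<lambda>n. \<integral>\<omega>. iexp (\<Sum>i\<in>I. u i * Xn n i \<omega>) \<partial>Mn n) \<longlonglongrightarrow> (\<integral>\<omega>. iexp (\<Sum>i\<in>I. u i * X i \<omega>) \<partial>M)"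
  shows "(\<lambda>n. \<integral>\<omega>. T (\<lambda>i. Xn n i \<omega>) \<partial>Mn n) \<longlonglongrightarrow> (\<integral>\<omega>. T (\<lambda>i. X i \<omega>) \<partial>M)"
  using assms(1)
proof (induction rule: trig_sum.induct)
  case (cosine c u d)
  have *: "(\<integral>\<omega>. c * cos ((\<Sum>i\<in>I. u i * Y i \<omega>) + d) \<partial>N) = c * Re (iexp d * (\<integral>\<omega>. iexp (\<Sum>i\<in>I. u i * Y i \<omega>) \<partial>N))"
    if "prob_space N" "\<And>i. i \<in> I \<Longrightarrow> Y i \<in> borel_measurable N" for N :: "'z measure" and Y
  proof -
    interpret N: prob_space N by fact
    note that(2)[measurable]
    have "(\<lambda>\<omega>. iexp (\<Sum>i\<in>I. u i * Y i \<omega>)) \<in> borel_measurable N"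
      by measurable
    then have int: "integrable N (\<lambda>\<omega>. iexp (\<Sum>i\<in>I. u i * Y i \<omega>))"
      by (intro N.integrable_const_bound[where B=1]) (auto simp del: of_real_sum)
    have pw: "cos (S + d) = Re (iexp d * iexp S)" for S d :: real
      by (simp only: cis_conv_exp[symmetric] cis_mult cis.sel add.commute)
    have "(\<integral>\<omega>. c * cos ((\<Sum>i\<in>I. u i * Y i \<omega>) + d) \<partial>N) = (\<integral>\<omega>. c * Re (iexp d * iexp (\<Sum>i\<in>I. u i * Y i \<omega>)) \<partial>N)"
      unfolding pw ..
    also have "\<dots> = c * Re (\<integral>\<omega>. iexp d * iexp (\<Sum>i\<in>I. u i * Y i \<omega>) \<partial>N)"
      using int by (simp del: of_real_sum)
    finally show ?thesis using int by (simp del: of_real_sum)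
  qed
  have 1: "(\<integral>\<omega>. c * cos ((\<Sum>i\<in>I. u i * Xn n i \<omega>) + d) \<partial>Mn n) = c * Re (iexp d * (\<integral>\<omega>. iexp (\<Sum>i\<in>I. u i * Xn n i \<omega>) \<partial>Mn n))" for n
    by (rule *) (use p m in auto)
  have 2: "(\<integral>\<omega>. c * cos ((\<Sum>i\<in>I. u i * X i \<omega>) + d) \<partial>M) = c * Re (iexp d * (\<integral>\<omega>. iexp (\<Sum>i\<in>I. u i * X i \<omega>) \<partial>M))"
    by (rule *) (use p m in auto)
  show ?case
    unfolding 1 2 by (intro tendsto_mult tendsto_const tendsto_Re conv)
next
  case (add f g)
  show ?case
    using add trig_sum_integrable[OF add.hyps(1) m(1) p(1)] trig_sum_integrable[OF add.hyps(2) m(1) p(1)]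
      trig_sum_integrable[OF add.hyps(1) m(2) p(2)] trig_sum_integrable[OF add.hyps(2) m(2) p(2)]
    by (simp add: tendsto_add)
qed

text \<open>Stone-Weierstrass on a compact cube, in the variables y = sin (x / L). The clamp
  \<open>L * arcsin (sin (x i / L))\<close> is a continuous function of y and equals x whenever |x|
  <= L pi/2. Hence the approximating sum follows h near the origin and stays controlled on the whole
  space, which an approximation on a bounded set alone would not give.\<close>

lemma trig_sum_approx:
  fixes h :: "('i \<Rightarrow> real) \<Rightarrow> real"
  assumes "finite I" and cont: "continuous_on UNIV h" and "L > 0" "\<epsilon> > 0"
  obtains T where "trig_sum I T"
    "\<And>x. \<bar>h (\<lambda>i. if i \<in> I then L * arcsin (sin (x i / L)) else 0) - T x\<bar> < \<epsilon>"
proof -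
  obtain e where "bij_betw e {0..<card I} I" using ex_bij_betw_nat_finite[OF \<open>finite I\<close>] by blast
  define d where "d = the_inv_into {0..<card I} e"
  have eI: "e k \<in> I" if "k < card I" for k
    using \<open>bij_betw e {0..<card I} I\<close> that by (auto simp: bij_betw_def)
  have dI: "d i < card I" "e (d i) = i" if "i \<in> I" for i
    using \<open>bij_betw e {0..<card I} I\<close> that f_the_inv_into_f_bij_betw[of e "{0..<card I}" I i]
      the_inv_into_into[of e "{0..<card I}" i "{0..<card I}"]
    unfolding d_def by (auto simp: bij_betw_def)
  define emb where "emb x = (\<lambda>k. if k < card I then sin (x (e k) / L) else 0)" for x :: "'i \<Rightarrow> real"
  \<comment> \<open>Coordinates from \<open>card I\<close> on are pinned to 0: the cube is then
    compact in the product topology over all of nat, and two different points of it differ in one of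
    the coordinates that carry a sine.\<close>
  define S :: "(nat \<Rightarrow> real) set" where "S = (\<Pi>\<^sub>E k\<in>UNIV. if k < card I then {-1..1} else {0})"
  define R where "R = {g. continuous_on S g \<and> (\<exists>T. trig_sum I T \<and> (\<forall>x. g (emb x) = T x))}"
  have "function_ring_on R S"
  proof
    have "compactin (product_topology (\<lambda>i. euclidean) UNIV) S"
      unfolding S_def by (subst compactin_PiE) (auto simp: compactin_euclidean_iff)
    then show "compact S" by (simp add: euclidean_product_topology compactin_euclidean_iff)
  next
    fix x y assume "x \<in> S" "y \<in> S" "x \<noteq> y"
    then obtain k where k: "x k \<noteq> y k" by blast
    have "k < card I"
    proof (rule ccontr)
      assume "\<not> k < card I"
      moreover have "x k \<in> (if k < card I then {-1..1} else {0})" "y k \<in> (if k < card I then {-1..1} else {0})"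
        using \<open>x \<in> S\<close> \<open>y \<in> S\<close> unfolding S_def PiE_iff by blast+
      ultimately show False using k by simp
    qed
    then have tk: "trig_sum I (\<lambda>x. sin (x (e k) / L))" by (intro trig_sum_sin \<open>finite I\<close> eI)
    have ek: "emb x k = sin (x (e k) / L)" for x unfolding emb_def using \<open>k < card I\<close> by simp
    have ck: "continuous_on S (\<lambda>z::nat \<Rightarrow> real. z k)"
      by (rule continuous_on_subset[OF continuous_on_product_coordinates subset_UNIV])
    have "(\<lambda>z. z k) \<in> R" unfolding R_def mem_Collect_eq
      by (intro conjI exI[of _ "\<lambda>x. sin (x (e k) / L)"] allI tk ek ck)
    with k show "\<exists>f\<in>R. f x \<noteq> f y" by (intro bexI[of _ "\<lambda>z. z k"]) auto
  next
    fix f g assume "f \<in> R" "g \<in> R"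
    then obtain T T' where "continuous_on S f" "continuous_on S g" "trig_sum I T" "trig_sum I T'"
      "\<And>x. f (emb x) = T x" "\<And>x. g (emb x) = T' x" unfolding R_def by blast
    note TT = this
    show "(\<lambda>x. f x + g x) \<in> R"
      unfolding R_def mem_Collect_eq
      by (intro conjI continuous_on_add TT exI[of _ "\<lambda>x. T x + T' x"] trig_sum.add allI arg_cong2[of _ _ _ _ "(+)"])
    show "(\<lambda>x. f x * g x) \<in> R"
      unfolding R_def mem_Collect_eq
      by (intro conjI continuous_on_mult TT exI[of _ "\<lambda>x. T x * T' x"] trig_sum_mult allI arg_cong2[of _ _ _ _ "(*)"])
  next
    fix c show "(\<lambda>_. c) \<in> R" unfolding R_def using trig_sum_const[of I c] by (auto intro!: exI[of _ "\<lambda>_. c"])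
  qed (simp add: R_def)
  then interpret function_ring_on R S .
  define G where "G = (\<lambda>y. h (\<lambda>i. if i \<in> I then L * arcsin (y (d i)) else 0))"
  have Sb: "-1 \<le> y k \<and> y k \<le> 1" if "y \<in> S" for y k
  proof -
    have "y k \<in> (if k < card I then {-1..1} else {0})" using that unfolding S_def PiE_iff by blast
    then show ?thesis by (auto split: if_splits)
  qed
  have "continuous_on S (\<lambda>y. (\<lambda>i. if i \<in> I then L * arcsin (y (d i)) else 0))"
  proof (rule continuous_on_coordinatewise_then_product)
    fix i
    have "continuous_on S (\<lambda>y::nat\<Rightarrow>real. y (d i))"
      by (rule continuous_on_subset[OF continuous_on_product_coordinates]) auto
    then have "continuous_on S (\<lambda>y. L * arcsin (y (d i)))"
      using Sb by (intro continuous_intros) auto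
    then show "continuous_on S (\<lambda>y. if i \<in> I then L * arcsin (y (d i)) else 0)" by (cases "i \<in> I") auto
  qed
  then have "continuous_on S G"
    unfolding G_def by (rule continuous_on_compose2[OF cont]) auto
  from Stone_Weierstrass_basic[OF this \<open>\<epsilon> > 0\<close>] obtain g where g: "g \<in> R" "\<And>y. y \<in> S \<Longrightarrow> \<bar>G y - g y\<bar> < \<epsilon>" by blast
  then obtain T where T: "trig_sum I T" "\<And>x. g (emb x) = T x"
    unfolding R_def by blast
  show thesis
  proof (rule that[OF T(1)])
    fix x :: "'i \<Rightarrow> real"
    have "emb x \<in> S" unfolding S_def emb_def by auto
    from g(2)[OF this] T(2)[of x]
    have "\<bar>G (emb x) - T x\<bar> < \<epsilon>" by simp
    moreover have "G (emb x) = h (\<lambda>i. if i \<in> I then L * arcsin (sin (x i / L)) else 0)"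
      unfolding G_def emb_def using dI by (intro arg_cong[of _ _ h]) (auto simp: fun_eq_iff)
    ultimately show "\<bar>h (\<lambda>i. if i \<in> I then L * arcsin (sin (x i / L)) else 0) - T x\<bar> < \<epsilon>" by simp
  qed
qed

text \<open>Functionals take the whole path as argument, which spares a type for every finite set of
  times; this predicate restores the finite dimension.\<close>

definition depends_on :: "'i set \<Rightarrow> (('i \<Rightarrow> real) \<Rightarrow> 'c) \<Rightarrow> bool" where
  "depends_on I h \<longleftrightarrow> (\<forall>x y. (\<forall>i\<in>I. x i = y i) \<longrightarrow> h x = h y)"

lemma depends_onD: "depends_on I h \<Longrightarrow> (\<And>i. i \<in> I \<Longrightarrow> x i = y i) \<Longrightarrow> h x = h y"
  unfolding depends_on_def by blast

lemma trig_sum_approx':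
  fixes h :: "('i \<Rightarrow> real) \<Rightarrow> real"
  assumes "finite I" "continuous_on UNIV h" "depends_on I h" "L > 0" "e > 0"
  obtains T where "trig_sum I T" "\<And>x. (\<forall>i\<in>I. \<bar>x i\<bar> \<le> L) \<Longrightarrow> \<bar>h x - T x\<bar> < e"
    "\<And>x H. (\<And>y. \<bar>h y\<bar> \<le> H) \<Longrightarrow> \<bar>T x\<bar> \<le> H + e"
proof -
  obtain T where T: "trig_sum I T"
    "\<And>x. \<bar>h (\<lambda>i. if i \<in> I then L * arcsin (sin (x i / L)) else 0) - T x\<bar> < e"
    using trig_sum_approx[OF assms(1,2,4,5)] by blast
  show thesis
  proof (rule that[OF T(1)])
    fix x :: "'i \<Rightarrow> real" assume x: "\<forall>i\<in>I. \<bar>x i\<bar> \<le> L"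
    have "L * arcsin (sin (x i / L)) = x i" if "i \<in> I" for i
    proof -
      have "\<bar>x i / L\<bar> \<le> 1" using x that \<open>L > 0\<close> by (simp add: abs_divide)
      then have "- (pi/2) \<le> x i / L" "x i / L \<le> pi/2" using pi_gt3 by linarith+
      then show ?thesis using \<open>L > 0\<close> by (simp add: arcsin_sin)
    qed
    then have "h (\<lambda>i. if i \<in> I then L * arcsin (sin (x i / L)) else 0) = h x"
      by (intro depends_onD[OF assms(3)]) auto
    with T(2)[of x] show "\<bar>h x - T x\<bar> < e" by simp
  next
    fix x :: "'i \<Rightarrow> real" and H assume "\<And>y. \<bar>h y\<bar> \<le> H"
    from this[of "\<lambda>i. if i \<in> I then L * arcsin (sin (x i / L)) else 0"] T(2)[of x]
    show "\<bar>T x\<bar> \<le> H + e" by linarith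
  qed
qed

text \<open>Since the index type may be uncountable, measurability is obtained by pointwise
  approximation: \<open>T k\<close> is a trigonometric sum within 1/(k+1) of h on the cube of
  half-width k+1, and every point lies in these cubes eventually.\<close>

lemma continuous_functional_measurable:
  fixes h :: "('i \<Rightarrow> real) \<Rightarrow> real"
  assumes "finite I" "continuous_on UNIV h" "depends_on I h"
    "\<And>i. i \<in> I \<Longrightarrow> X i \<in> borel_measurable M"
  shows "(\<lambda>\<omega>. h (\<lambda>i. X i \<omega>)) \<in> borel_measurable M"
proof -
  have "\<exists>T. trig_sum I T \<and> (\<forall>x. (\<forall>i\<in>I. \<bar>x i\<bar> \<le> real (Suc k)) \<longrightarrow> \<bar>h x - T x\<bar> < 1 / real (Suc k))" for k
    using trig_sum_approx'[OF assms(1-3), of "real (Suc k)" "1 / real (Suc k)"] by (metis of_nat_0_less_iff zero_less_Suc zero_less_divide_1_iff)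
  then obtain T where T: "\<And>k. trig_sum I (T k)"
    "\<And>k x. \<forall>i\<in>I. \<bar>x i\<bar> \<le> real (Suc k) \<Longrightarrow> \<bar>h x - T k x\<bar> < 1 / real (Suc k)" by metis
  have "(\<lambda>k. T k x) \<longlonglongrightarrow> h x" for x
  proof (rule LIMSEQ_I)
    fix r :: real assume "r > 0"
    obtain K where K: "1 / real (Suc K) < r" using \<open>r > 0\<close> nat_approx_posE by metis
    obtain K' :: nat where K': "(\<Sum>i\<in>I. \<bar>x i\<bar>) \<le> real K'" using real_arch_simple by blast
    have "norm (T k x - h x) < r" if "k \<ge> max K K'" for k
    proof -
      have "\<bar>x i\<bar> \<le> real (Suc k)" if "i \<in> I" for i
        using member_le_sum[OF that, of "\<lambda>i. \<bar>x i\<bar>"] assms(1) K' \<open>k \<ge> max K K'\<close> by (simp add: le_max_iff_disj)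
      then have "\<bar>h x - T k x\<bar> < 1 / real (Suc k)" by (intro T(2)) auto
      also have "\<dots> \<le> 1 / real (Suc K)" using that by (intro divide_left_mono) auto
      finally show ?thesis using K by (simp add: abs_minus_commute)
    qed
    then show "\<exists>no. \<forall>n\<ge>no. norm (T n x - h x) < r" by blast
  qed
  then show ?thesis
    by (rule borel_measurable_LIMSEQ_real[where u="\<lambda>k \<omega>. T k (\<lambda>i. X i \<omega>)", OF _ trig_sum_measurable[OF T(1) assms(4)]])
qed

text \<open>Levy's theorem on the line gives weak convergence of the single variable. The ramp
  \<open>g k\<close> lies between the indicators of |x| > k+1 and |x| > k; being bounded and
  continuous, it transfers a tail bound of the limit to the sequence.\<close>

lemma char_convergence_tight:
  assumes p: "\<And>n. prob_space (Mn n)" "prob_space M"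
    and m: "\<And>n. Yn n \<in> borel_measurable (Mn n)" "Y \<in> borel_measurable M"
    and conv: "\<And>v. (\<lambda>n. \<integral>\<omega>. iexp (v * Yn n \<omega>) \<partial>Mn n) \<longlonglongrightarrow> (\<integral>\<omega>. iexp (v * Y \<omega>) \<partial>M)"
    and "e > 0"
  obtains R where "R > 0" "measure M {\<omega>\<in>space M. R < \<bar>Y \<omega>\<bar>} < e"
    "\<forall>\<^sub>F n in sequentially. measure (Mn n) {\<omega>\<in>space (Mn n). R < \<bar>Yn n \<omega>\<bar>} < e"
proof -
  interpret M: prob_space M by fact
  interpret Mn: prob_space "Mn n" for n by fact
  note m[measurable]
  have rd: "real_distribution (distr (Mn n) borel (Yn n))" for n by (rule Mn.real_distribution_distr) simp
  have rd': "real_distribution (distr M borel Y)" by (rule M.real_distribution_distr) simp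
  have wc: "weak_conv_m (\<lambda>n. distr (Mn n) borel (Yn n)) (distr M borel Y)"
    using conv by (intro levy_continuity rd rd') (simp add: char_def integral_distr)
  define g :: "nat \<Rightarrow> real \<Rightarrow> real" where "g k x = max 0 (min 1 (\<bar>x\<bar> - real k))" for k x
  have gm[measurable]: "g k \<in> borel_measurable borel" for k unfolding g_def by measurable
  have gb: "0 \<le> g k x" "g k x \<le> 1" for k x unfolding g_def by auto
  have tail: "measure N {\<omega>\<in>space N. real (Suc k) < \<bar>Z \<omega>\<bar>} \<le> (\<integral>\<omega>. g k (Z \<omega>) \<partial>N)"
    if "prob_space N" and [measurable]: "Z \<in> borel_measurable N" for N :: "'z measure" and Z k
  proof -
    interpret N: prob_space N by fact
    have "measure N {\<omega>\<in>space N. real (Suc k) < \<bar>Z \<omega>\<bar>} = (\<integral>\<omega>. indicator {\<omega>\<in>space N. real (Suc k) < \<bar>Z \<omega>\<bar>} \<omega> \<partial>N)"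
      by simp
    also have "\<dots> \<le> (\<integral>\<omega>. g k (Z \<omega>) \<partial>N)"
      using gb by (intro integral_mono N.integrable_const_bound[where B=1]) (auto simp: g_def indicator_def)
    finally show ?thesis .
  qed
  have "(\<lambda>k. \<integral>\<omega>. g k (Y \<omega>) \<partial>M) \<longlonglongrightarrow> (\<integral>\<omega>. 0 \<partial>M)"
  proof (rule integral_dominated_convergence[where w="\<lambda>_. 1"])
    show "AE x in M. (\<lambda>k. g k (Y x)) \<longlonglongrightarrow> 0"
    proof (rule AE_I2)
      fix x
      obtain K :: nat where "\<bar>Y x\<bar> \<le> real K" using real_arch_simple by blast
      then have "\<forall>k\<ge>K. g k (Y x) = 0" unfolding g_def by (auto simp: max_def min_def)
      then show "(\<lambda>k. g k (Y x)) \<longlonglongrightarrow> 0"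
        by (intro tendsto_eventually eventually_sequentiallyI[of K]) auto
    qed
  qed (use gb in auto)
  then have "\<forall>\<^sub>F k in sequentially. (\<integral>\<omega>. g k (Y \<omega>) \<partial>M) < e"
    using \<open>e > 0\<close> by (intro order_tendstoD) auto
  then obtain k where k: "(\<integral>\<omega>. g k (Y \<omega>) \<partial>M) < e"
    unfolding eventually_sequentially by blast
  have "isCont (g k) x" for x
    unfolding g_def by (intro continuous_intros)
  then have "(\<lambda>n. integral\<^sup>L (distr (Mn n) borel (Yn n)) (g k)) \<longlonglongrightarrow> integral\<^sup>L (distr M borel Y) (g k)"
    using gb by (intro weak_conv_imp_integral_bdd_continuous_conv[OF rd rd' wc, where B=1]) auto
  then have "(\<lambda>n. \<integral>\<omega>. g k (Yn n \<omega>) \<partial>Mn n) \<longlonglongrightarrow> (\<integral>\<omega>. g k (Y \<omega>) \<partial>M)"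
    by (simp add: integral_distr)
  then have "\<forall>\<^sub>F n in sequentially. (\<integral>\<omega>. g k (Yn n \<omega>) \<partial>Mn n) < e"
    using k by (rule order_tendstoD)
  then have ev: "\<forall>\<^sub>F n in sequentially. measure (Mn n) {\<omega>\<in>space (Mn n). real (Suc k) < \<bar>Yn n \<omega>\<bar>} < e"
    by eventually_elim (rule le_less_trans[OF tail[OF p(1) m(1)]])
  show thesis
    by (rule that[of "real (Suc k)", OF _ le_less_trans[OF tail[OF p(2) m(2)] k] ev]) simp
qed

text \<open>Continuity theorem in several dimensions. Tightness of each coordinate confines
  everything to a cube up to small probability; on the cube h is replaced by a trigonometric sum,
  and off the cube the global bound of that sum limits the damage. The spaces \<open>Mn n\<close>
  may vary with n.\<close>

theorem levy_continuity_functional: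
  fixes Mn :: "nat \<Rightarrow> 'b measure" and Xn :: "nat \<Rightarrow> 'i \<Rightarrow> 'b \<Rightarrow> real"
    and M :: "'a measure" and X :: "'i \<Rightarrow> 'a \<Rightarrow> real" and h :: "('i \<Rightarrow> real) \<Rightarrow> real"
  assumes p: "\<And>n. prob_space (Mn n)" "prob_space M" and "finite I"
    and m: "\<And>n i. i \<in> I \<Longrightarrow> Xn n i \<in> borel_measurable (Mn n)" "\<And>i. i \<in> I \<Longrightarrow> X i \<in> borel_measurable M"
    and conv: "\<And>u. (\<lambda>n. \<integral>\<omega>. iexp (\<Sum>i\<in>I. u i * Xn n i \<omega>) \<partial>Mn n) \<longlonglongrightarrow> (\<integral>\<omega>. iexp (\<Sum>i\<in>I. u i * X i \<omega>) \<partial>M)"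
    and h: "continuous_on UNIV h" "depends_on I h" "\<And>x. \<bar>h x\<bar> \<le> H"
  shows "(\<lambda>n. \<integral>\<omega>. h (\<lambda>i. Xn n i \<omega>) \<partial>Mn n) \<longlonglongrightarrow> (\<integral>\<omega>. h (\<lambda>i. X i \<omega>) \<partial>M)"
proof (rule LIMSEQ_I)
  fix r :: real assume "r > 0"
  have "H \<ge> 0" using h(3)[of undefined] by linarith
  \<comment> \<open>Replacing h by the trigonometric sum costs at most e times the bracket on either
    side. With this choice each replacement costs at most r/4, and r/2 remains for the convergence
    of the trigonometric sum.\<close>
  define e where "e = min 1 (r / (4 * (1 + (2*H+1) * (real (card I) + 1))))"
  have den: "4 * (1 + (2*H+1) * (real (card I) + 1)) > 0" using \<open>H \<ge> 0\<close> by (intro mult_pos_pos add_pos_nonneg mult_nonneg_nonneg) auto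
  then have "e > 0" "e \<le> 1" unfolding e_def using \<open>r > 0\<close> by auto
  have e4: "4 * (e * (1 + (2*H+1) * (real (card I) + 1))) \<le> r"
  proof -
    have "e \<le> r / (4 * (1 + (2*H+1) * (real (card I) + 1)))" unfolding e_def by simp
    then have "e * (4 * (1 + (2*H+1) * (real (card I) + 1))) \<le> r" using den by (simp add: pos_le_divide_eq)
    then show ?thesis by (simp add: algebra_simps)
  qed
  have "\<exists>R>0. measure M {\<omega>\<in>space M. R < \<bar>X i \<omega>\<bar>} < e \<and>
    (\<forall>\<^sub>F n in sequentially. measure (Mn n) {\<omega>\<in>space (Mn n). R < \<bar>Xn n i \<omega>\<bar>} < e)" if "i \<in> I" for i
  proof -
    have "(\<lambda>n. \<integral>\<omega>. iexp (v * Xn n i \<omega>) \<partial>Mn n) \<longlonglongrightarrow> (\<integral>\<omega>. iexp (v * X i \<omega>) \<partial>M)" for v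
    proof -
      have *: "(\<Sum>j\<in>I. (if j = i then v else 0) * x j) = v * x i" for x :: "'i \<Rightarrow> real"
        using \<open>finite I\<close> that by (simp add: if_distrib[of "\<lambda>z. z * _"] sum.delta cong: if_cong)
      show ?thesis using conv[of "\<lambda>j. if j = i then v else 0"] unfolding * .
    qed
    note ct = char_convergence_tight[where Mn=Mn and M=M and Yn="\<lambda>n. Xn n i" and Y="X i", OF p m(1)[OF that] m(2)[OF that] this \<open>e > 0\<close>]
    show ?thesis by (rule ct) blast
  qed
  then have "\<forall>i\<in>I. \<exists>R>0. measure M {\<omega>\<in>space M. R < \<bar>X i \<omega>\<bar>} < e \<and>
    (\<forall>\<^sub>F n in sequentially. measure (Mn n) {\<omega>\<in>space (Mn n). R < \<bar>Xn n i \<omega>\<bar>} < e)" by blast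
  from bchoice[OF this] obtain R where R': "\<forall>i\<in>I. 0 < R i \<and> measure M {\<omega>\<in>space M. R i < \<bar>X i \<omega>\<bar>} < e \<and>
    (\<forall>\<^sub>F n in sequentially. measure (Mn n) {\<omega>\<in>space (Mn n). R i < \<bar>Xn n i \<omega>\<bar>} < e)" by blast
  have R: "\<And>i. i \<in> I \<Longrightarrow> R i > 0" "\<And>i. i \<in> I \<Longrightarrow> measure M {\<omega>\<in>space M. R i < \<bar>X i \<omega>\<bar>} < e"
    "\<And>i. i \<in> I \<Longrightarrow> \<forall>\<^sub>F n in sequentially. measure (Mn n) {\<omega>\<in>space (Mn n). R i < \<bar>Xn n i \<omega>\<bar>} < e" using R' by blast+
  define L where "L = 1 + (\<Sum>i\<in>I. R i)"
  have "(\<Sum>i\<in>I. R i) \<ge> 0" by (intro sum_nonneg) (use R(1) in fastforce)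
  then have "L > 0" unfolding L_def by simp
  have RL: "R i \<le> L" if "i \<in> I" for i
    using member_le_sum[OF that, of R] R(1) \<open>finite I\<close> unfolding L_def by fastforce
  obtain T where T: "trig_sum I T" "\<And>x. (\<forall>i\<in>I. \<bar>x i\<bar> \<le> L) \<Longrightarrow> \<bar>h x - T x\<bar> < e"
    "\<And>x H. (\<And>y. \<bar>h y\<bar> \<le> H) \<Longrightarrow> \<bar>T x\<bar> \<le> H + e"
    using trig_sum_approx'[OF \<open>finite I\<close> h(1,2) \<open>L > 0\<close> \<open>e > 0\<close>] by blast
  have hT: "\<bar>(\<integral>\<omega>. h (\<lambda>i. Z i \<omega>) \<partial>N) - (\<integral>\<omega>. T (\<lambda>i. Z i \<omega>) \<partial>N)\<bar> \<le> e * (1 + (2*H+1) * (real (card I) + 1))"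
    if N: "prob_space N" and Zm: "\<And>i. i \<in> I \<Longrightarrow> Z i \<in> borel_measurable N"
      and tail: "\<And>i. i \<in> I \<Longrightarrow> measure N {\<omega>\<in>space N. R i < \<bar>Z i \<omega>\<bar>} < e"
    for N :: "'z measure" and Z
  proof -
    interpret N: prob_space N by fact
    note Zm[measurable]
    have hm: "(\<lambda>\<omega>. h (\<lambda>i. Z i \<omega>)) \<in> borel_measurable N"
      by (rule continuous_functional_measurable[OF \<open>finite I\<close> h(1,2) Zm])
    have hi: "integrable N (\<lambda>\<omega>. h (\<lambda>i. Z i \<omega>))"
      using h(3) hm by (intro N.integrable_const_bound[where B=H]) auto
    have Ti: "integrable N (\<lambda>\<omega>. T (\<lambda>i. Z i \<omega>))" by (rule trig_sum_integrable[OF T(1) Zm N])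
    define A where "A i = {\<omega>\<in>space N. R i < \<bar>Z i \<omega>\<bar>}" for i
    have Am: "A i \<in> sets N" if "i \<in> I" for i unfolding A_def using that by measurable
    have "\<bar>(\<integral>\<omega>. h (\<lambda>i. Z i \<omega>) \<partial>N) - (\<integral>\<omega>. T (\<lambda>i. Z i \<omega>) \<partial>N)\<bar> = \<bar>\<integral>\<omega>. h (\<lambda>i. Z i \<omega>) - T (\<lambda>i. Z i \<omega>) \<partial>N\<bar>"
      using hi Ti by simp
    also have "\<dots> \<le> (\<integral>\<omega>. \<bar>h (\<lambda>i. Z i \<omega>) - T (\<lambda>i. Z i \<omega>)\<bar> \<partial>N)" by (rule integral_abs_bound)
    also have "\<dots> \<le> (\<integral>\<omega>. e + (2*H+1) * (\<Sum>i\<in>I. indicator (A i) \<omega>) \<partial>N)"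
    proof (rule integral_mono)
      show "integrable N (\<lambda>\<omega>. \<bar>h (\<lambda>i. Z i \<omega>) - T (\<lambda>i. Z i \<omega>)\<bar>)" using hi Ti by simp
      show "integrable N (\<lambda>\<omega>. e + (2*H+1) * (\<Sum>i\<in>I. indicator (A i) \<omega>))"
        using Am by (intro Bochner_Integration.integrable_add integrable_mult_right Bochner_Integration.integrable_sum) (auto simp: N.emeasure_eq_measure)
      fix \<omega> assume w: "\<omega> \<in> space N"
      show "\<bar>h (\<lambda>i. Z i \<omega>) - T (\<lambda>i. Z i \<omega>)\<bar> \<le> e + (2*H+1) * (\<Sum>i\<in>I. indicator (A i) \<omega>)"
      proof (cases "\<forall>i\<in>I. \<omega> \<notin> A i")
        case True
        then have "\<forall>i\<in>I. \<bar>Z i \<omega>\<bar> \<le> L" using w RL unfolding A_def by fastforce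
        then have "\<bar>h (\<lambda>i. Z i \<omega>) - T (\<lambda>i. Z i \<omega>)\<bar> < e" by (intro T(2)) auto
        moreover have "(\<Sum>i\<in>I. indicator (A i) \<omega>) = (0::real)" using True by (intro sum.neutral) auto
        ultimately show ?thesis by simp
      next
        case False
        then obtain i where "i \<in> I" "\<omega> \<in> A i" by blast
        then have "(1::real) \<le> (\<Sum>i\<in>I. indicator (A i) \<omega>)"
          using member_le_sum[of i I "\<lambda>i. indicator (A i) \<omega> :: real"] \<open>finite I\<close> by auto
        then have "(2*H+1) * 1 \<le> (2*H+1) * (\<Sum>i\<in>I. indicator (A i) \<omega>)" using \<open>H \<ge> 0\<close> by (intro mult_left_mono) auto
        moreover have "\<bar>h (\<lambda>i. Z i \<omega>)\<bar> \<le> H" "\<bar>T (\<lambda>i. Z i \<omega>)\<bar> \<le> H + e" using h(3) T(3)[OF h(3)] by auto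
        ultimately show ?thesis unfolding mult_1_right using \<open>e > 0\<close>
          by (simp only: abs_le_iff) linarith
      qed
    qed
    also have "\<dots> = e + (2*H+1) * (\<Sum>i\<in>I. measure N (A i))"
      using Am by (simp add: N.emeasure_eq_measure N.prob_space)
    also have "\<dots> \<le> e + (2*H+1) * (\<Sum>i\<in>I. e)"
      using tail \<open>H \<ge> 0\<close> unfolding A_def by (intro add_left_mono mult_left_mono sum_mono) (auto intro: less_imp_le)
    also have "\<dots> \<le> e * (1 + (2*H+1) * (real (card I) + 1))"
      using \<open>H \<ge> 0\<close> \<open>e > 0\<close> by (simp add: algebra_simps)
    finally show ?thesis .
  qed
  have "\<forall>\<^sub>F n in sequentially. \<forall>i\<in>I. measure (Mn n) {\<omega>\<in>space (Mn n). R i < \<bar>Xn n i \<omega>\<bar>} < e"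
    using R(3) \<open>finite I\<close> by (simp add: eventually_ball_finite)
  moreover have "(\<lambda>n. \<integral>\<omega>. T (\<lambda>i. Xn n i \<omega>) \<partial>Mn n) \<longlonglongrightarrow> (\<integral>\<omega>. T (\<lambda>i. X i \<omega>) \<partial>M)"
    by (rule trig_sum_convergence[OF T(1) p m conv])
  then have "\<forall>\<^sub>F n in sequentially. dist (\<integral>\<omega>. T (\<lambda>i. Xn n i \<omega>) \<partial>Mn n) (\<integral>\<omega>. T (\<lambda>i. X i \<omega>) \<partial>M) < r/2"
    using \<open>r > 0\<close> by (intro tendstoD) auto
  ultimately have "\<forall>\<^sub>F n in sequentially. norm ((\<integral>\<omega>. h (\<lambda>i. Xn n i \<omega>) \<partial>Mn n) - (\<integral>\<omega>. h (\<lambda>i. X i \<omega>) \<partial>M)) < r"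
  proof eventually_elim
    case (elim n)
    have "\<bar>(\<integral>\<omega>. h (\<lambda>i. Xn n i \<omega>) \<partial>Mn n) - (\<integral>\<omega>. T (\<lambda>i. Xn n i \<omega>) \<partial>Mn n)\<bar> \<le> e * (1 + (2*H+1) * (real (card I) + 1))"
      using elim(1) by (intro hT p m) auto
    moreover have "\<bar>(\<integral>\<omega>. h (\<lambda>i. X i \<omega>) \<partial>M) - (\<integral>\<omega>. T (\<lambda>i. X i \<omega>) \<partial>M)\<bar> \<le> e * (1 + (2*H+1) * (real (card I) + 1))"
      using R(2) by (intro hT p m) auto
    ultimately show ?case using elim(2) e4 unfolding dist_real_def real_norm_def by linarith
  qed
  then show "\<exists>no. \<forall>n\<ge>no. norm ((\<integral>\<omega>. h (\<lambda>i. Xn n i \<omega>) \<partial>Mn n) - (\<integral>\<omega>. h (\<lambda>i. X i \<omega>) \<partial>M)) < r"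
    by (simp add: eventually_sequentially)
qed

section \<open>Gaussian integration by parts\<close>

text \<open>Continuous functionals of the path that depend on the finitely many times in \<open>I\<close> and grow polynomially.\<close>
definition adm :: "'i set \<Rightarrow> (('i \<Rightarrow> real) \<Rightarrow> 'c::real_normed_vector) \<Rightarrow> bool" where
  "adm I \<Phi> \<longleftrightarrow> continuous_on UNIV \<Phi> \<and> depends_on I \<Phi> \<and>
     (\<exists>C p. \<forall>b. norm (\<Phi> b) \<le> C * (1 + (\<Sum>i\<in>I. \<bar>b i\<bar>)) ^ p)"

lemma admE:
  assumes "adm I \<Phi>"
  obtains C p where "C \<ge> 0" "\<And>b. norm (\<Phi> b) \<le> C * (1 + (\<Sum>i\<in>I. \<bar>b i\<bar>)) ^ p"
proof -
  obtain C p where *: "\<And>b. norm (\<Phi> b) \<le> C * (1 + (\<Sum>i\<in>I. \<bar>b i\<bar>)) ^ p" using assms unfolding adm_def by blast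
  have "norm (\<Phi> (\<lambda>_. 0)) \<le> C" using *[of "\<lambda>_. 0"] by simp
  then have "C \<ge> 0" using norm_ge_zero order_trans by blast
  with * that show thesis by blast
qed

lemma adm_continuous: "adm I \<Phi> \<Longrightarrow> continuous_on UNIV \<Phi>"
  and adm_depends: "adm I \<Phi> \<Longrightarrow> depends_on I \<Phi>"
  unfolding adm_def by blast+

lemma adm_const: "adm I (\<lambda>_. c)"
  unfolding adm_def depends_on_def by (intro conjI continuous_on_const exI[of _ "norm c"] exI[of _ 0]) auto

lemma adm_coord: "finite I \<Longrightarrow> i \<in> I \<Longrightarrow> adm I (\<lambda>b. b i)"
  unfolding adm_def depends_on_def
proof (intro conjI continuous_on_product_coordinates exI[of _ 1] exI[of _ 1])
  assume "finite I" "i \<in> I"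
  show "\<forall>b. norm (b i) \<le> 1 * (1 + (\<Sum>i\<in>I. \<bar>b i\<bar>)) ^ 1"
  proof
    fix b :: "'a \<Rightarrow> real"
    have "\<bar>b i\<bar> \<le> (\<Sum>i\<in>I. \<bar>b i\<bar>)" using \<open>finite I\<close> \<open>i \<in> I\<close> by (intro member_le_sum) auto
    then show "norm (b i) \<le> 1 * (1 + (\<Sum>i\<in>I. \<bar>b i\<bar>)) ^ 1" by simp
  qed
qed auto

text \<open>One proof for real and complex products, scalar multiples and inner products: under a
  bounded bilinear map the degrees of growth add.\<close>

lemma adm_bilinear:
  assumes "bounded_bilinear pr" "adm I \<Phi>" "adm I \<Psi>"
  shows "adm I (\<lambda>b. pr (\<Phi> b) (\<Psi> b))"
proof -
  interpret bounded_bilinear pr by fact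
  obtain C p where C: "C \<ge> 0" "\<And>b. norm (\<Phi> b) \<le> C * (1 + (\<Sum>i\<in>I. \<bar>b i\<bar>)) ^ p" using admE[OF assms(2)] by blast
  obtain D q where D: "D \<ge> 0" "\<And>b. norm (\<Psi> b) \<le> D * (1 + (\<Sum>i\<in>I. \<bar>b i\<bar>)) ^ q" using admE[OF assms(3)] by blast
  obtain K where K: "K \<ge> 0" "\<And>x y. norm (pr x y) \<le> norm x * norm y * K" using nonneg_bounded by blast
  have "norm (pr (\<Phi> b) (\<Psi> b)) \<le> (C*D*K) * (1 + (\<Sum>i\<in>I. \<bar>b i\<bar>)) ^ (p+q)" for b
  proof -
    have "norm (pr (\<Phi> b) (\<Psi> b)) \<le> norm (\<Phi> b) * norm (\<Psi> b) * K" by (rule K)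
    also have "\<dots> \<le> (C * (1 + (\<Sum>i\<in>I. \<bar>b i\<bar>)) ^ p) * (D * (1 + (\<Sum>i\<in>I. \<bar>b i\<bar>)) ^ q) * K"
      using C D K(1) by (intro mult_right_mono mult_mono mult_nonneg_nonneg zero_le_power add_nonneg_nonneg sum_nonneg) auto
    finally show ?thesis by (simp add: power_add algebra_simps)
  qed
  moreover have "continuous_on UNIV (\<lambda>b. pr (\<Phi> b) (\<Psi> b))"
    by (intro continuous_on adm_continuous[OF assms(2)] adm_continuous[OF assms(3)])
  moreover have "depends_on I (\<lambda>b. pr (\<Phi> b) (\<Psi> b))"
    using adm_depends[OF assms(2)] adm_depends[OF assms(3)] unfolding depends_on_def by metis
  ultimately show ?thesis unfolding adm_def by blast
qed

lemmas adm_mult = adm_bilinear[OF bounded_bilinear_mult]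
lemmas adm_scaleR = adm_bilinear[OF bounded_bilinear_scaleR]
lemmas adm_inner = adm_bilinear[OF bounded_bilinear_inner]

lemma adm_add:
  assumes "adm I \<Phi>" "adm I \<Psi>"
  shows "adm I (\<lambda>b. \<Phi> b + \<Psi> b)"
proof -
  obtain C p where C: "C \<ge> 0" "\<And>b. norm (\<Phi> b) \<le> C * (1 + (\<Sum>i\<in>I. \<bar>b i\<bar>)) ^ p" using admE[OF assms(1)] by blast
  obtain D q where D: "D \<ge> 0" "\<And>b. norm (\<Psi> b) \<le> D * (1 + (\<Sum>i\<in>I. \<bar>b i\<bar>)) ^ q" using admE[OF assms(2)] by blast
  have "norm (\<Phi> b + \<Psi> b) \<le> (C+D) * (1 + (\<Sum>i\<in>I. \<bar>b i\<bar>)) ^ (p+q)" for b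
  proof -
    let ?s = "1 + (\<Sum>i\<in>I. \<bar>b i\<bar>)"
    have "?s \<ge> 1" by (simp add: sum_nonneg)
    then have "?s ^ p \<le> ?s ^ (p+q)" "?s ^ q \<le> ?s ^ (p+q)" by (intro power_increasing; simp)+
    then have "C * ?s ^ p \<le> C * ?s ^ (p+q)" "D * ?s ^ q \<le> D * ?s ^ (p+q)" using C D by (auto intro: mult_left_mono)
    then have "norm (\<Phi> b) + norm (\<Psi> b) \<le> (C+D) * ?s ^ (p+q)" using C(2)[of b] D(2)[of b] by (simp add: distrib_right)
    then show ?thesis using norm_triangle_ineq order_trans by blast
  qed
  moreover have "continuous_on UNIV (\<lambda>b. \<Phi> b + \<Psi> b)"
    by (intro continuous_on_add adm_continuous[OF assms(1)] adm_continuous[OF assms(2)])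
  moreover have "depends_on I (\<lambda>b. \<Phi> b + \<Psi> b)"
    using adm_depends[OF assms(1)] adm_depends[OF assms(2)] unfolding depends_on_def by metis
  ultimately show ?thesis unfolding adm_def by blast
qed

lemma adm_sum: "(\<And>j. j \<in> J \<Longrightarrow> adm I (\<Phi> j)) \<Longrightarrow> adm I (\<lambda>b. \<Sum>j\<in>J. \<Phi> j b)"
  by (induction J rule: infinite_finite_induct) (auto intro: adm_const adm_add)

lemma adm_cmult: fixes c :: "'c::real_normed_algebra" shows "adm I \<Phi> \<Longrightarrow> adm I (\<lambda>b. c * \<Phi> b)"
  by (intro adm_mult adm_const)

lemma adm_diff: fixes \<Phi> :: "_ \<Rightarrow> 'c::real_normed_algebra_1" shows "adm I \<Phi> \<Longrightarrow> adm I \<Psi> \<Longrightarrow> adm I (\<lambda>b. \<Phi> b - \<Psi> b)"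
  using adm_add[of I \<Phi> "\<lambda>b. -1 * \<Psi> b"] adm_cmult[of I \<Psi> "-1"] by simp

lemma adm_power: fixes \<Phi> :: "_ \<Rightarrow> 'c::real_normed_algebra_1" shows "adm I \<Phi> \<Longrightarrow> adm I (\<lambda>b. \<Phi> b ^ n)"
  by (induction n) (auto intro: adm_const adm_mult)

lemma adm_lin: "finite I \<Longrightarrow> adm I (\<lambda>b. \<Sum>t\<in>I. c t * b t)"
  by (intro adm_sum adm_cmult adm_coord)

text \<open>A general g could destroy polynomial growth, a bounded one cannot. This makes
  \<open>iexp\<close> of a functional and the bounded derivatives of the truncated function
  admissible.\<close>

lemma adm_compose_bounded:
  fixes g :: "real \<Rightarrow> 'c::real_normed_vector"
  assumes "adm I \<Phi>" "continuous_on UNIV g" "\<And>x. norm (g x) \<le> C"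
  shows "adm I (\<lambda>b. g (\<Phi> b))"
  unfolding adm_def
proof (intro conjI exI[of _ C] exI[of _ 0] allI)
  show "continuous_on UNIV (\<lambda>b. g (\<Phi> b))"
    by (rule continuous_on_compose2[OF assms(2) adm_continuous[OF assms(1)]]) simp
  show "depends_on I (\<lambda>b. g (\<Phi> b))"
    using adm_depends[OF assms(1)] unfolding depends_on_def by metis
qed (use assms(3) in simp)

lemma adm_compose_linear:
  assumes "adm I \<Phi>" "bounded_linear g"
  shows "adm I (\<lambda>b. g (\<Phi> b))"
proof -
  obtain C p where C: "C \<ge> 0" "\<And>b. norm (\<Phi> b) \<le> C * (1 + (\<Sum>i\<in>I. \<bar>b i\<bar>)) ^ p" using admE[OF assms(1)] by blast
  obtain K where K: "K \<ge> 0" "\<And>x. norm (g x) \<le> norm x * K" using bounded_linear.nonneg_bounded[OF assms(2)] by blast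
  show ?thesis unfolding adm_def
  proof (intro conjI exI[of _ "C*K"] exI[of _ p] allI)
    show "continuous_on UNIV (\<lambda>b. g (\<Phi> b))"
      by (rule bounded_linear.continuous_on[OF assms(2) adm_continuous[OF assms(1)]])
    show "depends_on I (\<lambda>b. g (\<Phi> b))"
      using adm_depends[OF assms(1)] unfolding depends_on_def by metis
    fix b
    have "norm (g (\<Phi> b)) \<le> norm (\<Phi> b) * K" by (rule K)
    also have "\<dots> \<le> C * (1 + (\<Sum>i\<in>I. \<bar>b i\<bar>)) ^ p * K" by (rule mult_right_mono[OF C(2) K(1)])
    finally show "norm (g (\<Phi> b)) \<le> C*K * (1 + (\<Sum>i\<in>I. \<bar>b i\<bar>)) ^ p" by (simp add: mult_ac)
  qed
qed

text \<open>Restricted to a line in path space, an admissible functional grows polynomially in the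
  scalar parameter, which is the form needed for integration by parts in one variable.\<close>

lemma adm_line_bound:
  assumes "adm I \<Phi>"
  obtains C p where "\<And>x::real. norm (\<Phi> (\<lambda>t. b t + x * k t)) \<le> C * (1 + \<bar>x\<bar>) ^ p"
proof -
  obtain C p where C: "C \<ge> 0" "\<And>b. norm (\<Phi> b) \<le> C * (1 + (\<Sum>i\<in>I. \<bar>b i\<bar>)) ^ p" using admE[OF assms] by blast
  define S where "S = 1 + (\<Sum>i\<in>I. \<bar>b i\<bar>) + (\<Sum>i\<in>I. \<bar>k i\<bar>)"
  have "norm (\<Phi> (\<lambda>t. b t + x * k t)) \<le> (C * S ^ p) * (1 + \<bar>x\<bar>) ^ p" for x
  proof -
    have "(\<Sum>i\<in>I. \<bar>b i + x * k i\<bar>) \<le> (\<Sum>i\<in>I. \<bar>b i\<bar> + \<bar>x\<bar> * \<bar>k i\<bar>)"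
      by (intro sum_mono) (metis abs_mult abs_triangle_ineq)
    also have "\<dots> = (\<Sum>i\<in>I. \<bar>b i\<bar>) + \<bar>x\<bar> * (\<Sum>i\<in>I. \<bar>k i\<bar>)"
      by (simp add: sum.distrib sum_distrib_left)
    also have "1 + \<dots> \<le> S * (1 + \<bar>x\<bar>)"
      unfolding S_def using sum_nonneg[of I "\<lambda>i. \<bar>b i\<bar>"] sum_nonneg[of I "\<lambda>i. \<bar>k i\<bar>"]
      by (simp add: algebra_simps)
    finally have le: "1 + (\<Sum>i\<in>I. \<bar>b i + x * k i\<bar>) \<le> S * (1 + \<bar>x\<bar>)" by simp
    have "norm (\<Phi> (\<lambda>t. b t + x * k t)) \<le> C * (1 + (\<Sum>i\<in>I. \<bar>b i + x * k i\<bar>)) ^ p" by (rule C)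
    also have "\<dots> \<le> C * (S * (1 + \<bar>x\<bar>)) ^ p"
      using le C(1) by (intro mult_left_mono power_mono) (auto intro!: add_nonneg_nonneg sum_nonneg)
    finally show ?thesis by (simp add: power_mult_distrib)
  qed
  then show thesis by (rule that)
qed

text \<open>The monic (probabilists') Hermite polynomials, orthogonal for the standard normal
  law.\<close>

fun hermite :: "nat \<Rightarrow> real \<Rightarrow> real" where
  "hermite 0 x = 1"
| "hermite (Suc 0) x = x"
| "hermite (Suc (Suc n)) x = x * hermite (Suc n) x - real (Suc n) * hermite n x"

lemma hermite_deriv: "(hermite n has_real_derivative real n * hermite (n - 1) x) (at x)"
proof (induction n rule: hermite.induct[of "\<lambda>n _. (hermite n has_real_derivative real n * hermite (n - 1) x) (at x)", OF _ _ _ ])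
  case (3 n _)
  have "((\<lambda>x. x * hermite (Suc n) x - real (Suc n) * hermite n x) has_real_derivative
     (1 * hermite (Suc n) x + real (Suc n) * hermite (Suc n - 1) x * x) - real (Suc n) * (real n * hermite (n-1) x)) (at x)"
    by (intro DERIV_diff DERIV_mult DERIV_ident 3 DERIV_cmult)
  moreover have "(1 * hermite (Suc n) x + real (Suc n) * hermite (Suc n - 1) x * x) - real (Suc n) * (real n * hermite (n-1) x)
    = real (Suc (Suc n)) * hermite (Suc (Suc n) - 1) x"
    by (cases n) (simp_all add: algebra_simps)
  moreover have "hermite (Suc (Suc n)) = (\<lambda>x. x * hermite (Suc n) x - real (Suc n) * hermite n x)" by (simp add: fun_eq_iff)
  ultimately show ?case by simp
next
  case (2 _)
  have "hermite (Suc 0) = (\<lambda>x. x)" by (simp add: fun_eq_iff)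
  then show ?case by simp
next
  case (1 _)
  have "hermite 0 = (\<lambda>x. 1)" by (simp add: fun_eq_iff)
  then show ?case by simp
qed

lemma adm_hermite: fixes \<Phi> :: "('i \<Rightarrow> real) \<Rightarrow> real" shows "adm I \<Phi> \<Longrightarrow> adm I (\<lambda>b. hermite n (\<Phi> b))"
  by (induction n "0::real" rule: hermite.induct) (auto intro!: adm_const adm_mult adm_diff)

section \<open>Moments and integration by parts under the standard normal law\<close>

lemma std_normal_abs_moment_integrable: "integrable std_normal_distribution (\<lambda>x. \<bar>x\<bar> ^ p)"
  using integrable_std_normal_moment_abs[of p]
  by (subst integrable_density) (auto simp: normal_density_nonneg)

lemma std_normal_poly_integrable:
  assumes "\<And>x. norm (f x) \<le> C * (1 + \<bar>x\<bar>) ^ p" "f \<in> borel_measurable borel"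
  shows "integrable std_normal_distribution (f :: real \<Rightarrow> real)"
proof (rule Bochner_Integration.integrable_bound)
  have "(1 + \<bar>x\<bar>) ^ p = (\<Sum>k\<le>p. real (p choose k) * \<bar>x\<bar> ^ (p-k))" for x :: real
    by (subst binomial_ring) simp
  then show "integrable std_normal_distribution (\<lambda>x. C * (1 + \<bar>x\<bar>) ^ p)"
    using std_normal_abs_moment_integrable by (auto intro!: Bochner_Integration.integrable_sum)
  show "f \<in> borel_measurable std_normal_distribution" using assms(2) by simp
  show "AE x in std_normal_distribution. norm (f x) \<le> norm (C * (1 + \<bar>x\<bar>) ^ p)"
    unfolding real_norm_def by (intro AE_I2 order_trans[OF assms(1)[unfolded real_norm_def] abs_ge_self])
qed

lemma poly_times_std_normal_density_tendsto_0:
  assumes "\<And>x. \<bar>\<phi> x\<bar> \<le> C * (1 + \<bar>x\<bar>) ^ p"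
  shows "((\<lambda>x. \<phi> x * std_normal_density x) \<longlongrightarrow> 0) at_infinity"
proof (rule Lim_null_comparison)
  have lim: "((\<lambda>y::real. y ^ p / exp y) \<longlongrightarrow> 0) at_top" by (rule tendsto_power_div_exp_0)
  have "filterlim (\<lambda>x::real. norm x) at_top at_infinity" by (rule filterlim_norm_at_top)
  then have "filterlim (\<lambda>x::real. 1 + \<bar>x\<bar>) at_top at_infinity"
    by (intro filterlim_tendsto_add_at_top[OF tendsto_const]) simp
  from filterlim_compose[OF lim this]
  have "((\<lambda>x::real. C * exp (3/2) * ((1 + \<bar>x\<bar>) ^ p / exp (1 + \<bar>x\<bar>))) \<longlongrightarrow> C * exp (3/2) * 0) at_infinity"
    by (intro tendsto_mult tendsto_const)
  then show "((\<lambda>x::real. C * exp (3/2) * ((1 + \<bar>x\<bar>) ^ p / exp (1 + \<bar>x\<bar>))) \<longlongrightarrow> 0) at_infinity" by simp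
  have "norm (\<phi> x * std_normal_density x) \<le> C * exp (3/2) * ((1 + \<bar>x\<bar>) ^ p / exp (1 + \<bar>x\<bar>))" for x
  proof -
    \<comment> \<open>Completing the square replaces the Gaussian by an exponential: -x^2/2 <= 1/2 -
      |x| = 3/2 - (1 + |x|), the origin of \<open>exp (3/2)\<close>.\<close>
    have "0 \<le> (\<bar>x\<bar> - 1)^2" by simp
    then have "- x\<^sup>2 / 2 \<le> 3/2 - (1 + \<bar>x\<bar>)" by (simp add: power2_eq_square algebra_simps)
    then have e: "exp (- x\<^sup>2 / 2) \<le> exp (3/2) / exp (1 + \<bar>x\<bar>)" by (subst exp_diff[symmetric]) simp
    have "sqrt (2 * pi) \<ge> 1" using pi_gt3 by simp
    then have "std_normal_density x \<le> exp (- x\<^sup>2 / 2)" unfolding std_normal_density_def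
      by (simp add: divide_le_eq mult_le_cancel_left1)
    with e have "std_normal_density x \<le> exp (3/2) / exp (1 + \<bar>x\<bar>)" by linarith
    then have "\<bar>\<phi> x\<bar> * std_normal_density x \<le> (C * (1 + \<bar>x\<bar>) ^ p) * (exp (3/2) / exp (1 + \<bar>x\<bar>))"
      using assms[of x] by (intro mult_mono) (auto simp: normal_density_nonneg intro: order_trans[OF abs_ge_zero])
    then show ?thesis by (simp add: abs_mult normal_density_nonneg mult_ac)
  qed
  then show "\<forall>\<^sub>F x in at_infinity. norm (\<phi> x * std_normal_density x) \<le> C * exp (3/2) * ((1 + \<bar>x\<bar>) ^ p / exp (1 + \<bar>x\<bar>))"
    by simp
qed

text \<open>Stein's identity. The product of \<open>\<phi>\<close> and the density has derivative
  \<open>\<phi>' x - x * \<phi> x\<close> times the density, and it vanishes at both infinities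
  because \<open>\<phi>\<close> grows polynomially.\<close>

lemma std_normal_integration_by_parts:
  fixes \<phi> \<phi>' :: "real \<Rightarrow> real"
  assumes d: "\<And>x. (\<phi> has_real_derivative \<phi>' x) (at x)" and c: "continuous_on UNIV \<phi>'"
    and b: "\<And>x. \<bar>\<phi> x\<bar> \<le> C * (1 + \<bar>x\<bar>) ^ p" "\<And>x. \<bar>\<phi>' x\<bar> \<le> C' * (1 + \<bar>x\<bar>) ^ p'"
  shows "(\<integral>x. x * \<phi> x \<partial>std_normal_distribution) = (\<integral>x. \<phi>' x \<partial>std_normal_distribution)"
proof -
  let ?g = std_normal_density
  have c\<phi>: "continuous_on UNIV \<phi>" using d by (meson DERIV_isCont continuous_at_imp_continuous_on)
  have [measurable]: "\<phi> \<in> borel_measurable borel" "\<phi>' \<in> borel_measurable borel"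
    using c c\<phi> by (auto intro: borel_measurable_continuous_onI)
  have C0: "C \<ge> 0" using order_trans[OF abs_ge_zero b(1)[of 0]] by simp
  have "\<bar>x * \<phi> x\<bar> \<le> C * (1 + \<bar>x\<bar>) ^ (Suc p)" for x
  proof -
    have "\<bar>x\<bar> * \<bar>\<phi> x\<bar> \<le> (1 + \<bar>x\<bar>) * (C * (1 + \<bar>x\<bar>) ^ p)" using b(1)[of x] by (intro mult_mono) auto
    then show ?thesis by (simp add: abs_mult mult_ac)
  qed
  then have i1: "integrable std_normal_distribution (\<lambda>x. x * \<phi> x)"
    by (intro std_normal_poly_integrable[where p="Suc p" and C=C]) (auto simp del: power_Suc)
  have i2: "integrable std_normal_distribution \<phi>'"
    using b(2) by (intro std_normal_poly_integrable) auto
  have j1: "integrable lborel (\<lambda>x. ?g x * (x * \<phi> x))" and j2: "integrable lborel (\<lambda>x. ?g x * \<phi>' x)"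
    using i1 i2 by (auto simp: integrable_density normal_density_nonneg)
  have gd: "(?g has_real_derivative (- x * ?g x)) (at x)" for x
    unfolding std_normal_density_def by (auto intro!: derivative_eq_intros simp: field_simps)
  have lim: "((\<lambda>x. \<phi> x * ?g x) \<longlongrightarrow> 0) at_infinity" by (rule poly_times_std_normal_density_tendsto_0[OF b(1)])
  have "(LBINT x=-\<infinity>..\<infinity>. ?g x * \<phi>' x - ?g x * (x * \<phi> x)) = 0 - 0"
  proof (rule interval_integral_FTC_integrable[where F="\<lambda>x. \<phi> x * ?g x"])
    show "((\<lambda>x. \<phi> x * ?g x) has_vector_derivative ?g x * \<phi>' x - ?g x * (x * \<phi> x)) (at x)" for x
      unfolding has_real_derivative_iff_has_vector_derivative[symmetric]
      by (rule DERIV_cong[OF DERIV_mult[OF d gd]]) (simp add: algebra_simps)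
    show "isCont (\<lambda>x. ?g x * \<phi>' x - ?g x * (x * \<phi> x)) x" for x
      using c c\<phi> DERIV_isCont[OF gd, of x] by (intro continuous_intros) (auto simp: continuous_on_eq_continuous_at)
    show "set_integrable lborel (einterval (-\<infinity>) \<infinity>) (\<lambda>x. ?g x * \<phi>' x - ?g x * (x * \<phi> x))"
      using j1 j2 by (simp add: set_integrable_def einterval_def)
    show "(((\<lambda>x. \<phi> x * ?g x) \<circ> real_of_ereal) \<longlongrightarrow> 0) (at_right (-\<infinity>))"
      unfolding ereal_tendsto_simps1 using lim by (rule tendsto_mono[rotated]) (simp add: at_infinity_eq_at_top_bot)
    show "(((\<lambda>x. \<phi> x * ?g x) \<circ> real_of_ereal) \<longlongrightarrow> 0) (at_left \<infinity>)"
      unfolding ereal_tendsto_simps1 using lim by (rule tendsto_mono[rotated]) (simp add: at_infinity_eq_at_top_bot)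
  qed simp
  then have "(\<integral>x. ?g x * \<phi>' x - ?g x * (x * \<phi> x) \<partial>lborel) = 0"
    by (simp add: interval_lebesgue_integral_def einterval_def set_lebesgue_integral_def)
  then have "(\<integral>x. ?g x * \<phi>' x \<partial>lborel) = (\<integral>x. ?g x * (x * \<phi> x) \<partial>lborel)" using j1 j2 by simp
  then show ?thesis
    by (simp add: integral_density normal_density_nonneg)
qed

section \<open>Laws and moments of centered Gaussian variables\<close>

lemma integral_iexp_std_normal: "(\<integral>x. iexp (t * x) \<partial>std_normal_distribution) = complex_of_real (exp (- (t\<^sup>2) / 2))"
  using char_std_normal_distribution unfolding char_def fun_eq_iff by blast

text \<open>Writing the law as the image of a standard normal law under scaling treats the
  degenerate case v = 0 together with the others.\<close>

lemma (in prob_space) centered_gaussian_distr: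
  assumes g: "centered_gaussian M X v" and [measurable]: "X \<in> borel_measurable M"
  shows "v \<ge> 0" "distr M borel X = distr std_normal_distribution borel (\<lambda>x. sqrt v * x)"
proof -
  show "v \<ge> 0" using g unfolding centered_gaussian_def by (auto split: if_splits)
  interpret N: prob_space std_normal_distribution by (rule prob_space_normal_density) simp
  show "distr M borel X = distr std_normal_distribution borel (\<lambda>x. sqrt v * x)"
  proof (cases "v = 0")
    case True
    then have "AE \<omega> in M. X \<omega> = 0" using g unfolding centered_gaussian_def by simp
    then have "distr M borel X = distr M borel (\<lambda>_. 0)" by (intro distr_cong_AE) auto
    also have "\<dots> = return borel 0" by (rule distr_const) simp
    also have "\<dots> = distr std_normal_distribution borel (\<lambda>_. 0)" by (rule N.distr_const[symmetric]) simp
    finally show ?thesis using True by simp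
  next
    case False
    with g have v: "v > 0" "distributed M lborel X (normal_density 0 (sqrt v))"
      unfolding centered_gaussian_def by auto
    then have "distributed M lborel (\<lambda>x. (X x - 0) / sqrt v) std_normal_density"
      by (subst (asm) normal_standard_normal_convert) auto
    then have d: "distr M lborel (\<lambda>x. X x / sqrt v) = std_normal_distribution"
      by (simp add: distributed_def)
    have "distr M borel X = distr M borel (\<lambda>\<omega>. sqrt v * (X \<omega> / sqrt v))" using v by simp
    also have "\<dots> = distr (distr M lborel (\<lambda>x. X x / sqrt v)) borel (\<lambda>x. sqrt v * x)"
      by (subst distr_distr) (auto simp: o_def)
    finally show ?thesis unfolding d .
  qed
qed

lemma (in prob_space) centered_gaussian_iexp:
  assumes "centered_gaussian M X v" and [measurable]: "X \<in> borel_measurable M"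
  shows "(\<integral>\<omega>. iexp (X \<omega>) \<partial>M) = complex_of_real (exp (- v / 2))"
proof -
  note g = centered_gaussian_distr[OF assms]
  have "(\<integral>\<omega>. iexp (X \<omega>) \<partial>M) = (\<integral>x. iexp x \<partial>distr M borel X)"
    by (subst integral_distr) auto
  also have "\<dots> = (\<integral>x. iexp (sqrt v * x) \<partial>std_normal_distribution)"
    unfolding g(2) by (subst integral_distr) auto
  also have "\<dots> = complex_of_real (exp (- v / 2))"
    unfolding integral_iexp_std_normal using g(1) by simp
  finally show ?thesis .
qed

definition normal_abs_moment :: "nat \<Rightarrow> real" where
  "normal_abs_moment p = (\<integral>x. \<bar>x\<bar> ^ p \<partial>std_normal_distribution)"

lemma normal_abs_moment_nonneg: "normal_abs_moment p \<ge> 0"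
  unfolding normal_abs_moment_def by (intro integral_nonneg_AE) auto

lemma (in prob_space) centered_gaussian_moment:
  assumes "centered_gaussian M X v" and [measurable]: "X \<in> borel_measurable M"
  shows "integrable M (\<lambda>\<omega>. \<bar>X \<omega>\<bar> ^ p)" "(\<integral>\<omega>. \<bar>X \<omega>\<bar> ^ p \<partial>M) = sqrt v ^ p * normal_abs_moment p"
proof -
  note g = centered_gaussian_distr[OF assms]
  have "integrable (distr M borel X) (\<lambda>x. \<bar>x\<bar> ^ p)"
    unfolding g(2) using std_normal_abs_moment_integrable[of p]
    by (subst integrable_distr_eq) (auto simp: abs_mult power_mult_distrib)
  then show "integrable M (\<lambda>\<omega>. \<bar>X \<omega>\<bar> ^ p)" by (subst (asm) integrable_distr_eq) auto
  have "(\<integral>\<omega>. \<bar>X \<omega>\<bar> ^ p \<partial>M) = (\<integral>x. \<bar>x\<bar> ^ p \<partial>distr M borel X)"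
    by (subst integral_distr) auto
  also have "\<dots> = sqrt v ^ p * normal_abs_moment p"
    unfolding g(2) normal_abs_moment_def using g(1) by (subst integral_distr) (auto simp: abs_mult power_mult_distrib)
  finally show "(\<integral>\<omega>. \<bar>X \<omega>\<bar> ^ p \<partial>M) = sqrt v ^ p * normal_abs_moment p" .
qed

lemma power_sum_le: "(a + b) ^ p \<le> 2 ^ p * (a ^ p + b ^ p)" if "a \<ge> 0" "b \<ge> 0" for a b :: real
proof -
  have "(a + b) ^ p \<le> (2 * max a b) ^ p" using that by (intro power_mono) auto
  also have "\<dots> = 2 ^ p * max a b ^ p" by (rule power_mult_distrib)
  also have "max a b ^ p \<le> a ^ p + b ^ p" using that by (auto simp: max_def)
  finally show ?thesis by simp
qed

lemma (in prob_space) integrable_abs_sum_power: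
  fixes X :: "'b \<Rightarrow> 'a \<Rightarrow> real"
  assumes "c \<ge> 0" and "finite J" "\<And>j p. j \<in> J \<Longrightarrow> integrable M (\<lambda>\<omega>. \<bar>X j \<omega>\<bar> ^ p)"
    and "\<And>j. j \<in> J \<Longrightarrow> X j \<in> borel_measurable M"
  shows "integrable M (\<lambda>\<omega>. (c + (\<Sum>j\<in>J. \<bar>X j \<omega>\<bar>)) ^ p)"
  using assms(2-)
proof (induction J arbitrary: p)
  case (insert j J)
  note insert.prems(2)[measurable]
  show ?case
  proof (rule Bochner_Integration.integrable_bound)
    show "integrable M (\<lambda>\<omega>. 2 ^ p * (\<bar>X j \<omega>\<bar> ^ p + (c + (\<Sum>j\<in>J. \<bar>X j \<omega>\<bar>)) ^ p))"
      using insert by auto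
    show "(\<lambda>\<omega>. (c + (\<Sum>j\<in>insert j J. \<bar>X j \<omega>\<bar>)) ^ p) \<in> borel_measurable M" by measurable
    show "AE \<omega> in M. norm ((c + (\<Sum>j\<in>insert j J. \<bar>X j \<omega>\<bar>)) ^ p) \<le> norm (2 ^ p * (\<bar>X j \<omega>\<bar> ^ p + (c + (\<Sum>j\<in>J. \<bar>X j \<omega>\<bar>)) ^ p))"
    proof (rule AE_I2)
      fix \<omega>
      let ?s = "c + (\<Sum>j\<in>J. \<bar>X j \<omega>\<bar>)"
      have s0: "?s \<ge> 0" using assms(1) by (intro add_nonneg_nonneg sum_nonneg) auto
      have "c + (\<Sum>j\<in>insert j J. \<bar>X j \<omega>\<bar>) = \<bar>X j \<omega>\<bar> + ?s" using insert.hyps by simp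
      then show "norm ((c + (\<Sum>j\<in>insert j J. \<bar>X j \<omega>\<bar>)) ^ p) \<le> norm (2 ^ p * (\<bar>X j \<omega>\<bar> ^ p + ?s ^ p))"
        using power_sum_le[of "\<bar>X j \<omega>\<bar>" ?s p] s0 by (simp add: power_abs[symmetric] add_ac)
    qed
  qed
qed simp

text \<open>Common frame for \<open>B\<close> with kernel \<open>K10\<close> and for
  \<open>W\<close> with its Brownian kernel: measurability, the laws of finite linear combinations
  and the symmetry of the kernel.\<close>

locale gaussian_process = prob_space M for M :: "'a measure" +
  fixes B :: "real \<Rightarrow> 'a \<Rightarrow> real" and K :: "real \<Rightarrow> real \<Rightarrow> real"
  assumes B_measurable: "t \<ge> 0 \<Longrightarrow> B t \<in> borel_measurable M"
    and B_gaussian: "(\<And>i. i < n \<Longrightarrow> ts i \<ge> 0) \<Longrightarrow>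
        centered_gaussian M (\<lambda>\<omega>. \<Sum>i<n. c i * B (ts i) \<omega>) (\<Sum>i<(n::nat). \<Sum>j<n. c i * c j * K (ts i) (ts j))"
    and K_sym: "K s t = K t s"
begin

lemma gaussian_finite:
  assumes "finite I" "I \<subseteq> {0..}"
  shows "centered_gaussian M (\<lambda>\<omega>. \<Sum>t\<in>I. c t * B t \<omega>) (\<Sum>s\<in>I. \<Sum>t\<in>I. c s * c t * K s t)"
proof -
  obtain e where e: "bij_betw e {0..<card I} I" using ex_bij_betw_nat_finite[OF assms(1)] by blast
  then have e': "bij_betw e {..<card I} I" by (simp add: lessThan_atLeast0)
  have s: "(\<Sum>t\<in>I. g t) = (\<Sum>i<card I. g (e i))" for g :: "real \<Rightarrow> real"
    by (rule sum.reindex_bij_betw[OF e', symmetric])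
  have "e i \<ge> 0" if "i < card I" for i using bij_betwE[OF e'] that assms(2) by auto
  from B_gaussian[OF this, of "card I" "\<lambda>i. i" "\<lambda>i. c (e i)"] show ?thesis unfolding s by simp
qed

lemma B_lin_measurable: "I \<subseteq> {0..} \<Longrightarrow> (\<lambda>\<omega>. \<Sum>t\<in>I. c t * B t \<omega>) \<in> borel_measurable M"
  using B_measurable by (intro borel_measurable_sum borel_measurable_times borel_measurable_const) auto

lemma iexp_finite:
  assumes "finite I" "I \<subseteq> {0..}"
  shows "(\<integral>\<omega>. iexp (\<Sum>t\<in>I. c t * B t \<omega>) \<partial>M) = complex_of_real (exp (- (\<Sum>s\<in>I. \<Sum>t\<in>I. c s * c t * K s t) / 2))"
  by (rule centered_gaussian_iexp[OF gaussian_finite[OF assms] B_lin_measurable[OF assms(2)]])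

lemma B_moment_integrable:
  assumes "t \<ge> 0"
  shows "integrable M (\<lambda>\<omega>. \<bar>B t \<omega>\<bar> ^ p)"
proof -
  have "centered_gaussian M (B t) (K t t)"
    using gaussian_finite[of "{t}" "\<lambda>_. 1"] assms by simp
  then show ?thesis using B_measurable[OF assms] by (rule centered_gaussian_moment)
qed

lemma adm_measurable:
  fixes \<Phi> :: "(real \<Rightarrow> real) \<Rightarrow> 'c::euclidean_space"
  assumes "finite I" "I \<subseteq> {0..}" "adm I \<Phi>"
  shows "(\<lambda>\<omega>. \<Phi> (\<lambda>t. B t \<omega>)) \<in> borel_measurable M"
proof (subst borel_measurable_euclidean_space, rule ballI)
  fix e :: 'c assume "e \<in> Basis"
  have a: "adm I (\<lambda>b. \<Phi> b \<bullet> e)" by (intro adm_inner assms adm_const)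
  show "(\<lambda>\<omega>. \<Phi> (\<lambda>t. B t \<omega>) \<bullet> e) \<in> borel_measurable M"
    by (rule continuous_functional_measurable[OF assms(1) adm_continuous[OF a] adm_depends[OF a]])
       (use assms(2) B_measurable in auto)
qed

lemma adm_integrable:
  fixes \<Phi> :: "(real \<Rightarrow> real) \<Rightarrow> 'c::euclidean_space"
  assumes "finite I" "I \<subseteq> {0..}" "adm I \<Phi>"
  shows "integrable M (\<lambda>\<omega>. \<Phi> (\<lambda>t. B t \<omega>))"
proof -
  obtain C p where C: "C \<ge> 0" "\<And>b. norm (\<Phi> b) \<le> C * (1 + (\<Sum>i\<in>I. \<bar>b i\<bar>)) ^ p" using admE[OF assms(3)] by blast
  show ?thesis
  proof (rule Bochner_Integration.integrable_bound)
    show "integrable M (\<lambda>\<omega>. C * (1 + (\<Sum>i\<in>I. \<bar>B i \<omega>\<bar>)) ^ p)"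
      using assms B_measurable B_moment_integrable
      by (intro integrable_mult_right integrable_abs_sum_power) auto
    show "AE \<omega> in M. norm (\<Phi> (\<lambda>t. B t \<omega>)) \<le> norm (C * (1 + (\<Sum>i\<in>I. \<bar>B i \<omega>\<bar>)) ^ p)"
      unfolding real_norm_def by (intro AE_I2 order_trans[OF C(2) abs_ge_self])
  qed (rule adm_measurable[OF assms])
qed

end

section \<open>Integration by parts for functionals of a Gaussian process\<close>

context gaussian_process
begin

text \<open>Replacing the component of \<open>B\<close> along \<open>\<Sum>s\<in>I. c s * B s\<close> by an independent standard normal variable \<open>x\<close> does not change
  its law. One-dimensional integration by parts in \<open>x\<close> then gives integration by parts for functionals of \<open>B\<close>.\<close>
lemma shifted_char:
  assumes I: "finite I" "I \<subseteq> {0..}" and unit: "(\<Sum>s\<in>I. \<Sum>t\<in>I. c s * c t * K s t) = 1"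
    and k: "\<And>t. k t = (\<Sum>s\<in>I. c s * K s t)"
  shows "(\<integral>z. iexp (\<Sum>t\<in>I. u t * (B t (snd z) - k t * (\<Sum>s\<in>I. c s * B s (snd z)) + k t * fst z))
       \<partial>(std_normal_distribution \<Otimes>\<^sub>M M)) = (\<integral>\<omega>. iexp (\<Sum>t\<in>I. u t * B t \<omega>) \<partial>M)"
proof -
  interpret N: prob_space std_normal_distribution by (rule prob_space_normal_density) simp
  interpret P: pair_prob_space std_normal_distribution M ..
  define \<kappa> where "\<kappa> = (\<Sum>t\<in>I. u t * k t)"
  define w where "w t = u t - \<kappa> * c t" for t
  have Bm[measurable]: "B t \<in> borel_measurable M" if "t \<in> I" for t using that I B_measurable by auto
  have dec: "(\<Sum>t\<in>I. u t * (B t \<omega> - k t * (\<Sum>s\<in>I. c s * B s \<omega>) + k t * x)) = \<kappa> * x + (\<Sum>t\<in>I. w t * B t \<omega>)" for x \<omega>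
  proof -
    have "(\<Sum>t\<in>I. w t * B t \<omega>) = (\<Sum>t\<in>I. u t * B t \<omega>) - \<kappa> * (\<Sum>s\<in>I. c s * B s \<omega>)"
      unfolding w_def by (simp add: left_diff_distrib right_diff_distrib sum_subtractf sum_distrib_left mult_ac)
    moreover have "(\<Sum>t\<in>I. u t * (B t \<omega> - k t * S + k t * x)) = (\<Sum>t\<in>I. u t * B t \<omega>) - \<kappa> * S + \<kappa> * x" for S
      unfolding \<kappa>_def by (simp add: algebra_simps sum.distrib sum_subtractf sum_distrib_left sum_distrib_right)
    ultimately show ?thesis by simp
  qed
  have m: "(\<lambda>\<omega>. iexp (\<Sum>t\<in>I. w t * B t \<omega>)) \<in> borel_measurable M" by measurable
  have m2: "(\<lambda>z. iexp (\<kappa> * fst z) * iexp (\<Sum>t\<in>I. w t * B t (snd z))) \<in> borel_measurable (std_normal_distribution \<Otimes>\<^sub>M M)"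
    using m by measurable
  have int: "integrable (std_normal_distribution \<Otimes>\<^sub>M M) (\<lambda>z. iexp (\<kappa> * fst z) * iexp (\<Sum>t\<in>I. w t * B t (snd z)))"
    using m2 by (intro P.integrable_const_bound[where B=1]) (auto simp: norm_mult simp del: of_real_sum)
  have kk: "(\<Sum>s\<in>I. \<Sum>t\<in>I. u s * c t * K s t) = \<kappa>"
    unfolding \<kappa>_def k by (intro sum.cong refl) (simp add: sum_distrib_left K_sym mult_ac)
  then have kk': "(\<Sum>s\<in>I. \<Sum>t\<in>I. c s * u t * K s t) = \<kappa>"
    by (subst sum.swap) (simp add: K_sym mult_ac)
  have Q: "(\<Sum>s\<in>I. \<Sum>t\<in>I. w s * w t * K s t) = (\<Sum>s\<in>I. \<Sum>t\<in>I. u s * u t * K s t) - \<kappa>\<^sup>2"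
  proof -
    have "(\<Sum>s\<in>I. \<Sum>t\<in>I. w s * w t * K s t) = (\<Sum>s\<in>I. \<Sum>t\<in>I. u s * u t * K s t - \<kappa> * (u s * c t * K s t) - \<kappa> * (c s * u t * K s t) + \<kappa>\<^sup>2 * (c s * c t * K s t))"
      unfolding w_def by (intro sum.cong refl) (simp add: algebra_simps power2_eq_square)
    also have "\<dots> = (\<Sum>s\<in>I. \<Sum>t\<in>I. u s * u t * K s t) - \<kappa> * (\<Sum>s\<in>I. \<Sum>t\<in>I. u s * c t * K s t)
        - \<kappa> * (\<Sum>s\<in>I. \<Sum>t\<in>I. c s * u t * K s t) + \<kappa>\<^sup>2 * (\<Sum>s\<in>I. \<Sum>t\<in>I. c s * c t * K s t)"
      by (simp add: sum.distrib sum_subtractf sum_distrib_left)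
    finally show ?thesis unfolding kk kk' unit by (simp add: power2_eq_square)
  qed
  have "(\<integral>z. iexp (\<Sum>t\<in>I. u t * (B t (snd z) - k t * (\<Sum>s\<in>I. c s * B s (snd z)) + k t * fst z)) \<partial>(std_normal_distribution \<Otimes>\<^sub>M M))
     = (\<integral>z. iexp (\<kappa> * fst z) * iexp (\<Sum>t\<in>I. w t * B t (snd z)) \<partial>(std_normal_distribution \<Otimes>\<^sub>M M))"
    unfolding dec by (simp add: exp_add distrib_left del: of_real_sum)
  also have "\<dots> = (\<integral>x. (\<integral>\<omega>. iexp (\<kappa> * x) * iexp (\<Sum>t\<in>I. w t * B t \<omega>) \<partial>M) \<partial>std_normal_distribution)"
    using P.integral_fst'[OF int] by (simp del: of_real_sum)
  also have "\<dots> = (\<integral>x. iexp (\<kappa> * x) \<partial>std_normal_distribution) * (\<integral>\<omega>. iexp (\<Sum>t\<in>I. w t * B t \<omega>) \<partial>M)"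
    by (simp del: of_real_sum)
  also have "\<dots> = complex_of_real (exp (- (\<kappa>\<^sup>2) / 2) * exp (- (\<Sum>s\<in>I. \<Sum>t\<in>I. w s * w t * K s t) / 2))"
    unfolding integral_iexp_std_normal iexp_finite[OF I] by simp
  also have "exp (- (\<kappa>\<^sup>2) / 2) * exp (- (\<Sum>s\<in>I. \<Sum>t\<in>I. w s * w t * K s t) / 2) = exp (- (\<Sum>s\<in>I. \<Sum>t\<in>I. u s * u t * K s t) / 2)"
    unfolding Q by (simp add: exp_add[symmetric] field_simps)
  finally show ?thesis unfolding iexp_finite[OF I] .
qed

text \<open>\<open>levy_continuity_functional\<close>, applied to a constant sequence, upgrades
  equal joint characteristic functions to equal expectations of bounded continuous functionals.
  Testing with cosine and sine of \<open>\<Phi>\<close> gives the characteristic function of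
  \<open>\<Phi>\<close> itself, hence its law.\<close>

lemma shifted_law:
  assumes I: "finite I" "I \<subseteq> {0..}" and unit: "(\<Sum>s\<in>I. \<Sum>t\<in>I. c s * c t * K s t) = 1"
    and k: "\<And>t. k t = (\<Sum>s\<in>I. c s * K s t)" and a: "adm I (\<Phi> :: _ \<Rightarrow> real)"
  shows "(\<lambda>z. \<Phi> (\<lambda>t. B t (snd z) - k t * (\<Sum>s\<in>I. c s * B s (snd z)) + k t * fst z)) \<in> borel_measurable (std_normal_distribution \<Otimes>\<^sub>M M)" (is ?m)
    and "distr M borel (\<lambda>\<omega>. \<Phi> (\<lambda>t. B t \<omega>))
     = distr (std_normal_distribution \<Otimes>\<^sub>M M) borel (\<lambda>z. \<Phi> (\<lambda>t. B t (snd z) - k t * (\<Sum>s\<in>I. c s * B s (snd z)) + k t * fst z))"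
proof -
  interpret N: prob_space std_normal_distribution by (rule prob_space_normal_density) simp
  interpret P: pair_prob_space std_normal_distribution M ..
  define V where "V t = (\<lambda>z. B t (snd z) - k t * (\<Sum>s\<in>I. c s * B s (snd z)) + k t * fst z)" for t
  have Bm[measurable]: "B t \<in> borel_measurable M" if "t \<in> I" for t using that I B_measurable by auto
  have Vm: "V t \<in> borel_measurable (std_normal_distribution \<Otimes>\<^sub>M M)" if "t \<in> I" for t
  proof -
    have [measurable]: "B s \<in> borel_measurable M" if "s \<in> I" for s by (rule Bm[OF that])
    have [measurable]: "B t \<in> borel_measurable M" by (rule Bm[OF that])
    show ?thesis unfolding V_def by measurable
  qed
  note ca = adm_continuous[OF a] and da = adm_depends[OF a]
  have m1: "(\<lambda>z. \<Phi> (\<lambda>t. V t z)) \<in> borel_measurable (std_normal_distribution \<Otimes>\<^sub>M M)"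
    by (rule continuous_functional_measurable[OF I(1) ca da Vm])
  then show ?m unfolding V_def .
  have m2: "(\<lambda>\<omega>. \<Phi> (\<lambda>t. B t \<omega>)) \<in> borel_measurable M" by (rule adm_measurable[OF I a])
  have eq: "(\<integral>z. h (\<Phi> (\<lambda>t. V t z)) \<partial>(std_normal_distribution \<Otimes>\<^sub>M M)) = (\<integral>\<omega>. h (\<Phi> (\<lambda>t. B t \<omega>)) \<partial>M)"
    if h: "continuous_on UNIV h" "\<And>x. \<bar>h x\<bar> \<le> 1" for h :: "real \<Rightarrow> real"
  proof -
    have "(\<lambda>n::nat. \<integral>z. h (\<Phi> (\<lambda>t. V t z)) \<partial>(std_normal_distribution \<Otimes>\<^sub>M M)) \<longlonglongrightarrow> (\<integral>\<omega>. h (\<Phi> (\<lambda>t. B t \<omega>)) \<partial>M)"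
    proof (rule levy_continuity_functional[where h="\<lambda>b. h (\<Phi> b)" and H=1 and I=I])
      show "(\<lambda>n::nat. \<integral>z. iexp (\<Sum>t\<in>I. u t * V t z) \<partial>(std_normal_distribution \<Otimes>\<^sub>M M)) \<longlonglongrightarrow> (\<integral>\<omega>. iexp (\<Sum>t\<in>I. u t * B t \<omega>) \<partial>M)" for u
        unfolding V_def shifted_char[OF I unit k] by (rule tendsto_const)
      show "continuous_on UNIV (\<lambda>b. h (\<Phi> b))" by (rule continuous_on_compose2[OF h(1) ca]) simp
      show "depends_on I (\<lambda>b. h (\<Phi> b))" using da unfolding depends_on_def by metis
    qed (use I Vm Bm h P.prob_space_axioms prob_space_axioms in auto)
    from LIMSEQ_unique[OF tendsto_const this] show ?thesis .
  qed
  have char: "char (distr Q borel Y) u = Complex (\<integral>z. cos (u * Y z) \<partial>Q) (\<integral>z. sin (u * Y z) \<partial>Q)"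
    if Q: "prob_space Q" and [measurable]: "Y \<in> borel_measurable Q" for Q :: "'z measure" and Y u
  proof -
    interpret Q: prob_space Q by fact
    have "integrable Q (\<lambda>z. iexp (u * Y z))" by (intro Q.integrable_const_bound[where B=1]) auto
    from integral_Re[OF this] integral_Im[OF this] show ?thesis
      unfolding char_def by (subst integral_distr) (auto simp: complex_eq_iff Re_exp Im_exp)
  qed
  have "char (distr M borel (\<lambda>\<omega>. \<Phi> (\<lambda>t. B t \<omega>))) = char (distr (std_normal_distribution \<Otimes>\<^sub>M M) borel (\<lambda>z. \<Phi> (\<lambda>t. V t z)))"
  proof
    fix u
    have "(\<integral>z. cos (u * \<Phi> (\<lambda>t. V t z)) \<partial>(std_normal_distribution \<Otimes>\<^sub>M M)) = (\<integral>\<omega>. cos (u * \<Phi> (\<lambda>t. B t \<omega>)) \<partial>M)"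
      by (rule eq[of "\<lambda>x. cos (u * x)"]) (auto intro!: continuous_intros)
    moreover have "(\<integral>z. sin (u * \<Phi> (\<lambda>t. V t z)) \<partial>(std_normal_distribution \<Otimes>\<^sub>M M)) = (\<integral>\<omega>. sin (u * \<Phi> (\<lambda>t. B t \<omega>)) \<partial>M)"
      by (rule eq[of "\<lambda>x. sin (u * x)"]) (auto intro!: continuous_intros)
    ultimately show "char (distr M borel (\<lambda>\<omega>. \<Phi> (\<lambda>t. B t \<omega>))) u = char (distr (std_normal_distribution \<Otimes>\<^sub>M M) borel (\<lambda>z. \<Phi> (\<lambda>t. V t z))) u"
      by (simp add: char[OF P.prob_space_axioms m1] char[OF prob_space_axioms m2])
  qed
  then have "distr M borel (\<lambda>\<omega>. \<Phi> (\<lambda>t. B t \<omega>)) = distr (std_normal_distribution \<Otimes>\<^sub>M M) borel (\<lambda>z. \<Phi> (\<lambda>t. V t z))"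
    by (intro Levy_uniqueness real_distribution_distr P.real_distribution_distr m1 m2)
  then show "distr M borel (\<lambda>\<omega>. \<Phi> (\<lambda>t. B t \<omega>))
     = distr (std_normal_distribution \<Otimes>\<^sub>M M) borel (\<lambda>z. \<Phi> (\<lambda>t. B t (snd z) - k t * (\<Sum>s\<in>I. c s * B s (snd z)) + k t * fst z))"
    unfolding V_def .
qed

text \<open>Let \<open>\<xi>\<close> be the combination with coefficients c, of variance one. The
  residual path B - k \<open>\<xi>\<close> is uncorrelated with \<open>\<xi>\<close>; once it is
  fixed, \<open>\<Phi>\<close> is a function of one standard normal variable, and Stein's identity
  applies before the residual path is integrated out by Fubini.\<close>

lemma gaussian_ibp_real:
  assumes I: "finite I" "I \<subseteq> {0..}" and unit: "(\<Sum>s\<in>I. \<Sum>t\<in>I. c s * c t * K s t) = 1"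
    and k: "\<And>t. k t = (\<Sum>s\<in>I. c s * K s t)" and a: "adm I (\<Phi> :: _ \<Rightarrow> real)" "adm I \<Phi>'"
    and d: "\<And>b. ((\<lambda>x. \<Phi> (\<lambda>t. b t + x * k t)) has_real_derivative \<Phi>' b) (at 0)"
  shows "(\<integral>\<omega>. (\<Sum>t\<in>I. c t * B t \<omega>) * \<Phi> (\<lambda>t. B t \<omega>) \<partial>M) = (\<integral>\<omega>. \<Phi>' (\<lambda>t. B t \<omega>) \<partial>M)"
proof -
  interpret N: prob_space std_normal_distribution by (rule prob_space_normal_density) simp
  interpret P: pair_prob_space std_normal_distribution M ..
  define \<xi> where "\<xi> b = (\<Sum>t\<in>I. c t * b t)" for b :: "real \<Rightarrow> real"
  define V where "V x \<omega> = (\<lambda>t. B t \<omega> - k t * \<xi> (\<lambda>t. B t \<omega>) + k t * x)" for x \<omega>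
  \<comment> \<open>k is the covariance of B with \<open>\<xi>\<close>, so this is the variance of
    \<open>\<xi>\<close>: along direction k the variable \<open>\<xi>\<close> grows at unit
    rate.\<close>
  have ck: "(\<Sum>t\<in>I. c t * k t) = 1"
    using unit unfolding k by (subst (asm) sum.swap) (simp add: sum_distrib_left mult_ac)
  have xV: "\<xi> (V x \<omega>) = x" for x \<omega>
  proof -
    have *: "(\<Sum>t\<in>I. c t * (B t \<omega> - k t * S + k t * x)) = (\<Sum>t\<in>I. c t * B t \<omega>) - (\<Sum>t\<in>I. c t * k t) * S + (\<Sum>t\<in>I. c t * k t) * x" for S
      by (simp add: algebra_simps sum.distrib sum_subtractf sum_distrib_left sum_distrib_right)
    have "\<xi> (V x \<omega>) = \<xi> (\<lambda>t. B t \<omega>) - (\<Sum>t\<in>I. c t * k t) * \<xi> (\<lambda>t. B t \<omega>) + (\<Sum>t\<in>I. c t * k t) * x"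
      unfolding V_def using *[of "\<xi> (\<lambda>t. B t \<omega>)"] by (simp only: \<xi>_def)
    then show ?thesis unfolding ck by simp
  qed
  have transfer: "integrable (std_normal_distribution \<Otimes>\<^sub>M M) (\<lambda>z. \<Psi> (V (fst z) (snd z)))"
      "(\<integral>\<omega>. \<Psi> (\<lambda>t. B t \<omega>) \<partial>M) = (\<integral>z. \<Psi> (V (fst z) (snd z)) \<partial>(std_normal_distribution \<Otimes>\<^sub>M M))"
    if "adm I \<Psi>" for \<Psi> :: "_ \<Rightarrow> real"
  proof -
    note law = shifted_law[OF I unit k that]
    have m: "(\<lambda>z. \<Psi> (V (fst z) (snd z))) \<in> borel_measurable (std_normal_distribution \<Otimes>\<^sub>M M)"
      using law(1) unfolding V_def \<xi>_def .
    have l: "distr M borel (\<lambda>\<omega>. \<Psi> (\<lambda>t. B t \<omega>)) = distr (std_normal_distribution \<Otimes>\<^sub>M M) borel (\<lambda>z. \<Psi> (V (fst z) (snd z)))"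
      using law(2) unfolding V_def \<xi>_def .
    have m': "(\<lambda>\<omega>. \<Psi> (\<lambda>t. B t \<omega>)) \<in> borel_measurable M" by (rule adm_measurable[OF I that])
    have "integrable (distr M borel (\<lambda>\<omega>. \<Psi> (\<lambda>t. B t \<omega>))) (\<lambda>x. x)"
      using adm_integrable[OF I that] m' by (subst integrable_distr_eq) auto
    then show "integrable (std_normal_distribution \<Otimes>\<^sub>M M) (\<lambda>z. \<Psi> (V (fst z) (snd z)))"
      unfolding l using m by (subst (asm) integrable_distr_eq) auto
    have "(\<integral>\<omega>. \<Psi> (\<lambda>t. B t \<omega>) \<partial>M) = (\<integral>x. x \<partial>distr M borel (\<lambda>\<omega>. \<Psi> (\<lambda>t. B t \<omega>)))"
      using m' by (subst integral_distr) auto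
    also have "\<dots> = (\<integral>z. \<Psi> (V (fst z) (snd z)) \<partial>(std_normal_distribution \<Otimes>\<^sub>M M))"
      unfolding l using m by (subst integral_distr) auto
    finally show "(\<integral>\<omega>. \<Psi> (\<lambda>t. B t \<omega>) \<partial>M) = (\<integral>z. \<Psi> (V (fst z) (snd z)) \<partial>(std_normal_distribution \<Otimes>\<^sub>M M))" .
  qed
  have a\<xi>: "adm I (\<lambda>b. \<xi> b * \<Phi> b)" unfolding \<xi>_def by (intro adm_mult adm_lin I a)
  \<comment> \<open>For fixed \<open>\<omega>\<close> the path \<open>V x \<omega>\<close> runs
    along a line of direction k. The derivative in \<open>d\<close> is at 0 but at every base path,
    so moving the base path yields the derivative at every x.\<close>
  have inner: "(\<integral>x. x * \<Phi> (V x \<omega>) \<partial>std_normal_distribution) = (\<integral>x. \<Phi>' (V x \<omega>) \<partial>std_normal_distribution)" for \<omega>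
  proof -
    define b where "b t = B t \<omega> - k t * \<xi> (\<lambda>t. B t \<omega>)" for t
    have V: "V x \<omega> = (\<lambda>t. b t + x * k t)" for x unfolding V_def b_def by (simp add: mult.commute)
    obtain C p where C: "\<And>x. norm (\<Phi> (\<lambda>t. b t + x * k t)) \<le> C * (1 + \<bar>x\<bar>) ^ p" using adm_line_bound[OF a(1)] by blast
    obtain C' p' where C': "\<And>x. norm (\<Phi>' (\<lambda>t. b t + x * k t)) \<le> C' * (1 + \<bar>x\<bar>) ^ p'" using adm_line_bound[OF a(2)] by blast
    show ?thesis unfolding V
    proof (rule std_normal_integration_by_parts)
      fix x
      have "((\<lambda>y. \<Phi> (\<lambda>t. (b t + x * k t) + y * k t)) has_real_derivative \<Phi>' (\<lambda>t. b t + x * k t)) (at 0)" by (rule d)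
      then have "((\<lambda>y. \<Phi> (\<lambda>t. b t + (y + x) * k t)) has_real_derivative \<Phi>' (\<lambda>t. b t + x * k t)) (at 0)"
        by (simp add: algebra_simps)
      then show "((\<lambda>x. \<Phi> (\<lambda>t. b t + x * k t)) has_real_derivative \<Phi>' (\<lambda>t. b t + x * k t)) (at x)"
        using DERIV_shift[of "\<lambda>x. \<Phi> (\<lambda>t. b t + x * k t)" "\<Phi>' (\<lambda>t. b t + x * k t)" 0 x] by simp
    next
      have "continuous_on UNIV (\<lambda>x::real. (\<lambda>t. b t + x * k t))"
        by (rule continuous_on_coordinatewise_then_product) (intro continuous_intros)
      then show "continuous_on UNIV (\<lambda>x. \<Phi>' (\<lambda>t. b t + x * k t))"
        by (rule continuous_on_compose2[OF adm_continuous[OF a(2)]]) simp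
    qed (use C C' in auto)
  qed
  have "(\<integral>\<omega>. \<xi> (\<lambda>t. B t \<omega>) * \<Phi> (\<lambda>t. B t \<omega>) \<partial>M) = (\<integral>z. \<xi> (V (fst z) (snd z)) * \<Phi> (V (fst z) (snd z)) \<partial>(std_normal_distribution \<Otimes>\<^sub>M M))"
    by (rule transfer(2)[OF a\<xi>])
  also have "\<dots> = (\<integral>\<omega>. (\<integral>x. x * \<Phi> (V x \<omega>) \<partial>std_normal_distribution) \<partial>M)"
    using P.integral_snd[of "\<lambda>x \<omega>. x * \<Phi> (V x \<omega>)"] transfer(1)[OF a\<xi>] unfolding xV by (simp add: case_prod_beta')
  also have "\<dots> = (\<integral>\<omega>. (\<integral>x. \<Phi>' (V x \<omega>) \<partial>std_normal_distribution) \<partial>M)" unfolding inner ..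
  also have "\<dots> = (\<integral>z. \<Phi>' (V (fst z) (snd z)) \<partial>(std_normal_distribution \<Otimes>\<^sub>M M))"
    using P.integral_snd[of "\<lambda>x \<omega>. \<Phi>' (V x \<omega>)"] transfer(1)[OF a(2)] by (simp add: case_prod_beta')
  also have "\<dots> = (\<integral>\<omega>. \<Phi>' (\<lambda>t. B t \<omega>) \<partial>M)" by (rule transfer(2)[OF a(2), symmetric])
  finally show ?thesis unfolding \<xi>_def .
qed

text \<open>Reduction to real functionals by taking inner products with the basis; the complex case
  serves characteristic functions.\<close>

lemma gaussian_ibp:
  fixes \<Phi> :: "(real \<Rightarrow> real) \<Rightarrow> 'c::euclidean_space"
  assumes I: "finite I" "I \<subseteq> {0..}" and unit: "(\<Sum>s\<in>I. \<Sum>t\<in>I. c s * c t * K s t) = 1"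
    and k: "\<And>t. k t = (\<Sum>s\<in>I. c s * K s t)" and a: "adm I \<Phi>" "adm I \<Phi>'"
    and d: "\<And>b. ((\<lambda>x. \<Phi> (\<lambda>t. b t + x * k t)) has_vector_derivative \<Phi>' b) (at 0)"
  shows "(\<integral>\<omega>. (\<Sum>t\<in>I. c t * B t \<omega>) *\<^sub>R \<Phi> (\<lambda>t. B t \<omega>) \<partial>M) = (\<integral>\<omega>. \<Phi>' (\<lambda>t. B t \<omega>) \<partial>M)"
proof (rule euclidean_eqI)
  fix e :: 'c assume "e \<in> Basis"
  have i1: "integrable M (\<lambda>\<omega>. (\<Sum>t\<in>I. c t * B t \<omega>) *\<^sub>R \<Phi> (\<lambda>t. B t \<omega>))"
    by (rule adm_integrable[OF I]) (intro adm_scaleR adm_lin I a)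
  have i2: "integrable M (\<lambda>\<omega>. \<Phi>' (\<lambda>t. B t \<omega>))" by (rule adm_integrable[OF I a(2)])
  have "(\<integral>\<omega>. (\<Sum>t\<in>I. c t * B t \<omega>) * (\<Phi> (\<lambda>t. B t \<omega>) \<bullet> e) \<partial>M) = (\<integral>\<omega>. \<Phi>' (\<lambda>t. B t \<omega>) \<bullet> e \<partial>M)"
  proof (rule gaussian_ibp_real[OF I unit k])
    show "adm I (\<lambda>b. \<Phi> b \<bullet> e)" "adm I (\<lambda>b. \<Phi>' b \<bullet> e)" by (intro adm_inner a adm_const)+
    show "((\<lambda>x. \<Phi> (\<lambda>t. b t + x * k t) \<bullet> e) has_real_derivative \<Phi>' b \<bullet> e) (at 0)" for b
      unfolding has_real_derivative_iff_has_vector_derivative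
      by (rule bounded_linear.has_vector_derivative[OF bounded_linear_inner_left d])
  qed
  then show "(\<integral>\<omega>. (\<Sum>t\<in>I. c t * B t \<omega>) *\<^sub>R \<Phi> (\<lambda>t. B t \<omega>) \<partial>M) \<bullet> e = (\<integral>\<omega>. \<Phi>' (\<lambda>t. B t \<omega>) \<partial>M) \<bullet> e"
    using integral_inner_left[of e M "\<lambda>\<omega>. (\<Sum>t\<in>I. c t * B t \<omega>) *\<^sub>R \<Phi> (\<lambda>t. B t \<omega>)"] i1
      integral_inner_left[of e M "\<lambda>\<omega>. \<Phi>' (\<lambda>t. B t \<omega>)"] i2 by simp
qed

text \<open>Induction with the three-term recursion: integrating the factor x of
  \<open>x * hermite q x\<close> by parts differentiates \<open>hermite q\<close> as well, and this
  contribution cancels \<open>q * hermite (q - 1) x\<close>. Each degree thus passes exactly one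
  derivative to the functional.\<close>

lemma gaussian_hermite_ibp:
  fixes \<Phi> :: "nat \<Rightarrow> (real \<Rightarrow> real) \<Rightarrow> 'c::euclidean_space"
  assumes I: "finite I" "I \<subseteq> {0..}" and unit: "(\<Sum>s\<in>I. \<Sum>t\<in>I. c s * c t * K s t) = 1"
    and k: "\<And>t. k t = (\<Sum>s\<in>I. c s * K s t)" and a: "\<And>r. r \<le> q \<Longrightarrow> adm I (\<Phi> r)"
    and d: "\<And>r b. r < q \<Longrightarrow> ((\<lambda>x. \<Phi> r (\<lambda>t. b t + x * k t)) has_vector_derivative \<Phi> (Suc r) b) (at 0)"
  shows "(\<integral>\<omega>. hermite q (\<Sum>t\<in>I. c t * B t \<omega>) *\<^sub>R \<Phi> 0 (\<lambda>t. B t \<omega>) \<partial>M) = (\<integral>\<omega>. \<Phi> q (\<lambda>t. B t \<omega>) \<partial>M)"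
  using a d
proof (induction q arbitrary: \<Phi>)
  case 0
  then show ?case by simp
next
  case (Suc q)
  define \<xi> where "\<xi> b = (\<Sum>t\<in>I. c t * b t)" for b :: "real \<Rightarrow> real"
  have ck: "(\<Sum>t\<in>I. c t * k t) = 1"
    using unit unfolding k by (subst (asm) sum.swap) (simp add: sum_distrib_left mult_ac)
  have \<xi>l: "\<xi> (\<lambda>t. b t + x * k t) = \<xi> b + x" for b x
    unfolding \<xi>_def using ck by (simp add: distrib_left sum.distrib mult.left_commute[of _ x] sum_distrib_left[symmetric])
  have a\<xi>: "adm I \<xi>" unfolding \<xi>_def by (rule adm_lin[OF I(1)])
  have hd: "((\<lambda>x. hermite q (\<xi> (\<lambda>t. b t + x * k t))) has_real_derivative real q * hermite (q - 1) (\<xi> b)) (at 0)" for b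
    unfolding \<xi>l using DERIV_shift[of "hermite q" "real q * hermite (q - 1) (\<xi> b)" 0 "\<xi> b"] hermite_deriv[of q "\<xi> b"]
    by (simp add: add.commute)
  let ?Psi' = "\<lambda>b. hermite q (\<xi> b) *\<^sub>R \<Phi> 1 b + (real q * hermite (q - 1) (\<xi> b)) *\<^sub>R \<Phi> 0 b"
  have aP: "adm I (\<lambda>b. hermite q (\<xi> b) *\<^sub>R \<Phi> 0 b)" "adm I (\<lambda>b. hermite q (\<xi> b) *\<^sub>R \<Phi> 1 b)"
      "adm I (\<lambda>b. (real q * hermite (q - 1) (\<xi> b)) *\<^sub>R \<Phi> 0 b)" "adm I (\<lambda>b. hermite (q-1) (\<xi> b) *\<^sub>R \<Phi> 0 b)"
      "adm I (\<lambda>b. (\<xi> b * hermite q (\<xi> b)) *\<^sub>R \<Phi> 0 b)"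
    using Suc.prems(1) by (intro adm_scaleR adm_hermite a\<xi> adm_cmult adm_mult; simp)+
  have step: "(\<integral>\<omega>. \<xi> (\<lambda>t. B t \<omega>) *\<^sub>R (hermite q (\<xi> (\<lambda>t. B t \<omega>)) *\<^sub>R \<Phi> 0 (\<lambda>t. B t \<omega>)) \<partial>M) = (\<integral>\<omega>. ?Psi' (\<lambda>t. B t \<omega>) \<partial>M)"
    unfolding \<xi>_def[of "\<lambda>t. B t _"]
  proof (fold \<xi>_def, subst (1) \<xi>_def, rule gaussian_ibp[OF I unit k])
    show "adm I ?Psi'" by (intro adm_add aP)
    fix b
    have "((\<lambda>x. hermite q (\<xi> (\<lambda>t. b t + x * k t)) *\<^sub>R \<Phi> 0 (\<lambda>t. b t + x * k t)) has_vector_derivative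
       hermite q (\<xi> (\<lambda>t. b t + 0 * k t)) *\<^sub>R \<Phi> (Suc 0) b + (real q * hermite (q - 1) (\<xi> b)) *\<^sub>R \<Phi> 0 (\<lambda>t. b t + 0 * k t)) (at 0)"
      by (rule has_vector_derivative_scaleR[OF hd Suc.prems(2)]) simp
    then show "((\<lambda>x. hermite q (\<xi> (\<lambda>t. b t + x * k t)) *\<^sub>R \<Phi> 0 (\<lambda>t. b t + x * k t)) has_vector_derivative ?Psi' b) (at 0)"
      by simp
  qed (rule aP)
  have rec: "hermite (Suc q) x = x * hermite q x - real q * hermite (q - 1) x" for x
    by (cases q) auto
  have "(\<integral>\<omega>. hermite (Suc q) (\<xi> (\<lambda>t. B t \<omega>)) *\<^sub>R \<Phi> 0 (\<lambda>t. B t \<omega>) \<partial>M)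
     = (\<integral>\<omega>. (\<xi> (\<lambda>t. B t \<omega>) * hermite q (\<xi> (\<lambda>t. B t \<omega>))) *\<^sub>R \<Phi> 0 (\<lambda>t. B t \<omega>) - (real q * hermite (q - 1) (\<xi> (\<lambda>t. B t \<omega>))) *\<^sub>R \<Phi> 0 (\<lambda>t. B t \<omega>) \<partial>M)"
    unfolding rec scaleR_diff_left ..
  also have "\<dots> = (\<integral>\<omega>. \<xi> (\<lambda>t. B t \<omega>) *\<^sub>R (hermite q (\<xi> (\<lambda>t. B t \<omega>)) *\<^sub>R \<Phi> 0 (\<lambda>t. B t \<omega>)) \<partial>M)
      - (\<integral>\<omega>. (real q * hermite (q - 1) (\<xi> (\<lambda>t. B t \<omega>))) *\<^sub>R \<Phi> 0 (\<lambda>t. B t \<omega>) \<partial>M)"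
    using Bochner_Integration.integral_diff[OF adm_integrable[OF I aP(5)] adm_integrable[OF I aP(3)]] by simp
  also have "\<dots> = (\<integral>\<omega>. hermite q (\<xi> (\<lambda>t. B t \<omega>)) *\<^sub>R \<Phi> 1 (\<lambda>t. B t \<omega>) \<partial>M)"
    unfolding step using Bochner_Integration.integral_add[OF adm_integrable[OF I aP(2)] adm_integrable[OF I aP(3)]] by simp
  also have "\<dots> = (\<integral>\<omega>. \<Phi> (Suc q) (\<lambda>t. B t \<omega>) \<partial>M)"
    unfolding \<xi>_def using Suc.IH[of "\<lambda>r. \<Phi> (Suc r)"] Suc.prems by simp
  finally show ?case unfolding \<xi>_def .
qed

end

section \<open>Increments for Hurst parameter 1/10\<close>

abbreviation K10 :: "real \<Rightarrow> real \<Rightarrow> real" where "K10 \<equiv> fbm_cov (1/10)"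

lemma K10_eq: "K10 s t = (s powr (1/5) + t powr (1/5) - \<bar>t - s\<bar> powr (1/5)) / 2"
  unfolding fbm_cov_def by simp

lemma fbm_cov_sym: "fbm_cov H s t = fbm_cov H t s"
  unfolding fbm_cov_def by (simp add: abs_minus_commute add.commute)

lemma fbm_gaussian_process:
  assumes "fbm H M B"
  shows "gaussian_process M B (fbm_cov H)"
proof -
  interpret prob_space M using assms unfolding fbm_def by blast
  show ?thesis
    by unfold_locales (use assms fbm_cov_sym in \<open>auto simp: fbm_def\<close>)
qed

text \<open>The standard deviation of an increment of \<open>B\<close> over a time step \<open>1/n\<close>.\<close>
definition sn :: "nat \<Rightarrow> real" where "sn n = real n powr (-1/10)"

lemma sn_pos: "n \<ge> 1 \<Longrightarrow> sn n > 0"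
  and sn_le_1: "n \<ge> 1 \<Longrightarrow> sn n \<le> 1"
  and sn_sq: "n \<ge> 1 \<Longrightarrow> sn n ^ 2 = 1 / real n powr (1/5)"
  and sn_10: "n \<ge> 1 \<Longrightarrow> sn n ^ 10 = 1 / real n"
proof -
  assume n: "n \<ge> 1"
  then show p: "sn n > 0" unfolding sn_def by simp
  show "sn n \<le> 1" unfolding sn_def using n powr_mono[of "-1/10" 0 "real n"] by simp
  have "sn n ^ m = real n powr (- real m / 10)" for m
    using n p by (subst powr_realpow[symmetric]) (auto simp: sn_def powr_powr)
  note * = this
  have "- real 2 / 10 = - (1/5)" by simp
  then show "sn n ^ 2 = 1 / real n powr (1/5)" using *[of 2] by (simp only: powr_minus_divide)
  have "- real 10 / 10 = - 1" by simp
  then have "sn n ^ 10 = real n powr (- 1)" using *[of 10] by (simp only:)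
  then show "sn n ^ 10 = 1 / real n" using n by (simp add: powr_minus_divide)
qed

lemma sn_tendsto_0: "sn \<longlonglongrightarrow> 0"
  unfolding sn_def by (rule tendsto_neg_powr[OF _ filterlim_real_sequentially]) simp

lemma powr_subadd:
  fixes x y a :: real
  assumes "0 \<le> x" "0 \<le> y" "0 < a" "a \<le> 1"
  shows "(x + y) powr a \<le> x powr a + y powr a"
proof (cases "x + y = 0")
  case True
  then show ?thesis using assms by simp
next
  case False
  then have p: "x + y > 0" using assms by simp
  have *: "z / (x+y) \<le> (z / (x+y)) powr a" if "0 \<le> z" "z \<le> x + y" for z
  proof (cases "z = 0")
    case False
    have "(z/(x+y)) powr 1 \<le> (z/(x+y)) powr a"
      using that p assms False by (intro powr_mono') (auto simp: divide_le_eq)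
    then show ?thesis using that p by simp
  qed simp
  have "1 = x/(x+y) + y/(x+y)" using p by (simp add: add_divide_distrib[symmetric])
  also have "\<dots> \<le> (x/(x+y)) powr a + (y/(x+y)) powr a"
    using assms by (intro add_mono *) auto
  also have "\<dots> = (x powr a + y powr a) / (x+y) powr a"
    using assms p by (simp add: powr_divide add_divide_distrib)
  finally show ?thesis using p by (simp add: le_divide_eq)
qed

lemma powr_diff_le:
  fixes x y a :: real
  assumes "0 \<le> x" "0 \<le> y" "0 < a" "a \<le> 1"
  shows "\<bar>x powr a - y powr a\<bar> \<le> \<bar>x - y\<bar> powr a"
proof -
  have *: "x powr a \<le> y powr a + \<bar>x - y\<bar> powr a" if "0 \<le> x" "0 \<le> y" for x y
  proof -
    have "x powr a \<le> (y + \<bar>x - y\<bar>) powr a" using that assms by (intro powr_mono2) auto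
    also have "\<dots> \<le> y powr a + \<bar>x - y\<bar> powr a" using that assms by (intro powr_subadd) auto
    finally show ?thesis .
  qed
  from *[OF assms(1,2)] *[OF assms(2,1)] show ?thesis by (simp add: abs_minus_commute abs_le_iff)
qed

lemma K10_diff_le:
  assumes "0 \<le> u" "0 \<le> v"
  shows "\<bar>K10 u t - K10 v t\<bar> \<le> \<bar>u - v\<bar> powr (1/5)"
proof -
  have 1: "\<bar>u powr (1/5) - v powr (1/5)\<bar> \<le> \<bar>u - v\<bar> powr (1/5)"
    using assms by (intro powr_diff_le) auto
  have "\<bar>\<bar>t - u\<bar> powr (1/5) - \<bar>t - v\<bar> powr (1/5)\<bar> \<le> \<bar>\<bar>t - u\<bar> - \<bar>t - v\<bar>\<bar> powr (1/5)"
    by (intro powr_diff_le) auto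
  also have "\<dots> \<le> \<bar>u - v\<bar> powr (1/5)" by (intro powr_mono2) auto
  finally have 2: "\<bar>\<bar>t - u\<bar> powr (1/5) - \<bar>t - v\<bar> powr (1/5)\<bar> \<le> \<bar>u - v\<bar> powr (1/5)" .
  have "K10 u t - K10 v t = ((u powr (1/5) - v powr (1/5)) - (\<bar>t - u\<bar> powr (1/5) - \<bar>t - v\<bar> powr (1/5))) / 2"
    unfolding K10_eq by (simp add: field_simps)
  with 1 2 show ?thesis by (auto simp: abs_le_iff)
qed

definition incr :: "nat \<Rightarrow> nat \<Rightarrow> (real \<Rightarrow> real) \<Rightarrow> real" where
  "incr n j b = (b (real (Suc j) / real n) - b (real j / real n)) / sn n"

text \<open>The covariance of \<open>B t\<close> with the \<open>j\<close>-th normalised increment.\<close>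
definition kxi :: "nat \<Rightarrow> nat \<Rightarrow> real \<Rightarrow> real" where
  "kxi n j t = (K10 (real (Suc j) / real n) t - K10 (real j / real n) t) / sn n"

lemma incr_line: "incr n j (\<lambda>t. b t + x * k t) = incr n j b + x * incr n j k"
  unfolding incr_def by (simp add: algebra_simps add_divide_distrib[symmetric] diff_divide_distrib[symmetric])

text \<open>The covariance changes by at most (1/n)^(1/5), which is \<open>sn n ^ 2\<close>; the
  normalisation of the increment takes one factor back.\<close>

lemma kxi_bound:
  assumes "n \<ge> 1"
  shows "\<bar>kxi n j t\<bar> \<le> sn n"
proof -
  have "\<bar>K10 (real (Suc j) / real n) t - K10 (real j / real n) t\<bar> \<le> \<bar>real (Suc j) / real n - real j / real n\<bar> powr (1/5)"
    by (rule K10_diff_le) auto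
  also have "real (Suc j) / real n - real j / real n = 1 / real n" by (simp add: diff_divide_distrib[symmetric])
  also have "\<bar>1 / real n\<bar> powr (1/5) = sn n ^ 2" unfolding sn_sq[OF assms] by (simp add: powr_divide)
  finally show ?thesis unfolding kxi_def using sn_pos[OF assms]
    by (simp add: abs_divide divide_le_eq power2_eq_square)
qed

text \<open>Adding the bounds of \<open>kxi_bound\<close> would give order \<open>N * sn n\<close>.
  The gain comes from bounded variation: the kernel is built from u^(1/5), which increases, and |t -
  u|^(1/5), which decreases up to t and increases after it, so the absolute increments add up to a
  constant before division by \<open>sn n\<close>.\<close>

lemma kxi_sum_bound:
  assumes n: "n \<ge> 1" and "0 \<le> t" "t \<le> T" "real N / real n \<le> T"
  shows "(\<Sum>j<N. \<bar>kxi n j t\<bar>) \<le> 2 * T powr (1/5) / sn n"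
proof -
  \<comment> \<open>The signed fifth root of u - t is monotone, and its increments dominate the
    absolute increments of |t - u|^(1/5); sums of them telescope.\<close>
  define G where "G u = (if u \<ge> t then (u - t) powr (1/5) else - ((t - u) powr (1/5)))" for u
  have GG: "\<bar>\<bar>t - u\<bar> powr (1/5) - \<bar>t - v\<bar> powr (1/5)\<bar> \<le> G v - G u" if "u \<le> v" for u v
  proof -
    consider "t \<le> u" | "u < t" "t \<le> v" | "v < t" by linarith
    then show ?thesis
    proof cases
      case 1
      have "\<bar>t - u\<bar> powr (1/5) \<le> \<bar>t - v\<bar> powr (1/5)" using that 1 by (intro powr_mono2) auto
      then show ?thesis using that 1 unfolding G_def by (simp add: abs_if split: if_splits)
    next
      case 2
      then show ?thesis using that powr_ge_zero[of "t-u" "1/5"] powr_ge_zero[of "v-t" "1/5"] unfolding G_def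
        by (simp add: abs_if split: if_splits)
    next
      case 3
      have "\<bar>t - v\<bar> powr (1/5) \<le> \<bar>t - u\<bar> powr (1/5)" using that 3 by (intro powr_mono2) auto
      then show ?thesis using that 3 unfolding G_def by (simp add: abs_if split: if_splits)
    qed
  qed
  have aux: "\<bar>(A + D) / 2\<bar> \<le> (A + E) / 2" if "\<bar>D\<bar> \<le> E" "0 \<le> A" for A D E :: real
    using that by (auto simp: abs_le_iff)
  have aux2: "((a - z) + (g - h)) / 2 \<le> 2 * T'" if "a \<le> T'" "0 \<le> z" "- h \<le> T'" "g \<le> T'" "0 \<le> T'" for a z g h T' :: real
    using that by simp
  define u where "u j = real j / real n" for j :: nat
  have mono: "u j \<le> u (Suc j)" "u j \<ge> 0" for j unfolding u_def by (auto intro: divide_right_mono)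
  have "\<bar>kxi n j t\<bar> \<le> ((u (Suc j) powr (1/5) - u j powr (1/5)) + (G (u (Suc j)) - G (u j))) / 2 / sn n" for j
  proof -
    have m: "u j powr (1/5) \<le> u (Suc j) powr (1/5)" using mono[of j] by (intro powr_mono2) auto
    have "K10 (u (Suc j)) t - K10 (u j) t = ((u (Suc j) powr (1/5) - u j powr (1/5)) + (\<bar>t - u j\<bar> powr (1/5) - \<bar>t - u (Suc j)\<bar> powr (1/5))) / 2"
      unfolding K10_eq by (simp add: field_simps)
    then have "\<bar>K10 (u (Suc j)) t - K10 (u j) t\<bar> \<le> ((u (Suc j) powr (1/5) - u j powr (1/5)) + (G (u (Suc j)) - G (u j))) / 2"
      by (simp only:) (rule aux[OF GG[OF mono(1)]], use m in simp)
    then have "\<bar>K10 (u (Suc j)) t - K10 (u j) t\<bar> / sn n \<le> ((u (Suc j) powr (1/5) - u j powr (1/5)) + (G (u (Suc j)) - G (u j))) / 2 / sn n"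
      using sn_pos[OF n] by (intro divide_right_mono) auto
    then show ?thesis unfolding kxi_def u_def[symmetric] abs_divide abs_of_pos[OF sn_pos[OF n]] .
  qed
  then have "(\<Sum>j<N. \<bar>kxi n j t\<bar>) \<le> (\<Sum>j<N. ((u (Suc j) powr (1/5) - u j powr (1/5)) + (G (u (Suc j)) - G (u j))) / 2 / sn n)"
    by (rule sum_mono)
  also have "\<dots> = ((u N powr (1/5) - u 0 powr (1/5)) + (G (u N) - G (u 0))) / 2 / sn n"
    by (simp only: sum_divide_distrib[symmetric] sum.distrib
        sum_lessThan_telescope[of "\<lambda>j. u j powr (1/5)" N] sum_lessThan_telescope[of "\<lambda>j. G (u j)" N])
  also have "\<dots> \<le> 2 * T powr (1/5) / sn n"
  proof -
    have T: "u N powr (1/5) \<le> T powr (1/5)" using assms unfolding u_def by (intro powr_mono2) auto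
    have "t powr (1/5) \<le> T powr (1/5)" using assms by (intro powr_mono2) auto
    then have g0: "- G (u 0) \<le> T powr (1/5)" unfolding G_def u_def using assms by (auto split: if_splits)
    have gN: "G (u N) \<le> T powr (1/5)"
    proof (cases "u N \<ge> t")
      case True
      have "(u N - t) powr (1/5) \<le> T powr (1/5)" using assms True unfolding u_def by (intro powr_mono2) auto
      then show ?thesis unfolding G_def using True by simp
    next
      case False
      then have "G (u N) = - ((t - u N) powr (1/5))" unfolding G_def by simp
      then show ?thesis using powr_ge_zero[of "t - u N" "1/5"] powr_ge_zero[of T "1/5"] by linarith
    qed
    have "((u N powr (1/5) - u 0 powr (1/5)) + (G (u N) - G (u 0))) / 2 \<le> 2 * T powr (1/5)"
      by (rule aux2[OF T powr_ge_zero g0 gN powr_ge_zero])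
    then show ?thesis by (rule divide_right_mono) (use sn_pos[OF n] in simp)
  qed
  finally show ?thesis .
qed

text \<open>This is the covariance of two normalised increments. Stationarity makes it a function of
  j - l, and self-similarity removes n.\<close>

lemma incr_kxi:
  assumes n: "n \<ge> 1"
  shows "incr n l (kxi n j) = rho10 (int j - int l) / 2"
proof -
  have p: "\<bar>real a / real n - real c / real n\<bar> powr (1/5) = \<bar>real a - real c\<bar> powr (1/5) * sn n ^ 2" for a c
    unfolding sn_sq[OF n] using n by (simp add: diff_divide_distrib[symmetric] abs_divide powr_divide)
  have "incr n l (kxi n j) = (K10 (real (Suc j) / real n) (real (Suc l) / real n) - K10 (real j / real n) (real (Suc l) / real n)
      - (K10 (real (Suc j) / real n) (real l / real n) - K10 (real j / real n) (real l / real n))) / sn n ^ 2"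
    unfolding incr_def kxi_def power2_eq_square by (simp add: diff_divide_distrib)
  also have "\<dots> = (\<bar>real (Suc l) / real n - real j / real n\<bar> powr (1/5) + \<bar>real l / real n - real (Suc j) / real n\<bar> powr (1/5)
     - \<bar>real (Suc l) / real n - real (Suc j) / real n\<bar> powr (1/5) - \<bar>real l / real n - real j / real n\<bar> powr (1/5)) / 2 / sn n ^ 2"
    unfolding K10_eq by (rule arg_cong[of _ _ "\<lambda>z. z / sn n ^ 2"]) (simp add: field_simps)
  also have "\<dots> = (\<bar>real (Suc l) - real j\<bar> powr (1/5) + \<bar>real l - real (Suc j)\<bar> powr (1/5)
     - \<bar>real (Suc l) - real (Suc j)\<bar> powr (1/5) - \<bar>real l - real j\<bar> powr (1/5)) / 2"
    unfolding p using sn_pos[OF n] by (simp add: field_simps)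
  also have "\<dots> = rho10 (int j - int l) / 2"
  proof -
    have "\<bar>real (Suc l) - real j\<bar> = \<bar>real_of_int (int j - int l - 1)\<bar>" "\<bar>real l - real (Suc j)\<bar> = \<bar>real_of_int (int j - int l + 1)\<bar>"
      "\<bar>real (Suc l) - real (Suc j)\<bar> = \<bar>real_of_int (int j - int l)\<bar>" "\<bar>real l - real j\<bar> = \<bar>real_of_int (int j - int l)\<bar>" by auto
    then show ?thesis unfolding rho10_def by simp
  qed
  finally show ?thesis .
qed

section \<open>Signs and summability of the correlations\<close>

lemma rho10_0: "rho10 0 = 2" unfolding rho10_def by simp

lemma rho10_minus: "rho10 (- p) = rho10 p"
proof -
  have "\<bar>real_of_int (- p + 1)\<bar> = \<bar>real_of_int (p - 1)\<bar>" "\<bar>real_of_int (- p - 1)\<bar> = \<bar>real_of_int (p + 1)\<bar>" by auto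
  then show ?thesis unfolding rho10_def by simp
qed

text \<open>Concavity of the fifth root through its tangent line at m, which is Young's inequality
  with weights 1/5 and 4/5.\<close>

lemma powr_midpoint_concave:
  fixes m d :: real
  assumes "0 < m" "0 \<le> d" "d \<le> m"
  shows "(m + d) powr (1/5) + (m - d) powr (1/5) \<le> 2 * m powr (1/5)"
proof -
  have *: "z powr (1/5) \<le> m powr (1/5) * (z / m / 5 + 4/5)" if "z \<ge> 0" for z
  proof (cases "z = 0")
    case False
    have "(z/m) powr (1/5) * 1 powr (4/5) \<le> (1/5) * (z/m) + (4/5) * 1"
      using that False assms by (intro Youngs_inequality_0) auto
    then have "m powr (1/5) * (z/m) powr (1/5) \<le> m powr (1/5) * (z / m / 5 + 4/5)"
      by (intro mult_left_mono) auto
    moreover have "m powr (1/5) * (z/m) powr (1/5) = z powr (1/5)" using assms that by (simp add: powr_divide)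
    ultimately show ?thesis by simp
  qed simp
  have "(m + d) powr (1/5) + (m - d) powr (1/5) \<le> m powr (1/5) * ((m+d) / m / 5 + 4/5) + m powr (1/5) * ((m-d) / m / 5 + 4/5)"
    using assms by (intro add_mono *) auto
  also have "\<dots> = m powr (1/5) * ((m+d+(m-d)) / m / 5 + 8/5)" by (simp add: field_simps)
  also have "(m+d+(m-d)) / m = 2" using assms by simp
  finally show ?thesis by simp
qed

lemma rho10_nonpos: "p \<noteq> 0 \<Longrightarrow> rho10 p \<le> 0"
proof -
  have *: "rho10 p \<le> 0" if "p > 0" for p
    using powr_midpoint_concave[of "real_of_int p" 1] that unfolding rho10_def by (simp add: abs_if)
  assume "p \<noteq> 0"
  then show ?thesis using *[of p] *[of "-p"] by (cases "p > 0") (auto simp: rho10_minus)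
qed

text \<open>Off the origin \<open>rho10\<close> is nonpositive, so its absolute values are second
  differences with the sign reversed, and they telescope. The origin contributes 2 and each side at
  most 1, whence the bound 4 below.\<close>

lemma rho10_sum_eq:
  "(\<Sum>p\<in>{- int P..int P}. \<bar>rho10 p\<bar>) = 2 + 2 * (1 - (real (Suc P) powr (1/5) - real P powr (1/5)))"
proof (induction P)
  case 0
  then show ?case by (simp add: rho10_0)
next
  case (Suc P)
  have "{- int (Suc P)..int (Suc P)} = insert (- int (Suc P)) (insert (int (Suc P)) {- int P..int P})" by auto
  then have "(\<Sum>p\<in>{- int (Suc P)..int (Suc P)}. \<bar>rho10 p\<bar>) = 2 * \<bar>rho10 (int (Suc P))\<bar> + (\<Sum>p\<in>{- int P..int P}. \<bar>rho10 p\<bar>)"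
    by (simp add: rho10_minus[of "int (Suc P)", simplified])
  moreover have "\<bar>rho10 (int (Suc P))\<bar> = 2 * real (Suc P) powr (1/5) - real (Suc (Suc P)) powr (1/5) - real P powr (1/5)"
    using rho10_nonpos[of "int (Suc P)"] unfolding rho10_def by (simp add: abs_if)
  ultimately show ?case using Suc by simp
qed

lemma rho10_sum_bound: "finite F \<Longrightarrow> (\<Sum>p\<in>F. \<bar>rho10 p\<bar>) \<le> 4"
proof -
  assume F: "finite F"
  obtain P :: nat where "\<forall>p\<in>F. \<bar>p\<bar> \<le> int P"
  proof -
    have "\<bar>p\<bar> \<le> int (nat (\<Sum>p\<in>F. \<bar>p\<bar>))" if "p \<in> F" for p
      using member_le_sum[OF that, of abs] F by simp
    then show thesis using that by blast
  qed
  then have "F \<subseteq> {- int P..int P}" by (auto simp: abs_le_iff)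
  then have "(\<Sum>p\<in>F. \<bar>rho10 p\<bar>) \<le> (\<Sum>p\<in>{- int P..int P}. \<bar>rho10 p\<bar>)" by (intro sum_mono2) auto
  also have "\<dots> \<le> 4"
    unfolding rho10_sum_eq using powr_mono2[of "1/5" "real P" "real (Suc P)"] by simp
  finally show ?thesis .
qed

lemma rho10_abs_le: "\<bar>rho10 p\<bar> \<le> 4"
  using rho10_sum_bound[of "{p}"] by simp

lemma rho10_power_summable:
  assumes "q \<ge> 1"
  shows "(\<lambda>p. norm (rho10 p ^ q)) summable_on (UNIV :: int set)"
proof (rule nonneg_bdd_above_summable_on)
  show "bdd_above (sum (\<lambda>p. norm (rho10 p ^ q)) ` {F. F \<subseteq> UNIV \<and> finite F})"
  proof (rule bdd_aboveI2)
    fix F :: "int set" assume "F \<in> {F. F \<subseteq> UNIV \<and> finite F}"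
    then have F: "finite F" by simp
    have "(\<Sum>p\<in>F. norm (rho10 p ^ q)) \<le> (\<Sum>p\<in>F. 4 ^ (q-1) * \<bar>rho10 p\<bar>)"
    proof (rule sum_mono)
      fix p
      have "norm (rho10 p ^ q) = \<bar>rho10 p\<bar> ^ (q-1) * \<bar>rho10 p\<bar>"
        using assms by (cases q) (auto simp: power_abs abs_mult)
      also have "\<dots> \<le> 4 ^ (q-1) * \<bar>rho10 p\<bar>" by (intro mult_right_mono power_mono rho10_abs_le) auto
      finally show "norm (rho10 p ^ q) \<le> 4 ^ (q-1) * \<bar>rho10 p\<bar>" .
    qed
    also have "\<dots> \<le> 4 ^ (q-1) * 4"
      unfolding sum_distrib_left[symmetric] by (intro mult_left_mono rho10_sum_bound F) auto
    finally show "(\<Sum>p\<in>F. norm (rho10 p ^ q)) \<le> 4 ^ (q-1) * 4" .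
  qed
qed auto

lemma rho10_row_sum: "(\<Sum>l<N. \<bar>rho10 (int j - int l)\<bar>) \<le> 4"
  and rho10_col_sum: "(\<Sum>l<N. \<bar>rho10 (int l - int j)\<bar>) \<le> 4"
proof -
  have "inj_on (\<lambda>l. int j - int l) {..<N}" "inj_on (\<lambda>l. int l - int j) {..<N}" by (auto simp: inj_on_def)
  from sum.reindex[OF this(1), of "\<lambda>p. \<bar>rho10 p\<bar>"] sum.reindex[OF this(2), of "\<lambda>p. \<bar>rho10 p\<bar>"]
  show "(\<Sum>l<N. \<bar>rho10 (int j - int l)\<bar>) \<le> 4" "(\<Sum>l<N. \<bar>rho10 (int l - int j)\<bar>) \<le> 4"
    using rho10_sum_bound[of "(\<lambda>l. int j - int l) ` {..<N}"] rho10_sum_bound[of "(\<lambda>l. int l - int j) ` {..<N}"]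
    by (simp_all add: o_def)
qed

text \<open>Multiplicity of the difference p in the double sum of \<open>toeplitz_sum_limit\<close>:
  up to an error |p|, a diagonal of a rectangle is as long as the shorter side.\<close>

lemma card_diagonal_bounds:
  fixes a b :: nat and p :: int
  defines "D \<equiv> {z \<in> {..<a} \<times> {..<b}. int (fst z) - int (snd z) = p}"
  shows "card D \<le> a" "card D \<le> b" "min a b - nat \<bar>p\<bar> \<le> card D"
proof -
  have f: "finite D" unfolding D_def by simp
  have "inj_on fst D" "fst ` D \<subseteq> {..<a}" unfolding D_def by (auto simp: inj_on_def)
  then show "card D \<le> a" using card_inj_on_le[of fst D "{..<a}"] by simp
  have "inj_on snd D" "snd ` D \<subseteq> {..<b}" unfolding D_def by (auto simp: inj_on_def)
  then show "card D \<le> b" using card_inj_on_le[of snd D "{..<b}"] by simp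
  \<comment> \<open>At most one of \<open>nat p\<close> and \<open>nat (- p)\<close> is nonzero, so
    this walks along the diagonal from the border of the rectangle for either sign of p.\<close>
  let ?g = "\<lambda>i. (i + nat p, i + nat (- p))"
  have "inj_on ?g {..<min a b - nat \<bar>p\<bar>}" "?g ` {..<min a b - nat \<bar>p\<bar>} \<subseteq> D"
    unfolding D_def by (auto simp: inj_on_def)
  from card_inj_on_le[OF this f] show "min a b - nat \<bar>p\<bar> \<le> card D" by simp
qed

text \<open>Grouped by diagonals, the sum becomes an integral for counting measure of r p against
  the relative length of diagonal p. The length tends to \<open>min x y\<close> and is bounded, so
  dominated convergence applies. The minimum is the Brownian covariance of the limit.\<close>

lemma toeplitz_sum_limit:
  fixes r :: "int \<Rightarrow> real" and a b :: "nat \<Rightarrow> nat"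
  assumes r: "(\<lambda>p. norm (r p)) summable_on UNIV"
    and a: "(\<lambda>n. real (a n) / real n) \<longlonglongrightarrow> x" and b: "(\<lambda>n. real (b n) / real n) \<longlonglongrightarrow> y"
  shows "(\<lambda>n. (\<Sum>j<a n. \<Sum>l<b n. r (int j - int l)) / real n) \<longlonglongrightarrow> (\<Sum>\<^sub>\<infinity>p. r p) * min x y"
proof -
  define D where "D n p = {z \<in> {..<a n} \<times> {..<b n}. int (fst z) - int (snd z) = p}" for n p
  define w where "w n p = real (card (D n p)) / real n" for n p
  have ri: "integrable (count_space UNIV) r"
    using abs_summable_equivalent[of r UNIV] r by (simp add: Infinite_Set_Sum.abs_summable_on_def)
  have eq: "(\<Sum>j<a n. \<Sum>l<b n. r (int j - int l)) / real n = (\<integral>p. r p * w n p \<partial>count_space UNIV)" for n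
  proof -
    let ?S = "{..<a n} \<times> {..<b n}"
    let ?g = "\<lambda>z. int (fst z) - int (snd z)"
    have "(\<Sum>j<a n. \<Sum>l<b n. r (int j - int l)) = (\<Sum>z\<in>?S. r (?g z))"
      by (simp add: sum.cartesian_product case_prod_beta')
    also have "\<dots> = (\<Sum>p\<in>?g ` ?S. \<Sum>z\<in>{z\<in>?S. ?g z = p}. r (?g z))"
      by (rule sum.group[symmetric]) auto
    also have "\<dots> = (\<Sum>p\<in>?g ` ?S. r p * real (card (D n p)))"
      unfolding D_def by (intro sum.cong refl) simp
    finally have "(\<Sum>j<a n. \<Sum>l<b n. r (int j - int l)) / real n = (\<Sum>p\<in>?g ` ?S. r p * w n p)"
      unfolding w_def by (simp add: sum_divide_distrib)
    also have "\<dots> = (\<integral>p. r p * w n p \<partial>count_space UNIV)"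
    proof -
      have z: "r p * w n p = 0" if "p \<notin> ?g ` ?S" for p
      proof -
        have "D n p = {}" using that unfolding D_def by blast
        then show ?thesis unfolding w_def by simp
      qed
      have "{p. r p * w n p \<noteq> 0} \<subseteq> ?g ` ?S" using z by blast
      moreover have "finite (?g ` ?S)" by simp
      ultimately have "(\<Sum>p\<in>{p. r p * w n p \<noteq> 0}. r p * w n p) = (\<Sum>p\<in>?g ` ?S. r p * w n p)"
        by (intro sum.mono_neutral_left) auto
      moreover have "finite {p. r p * w n p \<noteq> 0}" using \<open>{p. r p * w n p \<noteq> 0} \<subseteq> ?g ` ?S\<close> \<open>finite (?g ` ?S)\<close> by (rule finite_subset)
      ultimately show ?thesis by (simp add: lebesgue_integral_count_space_finite_support)
    qed
    finally show ?thesis .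
  qed
  obtain W where W: "\<And>n. \<bar>real (a n) / real n\<bar> \<le> W"
    using convergent_imp_Bseq[OF convergentI[OF a]] unfolding Bseq_def by auto
  have wW: "\<bar>w n p\<bar> \<le> W" for n p
  proof -
    have "w n p \<le> real (a n) / real n" unfolding w_def D_def using card_diagonal_bounds(1)[of "a n" "b n" p] by (intro divide_right_mono) auto
    moreover have "0 \<le> w n p" unfolding w_def by simp
    ultimately show ?thesis using W[of n] by linarith
  qed
  have wl: "(\<lambda>n. w n p) \<longlonglongrightarrow> min x y" for p
  proof (rule tendsto_sandwich[where h="\<lambda>n. min (real (a n) / real n) (real (b n) / real n)"
        and f="\<lambda>n. min (real (a n) / real n) (real (b n) / real n) - real (nat \<bar>p\<bar>) / real n"])
    have ab: "(\<lambda>n. min (real (a n) / real n) (real (b n) / real n)) \<longlonglongrightarrow> min x y" by (rule tendsto_min[OF a b])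
    then show "(\<lambda>n. min (real (a n) / real n) (real (b n) / real n)) \<longlonglongrightarrow> min x y" .
    have "(\<lambda>n. real (nat \<bar>p\<bar>) / real n) \<longlonglongrightarrow> 0" by (rule lim_const_over_n)
    from tendsto_diff[OF ab this]
    show "(\<lambda>n. min (real (a n) / real n) (real (b n) / real n) - real (nat \<bar>p\<bar>) / real n) \<longlonglongrightarrow> min x y" by simp
    show "\<forall>\<^sub>F n in sequentially. w n p \<le> min (real (a n) / real n) (real (b n) / real n)"
      unfolding w_def D_def using card_diagonal_bounds(1,2) by (intro always_eventually allI min.boundedI divide_right_mono) auto
    show "\<forall>\<^sub>F n in sequentially. min (real (a n) / real n) (real (b n) / real n) - real (nat \<bar>p\<bar>) / real n \<le> w n p"
    proof (intro always_eventually allI)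
      fix n
      have "real (min (a n) (b n)) - real (nat \<bar>p\<bar>) \<le> real (card (D n p))"
        using card_diagonal_bounds(3)[of "a n" "b n" p] unfolding D_def by linarith
      then have "(real (min (a n) (b n)) - real (nat \<bar>p\<bar>)) / real n \<le> w n p"
        unfolding w_def by (rule divide_right_mono) simp
      moreover have "min (real (a n) / real n) (real (b n) / real n) = real (min (a n) (b n)) / real n"
        by (simp add: min_def divide_le_cancel)
      ultimately show "min (real (a n) / real n) (real (b n) / real n) - real (nat \<bar>p\<bar>) / real n \<le> w n p"
        by (simp add: diff_divide_distrib)
    qed
  qed
  have "(\<lambda>n. \<integral>p. r p * w n p \<partial>count_space UNIV) \<longlonglongrightarrow> (\<integral>p. r p * min x y \<partial>count_space UNIV)"
  proof (rule integral_dominated_convergence[where w="\<lambda>p. \<bar>r p\<bar> * W"])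
    show "integrable (count_space UNIV) (\<lambda>p. \<bar>r p\<bar> * W)" using ri by simp
    show "AE p in count_space UNIV. (\<lambda>n. r p * w n p) \<longlonglongrightarrow> r p * min x y" by (intro AE_I2 tendsto_mult tendsto_const wl)
    show "AE p in count_space UNIV. norm (r p * w n p) \<le> \<bar>r p\<bar> * W" for n
      using wW by (intro AE_I2) (auto simp: abs_mult intro: mult_left_mono)
  qed auto
  also have "(\<integral>p. r p * min x y \<partial>count_space UNIV) = (\<Sum>\<^sub>\<infinity>p. r p) * min x y"
    using infsetsum_infsum[of r UNIV] abs_summable_equivalent[of r UNIV] r by (simp add: infsetsum_def)
  finally show ?thesis unfolding eq .
qed

section \<open>A joint central limit theorem\<close>

lemma adm_abs: fixes \<Phi> :: "('i \<Rightarrow> real) \<Rightarrow> real" shows "adm I \<Phi> \<Longrightarrow> adm I (\<lambda>b. \<bar>\<Phi> b\<bar>)"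
proof -
  assume a: "adm I \<Phi>"
  obtain C p where C: "\<And>b. norm (\<Phi> b) \<le> C * (1 + (\<Sum>i\<in>I. \<bar>b i\<bar>)) ^ p" using admE[OF a] by blast
  show ?thesis unfolding adm_def
  proof (intro conjI exI[of _ C] exI[of _ p] allI)
    show "continuous_on UNIV (\<lambda>b. \<bar>\<Phi> b\<bar>)" by (rule continuous_on_rabs[OF adm_continuous[OF a]])
    show "depends_on I (\<lambda>b. \<bar>\<Phi> b\<bar>)" using adm_depends[OF a] unfolding depends_on_def by metis
    show "norm \<bar>\<Phi> b\<bar> \<le> C * (1 + (\<Sum>i\<in>I. \<bar>b i\<bar>)) ^ p" for b using C[of b] by simp
  qed
qed

lemma adm_of_real: fixes \<Phi> :: "('i \<Rightarrow> real) \<Rightarrow> real" shows "adm I \<Phi> \<Longrightarrow> adm I (\<lambda>b. complex_of_real (\<Phi> b))"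
  by (rule adm_compose_linear[OF _ bounded_linear_of_real])

lemma adm_Complex:
  fixes \<Phi> \<Psi> :: "('i \<Rightarrow> real) \<Rightarrow> real"
  shows "adm I \<Phi> \<Longrightarrow> adm I \<Psi> \<Longrightarrow> adm I (\<lambda>b. Complex (\<Phi> b) (\<Psi> b))"
  unfolding Complex_eq by (intro adm_add adm_cmult adm_of_real)

lemma adm_iexp: fixes \<Phi> :: "('i \<Rightarrow> real) \<Rightarrow> real" shows "adm I \<Phi> \<Longrightarrow> adm I (\<lambda>b. iexp (\<Phi> b))"
  by (rule adm_compose_bounded[where C=1]) (auto intro!: continuous_intros)

lemma adm_mono:
  assumes "adm I \<Phi>" "I \<subseteq> I'" "finite I'"
  shows "adm I' \<Phi>"
proof -
  obtain C p where C: "C \<ge> 0" "\<And>b. norm (\<Phi> b) \<le> C * (1 + (\<Sum>i\<in>I. \<bar>b i\<bar>)) ^ p" using admE[OF assms(1)] by blast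
  show ?thesis unfolding adm_def
  proof (intro conjI exI[of _ C] exI[of _ p] allI)
    show "continuous_on UNIV \<Phi>" by (rule adm_continuous[OF assms(1)])
    show "depends_on I' \<Phi>" using adm_depends[OF assms(1)] assms(2) unfolding depends_on_def by blast
    fix b :: "_ \<Rightarrow> real"
    have "(\<Sum>i\<in>I. \<bar>b i\<bar>) \<le> (\<Sum>i\<in>I'. \<bar>b i\<bar>)" by (rule sum_mono2[OF assms(3,2)]) simp
    then have "C * (1 + (\<Sum>i\<in>I. \<bar>b i\<bar>)) ^ p \<le> C * (1 + (\<Sum>i\<in>I'. \<bar>b i\<bar>)) ^ p"
      using C(1) by (intro mult_left_mono power_mono) (auto intro: add_nonneg_nonneg sum_nonneg)
    then show "norm (\<Phi> b) \<le> C * (1 + (\<Sum>i\<in>I'. \<bar>b i\<bar>)) ^ p" using C(2)[of b] by linarith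
  qed
qed

lemma adm_incr:
  assumes "finite I" "real j / real n \<in> I" "real (Suc j) / real n \<in> I"
  shows "adm I (incr n j)"
proof -
  have "adm I (\<lambda>b. (1 / sn n) * (b (real (Suc j) / real n) - b (real j / real n)))"
    by (intro adm_cmult adm_diff adm_coord assms)
  then show ?thesis unfolding incr_def[abs_def] by simp
qed

locale fbm10 = gaussian_process M B K10 for M :: "'a measure" and B
begin

lemma incr_coeff_sum:
  assumes "finite I" "real j / real n \<in> I" "real (Suc j) / real n \<in> I"
  shows "(\<Sum>t\<in>I. ((if t = real (Suc j) / real n then 1 else 0) - (if t = real j / real n then 1 else 0)) / sn n * g t) = incr n j g"
proof -
  have "(\<Sum>t\<in>I. ((if t = real (Suc j) / real n then 1 else 0) - (if t = real j / real n then 1 else 0)) / sn n * g t)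
    = (\<Sum>t\<in>I. (if t = real (Suc j) / real n then g t / sn n else 0) - (if t = real j / real n then g t / sn n else 0))"
    by (intro sum.cong refl) auto
  also have "\<dots> = g (real (Suc j) / real n) / sn n - g (real j / real n) / sn n"
    using assms by (simp only: sum_subtractf sum.delta if_True)
  finally show ?thesis unfolding incr_def by (simp add: diff_divide_distrib)
qed

lemma incr_variance:
  assumes "n \<ge> 1" "finite I" "real j / real n \<in> I" "real (Suc j) / real n \<in> I"
  defines "c \<equiv> \<lambda>t. ((if t = real (Suc j) / real n then 1 else 0) - (if t = real j / real n then 1 else 0)) / sn n"
  shows "(\<Sum>s\<in>I. \<Sum>t\<in>I. c s * c t * K10 s t) = 1" and "kxi n j t = (\<Sum>s\<in>I. c s * K10 s t)"
proof -
  have s: "(\<Sum>t\<in>I. c t * g t) = incr n j g" for g unfolding c_def by (rule incr_coeff_sum[OF assms(2-4)])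
  show k: "kxi n j t = (\<Sum>s\<in>I. c s * K10 s t)" for t unfolding s unfolding incr_def kxi_def ..
  have "(\<Sum>s\<in>I. \<Sum>t\<in>I. c s * c t * K10 s t) = (\<Sum>t\<in>I. c t * (\<Sum>s\<in>I. c s * K10 s t))"
    by (subst sum.swap) (simp add: sum_distrib_left mult_ac)
  also have "\<dots> = incr n j (kxi n j)" unfolding k[symmetric] by (rule s)
  also have "\<dots> = 1" unfolding incr_kxi[OF assms(1)] by (simp add: rho10_0)
  finally show "(\<Sum>s\<in>I. \<Sum>t\<in>I. c s * c t * K10 s t) = 1" .
qed

lemma incr_hermite_ibp:
  fixes \<Phi> :: "nat \<Rightarrow> (real \<Rightarrow> real) \<Rightarrow> 'c::euclidean_space"
  assumes "n \<ge> 1" and I: "finite I" "I \<subseteq> {0..}" "real j / real n \<in> I" "real (Suc j) / real n \<in> I"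
    and a: "\<And>r. r \<le> q \<Longrightarrow> adm I (\<Phi> r)"
    and d: "\<And>r b. r < q \<Longrightarrow> ((\<lambda>x. \<Phi> r (\<lambda>t. b t + x * kxi n j t)) has_vector_derivative \<Phi> (Suc r) b) (at 0)"
  shows "(\<integral>\<omega>. hermite q (incr n j (\<lambda>t. B t \<omega>)) *\<^sub>R \<Phi> 0 (\<lambda>t. B t \<omega>) \<partial>M) = (\<integral>\<omega>. \<Phi> q (\<lambda>t. B t \<omega>) \<partial>M)"
  using gaussian_hermite_ibp[where \<Phi>=\<Phi> and q=q and k="kxi n j", OF I(1,2) incr_variance(1)[OF assms(1) I(1,3,4)] incr_variance(2)[OF assms(1) I(1,3,4)] a d]
  unfolding incr_coeff_sum[OF I(1,3,4)] .

lemma incr_measurable: "incr n j (\<lambda>t. B t \<omega>) = (B (real (Suc j) / real n) \<omega> - B (real j / real n) \<omega>) / sn n"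
  "(\<lambda>\<omega>. incr n j (\<lambda>t. B t \<omega>)) \<in> borel_measurable M"
  unfolding incr_def using B_measurable by auto

lemma incr_gaussian:
  assumes "n \<ge> 1"
  shows "centered_gaussian M (\<lambda>\<omega>. incr n j (\<lambda>t. B t \<omega>)) 1"
proof -
  let ?I = "{real j / real n, real (Suc j) / real n}"
  have I: "finite ?I" "?I \<subseteq> {0..}" "real j / real n \<in> ?I" "real (Suc j) / real n \<in> ?I" by auto
  show ?thesis using gaussian_finite[OF I(1,2), of "\<lambda>t. ((if t = real (Suc j) / real n then 1 else 0) - (if t = real j / real n then 1 else 0)) / sn n"]
    unfolding incr_coeff_sum[OF I(1,3,4)] incr_variance(1)[OF assms I(1,3,4)] .
qed

lemma incr_expectation:
  assumes "n \<ge> 1" and [measurable]: "g \<in> borel_measurable borel"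
  shows "(\<integral>\<omega>. g (incr n j (\<lambda>t. B t \<omega>)) \<partial>M) = (\<integral>x. (g x :: real) \<partial>std_normal_distribution)"
proof -
  note m[measurable] = incr_measurable(2)[of n j]
  have d: "distr M borel (\<lambda>\<omega>. incr n j (\<lambda>t. B t \<omega>)) = distr std_normal_distribution borel (\<lambda>x. x)"
    using centered_gaussian_distr(2)[OF incr_gaussian[OF assms(1)] m] by simp
  have "(\<integral>\<omega>. g (incr n j (\<lambda>t. B t \<omega>)) \<partial>M) = (\<integral>x. g x \<partial>distr M borel (\<lambda>\<omega>. incr n j (\<lambda>t. B t \<omega>)))"
    by (subst integral_distr) auto
  also have "\<dots> = (\<integral>x. g x \<partial>std_normal_distribution)" unfolding d by (subst integral_distr) auto
  finally show ?thesis .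
qed

end

text \<open>Subtracting \<open>15 x\<close> from \<open>x\<^sup>5\<close> removes the component along \<open>hermite 1\<close>; \<open>pd r\<close> is the \<open>r\<close>-th derivative.\<close>
definition pd :: "nat \<Rightarrow> real \<Rightarrow> real" where
  "pd r x = (if r = 0 then x^5 - 15*x else if r = 1 then 5*x^4 - 15 else if r = 2 then 20*x^3
     else if r = 3 then 60*x^2 else if r = 4 then 120*x else if r = 5 then 120 else 0)"

text \<open>Source of the two series in \<open>beta10\<close>: the components of degrees 5 and 3
  bring the factors 5! = 120 and 10^2 * 3! = 600.\<close>

lemma pd_hermite: "pd 0 x = hermite 5 x + 10 * hermite 3 x"
  by (simp add: pd_def eval_nat_numeral algebra_simps)

text \<open>The mean 60 of the third derivative enters the limiting variance; the component of
  degree 2 is an error, estimated by \<open>hermite2_iexp_bound\<close>.\<close>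

lemma pd_3_hermite: "pd 3 x = 60 + 60 * hermite 2 x"
  by (simp add: pd_def eval_nat_numeral algebra_simps)

lemma pd_deriv: "(pd r has_real_derivative pd (Suc r) x) (at x)"
proof -
  consider "r = 0" | "r = 1" | "r = 2" | "r = 3" | "r = 4" | "r \<ge> 5" by linarith
  then show ?thesis
    by cases (auto simp: pd_def[abs_def] intro!: derivative_eq_intros)
qed

lemma pd_measurable[measurable]: "pd r \<in> borel_measurable borel"
  using pd_deriv by (intro borel_measurable_continuous_onI continuous_at_imp_continuous_on) (blast intro: DERIV_isCont)

lemma adm_pd: fixes \<Phi> :: "('i \<Rightarrow> real) \<Rightarrow> real" assumes "adm I \<Phi>" shows "adm I (\<lambda>b. pd r (\<Phi> b))"
proof -
  consider "r = 0" | "r = 1" | "r = 2" | "r = 3" | "r = 4" | "r = 5" | "r > 5" by linarith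
  then show ?thesis
    by cases (simp_all add: pd_def adm_const adm_diff adm_cmult adm_power assms)
qed

text \<open>Faa di Bruno: if \<open>y r\<close> is the \<open>r\<close>-th derivative of \<open>X\<close>, then the \<open>q\<close>-th derivative of \<open>iexp X\<close> is
  \<open>Complex (PQ q y) (RQ q y) * iexp X\<close>. For \<open>q = 3, 5\<close> the term \<open>y q\<close> is the only one that survives in the limit.\<close>
definition PQ :: "nat \<Rightarrow> (nat \<Rightarrow> real) \<Rightarrow> real" where
  "PQ q y = (if q = 0 then 1 else if q = 1 then 0 else if q = 2 then - (y 1 ^ 2) else if q = 3 then - 3 * (y 1 * y 2)
     else if q = 4 then y 1 ^ 4 - 4 * (y 1 * y 3) - 3 * y 2 ^ 2
     else 10 * (y 1 ^ 3 * y 2) - 5 * (y 1 * y 4) - 10 * (y 2 * y 3))"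

definition RQ :: "nat \<Rightarrow> (nat \<Rightarrow> real) \<Rightarrow> real" where
  "RQ q y = (if q = 0 then 0 else if q = 1 then y 1 else if q = 2 then y 2 else if q = 3 then y 3 - y 1 ^ 3
     else if q = 4 then y 4 - 6 * (y 1 ^ 2 * y 2)
     else y 5 - 10 * (y 1 ^ 2 * y 3) - 15 * (y 1 * y 2 ^ 2) + y 1 ^ 5)"

text \<open>Differentiating the factor \<open>iexp X\<close> adds \<open>- X' * R\<close> to the
  real and \<open>X' * P\<close> to the imaginary part. The extra terms here compensate exactly for
  this, so that \<open>iexp_times_Complex_deriv\<close> leads from q to
  \<open>Suc q\<close>.\<close>

lemma PQ_RQ_deriv:
  fixes y :: "real \<Rightarrow> nat \<Rightarrow> real"
  assumes d: "\<And>r. 1 \<le> r \<Longrightarrow> ((\<lambda>x. y x r) has_real_derivative y 0 (Suc r)) (at 0)" and "q < 5"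
  shows "((\<lambda>x. PQ q (y x)) has_real_derivative PQ (Suc q) (y 0) + y 0 1 * RQ q (y 0)) (at 0)"
    and "((\<lambda>x. RQ q (y x)) has_real_derivative RQ (Suc q) (y 0) - y 0 1 * PQ q (y 0)) (at 0)"
proof -
  have d1: "((\<lambda>x. y x 1) has_real_derivative y 0 2) (at 0)" and d2: "((\<lambda>x. y x 2) has_real_derivative y 0 3) (at 0)"
    and d3: "((\<lambda>x. y x 3) has_real_derivative y 0 4) (at 0)" and d4: "((\<lambda>x. y x 4) has_real_derivative y 0 5) (at 0)"
    using d[of 1] d[of 2] d[of 3] d[of 4] by (simp_all add: eval_nat_numeral)
  note dd = d1[unfolded One_nat_def] d2 d3 d4
  consider "q = 0" | "q = 1" | "q = 2" | "q = 3" | "q = 4" using \<open>q < 5\<close> by linarith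
  then have "((\<lambda>x. PQ q (y x)) has_real_derivative PQ (Suc q) (y 0) + y 0 1 * RQ q (y 0)) (at 0) \<and>
     ((\<lambda>x. RQ q (y x)) has_real_derivative RQ (Suc q) (y 0) - y 0 1 * PQ q (y 0)) (at 0)"
    by cases (auto simp: PQ_def RQ_def intro!: derivative_eq_intros dd, (use dd in \<open>auto simp: algebra_simps eval_nat_numeral\<close>)+)
  then show "((\<lambda>x. PQ q (y x)) has_real_derivative PQ (Suc q) (y 0) + y 0 1 * RQ q (y 0)) (at 0)"
    and "((\<lambda>x. RQ q (y x)) has_real_derivative RQ (Suc q) (y 0) - y 0 1 * PQ q (y 0)) (at 0)" by blast+
qed

lemma iexp_times_Complex_deriv:
  fixes X P R :: "real \<Rightarrow> real"
  assumes X: "(X has_real_derivative X') (at x)" and P: "(P has_real_derivative P') (at x)" and R: "(R has_real_derivative R') (at x)"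
  shows "((\<lambda>x. iexp (X x) * Complex (P x) (R x)) has_vector_derivative
     iexp (X x) * Complex (P' - X' * R x) (R' + X' * P x)) (at x)"
proof -
  have oX: "((\<lambda>x. complex_of_real (X x)) has_vector_derivative complex_of_real X') (at x)"
    and oP: "((\<lambda>x. complex_of_real (P x)) has_vector_derivative complex_of_real P') (at x)"
    and oR: "((\<lambda>x. complex_of_real (R x)) has_vector_derivative complex_of_real R') (at x)"
    using X P R by (auto intro!: has_vector_derivative_of_real simp: has_real_derivative_iff_has_vector_derivative)
  have "((exp \<circ> (\<lambda>x. \<i> * complex_of_real (X x))) has_vector_derivative (\<i> * complex_of_real X') * exp (\<i> * complex_of_real (X x))) (at x)"
    by (rule field_vector_diff_chain_at[OF has_vector_derivative_mult_right[OF oX] DERIV_exp])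
  then have e: "((\<lambda>x. iexp (X x)) has_vector_derivative (\<i> * complex_of_real X') * iexp (X x)) (at x)"
    by (simp add: o_def)
  have "((\<lambda>x. iexp (X x) * (complex_of_real (P x) + \<i> * complex_of_real (R x))) has_vector_derivative
     iexp (X x) * (complex_of_real P' + \<i> * complex_of_real R') + (\<i> * complex_of_real X') * iexp (X x) * (complex_of_real (P x) + \<i> * complex_of_real (R x))) (at x)"
    by (intro has_vector_derivative_mult[OF e] has_vector_derivative_add oP has_vector_derivative_mult_right oR)
  moreover have "iexp (X x) * (complex_of_real P' + \<i> * complex_of_real R') + (\<i> * complex_of_real X') * iexp (X x) * (complex_of_real (P x) + \<i> * complex_of_real (R x))
     = iexp (X x) * Complex (P' - X' * R x) (R' + X' * P x)"
  proof -
    have "z * (complex_of_real P' + \<i> * complex_of_real R') + (\<i> * complex_of_real X') * z * (complex_of_real (P x) + \<i> * complex_of_real (R x))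
      = z * Complex (P' - X' * R x) (R' + X' * P x)" for z
    proof -
      have "Complex (P' - X' * R x) (R' + X' * P x) = (complex_of_real P' + \<i> * complex_of_real R') + \<i> * complex_of_real X' * (complex_of_real (P x) + \<i> * complex_of_real (R x))"
        by (simp add: complex_eq_iff)
      then show ?thesis by (simp only: ) (simp add: algebra_simps)
    qed
    then show ?thesis .
  qed
  ultimately show ?thesis unfolding Complex_eq[of "P _" "R _"] by simp
qed

text \<open>Every remaining monomial has between two and five factors, each at most
  \<open>u * Z\<close>. Two powers of u are kept, since squares are summable in the application; the
  others are absorbed into \<open>D ^ 3\<close>. 25 and 26 are the sums of the absolute coefficients
  at q = 5.\<close>

lemma PQ_RQ_remainder:
  fixes y :: "nat \<Rightarrow> real"
  assumes y: "\<And>r. 1 \<le> r \<Longrightarrow> r \<le> 5 \<Longrightarrow> \<bar>y r\<bar> \<le> u * Z" and "Z \<ge> 1" "0 \<le> u" "u \<le> D" "D \<ge> 1"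
  shows "\<bar>PQ 5 y\<bar> \<le> 25 * D^3 * u^2 * Z^5" "\<bar>RQ 5 y - y 5\<bar> \<le> 26 * D^3 * u^2 * Z^5"
    "\<bar>PQ 3 y\<bar> \<le> 25 * D^3 * u^2 * Z^5" "\<bar>RQ 3 y - y 3\<bar> \<le> 26 * D^3 * u^2 * Z^5" "\<bar>PQ 2 y\<bar> \<le> 25 * D^3 * u^2 * Z^5"
proof -
  define w where "w = D^3 * u^2 * Z^5"
  have w0: "w \<ge> 0" unfolding w_def using assms by (intro mult_nonneg_nonneg zero_le_power) auto
  have pw: "(u * Z) ^ k \<le> w" if "2 \<le> k" "k \<le> 5" for k
  proof -
    have "u ^ k = u ^ 2 * u ^ (k-2)" using that by (metis le_add_diff_inverse power_add)
    also have "\<dots> \<le> u^2 * D ^ (k-2)" using assms by (intro mult_left_mono power_mono) auto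
    also have "\<dots> \<le> u^2 * D ^ 3" using assms that by (intro mult_left_mono power_increasing) auto
    finally have 1: "u ^ k \<le> D^3 * u^2" by (simp add: mult.commute)
    have 2: "Z ^ k \<le> Z ^ 5" using assms that by (intro power_increasing) auto
    have "u ^ k * Z ^ k \<le> (D^3 * u^2) * Z^5" using assms by (intro mult_mono 1 2) auto
    then show ?thesis unfolding w_def by (simp add: power_mult_distrib)
  qed
  have uz: "0 \<le> u * Z" using assms by simp
  have b1: "\<bar>y 1\<bar> \<le> u*Z" and b2: "\<bar>y 2\<bar> \<le> u*Z" and b3: "\<bar>y 3\<bar> \<le> u*Z" and b4: "\<bar>y 4\<bar> \<le> u*Z" using y by auto
  have m2: "\<bar>y i * y j\<bar> \<le> w" if "\<bar>y i\<bar> \<le> u*Z" "\<bar>y j\<bar> \<le> u*Z" for i j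
  proof -
    have "\<bar>y i * y j\<bar> \<le> (u*Z) * (u*Z)" unfolding abs_mult using that uz by (intro mult_mono) auto
    then show ?thesis using pw[of 2] by (simp add: power2_eq_square)
  qed
  have m: "\<bar>y 1 ^ i * y k ^ j\<bar> \<le> w" if "\<bar>y k\<bar> \<le> u*Z" "2 \<le> i + j" "i + j \<le> 5" for i j k
  proof -
    have "\<bar>y 1 ^ i * y k ^ j\<bar> \<le> (u*Z) ^ i * (u*Z) ^ j"
      unfolding abs_mult power_abs using that b1 uz by (intro mult_mono power_mono) auto
    then show ?thesis using pw[of "i+j"] that by (simp add: power_add)
  qed
  have t: "\<bar>y 1 ^ 3 * y 2\<bar> \<le> w" "\<bar>y 1 * y 4\<bar> \<le> w" "\<bar>y 2 * y 3\<bar> \<le> w" "\<bar>y 1 ^ 2 * y 3\<bar> \<le> w" "\<bar>y 1 * y 2 ^ 2\<bar> \<le> w"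
     "\<bar>y 1 ^ 5\<bar> \<le> w" "\<bar>y 1 * y 2\<bar> \<le> w" "\<bar>y 1 ^ 3\<bar> \<le> w" "\<bar>y 1 ^ 2\<bar> \<le> w"
    using m[OF b2, of 3 1] m2[OF b1 b4] m2[OF b2 b3] m[OF b3, of 2 1] m[OF b2, of 1 2] m[OF b2, of 5 0] m2[OF b1 b2] m[OF b2, of 3 0] m[OF b2, of 2 0]
    by simp_all
  have "\<bar>PQ 5 y\<bar> \<le> 25 * w" "\<bar>RQ 5 y - y 5\<bar> \<le> 26 * w" "\<bar>PQ 3 y\<bar> \<le> 25 * w" "\<bar>RQ 3 y - y 3\<bar> \<le> 26 * w" "\<bar>PQ 2 y\<bar> \<le> 25 * w"
    unfolding PQ_def RQ_def using t w0 by (simp_all add: abs_le_iff del: abs_mult)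
  then show "\<bar>PQ 5 y\<bar> \<le> 25 * D^3 * u^2 * Z^5" "\<bar>RQ 5 y - y 5\<bar> \<le> 26 * D^3 * u^2 * Z^5"
    "\<bar>PQ 3 y\<bar> \<le> 25 * D^3 * u^2 * Z^5" "\<bar>RQ 3 y - y 3\<bar> \<le> 26 * D^3 * u^2 * Z^5" "\<bar>PQ 2 y\<bar> \<le> 25 * D^3 * u^2 * Z^5"
    unfolding w_def by (simp_all add: mult_ac)
qed

text \<open>Jensen's inequality for the fifth power with weights divided by their total; the fourth
  power of the total is left after undoing the normalisation.\<close>

lemma weighted_sum_power5_le:
  fixes w g :: "'b \<Rightarrow> real"
  assumes "finite S" "\<And>i. i \<in> S \<Longrightarrow> w i \<ge> 0" "\<And>i. i \<in> S \<Longrightarrow> g i \<ge> 0"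
  shows "(\<Sum>i\<in>S. w i * g i) ^ 5 \<le> (\<Sum>i\<in>S. w i) ^ 4 * (\<Sum>i\<in>S. w i * g i ^ 5)"
proof (cases "(\<Sum>i\<in>S. w i) = 0")
  case True
  then have "\<forall>i\<in>S. w i = 0" using assms by (simp add: sum_nonneg_eq_0_iff)
  then show ?thesis by simp
next
  case False
  define W where "W = (\<Sum>i\<in>S. w i)"
  have W: "W > 0" unfolding W_def using False assms sum_nonneg[of S w] by fastforce
  have ne: "S \<noteq> {}" using False by auto
  have "(\<Sum>i\<in>S. (w i / W) *\<^sub>R g i) ^ 5 \<le> (\<Sum>i\<in>S. w i / W * g i ^ 5)"
  proof (rule convex_on_sum[OF assms(1) ne convex_power_odd[of 5]])
    show "(\<Sum>i\<in>S. w i / W) = 1" using W unfolding sum_divide_distrib[symmetric] W_def by simp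
  qed (use assms W in auto)
  also have "(\<Sum>i\<in>S. (w i / W) *\<^sub>R g i) = (\<Sum>i\<in>S. w i * g i) / W" by (simp add: sum_divide_distrib)
  also have "(\<Sum>i\<in>S. w i / W * g i ^ 5) = (\<Sum>i\<in>S. w i * g i ^ 5) / W" by (simp add: sum_divide_distrib)
  finally have "(\<Sum>i\<in>S. w i * g i) ^ 5 / W ^ 5 \<le> (\<Sum>i\<in>S. w i * g i ^ 5) / W" by (simp add: power_divide)
  then have "(\<Sum>i\<in>S. w i * g i) ^ 5 \<le> (\<Sum>i\<in>S. w i * g i ^ 5) / W * W ^ 5" using W by (simp add: pos_divide_le_eq)
  also have "\<dots> = W ^ 4 * (\<Sum>i\<in>S. w i * g i ^ 5)" using W by (simp add: eval_nat_numeral)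
  finally show ?thesis unfolding W_def .
qed

text \<open>The Taylor remainder of the exponential is at most (y - \<theta>)^2 F^2, so a finite
  second moment of F allows differentiation under the integral.\<close>

lemma (in prob_space) iexp_expectation_deriv:
  fixes A F :: "'a \<Rightarrow> real"
  assumes [measurable]: "A \<in> borel_measurable M" "F \<in> borel_measurable M"
    and i1: "integrable M F" and i2: "integrable M (\<lambda>\<omega>. F \<omega> ^ 2)"
  shows "((\<lambda>\<theta>. \<integral>\<omega>. iexp (A \<omega> + \<theta> * F \<omega>) \<partial>M) has_vector_derivative (\<integral>\<omega>. \<i> * F \<omega> * iexp (A \<omega> + \<theta> * F \<omega>) \<partial>M)) (at \<theta>)"
  unfolding has_vector_derivative_def
proof (rule has_derivativeI_sandwich[where e=1 and H="\<lambda>y. \<bar>y - \<theta>\<bar> * (\<integral>\<omega>. F \<omega> ^ 2 \<partial>M)"])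
  show "((\<lambda>y. \<bar>y - \<theta>\<bar> * (\<integral>\<omega>. F \<omega> ^ 2 \<partial>M)) \<longlongrightarrow> 0) (at \<theta>)"
    by (auto intro!: tendsto_eq_intros)
  fix y :: real assume "y \<noteq> \<theta>"
  let ?D = "\<lambda>\<omega>. iexp (A \<omega> + y * F \<omega>) - iexp (A \<omega> + \<theta> * F \<omega>) - (y - \<theta>) *\<^sub>R (\<i> * F \<omega> * iexp (A \<omega> + \<theta> * F \<omega>))"
  have int: "integrable M (\<lambda>\<omega>. iexp (A \<omega> + z * F \<omega>))" for z
    by (intro integrable_const_bound[where B=1]) auto
  have int2: "integrable M (\<lambda>\<omega>. \<i> * F \<omega> * iexp (A \<omega> + \<theta> * F \<omega>))"
    by (rule Bochner_Integration.integrable_bound[OF i1]) (auto simp: norm_mult)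
  have le: "norm (?D \<omega>) \<le> (y - \<theta>)^2 * F \<omega> ^ 2" for \<omega>
  proof -
    define x where "x = (y - \<theta>) * F \<omega>"
    have e: "iexp (A \<omega> + y * F \<omega>) = iexp (A \<omega> + \<theta> * F \<omega>) * iexp x"
      unfolding x_def exp_add[symmetric] by (rule arg_cong[of _ _ exp]) (simp add: algebra_simps)
    have "?D \<omega> = iexp (A \<omega> + \<theta> * F \<omega>) * (iexp x - 1 - \<i> * x)"
      unfolding e x_def by (simp add: algebra_simps scaleR_conv_of_real)
    then have "norm (?D \<omega>) = norm (iexp x - 1 - \<i> * x)" by (simp add: norm_mult)
    also have "\<dots> = norm (iexp x - (\<Sum>k\<le>1. (\<i> * x)^k / fact k))" by (simp add: algebra_simps)
    also have "\<dots> \<le> \<bar>x\<bar> ^ Suc 1 / fact (Suc 1)" by (rule iexp_approx1)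
    also have "\<dots> \<le> x^2" by (simp add: power2_eq_square)
    finally show ?thesis unfolding x_def by (simp add: power_mult_distrib)
  qed
  have "norm ((\<integral>\<omega>. iexp (A \<omega> + y * F \<omega>) \<partial>M) - (\<integral>\<omega>. iexp (A \<omega> + \<theta> * F \<omega>) \<partial>M) - (y - \<theta>) *\<^sub>R (\<integral>\<omega>. \<i> * F \<omega> * iexp (A \<omega> + \<theta> * F \<omega>) \<partial>M))
     = norm (\<integral>\<omega>. ?D \<omega> \<partial>M)"
    using int int2 by simp
  also have "\<dots> \<le> (\<integral>\<omega>. norm (?D \<omega>) \<partial>M)" by (rule integral_norm_bound)
  also have "\<dots> \<le> (\<integral>\<omega>. (y - \<theta>)^2 * F \<omega> ^ 2 \<partial>M)"
    using int int2 i2 le by (intro integral_mono integrable_norm Bochner_Integration.integrable_diff integrable_scaleR_right) auto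
  also have "\<dots> = (y - \<theta>)^2 * (\<integral>\<omega>. F \<omega> ^ 2 \<partial>M)" by simp
  finally show "norm ((\<integral>\<omega>. iexp (A \<omega> + y * F \<omega>) \<partial>M) - (\<integral>\<omega>. iexp (A \<omega> + \<theta> * F \<omega>) \<partial>M) - (y - \<theta>) *\<^sub>R (\<integral>\<omega>. \<i> * F \<omega> * iexp (A \<omega> + \<theta> * F \<omega>) \<partial>M)) / norm (y - \<theta>)
     \<le> \<bar>y - \<theta>\<bar> * (\<integral>\<omega>. F \<omega> ^ 2 \<partial>M)"
    using \<open>y \<noteq> \<theta>\<close> by (simp add: pos_divide_le_eq power2_eq_square mult_ac abs_mult_self_eq)
qed (auto intro: bounded_linear_scaleR_left)

context gaussian_process
begin

lemma expectation_norm_le: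
  fixes \<Phi> :: "(real \<Rightarrow> real) \<Rightarrow> 'c::euclidean_space" and \<Psi> :: "(real \<Rightarrow> real) \<Rightarrow> real"
  assumes I: "finite I" "I \<subseteq> {0..}" and a: "adm I \<Phi>" "adm I \<Psi>" and le: "\<And>b. norm (\<Phi> b) \<le> \<Psi> b"
  shows "norm (\<integral>\<omega>. \<Phi> (\<lambda>t. B t \<omega>) \<partial>M) \<le> (\<integral>\<omega>. \<Psi> (\<lambda>t. B t \<omega>) \<partial>M)"
proof -
  have "norm (\<integral>\<omega>. \<Phi> (\<lambda>t. B t \<omega>) \<partial>M) \<le> (\<integral>\<omega>. norm (\<Phi> (\<lambda>t. B t \<omega>)) \<partial>M)" by (rule integral_norm_bound)
  also have "\<dots> \<le> (\<integral>\<omega>. \<Psi> (\<lambda>t. B t \<omega>) \<partial>M)"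
    by (rule integral_mono[OF integrable_norm[OF adm_integrable[OF I a(1)]] adm_integrable[OF I a(2)] le])
  finally show ?thesis .
qed

lemma expectation_mono:
  fixes \<Phi> \<Psi> :: "(real \<Rightarrow> real) \<Rightarrow> real"
  assumes I: "finite I" "I \<subseteq> {0..}" and a: "adm I \<Phi>" "adm I \<Psi>" and le: "\<And>b. \<Phi> b \<le> \<Psi> b"
  shows "(\<integral>\<omega>. \<Phi> (\<lambda>t. B t \<omega>) \<partial>M) \<le> (\<integral>\<omega>. \<Psi> (\<lambda>t. B t \<omega>) \<partial>M)"
  by (rule integral_mono[OF adm_integrable[OF I a(1)] adm_integrable[OF I a(2)] le])

lemma expectation_sum:
  fixes \<Phi> :: "'j \<Rightarrow> (real \<Rightarrow> real) \<Rightarrow> 'c::euclidean_space"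
  assumes I: "finite I" "I \<subseteq> {0..}" and a: "\<And>j. j \<in> S \<Longrightarrow> adm I (\<Phi> j)"
  shows "(\<integral>\<omega>. (\<Sum>j\<in>S. \<Phi> j (\<lambda>t. B t \<omega>)) \<partial>M) = (\<Sum>j\<in>S. \<integral>\<omega>. \<Phi> j (\<lambda>t. B t \<omega>) \<partial>M)"
  by (rule Bochner_Integration.integral_sum[OF adm_integrable[OF I a]])

end

lemma adm_PQ_RQ:
  fixes Y :: "nat \<Rightarrow> ('i \<Rightarrow> real) \<Rightarrow> real"
  assumes "\<And>r. adm I (Y r)"
  shows "adm I (\<lambda>b. PQ q (\<lambda>r. Y r b))" "adm I (\<lambda>b. RQ q (\<lambda>r. Y r b))"
proof -
  have n: "adm I (\<lambda>b. - \<Phi> b)" if "adm I \<Phi>" for \<Phi> :: "('i \<Rightarrow> real) \<Rightarrow> real"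
    using adm_cmult[OF that, of "-1"] by simp
  show "adm I (\<lambda>b. PQ q (\<lambda>r. Y r b))"
    unfolding PQ_def by (cases "q = 0"; cases "q = 1"; cases "q = 2"; cases "q = 3"; cases "q = 4"; simp only: if_True if_False simp_thms; intro n adm_const adm_add adm_diff adm_cmult adm_power adm_mult assms)
  show "adm I (\<lambda>b. RQ q (\<lambda>r. Y r b))"
    unfolding RQ_def by (cases "q = 0"; cases "q = 1"; cases "q = 2"; cases "q = 3"; cases "q = 4"; simp only: if_True if_False simp_thms; intro n adm_const adm_add adm_diff adm_cmult adm_power adm_mult assms)
qed

definition pd_moment :: real where
  "pd_moment = (\<Sum>r\<in>{1..5}. \<integral>x. \<bar>pd r x\<bar> ^ 5 \<partial>std_normal_distribution)"

lemma pd_moment_nonneg: "pd_moment \<ge> 0"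
  unfolding pd_moment_def by (intro sum_nonneg integral_nonneg_AE) auto

lemma pd_moment_le: "r \<in> {1..5} \<Longrightarrow> (\<integral>x. \<bar>pd r x\<bar> ^ 5 \<partial>std_normal_distribution) \<le> pd_moment"
  unfolding pd_moment_def by (rule member_le_sum) (auto intro!: integral_nonneg_AE)

text \<open>Bound for the fifth moment in \<open>Z_moment\<close>: 32 = 2^5 stems from
  \<open>power_sum_le\<close>, and 62 = 2 * (1 + 2 + 4 + 8 + 16) collects the row sums of the powers
  of the correlations up to degree 5.\<close>

definition Zbound :: "real \<Rightarrow> real" where
  "Zbound \<Lambda> = 32 * (1 + (62 * \<Lambda>) ^ 5 * pd_moment)"

text \<open>One step of the central limit theorem: \<open>F\<close> is the linear combination of values of \<open>V\<close> in which the increment \<open>l\<close>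
  carries the weight \<open>\<mu> l\<close>, and \<open>ac\<close> are the coefficients of the linear part.\<close>
locale clt_step = fbm10 M B for M :: "'a measure" and B +
  fixes n N :: nat and \<mu> :: "nat \<Rightarrow> real" and \<Lambda> D T :: real and J :: "real set" and ac :: "real \<Rightarrow> real"
  assumes n1: "n \<ge> 1" and \<mu>: "\<And>j. \<bar>\<mu> j\<bar> \<le> \<Lambda>" and J: "finite J" "J \<subseteq> {0..}" and D1: "D \<ge> 1"
    and aj: "\<And>j. \<bar>\<Sum>t\<in>J. ac t * kxi n j t\<bar> \<le> D" and ajs: "(\<Sum>j<N. (\<Sum>t\<in>J. ac t * kxi n j t)\<^sup>2) \<le> D"
    and NT: "real N * sn n ^ 10 \<le> T"
begin

definition a where "a j = (\<Sum>t\<in>J. ac t * kxi n j t)"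
definition g where "g j l = incr n l (kxi n j)"
definition F where "F b = sn n ^ 5 * (\<Sum>l<N. \<mu> l * pd 0 (incr n l b))"
definition X where "X \<theta> b = (\<Sum>t\<in>J. ac t * b t) + \<theta> * F b"
text \<open>For r >= 1 this is the derivative of order r of \<open>X \<theta>\<close> in the
  direction \<open>kxi n j\<close>. The linear part of \<open>X \<theta>\<close> is seen only at r =
  1.\<close>

definition Y where "Y \<theta> j r b = (if r = 1 then a j else 0) + \<theta> * (sn n ^ 5 * (\<Sum>l<N. \<mu> l * g j l ^ r * pd r (incr n l b)))"
definition II where "II = J \<union> (\<lambda>i. real i / real n) ` {..N}"
text \<open>One variable that dominates the random part of all five derivatives at once; the summand
  1 lets it multiply the deterministic \<open>a j\<close> too.\<close>

definition Z where "Z j b = 1 + (\<Sum>(r,l)\<in>{1..5}\<times>{..<N}. (\<bar>\<mu> l\<bar> * \<bar>g j l\<bar> ^ r) * \<bar>pd r (incr n l b)\<bar>)"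
text \<open>Deterministic size of the derivatives \<open>Y \<theta> j r\<close>. Its squares have a
  sum bounded independently of n, by \<open>u_sum\<close>, which is why errors quadratic in
  \<open>u j\<close> are harmless.\<close>

definition u where "u j = \<bar>a j\<bar> + sn n ^ 5"

lemma II: "finite II" "II \<subseteq> {0..}" "j < N \<Longrightarrow> real j / real n \<in> II" "j < N \<Longrightarrow> real (Suc j) / real n \<in> II"
  unfolding II_def using J by (auto simp del: of_nat_Suc)

lemma \<Lambda>0: "\<Lambda> \<ge> 0" using \<mu>[of 0] by linarith

lemma s0: "sn n > 0" "sn n \<le> 1" using sn_pos[OF n1] sn_le_1[OF n1] by auto

lemma u_bounds: "0 \<le> u j" "u j \<le> D + 1"
proof -
  have "sn n ^ 5 \<le> 1" using s0 by (intro power_le_one) auto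
  then show "0 \<le> u j" "u j \<le> D + 1" unfolding u_def a_def using aj[of j] s0 by (auto intro: add_mono)
qed

lemma u_sum: "(\<Sum>j<N. u j ^ 2) \<le> 2 * (D + T)"
proof -
  have "(\<Sum>j<N. u j ^ 2) \<le> (\<Sum>j<N. 2 * (a j ^ 2) + 2 * sn n ^ 10)"
  proof (rule sum_mono)
    fix j
    have aux: "(\<bar>x\<bar> + y)\<^sup>2 \<le> 2 * x\<^sup>2 + 2 * y\<^sup>2" for x y :: real
      using sum_squares_bound[of "\<bar>x\<bar>" y] by (simp add: power2_sum)
    have "sn n ^ 10 = (sn n ^ 5)\<^sup>2" by (simp add: power_mult[symmetric])
    then show "u j ^ 2 \<le> 2 * (a j ^ 2) + 2 * sn n ^ 10"
      unfolding u_def using aux[of "a j" "sn n ^ 5"] by (simp only:)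
  qed
  also have "\<dots> = 2 * (\<Sum>j<N. a j ^ 2) + 2 * (real N * sn n ^ 10)"
    by (simp add: sum.distrib sum_distrib_left)
  also have "\<dots> \<le> 2 * (D + T)" using ajs NT unfolding a_def by simp
  finally show ?thesis .
qed

lemma g_eq: "g j l = rho10 (int j - int l) / 2" unfolding g_def by (rule incr_kxi[OF n1])

lemma g_le: "\<bar>g j l\<bar> \<le> 2" unfolding g_eq using rho10_abs_le[of "int j - int l"] by simp

lemma g_row: "(\<Sum>l<N. \<bar>g j l\<bar>) \<le> 2" and g_col: "(\<Sum>j<N. \<bar>g j l\<bar>) \<le> 2"
  unfolding g_eq using rho10_row_sum[where N=N and j=j] rho10_col_sum[where N=N and j=l]
  by (simp_all add: abs_divide sum_divide_distrib[symmetric])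

lemma g_power_le: "r \<ge> 1 \<Longrightarrow> \<bar>g j l\<bar> ^ r \<le> 2 ^ (r-1) * \<bar>g j l\<bar>"
proof -
  assume "r \<ge> 1"
  then have "\<bar>g j l\<bar> ^ r = \<bar>g j l\<bar> ^ (r-1) * \<bar>g j l\<bar>" by (cases r) auto
  also have "\<dots> \<le> 2 ^ (r-1) * \<bar>g j l\<bar>" by (intro mult_right_mono power_mono g_le) auto
  finally show ?thesis .
qed

lemma adm_incr_II: "l < N \<Longrightarrow> adm II (incr n l)"
  by (intro adm_incr II)

lemma adm_F: "adm II F"
  unfolding F_def[abs_def] by (intro adm_cmult adm_sum adm_pd adm_incr_II) auto

lemma adm_X: "adm II (X \<theta>)"
proof -
  have "adm II (\<lambda>b. \<Sum>t\<in>J. ac t * b t)"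
    by (intro adm_sum adm_cmult adm_coord II) (auto simp: II_def)
  then show ?thesis unfolding X_def[abs_def] by (intro adm_add adm_cmult adm_F)
qed

lemma adm_Y: "adm II (Y \<theta> j r)"
  unfolding Y_def[abs_def] by (intro adm_add adm_const adm_cmult adm_sum adm_pd adm_incr_II) auto

lemma adm_Z: "adm II (Z j)"
  unfolding Z_def[abs_def] case_prod_beta' by (intro adm_add adm_const adm_cmult adm_sum adm_abs adm_pd adm_incr_II) auto

lemma pd_line_deriv: "((\<lambda>x. pd r (incr n l (\<lambda>t. b t + x * kxi n j t))) has_real_derivative g j l * pd (Suc r) (incr n l b)) (at 0)"
proof -
  have "((\<lambda>x. pd r (incr n l b + x * g j l)) has_real_derivative pd (Suc r) (incr n l b + 0 * g j l) * (g j l)) (at 0)"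
    by (rule DERIV_chain2[OF pd_deriv]) (auto intro!: derivative_eq_intros)
  then show ?thesis unfolding incr_line g_def by (simp add: mult.commute)
qed

lemma sum_pd_line_deriv:
  "((\<lambda>x. \<Sum>l<N. c l * pd r (incr n l (\<lambda>t. b t + x * kxi n j t))) has_real_derivative (\<Sum>l<N. c l * (g j l * pd (Suc r) (incr n l b)))) (at 0)"
  by (rule DERIV_sum) (rule DERIV_cmult[OF pd_line_deriv])

lemma X_deriv: "((\<lambda>x. X \<theta> (\<lambda>t. b t + x * kxi n j t)) has_real_derivative Y \<theta> j 1 b) (at 0)"
proof -
  have l: "(\<Sum>t\<in>J. ac t * (b t + x * kxi n j t)) = (\<Sum>t\<in>J. ac t * b t) + x * a j" for x
    unfolding a_def by (simp add: distrib_left sum.distrib sum_distrib_left mult_ac)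
  have "((\<lambda>x. ((\<Sum>t\<in>J. ac t * b t) + x * a j) + \<theta> * (sn n ^ 5 * (\<Sum>l<N. \<mu> l * pd 0 (incr n l (\<lambda>t. b t + x * kxi n j t)))))
     has_real_derivative (a j + \<theta> * (sn n ^ 5 * (\<Sum>l<N. \<mu> l * (g j l * pd (Suc 0) (incr n l b)))))) (at 0)"
    by (intro DERIV_add DERIV_cmult sum_pd_line_deriv) (auto intro!: derivative_eq_intros)
  then show ?thesis unfolding X_def F_def Y_def l by (simp add: mult_ac)
qed

lemma Y_deriv: "1 \<le> r \<Longrightarrow> ((\<lambda>x. Y \<theta> j r (\<lambda>t. b t + x * kxi n j t)) has_real_derivative Y \<theta> j (Suc r) b) (at 0)"
proof -
  assume "1 \<le> r"
  have "((\<lambda>x. (if r = 1 then a j else 0) + \<theta> * (sn n ^ 5 * (\<Sum>l<N. (\<mu> l * g j l ^ r) * pd r (incr n l (\<lambda>t. b t + x * kxi n j t)))))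
     has_real_derivative (0 + \<theta> * (sn n ^ 5 * (\<Sum>l<N. (\<mu> l * g j l ^ r) * (g j l * pd (Suc r) (incr n l b)))))) (at 0)"
    by (intro DERIV_add DERIV_cmult sum_pd_line_deriv DERIV_const)
  then show ?thesis unfolding Y_def using \<open>1 \<le> r\<close> by (simp add: mult_ac)
qed

abbreviation Ex :: "((real \<Rightarrow> real) \<Rightarrow> 'c::euclidean_space) \<Rightarrow> 'c" where
  "Ex \<Phi> \<equiv> \<integral>\<omega>. \<Phi> (\<lambda>t. B t \<omega>) \<partial>M"

lemma hermite_iexp_expectation:
  assumes "j < N" "q \<le> 5"
  shows "Ex (\<lambda>b. hermite q (incr n j b) *\<^sub>R iexp (X \<theta> b))
    = Ex (\<lambda>b. iexp (X \<theta> b) * Complex (PQ q (\<lambda>r. Y \<theta> j r b)) (RQ q (\<lambda>r. Y \<theta> j r b)))"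
proof -
  define \<Phi> where "\<Phi> q b = iexp (X \<theta> b) * Complex (PQ q (\<lambda>r. Y \<theta> j r b)) (RQ q (\<lambda>r. Y \<theta> j r b))" for q b
  have "Ex (\<lambda>b. hermite q (incr n j b) *\<^sub>R \<Phi> 0 b) = Ex (\<Phi> q)"
  proof (rule incr_hermite_ibp[OF n1 II(1,2) II(3,4)[OF assms(1)]])
    show "adm II (\<Phi> r)" for r
      unfolding \<Phi>_def[abs_def] by (intro adm_mult adm_iexp adm_X adm_Complex adm_PQ_RQ adm_Y)
  next
    fix r b assume "r < q"
    then have r5: "r < 5" using assms by simp
    note pq = PQ_RQ_deriv[of "\<lambda>x r. Y \<theta> j r (\<lambda>t. b t + x * kxi n j t)", OF _ r5]
    have y: "((\<lambda>x. Y \<theta> j r (\<lambda>t. b t + x * kxi n j t)) has_real_derivative Y \<theta> j (Suc r) (\<lambda>t. b t + 0 * kxi n j t)) (at 0)" if "1 \<le> r" for r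
      using Y_deriv[OF that] by simp
    from iexp_times_Complex_deriv[OF X_deriv[of \<theta> b j] pq(1)[OF y] pq(2)[OF y]]
    show "((\<lambda>x. \<Phi> r (\<lambda>t. b t + x * kxi n j t)) has_vector_derivative \<Phi> (Suc r) b) (at 0)"
      unfolding \<Phi>_def by simp
  qed
  then show ?thesis unfolding \<Phi>_def by (simp add: PQ_def RQ_def Complex_eq)
qed

lemma Z_ge_1: "Z j b \<ge> 1"
  unfolding Z_def by (auto intro!: sum_nonneg)

lemma Y_bound:
  assumes "0 \<le> \<theta>" "\<theta> \<le> 1" "1 \<le> r" "r \<le> 5"
  shows "r \<ge> 2 \<Longrightarrow> \<bar>Y \<theta> j r b\<bar> \<le> sn n ^ 5 * Z j b" and "\<bar>Y \<theta> j r b\<bar> \<le> u j * Z j b"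
proof -
  define S where "S = (\<Sum>l<N. \<mu> l * g j l ^ r * pd r (incr n l b))"
  have "\<bar>S\<bar> \<le> (\<Sum>l<N. (\<bar>\<mu> l\<bar> * \<bar>g j l\<bar> ^ r) * \<bar>pd r (incr n l b)\<bar>)"
    unfolding S_def by (rule order_trans[OF sum_abs]) (simp add: abs_mult power_abs)
  also have "\<dots> \<le> (\<Sum>r\<in>{1..5}. \<Sum>l<N. (\<bar>\<mu> l\<bar> * \<bar>g j l\<bar> ^ r) * \<bar>pd r (incr n l b)\<bar>)"
    using assms by (intro member_le_sum[where f="\<lambda>r. \<Sum>l<N. (\<bar>\<mu> l\<bar> * \<bar>g j l\<bar> ^ r) * \<bar>pd r (incr n l b)\<bar>"] sum_nonneg) auto
  also have "\<dots> \<le> Z j b" unfolding Z_def by (simp add: sum.cartesian_product)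
  finally have S: "\<bar>S\<bar> \<le> Z j b" .
  have "\<bar>\<theta> * (sn n ^ 5 * S)\<bar> = \<theta> * (sn n ^ 5 * \<bar>S\<bar>)" using assms s0 by (simp add: abs_mult)
  also have "\<dots> \<le> 1 * (sn n ^ 5 * Z j b)" using assms s0 S by (intro mult_mono mult_left_mono mult_nonneg_nonneg) auto
  finally have t: "\<bar>\<theta> * (sn n ^ 5 * S)\<bar> \<le> sn n ^ 5 * Z j b" by simp
  show "\<bar>Y \<theta> j r b\<bar> \<le> sn n ^ 5 * Z j b" if "r \<ge> 2" using t that unfolding Y_def S_def by simp
  have "\<bar>Y \<theta> j r b\<bar> \<le> \<bar>a j\<bar> + sn n ^ 5 * Z j b" using t unfolding Y_def S_def by auto
  also have "\<dots> \<le> u j * Z j b"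
    unfolding u_def using mult_left_mono[OF Z_ge_1[of j b], of "\<bar>a j\<bar>"] by (simp add: distrib_right)
  finally show "\<bar>Y \<theta> j r b\<bar> \<le> u j * Z j b" .
qed

text \<open>Jensen's inequality with the weights |\<open>\<mu> l\<close>| |\<open>g j l\<close>|^r:
  their total is bounded independently of N through the row sums of g, and each increment is
  standard normal, so only moments of the polynomials \<open>pd r\<close> remain.\<close>

lemma Z_moment: "Ex (\<lambda>b. Z j b ^ 5) \<le> Zbound \<Lambda>"
proof -
  define S where "S = {1..5::nat} \<times> {..<N}"
  define w where "w p = \<bar>\<mu> (snd p)\<bar> * \<bar>g j (snd p)\<bar> ^ (fst p)" for p :: "nat \<times> nat"
  define W where "W = (\<Sum>p\<in>S. w p)"
  have w0: "w p \<ge> 0" for p unfolding w_def by simp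
  then have W0: "W \<ge> 0" unfolding W_def by (simp add: sum_nonneg)
  have "W = (\<Sum>r\<in>{1..5}. \<Sum>l<N. \<bar>\<mu> l\<bar> * \<bar>g j l\<bar> ^ r)"
    unfolding W_def S_def w_def by (simp add: sum.cartesian_product case_prod_beta')
  also have "\<dots> \<le> (\<Sum>r\<in>{1..5}. \<Lambda> * (2 ^ (r-1) * 2))"
  proof (rule sum_mono)
    fix r :: nat assume "r \<in> {1..5}"
    then have "(\<Sum>l<N. \<bar>\<mu> l\<bar> * \<bar>g j l\<bar> ^ r) \<le> (\<Sum>l<N. \<Lambda> * (2 ^ (r-1) * \<bar>g j l\<bar>))"
      using \<Lambda>0 by (intro sum_mono mult_mono \<mu> g_power_le) auto
    also have "\<dots> = \<Lambda> * (2 ^ (r-1) * (\<Sum>l<N. \<bar>g j l\<bar>))" by (simp add: sum_distrib_left)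
    also have "\<dots> \<le> \<Lambda> * (2 ^ (r-1) * 2)" using \<Lambda>0 by (intro mult_left_mono g_row) auto
    finally show "(\<Sum>l<N. \<bar>\<mu> l\<bar> * \<bar>g j l\<bar> ^ r) \<le> \<Lambda> * (2 ^ (r-1) * 2)" .
  qed
  also have "\<dots> = 62 * \<Lambda>"
  proof -
    have "{1..5::nat} = {1,2,3,4,5}" by auto
    then show ?thesis by simp
  qed
  finally have W62: "W \<le> 62 * \<Lambda>" .
  have aw: "adm II (\<lambda>b. w p * \<bar>pd (fst p) (incr n (snd p) b)\<bar> ^ 5)" if "p \<in> S" for p
    using that unfolding S_def by (intro adm_cmult adm_power adm_abs adm_pd adm_incr_II) auto
  have "Ex (\<lambda>b. Z j b ^ 5) \<le> Ex (\<lambda>b. 32 * (1 + W ^ 4 * (\<Sum>p\<in>S. w p * \<bar>pd (fst p) (incr n (snd p) b)\<bar> ^ 5)))"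
  proof (rule expectation_mono[OF II(1,2)])
    show "adm II (\<lambda>b. Z j b ^ 5)" by (intro adm_power adm_Z)
    show "adm II (\<lambda>b. 32 * (1 + W ^ 4 * (\<Sum>p\<in>S. w p * \<bar>pd (fst p) (incr n (snd p) b)\<bar> ^ 5)))"
      by (intro adm_cmult adm_add adm_const adm_sum aw)
    fix b
    let ?G = "\<Sum>p\<in>S. w p * \<bar>pd (fst p) (incr n (snd p) b)\<bar>"
    have "Z j b ^ 5 = (1 + ?G) ^ 5" unfolding Z_def S_def w_def by (simp add: case_prod_beta')
    also have "\<dots> \<le> 2 ^ 5 * (1 ^ 5 + ?G ^ 5)" using w0 by (intro power_sum_le sum_nonneg) auto
    also have "\<dots> \<le> 32 * (1 + W ^ 4 * (\<Sum>p\<in>S. w p * \<bar>pd (fst p) (incr n (snd p) b)\<bar> ^ 5))"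
      using weighted_sum_power5_le[of S w "\<lambda>p. \<bar>pd (fst p) (incr n (snd p) b)\<bar>"] w0
      unfolding W_def S_def by simp
    finally show "Z j b ^ 5 \<le> 32 * (1 + W ^ 4 * (\<Sum>p\<in>S. w p * \<bar>pd (fst p) (incr n (snd p) b)\<bar> ^ 5))" .
  qed
  also have "\<dots> = 32 * (1 + W ^ 4 * (\<Sum>p\<in>S. w p * Ex (\<lambda>b. \<bar>pd (fst p) (incr n (snd p) b)\<bar> ^ 5)))"
  proof -
    have i: "integrable M (\<lambda>\<omega>. \<Sum>p\<in>S. w p * \<bar>pd (fst p) (incr n (snd p) (\<lambda>t. B t \<omega>))\<bar> ^ 5)"
      by (rule adm_integrable[OF II(1,2)]) (intro adm_sum aw)
    have "Ex (\<lambda>b. \<Sum>p\<in>S. w p * \<bar>pd (fst p) (incr n (snd p) b)\<bar> ^ 5) = (\<Sum>p\<in>S. w p * Ex (\<lambda>b. \<bar>pd (fst p) (incr n (snd p) b)\<bar> ^ 5))"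
      by (subst expectation_sum[OF II(1,2) aw]) simp_all
    then show ?thesis using i by (simp add: prob_space)
  qed
  also have "\<dots> \<le> 32 * (1 + W ^ 4 * (\<Sum>p\<in>S. w p * pd_moment))"
  proof -
    have "Ex (\<lambda>b. \<bar>pd (fst p) (incr n (snd p) b)\<bar> ^ 5) \<le> pd_moment" if "p \<in> S" for p
    proof -
      have "Ex (\<lambda>b. \<bar>pd (fst p) (incr n (snd p) b)\<bar> ^ 5) = (\<integral>x. \<bar>pd (fst p) x\<bar> ^ 5 \<partial>std_normal_distribution)"
        by (rule incr_expectation[OF n1, of "\<lambda>x. \<bar>pd (fst p) x\<bar> ^ 5"]) measurable
      also have "\<dots> \<le> pd_moment" using that unfolding S_def by (intro pd_moment_le) auto
      finally show ?thesis .
    qed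
    then have "(\<Sum>p\<in>S. w p * Ex (\<lambda>b. \<bar>pd (fst p) (incr n (snd p) b)\<bar> ^ 5)) \<le> (\<Sum>p\<in>S. w p * pd_moment)"
      using w0 by (intro sum_mono mult_left_mono) auto
    then show ?thesis using W0 by (intro mult_left_mono add_left_mono) auto
  qed
  also have "\<dots> = 32 * (1 + W ^ 5 * pd_moment)"
    unfolding sum_distrib_right[symmetric] W_def[symmetric] by (simp add: eval_nat_numeral)
  also have "\<dots> \<le> Zbound \<Lambda>"
    unfolding Zbound_def using W0 W62 pd_moment_nonneg by (intro mult_left_mono add_left_mono mult_right_mono power_mono) auto
  finally show ?thesis .
qed

end

section \<open>The differential equation for the characteristic function\<close>

context clt_step
begin

text \<open>51 = 25 + 26 adds the two constants of \<open>PQ_RQ_remainder\<close>, used there with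
  the bound D + 1 for \<open>u j\<close>.\<close>

definition c1 where "c1 = 51 * (D + 1)^3 * Zbound \<Lambda>"

lemma Zbound_ge_1: "Zbound \<Lambda> \<ge> 1"
  unfolding Zbound_def using \<Lambda>0 pd_moment_nonneg by simp

lemma c1_ge: "c1 \<ge> Zbound \<Lambda>"
proof -
  have "1 \<le> (D+1)^3" using D1 by (intro one_le_power) simp
  then have "1 \<le> 51 * (D+1)^3" by linarith
  then have "1 * Zbound \<Lambda> \<le> 51 * (D+1)^3 * Zbound \<Lambda>" using Zbound_ge_1 by (intro mult_right_mono) auto
  then show ?thesis unfolding c1_def by simp
qed

text \<open>After q integrations by parts the only term linear in the derivatives is
  \<open>Y \<theta> j q\<close>. All others have at least two factors and are of order
  \<open>u j ^ 2\<close>, hence summable over j.\<close>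

lemma hermite_iexp_remainder:
  assumes j: "j < N" and \<theta>: "0 \<le> \<theta>" "\<theta> \<le> 1" and q: "q = 3 \<or> q = 5"
  shows "norm (Ex (\<lambda>b. hermite q (incr n j b) *\<^sub>R iexp (X \<theta> b)) - \<i> * Ex (\<lambda>b. complex_of_real (Y \<theta> j q b) * iexp (X \<theta> b))) \<le> c1 * u j ^ 2"
proof -
  let ?y = "\<lambda>b r. Y \<theta> j r b"
  have ai: "adm II (\<lambda>b. iexp (X \<theta> b) * Complex (PQ q (?y b)) (RQ q (?y b)))" "adm II (\<lambda>b. complex_of_real (Y \<theta> j q b) * iexp (X \<theta> b))"
    by (intro adm_mult adm_iexp adm_X adm_Complex adm_PQ_RQ adm_Y adm_of_real)+
  have eqn: "Ex (\<lambda>b. hermite q (incr n j b) *\<^sub>R iexp (X \<theta> b)) - \<i> * Ex (\<lambda>b. complex_of_real (Y \<theta> j q b) * iexp (X \<theta> b))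
     = Ex (\<lambda>b. iexp (X \<theta> b) * Complex (PQ q (?y b)) (RQ q (?y b)) - \<i> * (complex_of_real (Y \<theta> j q b) * iexp (X \<theta> b)))"
    using hermite_iexp_expectation[OF j, of q \<theta>] q adm_integrable[OF II(1,2) ai(1)] adm_integrable[OF II(1,2) ai(2)] by auto
  have "norm (Ex (\<lambda>b. hermite q (incr n j b) *\<^sub>R iexp (X \<theta> b)) - \<i> * Ex (\<lambda>b. complex_of_real (Y \<theta> j q b) * iexp (X \<theta> b))) \<le> Ex (\<lambda>b. 51 * (D+1)^3 * u j ^ 2 * Z j b ^ 5)"
    unfolding eqn
  proof (rule expectation_norm_le[OF II(1,2)])
    show "adm II (\<lambda>b. iexp (X \<theta> b) * Complex (PQ q (?y b)) (RQ q (?y b)) - \<i> * (complex_of_real (Y \<theta> j q b) * iexp (X \<theta> b)))"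
      by (intro adm_diff ai adm_cmult)
    show "adm II (\<lambda>b. 51 * (D+1)^3 * u j ^ 2 * Z j b ^ 5)" by (intro adm_cmult adm_power adm_Z)
    fix b
    have yb: "\<bar>?y b r\<bar> \<le> u j * Z j b" if "1 \<le> r" "r \<le> 5" for r using Y_bound(2)[OF \<theta> that] .
    have D1': "D + 1 \<ge> 1" using D1 by simp
    note rem = PQ_RQ_remainder[where y="?y b", OF yb Z_ge_1 u_bounds D1']
    have eqn': "iexp (X \<theta> b) * Complex (PQ q (?y b)) (RQ q (?y b)) - \<i> * (complex_of_real (Y \<theta> j q b) * iexp (X \<theta> b))
      = iexp (X \<theta> b) * Complex (PQ q (?y b)) (RQ q (?y b) - Y \<theta> j q b)"
    proof -
      have "z * Complex p r - \<i> * (complex_of_real y * z) = z * Complex p (r - y)" for z p r y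
      proof -
        have "Complex p (r - y) = Complex p r - \<i> * complex_of_real y" by (simp add: complex_eq_iff)
        then show ?thesis by (simp only:) (simp add: algebra_simps)
      qed
      then show ?thesis .
    qed
    have "norm (iexp (X \<theta> b) * Complex (PQ q (?y b)) (RQ q (?y b)) - \<i> * (complex_of_real (Y \<theta> j q b) * iexp (X \<theta> b)))
      = norm (Complex (PQ q (?y b)) (RQ q (?y b) - Y \<theta> j q b))" unfolding eqn' by (simp add: norm_mult)
    also have "\<dots> \<le> \<bar>PQ q (?y b)\<bar> + \<bar>RQ q (?y b) - Y \<theta> j q b\<bar>" by (rule order_trans[OF cmod_le]) (simp only: complex.sel order_refl)
    also have "\<dots> \<le> 25 * (D+1)^3 * u j ^ 2 * Z j b ^ 5 + 26 * (D+1)^3 * u j ^ 2 * Z j b ^ 5"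
      by (rule disjE[OF q]; simp only:; intro add_mono rem)
    also have "\<dots> = 51 * (D+1)^3 * u j ^ 2 * Z j b ^ 5" by (simp add: algebra_simps)
    finally show "norm (iexp (X \<theta> b) * Complex (PQ q (?y b)) (RQ q (?y b)) - \<i> * (complex_of_real (Y \<theta> j q b) * iexp (X \<theta> b)))
      \<le> 51 * (D+1)^3 * u j ^ 2 * Z j b ^ 5" .
  qed
  also have "\<dots> = 51 * (D+1)^3 * u j ^ 2 * Ex (\<lambda>b. Z j b ^ 5)" by simp
  also have "\<dots> \<le> 51 * (D+1)^3 * u j ^ 2 * Zbound \<Lambda>"
    using D1 by (intro mult_left_mono Z_moment) auto
  finally show ?thesis unfolding c1_def by (simp add: mult_ac)
qed

text \<open>Here even the linear term is small: a second derivative does not see the linear part of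
  \<open>X \<theta>\<close>, so it carries the factor \<open>sn n ^ 5\<close>.\<close>

lemma hermite2_iexp_bound:
  assumes j: "j < N" and \<theta>: "0 \<le> \<theta>" "\<theta> \<le> 1"
  shows "norm (Ex (\<lambda>b. hermite 2 (incr n j b) *\<^sub>R iexp (X \<theta> b))) \<le> c1 * (u j ^ 2 + sn n ^ 5)"
proof -
  let ?y = "\<lambda>b r. Y \<theta> j r b"
  have eqn: "Ex (\<lambda>b. hermite 2 (incr n j b) *\<^sub>R iexp (X \<theta> b)) = Ex (\<lambda>b. iexp (X \<theta> b) * Complex (PQ 2 (?y b)) (RQ 2 (?y b)))"
    using hermite_iexp_expectation[OF j, of 2 \<theta>] by simp
  have "norm (Ex (\<lambda>b. hermite 2 (incr n j b) *\<^sub>R iexp (X \<theta> b))) \<le> Ex (\<lambda>b. (25 * (D+1)^3 * u j ^ 2 + sn n ^ 5) * Z j b ^ 5)"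
    unfolding eqn
  proof (rule expectation_norm_le[OF II(1,2)])
    show "adm II (\<lambda>b. iexp (X \<theta> b) * Complex (PQ 2 (?y b)) (RQ 2 (?y b)))"
      by (intro adm_mult adm_iexp adm_X adm_Complex adm_PQ_RQ adm_Y)
    show "adm II (\<lambda>b. (25 * (D+1)^3 * u j ^ 2 + sn n ^ 5) * Z j b ^ 5)" by (intro adm_cmult adm_power adm_Z)
    fix b
    have yb: "\<bar>?y b r\<bar> \<le> u j * Z j b" if "1 \<le> r" "r \<le> 5" for r using Y_bound(2)[OF \<theta> that] .
    have D1': "D + 1 \<ge> 1" using D1 by simp
    note rem = PQ_RQ_remainder[where y="?y b", OF yb Z_ge_1 u_bounds D1']
    have "norm (iexp (X \<theta> b) * Complex (PQ 2 (?y b)) (RQ 2 (?y b))) = norm (Complex (PQ 2 (?y b)) (RQ 2 (?y b)))" by (simp add: norm_mult)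
    also have "\<dots> \<le> \<bar>PQ 2 (?y b)\<bar> + \<bar>RQ 2 (?y b)\<bar>" by (rule order_trans[OF cmod_le]) (simp only: complex.sel order_refl)
    also have "\<bar>RQ 2 (?y b)\<bar> \<le> sn n ^ 5 * Z j b" unfolding RQ_def using Y_bound(1)[OF \<theta>, of 2] by simp
    also have "sn n ^ 5 * Z j b \<le> sn n ^ 5 * Z j b ^ 5"
      using s0 Z_ge_1[of j b] by (intro mult_left_mono self_le_power) auto
    finally show "norm (iexp (X \<theta> b) * Complex (PQ 2 (?y b)) (RQ 2 (?y b))) \<le> (25 * (D+1)^3 * u j ^ 2 + sn n ^ 5) * Z j b ^ 5"
      using rem(5) unfolding distrib_right by linarith
  qed
  also have "\<dots> = (25 * (D+1)^3 * u j ^ 2 + sn n ^ 5) * Ex (\<lambda>b. Z j b ^ 5)" by simp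
  also have "\<dots> \<le> (25 * (D+1)^3 * u j ^ 2 + sn n ^ 5) * Zbound \<Lambda>"
    using D1 s0 by (intro mult_left_mono Z_moment add_nonneg_nonneg mult_nonneg_nonneg) auto
  also have "\<dots> = 25 * (D+1)^3 * Zbound \<Lambda> * u j ^ 2 + Zbound \<Lambda> * sn n ^ 5" by (simp add: algebra_simps)
  also have "\<dots> \<le> c1 * u j ^ 2 + c1 * sn n ^ 5"
  proof (intro add_mono mult_right_mono c1_ge)
    have "0 \<le> (D+1)^3 * Zbound \<Lambda>" using D1 Zbound_ge_1 by simp
    then have "25 * ((D+1)^3 * Zbound \<Lambda>) \<le> 51 * ((D+1)^3 * Zbound \<Lambda>)" by linarith
    then show "25 * (D+1)^3 * Zbound \<Lambda> \<le> c1" unfolding c1_def by (simp only: mult.assoc)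
  qed (use s0 in auto)
  finally show ?thesis by (simp add: distrib_left)
qed

text \<open>By \<open>pd_hermite\<close> and the orthogonality of Hermite polynomials this is the
  variance of \<open>F\<close>, with 120 = 5! and 600 = 10^2 * 3!.\<close>

definition v where "v = sn n ^ 10 * (\<Sum>j<N. \<Sum>l<N. \<mu> j * \<mu> l * (120 * g j l ^ 5 + 600 * g j l ^ 3))"
definition err where "err = sn n ^ 5 * (22 * \<Lambda> * c1 * (D + T) + 4800 * \<Lambda>^2 * c1 * (2 * D + 3 * T))"

text \<open>The derivative of \<open>Ex (\<lambda>b. iexp (X \<theta> b))\<close> in \<open>\<theta>\<close> is \<open>- \<theta> v\<close> times the function itself, up to \<open>err\<close>.\<close>
lemma characteristic_ode:
  assumes \<theta>: "0 \<le> \<theta>" "\<theta> \<le> 1"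
  shows "norm (Ex (\<lambda>b. \<i> * complex_of_real (F b) * iexp (X \<theta> b)) + complex_of_real (\<theta> * v) * Ex (\<lambda>b. iexp (X \<theta> b))) \<le> err"
proof -
  define \<phi> where "\<phi> = Ex (\<lambda>b. iexp (X \<theta> b))"
  define H where "H q j = Ex (\<lambda>b. hermite q (incr n j b) *\<^sub>R iexp (X \<theta> b))" for q j
  define Yi where "Yi q j = Ex (\<lambda>b. complex_of_real (Y \<theta> j q b) * iexp (X \<theta> b))" for q j
  let ?s5 = "complex_of_real (sn n ^ 5)"
  have aX: "adm II (\<lambda>b. iexp (X \<theta> b))" by (intro adm_iexp adm_X)
  have aH: "adm II (\<lambda>b. hermite q (incr n j b) *\<^sub>R iexp (X \<theta> b))" if "j < N" for q j
    using that by (intro adm_scaleR adm_hermite adm_incr_II aX)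
  have E1: "Ex (\<lambda>b. \<i> * complex_of_real (F b) * iexp (X \<theta> b)) = (\<Sum>j<N. \<i> * ?s5 * complex_of_real (\<mu> j) * (H 5 j + 10 * H 3 j))"
  proof -
    have "\<i> * complex_of_real (F b) * iexp (X \<theta> b) = (\<Sum>j<N. \<i> * ?s5 * complex_of_real (\<mu> j) * (hermite 5 (incr n j b) *\<^sub>R iexp (X \<theta> b) + 10 * (hermite 3 (incr n j b) *\<^sub>R iexp (X \<theta> b))))" for b
      unfolding F_def pd_hermite by (simp add: sum_distrib_left sum_distrib_right scaleR_conv_of_real algebra_simps)
    then have "Ex (\<lambda>b. \<i> * complex_of_real (F b) * iexp (X \<theta> b)) = Ex (\<lambda>b. \<Sum>j<N. \<i> * ?s5 * complex_of_real (\<mu> j) * (hermite 5 (incr n j b) *\<^sub>R iexp (X \<theta> b) + 10 * (hermite 3 (incr n j b) *\<^sub>R iexp (X \<theta> b))))"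
      by (simp only:)
    also have "\<dots> = (\<Sum>j<N. Ex (\<lambda>b. \<i> * ?s5 * complex_of_real (\<mu> j) * (hermite 5 (incr n j b) *\<^sub>R iexp (X \<theta> b) + 10 * (hermite 3 (incr n j b) *\<^sub>R iexp (X \<theta> b)))))"
      by (rule expectation_sum[OF II(1,2)]) (intro adm_cmult adm_add aH, auto)
    also have "\<dots> = (\<Sum>j<N. \<i> * ?s5 * complex_of_real (\<mu> j) * (H 5 j + 10 * H 3 j))"
    proof (intro sum.cong refl)
      fix j assume "j \<in> {..<N}"
      then have i: "integrable M (\<lambda>\<omega>. hermite q (incr n j (\<lambda>t. B t \<omega>)) *\<^sub>R iexp (X \<theta> (\<lambda>t. B t \<omega>)))" for q
        using adm_integrable[OF II(1,2) aH] by simp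
      have i2: "integrable M (\<lambda>\<omega>. 10 * (hermite 3 (incr n j (\<lambda>t. B t \<omega>)) *\<^sub>R iexp (X \<theta> (\<lambda>t. B t \<omega>))))"
        using i by (rule integrable_mult_right)
      show "Ex (\<lambda>b. \<i> * ?s5 * complex_of_real (\<mu> j) * (hermite 5 (incr n j b) *\<^sub>R iexp (X \<theta> b) + 10 * (hermite 3 (incr n j b) *\<^sub>R iexp (X \<theta> b))))
         = \<i> * ?s5 * complex_of_real (\<mu> j) * (H 5 j + 10 * H 3 j)"
        unfolding H_def integral_mult_right_zero Bochner_Integration.integral_add[OF i i2] ..
    qed
    finally show ?thesis .
  qed
  \<comment> \<open>\<open>pd 5\<close> is constant, so the fifth derivative is deterministic and
    leaves the expectation.\<close>
  have Y5: "Yi 5 j = complex_of_real (\<theta> * sn n ^ 5 * (\<Sum>l<N. \<mu> l * (120 * g j l ^ 5))) * \<phi>" for j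
  proof -
    have "Y \<theta> j 5 b = \<theta> * sn n ^ 5 * (\<Sum>l<N. \<mu> l * (120 * g j l ^ 5))" for b
      unfolding Y_def pd_def by (simp add: mult_ac)
    then show ?thesis unfolding Yi_def \<phi>_def by (simp only: integral_mult_right_zero)
  qed
  \<comment> \<open>The third derivative is deterministic up to its component of degree 2, which
    gives expectations \<open>H 2 l\<close> that are themselves small by a further integration by
    parts.\<close>
  have Y3: "Yi 3 j = complex_of_real (\<theta> * sn n ^ 5 * (\<Sum>l<N. \<mu> l * (60 * g j l ^ 3))) * \<phi>
      + (\<Sum>l<N. complex_of_real (60 * \<theta> * sn n ^ 5 * \<mu> l * g j l ^ 3) * H 2 l)" for j
  proof -
    have "complex_of_real (Y \<theta> j 3 b) * iexp (X \<theta> b) = (\<Sum>l<N. complex_of_real (\<theta> * sn n ^ 5 * (\<mu> l * (60 * g j l ^ 3))) * iexp (X \<theta> b)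
       + complex_of_real (60 * \<theta> * sn n ^ 5 * \<mu> l * g j l ^ 3) * (hermite 2 (incr n l b) *\<^sub>R iexp (X \<theta> b)))" for b
      unfolding Y_def pd_3_hermite by (simp add: sum_distrib_left sum_distrib_right scaleR_conv_of_real algebra_simps del: hermite.simps)
    then have "Yi 3 j = Ex (\<lambda>b. \<Sum>l<N. complex_of_real (\<theta> * sn n ^ 5 * (\<mu> l * (60 * g j l ^ 3))) * iexp (X \<theta> b)
       + complex_of_real (60 * \<theta> * sn n ^ 5 * \<mu> l * g j l ^ 3) * (hermite 2 (incr n l b) *\<^sub>R iexp (X \<theta> b)))"
      unfolding Yi_def by (simp only:)
    also have "\<dots> = (\<Sum>l<N. Ex (\<lambda>b. complex_of_real (\<theta> * sn n ^ 5 * (\<mu> l * (60 * g j l ^ 3))) * iexp (X \<theta> b)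
       + complex_of_real (60 * \<theta> * sn n ^ 5 * \<mu> l * g j l ^ 3) * (hermite 2 (incr n l b) *\<^sub>R iexp (X \<theta> b))))"
      by (rule expectation_sum[OF II(1,2)]) (intro adm_cmult adm_add aH aX, auto)
    also have "\<dots> = (\<Sum>l<N. complex_of_real (\<theta> * sn n ^ 5 * (\<mu> l * (60 * g j l ^ 3))) * \<phi>
       + complex_of_real (60 * \<theta> * sn n ^ 5 * \<mu> l * g j l ^ 3) * H 2 l)"
    proof (intro sum.cong refl)
      fix l assume "l \<in> {..<N}"
      then have "integrable M (\<lambda>\<omega>. complex_of_real c * (hermite 2 (incr n l (\<lambda>t. B t \<omega>)) *\<^sub>R iexp (X \<theta> (\<lambda>t. B t \<omega>))))" for c
        using adm_integrable[OF II(1,2) aH, of l 2] by (intro integrable_mult_right) simp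
      moreover have "integrable M (\<lambda>\<omega>. complex_of_real c * iexp (X \<theta> (\<lambda>t. B t \<omega>)))" for c
        using adm_integrable[OF II(1,2) aX] by (intro integrable_mult_right)
      ultimately show "Ex (\<lambda>b. complex_of_real (\<theta> * sn n ^ 5 * (\<mu> l * (60 * g j l ^ 3))) * iexp (X \<theta> b)
       + complex_of_real (60 * \<theta> * sn n ^ 5 * \<mu> l * g j l ^ 3) * (hermite 2 (incr n l b) *\<^sub>R iexp (X \<theta> b)))
        = complex_of_real (\<theta> * sn n ^ 5 * (\<mu> l * (60 * g j l ^ 3))) * \<phi> + complex_of_real (60 * \<theta> * sn n ^ 5 * \<mu> l * g j l ^ 3) * H 2 l"
        unfolding H_def \<phi>_def by (simp only: Bochner_Integration.integral_add integral_mult_right_zero)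
    qed
    finally show ?thesis by (simp add: sum.distrib sum_distrib_left sum_distrib_right)
  qed
  \<comment> \<open>\<open>R\<close> gathers the remainders of the two integrations by parts and
    \<open>Q\<close> the fluctuation of the third derivative. What is left adds up to
    \<open>\<theta> * v\<close> times the characteristic function.\<close>
  define R where "R j = (H 5 j - \<i> * Yi 5 j) + 10 * (H 3 j - \<i> * Yi 3 j)" for j
  define Q where "Q j l = complex_of_real (600 * \<theta> * sn n ^ 10 * \<mu> j * \<mu> l * g j l ^ 3) * H 2 l" for j l
  have s10: "sn n ^ 10 = sn n ^ 5 * sn n ^ 5" by (simp add: power_add[symmetric])
  have trm: "\<i> * ?s5 * complex_of_real (\<mu> j) * (H 5 j + 10 * H 3 j) =
     \<i> * ?s5 * complex_of_real (\<mu> j) * R j - (\<Sum>l<N. Q j l)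
      - complex_of_real (\<theta> * (sn n ^ 10 * (\<Sum>l<N. \<mu> j * \<mu> l * (120 * g j l ^ 5 + 600 * g j l ^ 3)))) * \<phi>" for j
  proof -
    have "\<i> * ?s5 * complex_of_real (\<mu> j) * (H 5 j + 10 * H 3 j) = \<i> * ?s5 * complex_of_real (\<mu> j) * R j
       - ?s5 * complex_of_real (\<mu> j) * (Yi 5 j + 10 * Yi 3 j)"
    proof -
      have "\<i> * c * (h5 + 10 * h3) = \<i> * c * ((h5 - \<i> * y5) + 10 * (h3 - \<i> * y3)) - c * (y5 + 10 * y3)" for c h5 h3 y5 y3
      proof -
        have "\<i> * c * ((h5 - \<i> * y5) + 10 * (h3 - \<i> * y3)) = \<i> * c * (h5 + 10 * h3) - \<i> * \<i> * c * (y5 + 10 * y3)"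
          by (simp only: algebra_simps)
        then show ?thesis by simp
      qed
      from this[of "?s5 * complex_of_real (\<mu> j)"] show ?thesis unfolding R_def by (simp only: mult.assoc)
    qed
    also have "?s5 * complex_of_real (\<mu> j) * (Yi 5 j + 10 * Yi 3 j) = (\<Sum>l<N. Q j l)
      + complex_of_real (\<theta> * (sn n ^ 10 * (\<Sum>l<N. \<mu> j * \<mu> l * (120 * g j l ^ 5 + 600 * g j l ^ 3)))) * \<phi>"
    proof -
      have "?s5 * complex_of_real (\<mu> j) * (Yi 5 j + 10 * Yi 3 j) =
        complex_of_real (sn n ^ 5 * \<mu> j * (\<theta> * sn n ^ 5 * (\<Sum>l<N. \<mu> l * (120 * g j l ^ 5))) + 10 * (sn n ^ 5 * \<mu> j * (\<theta> * sn n ^ 5 * (\<Sum>l<N. \<mu> l * (60 * g j l ^ 3))))) * \<phi>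
        + (\<Sum>l<N. ?s5 * complex_of_real (\<mu> j) * 10 * (complex_of_real (60 * \<theta> * sn n ^ 5 * \<mu> l * g j l ^ 3) * H 2 l))"
      proof -
        have "complex_of_real s * complex_of_real m * (complex_of_real p * z + 10 * (complex_of_real r * z + S))
          = complex_of_real (s * m * p + 10 * (s * m * r)) * z + complex_of_real s * complex_of_real m * 10 * S" for s m p r z S
          by (simp add: algebra_simps)
        then show ?thesis unfolding Y5 Y3 sum_distrib_left[of "?s5 * complex_of_real (\<mu> j) * 10", symmetric] .
      qed
      also have "(\<Sum>l<N. ?s5 * complex_of_real (\<mu> j) * 10 * (complex_of_real (60 * \<theta> * sn n ^ 5 * \<mu> l * g j l ^ 3) * H 2 l)) = (\<Sum>l<N. Q j l)"
        unfolding Q_def s10 by (intro sum.cong refl) (simp add: mult_ac)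
      also have "sn n ^ 5 * \<mu> j * (\<theta> * sn n ^ 5 * (\<Sum>l<N. \<mu> l * (120 * g j l ^ 5))) + 10 * (sn n ^ 5 * \<mu> j * (\<theta> * sn n ^ 5 * (\<Sum>l<N. \<mu> l * (60 * g j l ^ 3))))
        = \<theta> * (sn n ^ 10 * (\<Sum>l<N. \<mu> j * \<mu> l * (120 * g j l ^ 5 + 600 * g j l ^ 3)))"
        unfolding s10 by (simp add: sum_distrib_left sum.distrib[symmetric] algebra_simps)
      finally show ?thesis by simp
    qed
    finally show ?thesis by simp
  qed
  have sumv: "(\<Sum>j<N. complex_of_real (\<theta> * (sn n ^ 10 * (\<Sum>l<N. \<mu> j * \<mu> l * (120 * g j l ^ 5 + 600 * g j l ^ 3)))) * \<phi>) = complex_of_real (\<theta> * v) * \<phi>"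
    unfolding v_def sum_distrib_right[symmetric] of_real_sum[symmetric] by (simp only: sum_distrib_left)
  have main: "Ex (\<lambda>b. \<i> * complex_of_real (F b) * iexp (X \<theta> b)) + complex_of_real (\<theta> * v) * \<phi>
     = (\<Sum>j<N. \<i> * ?s5 * complex_of_real (\<mu> j) * R j) - (\<Sum>j<N. \<Sum>l<N. Q j l)"
    unfolding E1 trm sum_subtractf sumv by simp
  have Rb: "norm (R j) \<le> 11 * c1 * u j ^ 2" if "j < N" for j
  proof -
    have h5: "norm (H 5 j - \<i> * Yi 5 j) \<le> c1 * u j ^ 2" and h3: "norm (H 3 j - \<i> * Yi 3 j) \<le> c1 * u j ^ 2"
      unfolding H_def Yi_def using hermite_iexp_remainder[OF that \<theta>] by auto
    have "norm (R j) \<le> norm (H 5 j - \<i> * Yi 5 j) + norm (10 * (H 3 j - \<i> * Yi 3 j))" unfolding R_def by (rule norm_triangle_ineq)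
    also have "norm (10 * (H 3 j - \<i> * Yi 3 j)) = 10 * norm (H 3 j - \<i> * Yi 3 j)" by (simp only: norm_mult norm_numeral)
    finally show ?thesis using h5 h3 by linarith
  qed
  have S1: "norm (\<Sum>j<N. \<i> * ?s5 * complex_of_real (\<mu> j) * R j) \<le> sn n ^ 5 * (22 * \<Lambda> * c1 * (D + T))"
  proof -
    have "norm (\<Sum>j<N. \<i> * ?s5 * complex_of_real (\<mu> j) * R j) \<le> (\<Sum>j<N. sn n ^ 5 * (\<Lambda> * (11 * c1 * u j ^ 2)))"
    proof (rule sum_norm_le)
      fix j assume j: "j \<in> {..<N}"
      have "norm (\<i> * ?s5 * complex_of_real (\<mu> j) * R j) = sn n ^ 5 * (\<bar>\<mu> j\<bar> * norm (R j))" using s0 by (simp add: norm_mult norm_power)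
      also have "\<dots> \<le> sn n ^ 5 * (\<Lambda> * (11 * c1 * u j ^ 2))"
        using j s0 \<Lambda>0 by (intro mult_left_mono mult_mono \<mu> Rb) auto
      finally show "norm (\<i> * ?s5 * complex_of_real (\<mu> j) * R j) \<le> sn n ^ 5 * (\<Lambda> * (11 * c1 * u j ^ 2))" .
    qed
    also have "\<dots> = (sn n ^ 5 * (\<Lambda> * (11 * c1))) * (\<Sum>j<N. u j ^ 2)" by (simp add: sum_distrib_left mult_ac)
    also have "\<dots> \<le> (sn n ^ 5 * (\<Lambda> * (11 * c1))) * (2 * (D + T))"
      using s0 \<Lambda>0 c1_ge Zbound_ge_1 by (intro mult_left_mono u_sum mult_nonneg_nonneg) auto
    also have "\<dots> = sn n ^ 5 * (22 * \<Lambda> * c1 * (D + T))" by (simp add: algebra_simps)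
    finally show ?thesis .
  qed
  have S2: "norm (\<Sum>j<N. \<Sum>l<N. Q j l) \<le> sn n ^ 5 * (4800 * \<Lambda>^2 * c1 * (2 * D + 3 * T))"
  proof -
    have c10: "c1 \<ge> 0" using c1_ge Zbound_ge_1 by linarith
    have "norm (\<Sum>j<N. \<Sum>l<N. Q j l) \<le> (\<Sum>j<N. \<Sum>l<N. 600 * sn n ^ 10 * \<Lambda>^2 * (\<bar>g j l\<bar> ^ 3 * (c1 * (u l ^ 2 + sn n ^ 5))))"
    proof (intro sum_norm_le)
      fix j l assume "j \<in> {..<N}" "l \<in> {..<N}"
      then have hb: "norm (H 2 l) \<le> c1 * (u l ^ 2 + sn n ^ 5)" unfolding H_def using hermite2_iexp_bound[OF _ \<theta>] by simp
      have mm: "\<theta> * (\<bar>\<mu> j\<bar> * \<bar>\<mu> l\<bar>) \<le> 1 * (\<Lambda> * \<Lambda>)" using \<theta> \<Lambda>0 by (intro mult_mono \<mu> mult_nonneg_nonneg) auto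
      have "norm (Q j l) = (600 * sn n ^ 10) * ((\<theta> * (\<bar>\<mu> j\<bar> * \<bar>\<mu> l\<bar>)) * (\<bar>g j l\<bar> ^ 3 * norm (H 2 l)))"
        unfolding Q_def using \<theta> s0 by (simp add: norm_mult abs_mult power_abs norm_power)
      also have "\<dots> \<le> (600 * sn n ^ 10) * ((1 * (\<Lambda> * \<Lambda>)) * (\<bar>g j l\<bar> ^ 3 * (c1 * (u l ^ 2 + sn n ^ 5))))"
        using s0 \<Lambda>0 \<theta> c10 by (intro mult_left_mono mult_mono mm hb mult_nonneg_nonneg add_nonneg_nonneg) auto
      finally show "norm (Q j l) \<le> 600 * sn n ^ 10 * \<Lambda>^2 * (\<bar>g j l\<bar> ^ 3 * (c1 * (u l ^ 2 + sn n ^ 5)))"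
        by (simp add: power2_eq_square mult_ac)
    qed
    also have "\<dots> = (\<Sum>l<N. (600 * sn n ^ 10 * \<Lambda>^2 * (c1 * (u l ^ 2 + sn n ^ 5))) * (\<Sum>j<N. \<bar>g j l\<bar> ^ 3))"
    proof -
      have "(\<Sum>j<N. \<Sum>l<N. k * (x j l * y l)) = (\<Sum>l<N. (k * y l) * (\<Sum>j<N. x j l))" for k and x :: "nat \<Rightarrow> nat \<Rightarrow> real" and y
        by (subst sum.swap) (simp add: sum_distrib_left mult_ac)
      from this[of "600 * sn n ^ 10 * \<Lambda>^2" "\<lambda>j l. \<bar>g j l\<bar> ^ 3" "\<lambda>l. c1 * (u l ^ 2 + sn n ^ 5)"] show ?thesis .
    qed
    \<comment> \<open>Columns of |g|^3 add up to at most 2^2 * 2 = 8, which turns 600 into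
      4800.\<close>
    also have "\<dots> \<le> (\<Sum>l<N. (600 * sn n ^ 10 * \<Lambda>^2 * (c1 * (u l ^ 2 + sn n ^ 5))) * 8)"
    proof (intro sum_mono mult_left_mono)
      fix l
      have "(\<Sum>j<N. \<bar>g j l\<bar> ^ 3) \<le> (\<Sum>j<N. 2 ^ 2 * \<bar>g j l\<bar>)" using g_power_le[of 3 _ l] by (intro sum_mono) simp
      also have "\<dots> \<le> 2^2 * 2" unfolding sum_distrib_left[symmetric] by (intro mult_left_mono g_col) auto
      finally show "(\<Sum>j<N. \<bar>g j l\<bar> ^ 3) \<le> 8" by simp
      show "0 \<le> 600 * sn n ^ 10 * \<Lambda>^2 * (c1 * (u l ^ 2 + sn n ^ 5))" using s0 c10 by (intro mult_nonneg_nonneg add_nonneg_nonneg) auto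
    qed
    also have "\<dots> = 4800 * \<Lambda>^2 * c1 * (sn n ^ 10 * ((\<Sum>l<N. u l ^ 2) + real N * sn n ^ 5))"
      by (simp add: sum_distrib_left sum_distrib_right sum.distrib algebra_simps)
    also have "\<dots> \<le> 4800 * \<Lambda>^2 * c1 * (sn n ^ 5 * (2 * D + 3 * T))"
    proof (rule mult_left_mono)
      have "sn n ^ 10 * (\<Sum>l<N. u l ^ 2) \<le> sn n ^ 5 * (2 * (D + T))"
        using s0 by (intro mult_mono u_sum power_decreasing sum_nonneg) auto
      moreover have "sn n ^ 10 * (real N * sn n ^ 5) \<le> sn n ^ 5 * T"
        using mult_left_mono[OF NT, of "sn n ^ 5"] s0 by (simp add: mult_ac)
      ultimately show "sn n ^ 10 * ((\<Sum>l<N. u l ^ 2) + real N * sn n ^ 5) \<le> sn n ^ 5 * (2 * D + 3 * T)"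
        by (simp add: distrib_left)
    qed (use c10 in auto)
    finally show ?thesis by (simp add: mult_ac)
  qed
  have "norm ((\<Sum>j<N. \<i> * ?s5 * complex_of_real (\<mu> j) * R j) - (\<Sum>j<N. \<Sum>l<N. Q j l)) \<le> err"
    using norm_triangle_ineq4[of "\<Sum>j<N. \<i> * ?s5 * complex_of_real (\<mu> j) * R j" "\<Sum>j<N. \<Sum>l<N. Q j l"] S1 S2
    unfolding err_def distrib_left by linarith
  then show ?thesis unfolding main[symmetric] \<phi>_def .
qed

text \<open>The integrating factor \<open>exp (\<theta>^2 * v / 2)\<close> removes the main term, so
  the derivative of \<open>G\<close> is of the size of \<open>err\<close>, and a mean value bound
  compares 1 with 0. In the factor 3, two units come from the variation of the derivative and one
  from its value at 0.\<close>

lemma characteristic_estimate: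
  "norm (Ex (\<lambda>b. iexp (X 1 b)) - complex_of_real (exp (- v / 2)) * Ex (\<lambda>b. iexp (X 0 b))) \<le> 3 * exp \<bar>v\<bar> * err"
proof -
  define \<phi> where "\<phi> \<theta> = Ex (\<lambda>b. iexp (X \<theta> b))" for \<theta>
  define \<phi>' where "\<phi>' \<theta> = Ex (\<lambda>b. \<i> * complex_of_real (F b) * iexp (X \<theta> b))" for \<theta>
  define G where "G \<theta> = complex_of_real (exp (\<theta>^2 * v / 2)) * \<phi> \<theta>" for \<theta>
  define G' where "G' \<theta> = complex_of_real (exp (\<theta>^2 * v / 2)) * (\<phi>' \<theta> + complex_of_real (\<theta> * v) * \<phi> \<theta>)" for \<theta>
  have err0: "err \<ge> 0" using characteristic_ode[of 0] by (meson norm_ge_zero order_trans zero_le_one order_refl)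
  have aJ: "adm II (\<lambda>b. \<Sum>t\<in>J. ac t * b t)"
    by (intro adm_sum adm_cmult adm_coord II) (auto simp: II_def)
  have d\<phi>: "(\<phi> has_vector_derivative \<phi>' \<theta>) (at \<theta>)" for \<theta>
    unfolding \<phi>_def \<phi>'_def X_def
    by (rule iexp_expectation_deriv) (intro adm_measurable[OF II(1,2)] adm_integrable[OF II(1,2)] aJ adm_F adm_power)+
  have dG: "(G has_vector_derivative G' \<theta>) (at \<theta>)" for \<theta>
  proof -
    have "((\<lambda>\<theta>. exp (\<theta>^2 * v / 2)) has_real_derivative (\<theta> * v) * exp (\<theta>^2 * v / 2)) (at \<theta>)"
      by (auto intro!: derivative_eq_intros)
    then have "((\<lambda>\<theta>. complex_of_real (exp (\<theta>^2 * v / 2))) has_vector_derivative complex_of_real ((\<theta> * v) * exp (\<theta>^2 * v / 2))) (at \<theta>)"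
      by (intro has_vector_derivative_of_real) (simp add: has_real_derivative_iff_has_vector_derivative)
    from has_vector_derivative_mult[OF this d\<phi>]
    have "(G has_vector_derivative complex_of_real (exp (\<theta>^2 * v / 2)) * \<phi>' \<theta> + complex_of_real ((\<theta> * v) * exp (\<theta>^2 * v / 2)) * \<phi> \<theta>) (at \<theta>)"
      unfolding G_def .
    moreover have "complex_of_real (exp (\<theta>^2 * v / 2)) * \<phi>' \<theta> + complex_of_real ((\<theta> * v) * exp (\<theta>^2 * v / 2)) * \<phi> \<theta> = G' \<theta>"
      unfolding G'_def of_real_mult by (simp only: algebra_simps)
    ultimately show ?thesis by (simp only:)
  qed
  have G'b: "norm (G' \<theta>) \<le> exp (\<bar>v\<bar> / 2) * err" if "\<theta> \<in> {0..1}" for \<theta>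
  proof -
    have t: "\<theta>^2 \<le> 1" using that by (auto simp: power_le_one)
    have "\<theta>^2 * v \<le> \<theta>^2 * \<bar>v\<bar>" by (intro mult_left_mono) auto
    also have "\<dots> \<le> 1 * \<bar>v\<bar>" using t by (intro mult_right_mono) auto
    finally have e: "exp (\<theta>^2 * v / 2) \<le> exp (\<bar>v\<bar> / 2)" by simp
    have "norm (G' \<theta>) = exp (\<theta>^2 * v / 2) * norm (\<phi>' \<theta> + complex_of_real (\<theta> * v) * \<phi> \<theta>)" unfolding G'_def norm_mult by simp
    also have "\<dots> \<le> exp (\<bar>v\<bar> / 2) * err"
      using characteristic_ode[of \<theta>] that unfolding \<phi>_def \<phi>'_def by (intro mult_mono e) auto
    finally show ?thesis .
  qed
  have "norm (G 1 - G 0 - (1 - 0) *\<^sub>R G' 0) \<le> norm (1 - 0 :: real) * (2 * (exp (\<bar>v\<bar> / 2) * err))"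
  proof (rule vector_differentiable_bound_linearization[where S="{0..1}"])
    show "(G has_vector_derivative G' x) (at x within {0..1})" for x by (rule has_vector_derivative_at_within[OF dG])
    show "closed_segment 0 1 \<subseteq> {0..1::real}" by (simp add: closed_segment_eq_real_ivl)
    show "norm (G' x - G' 0) \<le> 2 * (exp (\<bar>v\<bar> / 2) * err)" if "x \<in> {0..1}" for x
      using norm_triangle_ineq4[of "G' x" "G' 0"] G'b[OF that] G'b[of 0] by simp
  qed auto
  then have "norm (G 1 - G 0) \<le> 3 * (exp (\<bar>v\<bar> / 2) * err)"
    using G'b[of 0] norm_triangle_sub[of "G 1 - G 0" "G' 0"] by simp
  have "\<phi> 1 - complex_of_real (exp (- v / 2)) * \<phi> 0 = complex_of_real (exp (- v / 2)) * (G 1 - G 0)"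
  proof -
    have "exp (- v / 2) * exp (v / 2) = 1" by (simp add: exp_add[symmetric])
    then have "complex_of_real (exp (- v / 2)) * complex_of_real (exp (v / 2)) = 1" by (simp only: of_real_mult[symmetric] of_real_1)
    then have "complex_of_real (exp (- v / 2)) * (complex_of_real (exp (v / 2)) * \<phi> 1) = \<phi> 1" by (simp only: mult.assoc[symmetric] mult_1)
    then show ?thesis unfolding G_def by (simp add: right_diff_distrib)
  qed
  then have "norm (\<phi> 1 - complex_of_real (exp (- v / 2)) * \<phi> 0) = exp (- v / 2) * norm (G 1 - G 0)" by (simp add: norm_mult)
  also have "\<dots> \<le> exp (\<bar>v\<bar> / 2) * (3 * (exp (\<bar>v\<bar> / 2) * err))"
    using \<open>norm (G 1 - G 0) \<le> _\<close> by (intro mult_mono) auto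
  also have "\<dots> = 3 * (exp (\<bar>v\<bar> / 2) * exp (\<bar>v\<bar> / 2)) * err" by simp
  also have "exp (\<bar>v\<bar> / 2) * exp (\<bar>v\<bar> / 2) = exp \<bar>v\<bar>" by (simp add: exp_add[symmetric])
  finally show ?thesis unfolding \<phi>_def .
qed

end

text \<open>The origin contributes 2^q. The other terms have absolute sum at most 4 - 2 = 2 and
  absolute value at most 1, so raising them to the power q cannot increase that sum.\<close>

lemma kappa_lower:
  assumes "q \<ge> 1"
  shows "(\<Sum>\<^sub>\<infinity>p\<in>(UNIV::int set). rho10 p ^ q) \<ge> 2 ^ q - 2"
proof -
  have s: "(\<lambda>p. rho10 p ^ q) summable_on UNIV"
    using rho10_power_summable[OF assms] by (rule abs_summable_summable)
  \<comment> \<open>p and -p share, in equal parts, what the origin leaves of the total 4.\<close>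
  have r1: "\<bar>rho10 p\<bar> \<le> 1" if "p \<noteq> 0" for p
  proof -
    have "- p \<noteq> p" "p \<notin> {0}" "-p \<noteq> 0" using that by auto
    then have "(\<Sum>p\<in>{0, p, -p}. \<bar>rho10 p\<bar>) = 2 + 2 * \<bar>rho10 p\<bar>" using that by (simp add: rho10_0 rho10_minus)
    then show ?thesis using rho10_sum_bound[of "{0, p, -p}"] by simp
  qed
  have F: "2 ^ q - 2 \<le> (\<Sum>p\<in>F. rho10 p ^ q)" if "finite F" "0 \<in> F" for F
  proof -
    have "(\<Sum>p\<in>F. \<bar>rho10 p\<bar>) = \<bar>rho10 0\<bar> + (\<Sum>p\<in>F - {0}. \<bar>rho10 p\<bar>)" by (rule sum.remove[OF that])
    then have le: "(\<Sum>p\<in>F - {0}. \<bar>rho10 p\<bar>) \<le> 2" using rho10_sum_bound[OF that(1)] by (simp add: rho10_0)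
    have "- (\<Sum>p\<in>F - {0}. \<bar>rho10 p\<bar>) \<le> (\<Sum>p\<in>F - {0}. rho10 p ^ q)"
      unfolding sum_negf[symmetric]
    proof (rule sum_mono)
      fix p assume "p \<in> F - {0}"
      then have "\<bar>rho10 p\<bar> ^ q \<le> \<bar>rho10 p\<bar> ^ 1" using r1 assms by (intro power_decreasing) auto
      then have "\<bar>rho10 p ^ q\<bar> \<le> \<bar>rho10 p\<bar>" by (simp add: power_abs)
      then show "- \<bar>rho10 p\<bar> \<le> rho10 p ^ q" by linarith
    qed
    moreover have "(\<Sum>p\<in>F. rho10 p ^ q) = rho10 0 ^ q + (\<Sum>p\<in>F - {0}. rho10 p ^ q)" by (rule sum.remove[OF that])
    ultimately show ?thesis using le by (simp add: rho10_0)
  qed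
  have "((\<lambda>F. \<Sum>p\<in>F. rho10 p ^ q) \<longlongrightarrow> (\<Sum>\<^sub>\<infinity>p. rho10 p ^ q)) (finite_subsets_at_top UNIV)"
    by (rule infsum_tendsto[OF s])
  then show ?thesis
  proof (rule tendsto_lowerbound)
    show "\<forall>\<^sub>F F in finite_subsets_at_top UNIV. 2 ^ q - 2 \<le> (\<Sum>p\<in>F. rho10 p ^ q)"
      unfolding eventually_finite_subsets_at_top using F by (intro exI[of _ "{0}"]) auto
  qed simp
qed

text \<open>The expression under the root is positive, so \<open>sqrt\<close> takes no junk value.\<close>
lemma beta10_sq: "beta10 ^ 2 = 15/4 * kappa5 + 75 * kappa3"
proof -
  have "kappa5 \<ge> 30" "kappa3 \<ge> 6" using kappa_lower[of 5] kappa_lower[of 3] unfolding kappa5_def kappa3_def by simp_all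
  then have "0 \<le> fact 5 * (1 / 2^5) * kappa5 + 75 * kappa3" by simp
  then show ?thesis unfolding beta10_def by (simp add: fact_numeral)
qed

text \<open>The constants arise from \<open>g = rho10 / 2\<close>: 120 / 2^5 = 15/4 and 600 / 2^3 =
  75.\<close>

lemma cov_density_infsum:
  "(\<lambda>p. norm (15/4 * rho10 p ^ 5 + 75 * rho10 p ^ 3)) summable_on (UNIV::int set)"
  "(\<Sum>\<^sub>\<infinity>p. 15/4 * rho10 p ^ 5 + 75 * rho10 p ^ 3) = beta10 ^ 2"
proof -
  have s5: "(\<lambda>p. norm (15/4 * rho10 p ^ 5)) summable_on UNIV" and s3: "(\<lambda>p. norm (75 * rho10 p ^ 3)) summable_on UNIV"
    using summable_on_cmult_right[OF rho10_power_summable[of 5], of "15/4"] summable_on_cmult_right[OF rho10_power_summable[of 3], of 75]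
    by (simp_all add: abs_mult)
  show "(\<lambda>p. norm (15/4 * rho10 p ^ 5 + 75 * rho10 p ^ 3)) summable_on (UNIV::int set)"
    by (rule Infinite_Sum.abs_summable_on_comparison_test'[OF summable_on_add[OF s5 s3]]) (rule norm_triangle_ineq)
  have t5: "(\<lambda>p. rho10 p ^ 5) summable_on UNIV" and t3: "(\<lambda>p. rho10 p ^ 3) summable_on UNIV"
    using abs_summable_summable[OF rho10_power_summable[of 5]] abs_summable_summable[OF rho10_power_summable[of 3]] by simp_all
  have "(\<Sum>\<^sub>\<infinity>p. 15/4 * rho10 p ^ 5 + 75 * rho10 p ^ 3) = (\<Sum>\<^sub>\<infinity>p. 15/4 * rho10 p ^ 5) + (\<Sum>\<^sub>\<infinity>p. 75 * rho10 p ^ 3)"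
    by (rule infsum_add) (rule abs_summable_summable[OF s5] abs_summable_summable[OF s3])+
  also have "\<dots> = 15/4 * kappa5 + 75 * kappa3"
    unfolding kappa5_def kappa3_def by (simp only: infsum_cmult_right[OF t5] infsum_cmult_right[OF t3])
  finally show "(\<Sum>\<^sub>\<infinity>p. 15/4 * rho10 p ^ 5 + 75 * rho10 p ^ 3) = beta10 ^ 2" unfolding beta10_sq .
qed

lemma floor_ratio_limit:
  assumes "x \<ge> 0"
  shows "(\<lambda>n. real (nat \<lfloor>real n * x\<rfloor>) / real n) \<longlonglongrightarrow> x"
proof (rule tendsto_sandwich[where f="\<lambda>n. x - 1 / real n" and h="\<lambda>n. x"])
  have b: "real n * x - 1 \<le> real (nat \<lfloor>real n * x\<rfloor>)" "real (nat \<lfloor>real n * x\<rfloor>) \<le> real n * x" for n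
    using assms by (auto simp: of_nat_nat)
  show "\<forall>\<^sub>F n in sequentially. x - 1 / real n \<le> real (nat \<lfloor>real n * x\<rfloor>) / real n"
  proof (rule eventually_sequentiallyI[of 1])
    fix n :: nat assume "1 \<le> n"
    then have "x - 1 / real n = (real n * x - 1) / real n" by (simp add: diff_divide_distrib)
    also have "\<dots> \<le> real (nat \<lfloor>real n * x\<rfloor>) / real n" by (rule divide_right_mono[OF b(1)]) simp
    finally show "x - 1 / real n \<le> real (nat \<lfloor>real n * x\<rfloor>) / real n" .
  qed
  show "\<forall>\<^sub>F n in sequentially. real (nat \<lfloor>real n * x\<rfloor>) / real n \<le> x"
    using b(2) by (intro eventually_sequentiallyI[of 1]) (auto simp: divide_le_eq mult.commute)
  have "(\<lambda>n. x - 1 / real n) \<longlonglongrightarrow> x - 0" by (intro tendsto_diff tendsto_const lim_const_over_n)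
  then show "(\<lambda>n. x - 1 / real n) \<longlonglongrightarrow> x" by simp
qed auto

section \<open>Joint limit of the characteristic functions of B and V\<close>

context fbm10
begin

definition V :: "nat \<Rightarrow> real \<Rightarrow> 'a \<Rightarrow> real" where
  "V n p \<omega> = sn n ^ 5 * (\<Sum>j<nat \<lfloor>real n * p\<rfloor>. pd 0 (incr n j (\<lambda>t. B t \<omega>)))"

lemma V_measurable: "V n p \<in> borel_measurable M"
proof -
  note incr_measurable(2)[measurable]
  show ?thesis unfolding V_def[abs_def] by measurable
qed

text \<open>The combination of the values of \<open>V n\<close> is the \<open>F\<close> of
  \<open>clt_step\<close>, where increment j has as weight the sum of \<open>\<nu> p\<close> over
  the times p that it precedes. Its variance converges by \<open>toeplitz_sum_limit\<close>, and the
  product form of the limit expresses asymptotic independence of B.\<close>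

theorem joint_char_limit:
  fixes J P :: "real set" and ac \<nu> :: "real \<Rightarrow> real"
  assumes J: "finite J" "J \<subseteq> {0..}" and P: "finite P" "P \<subseteq> {0..}"
  shows "(\<lambda>n. \<integral>\<omega>. iexp ((\<Sum>t\<in>J. ac t * B t \<omega>) + (\<Sum>p\<in>P. \<nu> p * V n p \<omega>)) \<partial>M) \<longlonglongrightarrow>
    complex_of_real (exp (- (beta10^2 * (\<Sum>p\<in>P. \<Sum>q\<in>P. \<nu> p * \<nu> q * min p q)) / 2)) * (\<integral>\<omega>. iexp (\<Sum>t\<in>J. ac t * B t \<omega>) \<partial>M)"
proof -
  define T where "T = 1 + \<Sum>P + \<Sum>J"
  have P0: "\<Sum>P \<ge> 0" "\<Sum>J \<ge> 0" using J P by (auto intro: sum_nonneg)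
  have PT: "p \<le> T" "0 \<le> p" if "p \<in> P" for p
    proof -
    have "p \<le> \<Sum>P" using that P by (intro member_le_sum) auto
    then show "p \<le> T" unfolding T_def using P0 by linarith
    show "0 \<le> p" using that P by auto
  qed
  have JT: "t \<le> T" "0 \<le> t" if "t \<in> J" for t
    proof -
    have "t \<le> \<Sum>J" using that J by (intro member_le_sum) auto
    then show "t \<le> T" unfolding T_def using P0 by linarith
    show "0 \<le> t" using that J by auto
  qed
  have T1: "T \<ge> 1" unfolding T_def using P0 by simp
  define Np where "Np n p = nat \<lfloor>real n * p\<rfloor>" for n p
  define \<mu> where "\<mu> n j = (\<Sum>p\<in>P. \<nu> p * (if j < Np n p then 1 else 0))" for n j
  define \<Lambda> where "\<Lambda> = (\<Sum>p\<in>P. \<bar>\<nu> p\<bar>)"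
  define A where "A = (\<Sum>t\<in>J. \<bar>ac t\<bar>)"
  \<comment> \<open>A bounds each covariance with the linear part. The last term bounds the sum of
    their squares: a maximum of order \<open>A * sn n\<close> times a sum of order
    \<open>2 * A * T powr (1/5) / sn n\<close>.\<close>
  define D where "D = 1 + A + 2 * A^2 * T powr (1/5)"
  have A0: "A \<ge> 0" unfolding A_def by (simp add: sum_nonneg)
  have NT: "real (Np n T) / real n \<le> T" if "n \<ge> 1" for n
  proof -
    have "real (Np n T) \<le> real n * T" unfolding Np_def using T1 by (auto simp: of_nat_nat)
    then show ?thesis using that by (simp add: divide_le_eq mult.commute)
  qed
  have aj: "\<bar>\<Sum>t\<in>J. ac t * kxi n j t\<bar> \<le> A * sn n" if "n \<ge> 1" for n j
  proof -
    have "\<bar>\<Sum>t\<in>J. ac t * kxi n j t\<bar> \<le> (\<Sum>t\<in>J. \<bar>ac t\<bar> * \<bar>kxi n j t\<bar>)" by (rule order_trans[OF sum_abs]) (simp add: abs_mult)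
    also have "\<dots> \<le> (\<Sum>t\<in>J. \<bar>ac t\<bar> * sn n)" by (intro sum_mono mult_left_mono kxi_bound[OF that]) auto
    finally show ?thesis unfolding A_def by (simp add: sum_distrib_right)
  qed
  have step: "clt_step M B n (Np n T) (\<mu> n) \<Lambda> D T J ac" if n: "n \<ge> 1" for n
  proof
    show "\<bar>\<mu> n j\<bar> \<le> \<Lambda>" for j
      unfolding \<mu>_def \<Lambda>_def by (rule order_trans[OF sum_abs]) (intro sum_mono, simp)
    show "D \<ge> 1" unfolding D_def using A0 by simp
    have sA: "A * sn n \<le> A" using sn_le_1[OF n] A0 by (simp add: mult_left_le)
    have AD: "A \<le> D" unfolding D_def using A0 by simp
    show "\<bar>\<Sum>t\<in>J. ac t * kxi n j t\<bar> \<le> D" for j using aj[OF n, of j] sA AD by linarith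
    show "(\<Sum>j<Np n T. (\<Sum>t\<in>J. ac t * kxi n j t)\<^sup>2) \<le> D"
    proof -
      have "(\<Sum>j<Np n T. (\<Sum>t\<in>J. ac t * kxi n j t)\<^sup>2) \<le> (\<Sum>j<Np n T. (A * sn n) * (\<Sum>t\<in>J. \<bar>ac t\<bar> * \<bar>kxi n j t\<bar>))"
      proof (rule sum_mono)
        fix j
        have le: "\<bar>\<Sum>t\<in>J. ac t * kxi n j t\<bar> \<le> (\<Sum>t\<in>J. \<bar>ac t\<bar> * \<bar>kxi n j t\<bar>)" by (rule order_trans[OF sum_abs]) (simp add: abs_mult)
        have "(\<Sum>t\<in>J. ac t * kxi n j t)\<^sup>2 = \<bar>\<Sum>t\<in>J. ac t * kxi n j t\<bar> * \<bar>\<Sum>t\<in>J. ac t * kxi n j t\<bar>"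
          by (simp add: power2_eq_square abs_mult_self_eq)
        also have "\<dots> \<le> (A * sn n) * (\<Sum>t\<in>J. \<bar>ac t\<bar> * \<bar>kxi n j t\<bar>)"
          using A0 sn_pos[OF n] by (intro mult_mono aj[OF n] le) auto
        finally show "(\<Sum>t\<in>J. ac t * kxi n j t)\<^sup>2 \<le> (A * sn n) * (\<Sum>t\<in>J. \<bar>ac t\<bar> * \<bar>kxi n j t\<bar>)" .
      qed
      also have "\<dots> = (A * sn n) * (\<Sum>t\<in>J. \<bar>ac t\<bar> * (\<Sum>j<Np n T. \<bar>kxi n j t\<bar>))"
        unfolding sum_distrib_left[symmetric] by (subst sum.swap) (simp add: sum_distrib_left)
      also have "\<dots> \<le> (A * sn n) * (\<Sum>t\<in>J. \<bar>ac t\<bar> * (2 * T powr (1/5) / sn n))"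
        using A0 sn_pos[OF n] JT NT[OF n] by (intro mult_left_mono sum_mono kxi_sum_bound[OF n]) auto
      also have "\<dots> = (A * sn n) * (A * (2 * T powr (1/5) / sn n))" unfolding A_def by (simp only: sum_distrib_right)
      also have "\<dots> = 2 * A^2 * T powr (1/5)" using sn_pos[OF n] by (simp add: power2_eq_square)
      also have "\<dots> \<le> D" unfolding D_def using A0 by simp
      finally show ?thesis .
    qed
    show "real (Np n T) * sn n ^ 10 \<le> T" using NT[OF n] unfolding sn_10[OF n] by simp
  qed (use J n in auto)
  define r where "r p = 15/4 * rho10 p ^ 5 + 75 * rho10 p ^ 3" for p
  define vn where "vn n = (\<Sum>p\<in>P. \<Sum>q\<in>P. \<nu> p * \<nu> q * ((\<Sum>j<Np n p. \<Sum>l<Np n q. r (int j - int l)) / real n))" for n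
  have sumN: "(\<Sum>j<Np n T. \<mu> n j * x j) = (\<Sum>p\<in>P. \<nu> p * (\<Sum>j<Np n p. x j))" for n and x :: "nat \<Rightarrow> real"
  proof -
    have "(\<Sum>j<Np n T. (if j < Np n p then 1 else 0) * x j) = (\<Sum>j<Np n p. x j)" if "p \<in> P" for p
    proof -
      have "Np n p \<le> Np n T" unfolding Np_def using PT[OF that] by (intro nat_mono floor_mono mult_left_mono) auto
      then have "{..<Np n T} \<inter> {j. j < Np n p} = {..<Np n p}" by auto
      then show ?thesis by (simp add: if_distrib[of "\<lambda>z. z * _"] sum.If_cases cong: if_cong)
    qed
    then have "(\<Sum>p\<in>P. \<nu> p * (\<Sum>j<Np n p. x j)) = (\<Sum>p\<in>P. \<nu> p * (\<Sum>j<Np n T. (if j < Np n p then 1 else 0) * x j))" by simp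
    also have "\<dots> = (\<Sum>j<Np n T. \<Sum>p\<in>P. \<nu> p * ((if j < Np n p then 1 else 0) * x j))"
      unfolding sum_distrib_left by (rule sum.swap)
    also have "\<dots> = (\<Sum>j<Np n T. \<mu> n j * x j)" unfolding \<mu>_def by (simp only: sum_distrib_right mult.assoc)
    finally show ?thesis by simp
  qed
  have v_eq: "clt_step.v n (Np n T) (\<mu> n) = vn n" if n: "n \<ge> 1" for n
  proof -
    interpret clt_step M B n "Np n T" "\<mu> n" \<Lambda> D T J ac by (rule step[OF n])
    have gr: "120 * g j l ^ 5 + 600 * g j l ^ 3 = r (int j - int l)" for j l
      unfolding g_eq r_def by (simp add: power_divide)
    have "v = sn n ^ 10 * (\<Sum>j<Np n T. \<mu> n j * (\<Sum>l<Np n T. \<mu> n l * r (int j - int l)))"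
      unfolding v_def gr by (simp only: sum_distrib_left mult.assoc)
    also have "\<dots> = sn n ^ 10 * (\<Sum>j<Np n T. \<mu> n j * (\<Sum>q\<in>P. \<nu> q * (\<Sum>l<Np n q. r (int j - int l))))"
      unfolding sumN ..
    also have "\<dots> = sn n ^ 10 * (\<Sum>p\<in>P. \<nu> p * (\<Sum>j<Np n p. (\<Sum>q\<in>P. \<nu> q * (\<Sum>l<Np n q. r (int j - int l)))))"
      unfolding sumN ..
    also have "\<dots> = sn n ^ 10 * (\<Sum>p\<in>P. \<nu> p * (\<Sum>q\<in>P. \<nu> q * (\<Sum>j<Np n p. \<Sum>l<Np n q. r (int j - int l))))"
    proof -
      have "(\<Sum>j<m. (\<Sum>q\<in>P. \<nu> q * y q j)) = (\<Sum>q\<in>P. \<nu> q * (\<Sum>j<m. y q j))" for m and y :: "real \<Rightarrow> nat \<Rightarrow> real"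
        unfolding sum_distrib_left by (rule sum.swap)
      then show ?thesis by (simp only:)
    qed
    also have "\<dots> = vn n"
      unfolding vn_def sn_10[OF n] by (simp only: sum_distrib_left sum_divide_distrib mult.assoc times_divide_eq_left times_divide_eq_right mult_1)
    finally show ?thesis .
  qed
  have vl: "vn \<longlonglongrightarrow> (\<Sum>p\<in>P. \<Sum>q\<in>P. \<nu> p * \<nu> q * (beta10^2 * min p q))"
    unfolding vn_def
  proof (intro tendsto_sum tendsto_mult tendsto_const)
    fix p q assume "p \<in> P" "q \<in> P"
    have "(\<lambda>n. (\<Sum>j<Np n p. \<Sum>l<Np n q. r (int j - int l)) / real n) \<longlonglongrightarrow> (\<Sum>\<^sub>\<infinity>p. r p) * min p q"
      unfolding Np_def
      by (rule toeplitz_sum_limit[OF _ floor_ratio_limit[OF PT(2)[OF \<open>p \<in> P\<close>]] floor_ratio_limit[OF PT(2)[OF \<open>q \<in> P\<close>]]])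
         (use cov_density_infsum(1) in \<open>simp only: r_def\<close>)
    then show "(\<lambda>n. (\<Sum>j<Np n p. \<Sum>l<Np n q. r (int j - int l)) / real n) \<longlonglongrightarrow> beta10^2 * min p q"
      using cov_density_infsum(2) unfolding r_def by (simp only:)
  qed
  then have vl': "vn \<longlonglongrightarrow> beta10^2 * (\<Sum>p\<in>P. \<Sum>q\<in>P. \<nu> p * \<nu> q * min p q)"
    by (simp only: sum_distrib_left mult.left_commute)
  define \<phi> where "\<phi> n = (\<integral>\<omega>. iexp ((\<Sum>t\<in>J. ac t * B t \<omega>) + (\<Sum>p\<in>P. \<nu> p * V n p \<omega>)) \<partial>M)" for n
  define \<phi>0 where "\<phi>0 = (\<integral>\<omega>. iexp (\<Sum>t\<in>J. ac t * B t \<omega>) \<partial>M)"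
  define c where "c = 51 * (D + 1)^3 * Zbound \<Lambda>"
  define EC where "EC = 22 * \<Lambda> * c * (D + T) + 4800 * \<Lambda>^2 * c * (2 * D + 3 * T)"
  have est: "norm (\<phi> n - complex_of_real (exp (- vn n / 2)) * \<phi>0) \<le> 3 * exp \<bar>vn n\<bar> * (sn n ^ 5 * EC)" if n: "n \<ge> 1" for n
  proof -
    interpret clt_step M B n "Np n T" "\<mu> n" \<Lambda> D T J ac by (rule step[OF n])
    have Feq: "F b = (\<Sum>p\<in>P. \<nu> p * (sn n ^ 5 * (\<Sum>j<Np n p. pd 0 (incr n j b))))" for b
      unfolding F_def sumN by (simp add: sum_distrib_left mult_ac)
    have X1: "X 1 (\<lambda>t. B t \<omega>) = (\<Sum>t\<in>J. ac t * B t \<omega>) + (\<Sum>p\<in>P. \<nu> p * V n p \<omega>)" for \<omega>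
      unfolding X_def unfolding Feq unfolding V_def Np_def mult_1 ..
    have X0: "X 0 (\<lambda>t. B t \<omega>) = (\<Sum>t\<in>J. ac t * B t \<omega>)" for \<omega> unfolding X_def by simp
    have e: "err = sn n ^ 5 * EC" unfolding err_def EC_def c_def c1_def ..
    show ?thesis using characteristic_estimate unfolding X1 X0 e v_eq[OF n] \<phi>_def \<phi>0_def .
  qed
  have "(\<lambda>n. 3 * exp \<bar>vn n\<bar> * (sn n ^ 5 * EC)) \<longlonglongrightarrow> 3 * exp \<bar>beta10^2 * (\<Sum>p\<in>P. \<Sum>q\<in>P. \<nu> p * \<nu> q * min p q)\<bar> * (0 ^ 5 * EC)"
    by (intro tendsto_intros vl' sn_tendsto_0)
  then have z: "(\<lambda>n. 3 * exp \<bar>vn n\<bar> * (sn n ^ 5 * EC)) \<longlonglongrightarrow> 0" by simp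
  have "(\<lambda>n. \<phi> n - complex_of_real (exp (- vn n / 2)) * \<phi>0) \<longlonglongrightarrow> 0"
    by (rule Lim_null_comparison[OF _ z]) (use est in \<open>intro eventually_sequentiallyI[of 1], auto\<close>)
  moreover have "(\<lambda>n. complex_of_real (exp (- vn n / 2)) * \<phi>0) \<longlonglongrightarrow> complex_of_real (exp (- (beta10^2 * (\<Sum>p\<in>P. \<Sum>q\<in>P. \<nu> p * \<nu> q * min p q)) / 2)) * \<phi>0"
    by (intro tendsto_intros vl') simp
  ultimately have "(\<lambda>n. (\<phi> n - complex_of_real (exp (- vn n / 2)) * \<phi>0) + complex_of_real (exp (- vn n / 2)) * \<phi>0) \<longlonglongrightarrow>
     0 + complex_of_real (exp (- (beta10^2 * (\<Sum>p\<in>P. \<Sum>q\<in>P. \<nu> p * \<nu> q * min p q)) / 2)) * \<phi>0"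
    by (rule tendsto_add)
  then show ?thesis unfolding \<phi>_def \<phi>0_def by simp
qed

end

section \<open>Weighted Hermite variations\<close>

definition dir_derivs :: "('i \<Rightarrow> real) \<Rightarrow> nat \<Rightarrow> (nat \<Rightarrow> ('i \<Rightarrow> real) \<Rightarrow> real) \<Rightarrow> bool" where
  "dir_derivs k q f \<longleftrightarrow> (\<forall>m<q. \<forall>b. ((\<lambda>x. f m (\<lambda>t. b t + x * k t)) has_real_derivative f (Suc m) b) (at 0))"

definition leibniz :: "(nat \<Rightarrow> 'b \<Rightarrow> real) \<Rightarrow> (nat \<Rightarrow> 'b \<Rightarrow> real) \<Rightarrow> nat \<Rightarrow> 'b \<Rightarrow> real" where
  "leibniz f g m b = (\<Sum>i\<le>m. real (m choose i) * (f i b * g (m - i) b))"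

lemma leibniz_step:
  "(\<Sum>i\<le>m. real (m choose i) * (f (Suc i) * g (m - i) + f i * g (Suc (m - i)))) = (\<Sum>i\<le>Suc m. real (Suc m choose i) * (f i * (g (Suc m - i) :: real)))"
proof -
  have "(\<Sum>i\<le>Suc m. real (Suc m choose i) * (f i * g (Suc m - i)))
    = f 0 * g (Suc m) + (\<Sum>i\<le>m. real (Suc m choose Suc i) * (f (Suc i) * g (m - i)))"
    by (subst sum.atMost_Suc_shift) simp
  also have "(\<Sum>i\<le>m. real (Suc m choose Suc i) * (f (Suc i) * g (m - i))) =
     (\<Sum>i\<le>m. real (m choose i) * (f (Suc i) * g (m - i))) + (\<Sum>i\<le>m. real (m choose Suc i) * (f (Suc i) * g (m - i)))"
    by (simp add: distrib_right sum.distrib)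
  also have "f 0 * g (Suc m) + ((\<Sum>i\<le>m. real (m choose i) * (f (Suc i) * g (m - i))) + (\<Sum>i\<le>m. real (m choose Suc i) * (f (Suc i) * g (m - i))))
     = (\<Sum>i\<le>m. real (m choose i) * (f (Suc i) * g (m - i))) + (\<Sum>i\<le>Suc m. real (m choose i) * (f i * g (Suc m - i)))"
    by (subst sum.atMost_Suc_shift[of _ m]) simp
  also have "(\<Sum>i\<le>Suc m. real (m choose i) * (f i * g (Suc m - i))) = (\<Sum>i\<le>m. real (m choose i) * (f i * g (Suc (m - i))))"
    by (simp add: Suc_diff_le)
  finally show ?thesis by (simp add: sum.distrib distrib_left)
qed

lemma dir_derivs_leibniz:
  assumes "dir_derivs k q f" "dir_derivs k q g"
  shows "dir_derivs k q (leibniz f g)"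
  unfolding dir_derivs_def
proof (intro allI impI)
  fix m b assume m: "m < q"
  have "((\<lambda>x. \<Sum>i\<le>m. real (m choose i) * (f i (\<lambda>t. b t + x * k t) * g (m - i) (\<lambda>t. b t + x * k t))) has_real_derivative
     (\<Sum>i\<le>m. real (m choose i) * (f (Suc i) b * g (m - i) (\<lambda>t. b t + 0 * k t) + g (Suc (m - i)) b * f i (\<lambda>t. b t + 0 * k t)))) (at 0)"
    using assms m unfolding dir_derivs_def by (intro DERIV_sum DERIV_cmult DERIV_mult) auto
  moreover have "(\<Sum>i\<le>m. real (m choose i) * (f (Suc i) b * g (m - i) (\<lambda>t. b t + 0 * k t) + g (Suc (m - i)) b * f i (\<lambda>t. b t + 0 * k t)))
     = leibniz f g (Suc m) b"
  proof -
    have "(\<Sum>i\<le>m. real (m choose i) * (f (Suc i) b * g (m - i) (\<lambda>t. b t + 0 * k t) + g (Suc (m - i)) b * f i (\<lambda>t. b t + 0 * k t)))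
      = (\<Sum>i\<le>m. real (m choose i) * (f (Suc i) b * g (m - i) b + f i b * g (Suc (m - i)) b))" by (simp add: mult.commute)
    also have "\<dots> = leibniz f g (Suc m) b"
      unfolding leibniz_def by (rule leibniz_step[of m "\<lambda>i. f i b" "\<lambda>i. g i b"])
    finally show ?thesis .
  qed
  ultimately show "((\<lambda>x. leibniz f g m (\<lambda>t. b t + x * k t)) has_real_derivative leibniz f g (Suc m) b) (at 0)"
    unfolding leibniz_def[of f g m] by (simp only:)
qed

lemma adm_leibniz:
  assumes "\<And>r. r \<le> m \<Longrightarrow> adm I (f r)" "\<And>r. r \<le> m \<Longrightarrow> adm I (g r)"
  shows "adm I (leibniz f g m)"
  unfolding leibniz_def[abs_def] by (intro adm_sum adm_cmult adm_mult assms) auto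

text \<open>The derivatives are given as a sequence of finite length because the truncated functions
  are only finitely often differentiable.\<close>

definition bounded_derivs :: "nat \<Rightarrow> (nat \<Rightarrow> real \<Rightarrow> real) \<Rightarrow> real \<Rightarrow> bool" where
  "bounded_derivs q \<phi> C \<longleftrightarrow> (\<forall>k<q. \<forall>x. (\<phi> k has_real_derivative \<phi> (Suc k) x) (at x)) \<and>
     (\<forall>k\<le>q. \<forall>x. \<bar>\<phi> k x\<bar> \<le> C) \<and> (\<forall>k\<le>q. continuous_on UNIV (\<phi> k))"

lemma bounded_derivsD:
  assumes "bounded_derivs q \<phi> C"
  shows "k < q \<Longrightarrow> (\<phi> k has_real_derivative \<phi> (Suc k) x) (at x)" "k \<le> q \<Longrightarrow> \<bar>\<phi> k x\<bar> \<le> C" "k \<le> q \<Longrightarrow> continuous_on UNIV (\<phi> k)"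
    "C \<ge> 0"
proof -
  show "k < q \<Longrightarrow> (\<phi> k has_real_derivative \<phi> (Suc k) x) (at x)" "k \<le> q \<Longrightarrow> \<bar>\<phi> k x\<bar> \<le> C" "k \<le> q \<Longrightarrow> continuous_on UNIV (\<phi> k)"
    using assms unfolding bounded_derivs_def by blast+
  have "\<bar>\<phi> 0 0\<bar> \<le> C" using assms unfolding bounded_derivs_def by blast
  then show "C \<ge> 0" by linarith
qed

text \<open>With u = v this is the value at a point, so midpoint weights and frozen weights fall
  under the same estimates.\<close>

definition mid :: "real \<Rightarrow> real \<Rightarrow> (real \<Rightarrow> real) \<Rightarrow> real" where
  "mid u v b = (b u + b v) / 2"

lemma adm_mid: "finite I \<Longrightarrow> u \<in> I \<Longrightarrow> v \<in> I \<Longrightarrow> adm I (mid u v)"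
proof -
  assume "finite I" "u \<in> I" "v \<in> I"
  then have "adm I (\<lambda>b. (1/2) * (b u + b v))" by (intro adm_cmult adm_add adm_coord)
  then show ?thesis unfolding mid_def[abs_def] by simp
qed

lemma mid_line: "mid u v (\<lambda>t. b t + x * k t) = mid u v b + x * mid u v k"
  unfolding mid_def by (simp add: algebra_simps add_divide_distrib[symmetric])

lemma dir_derivs_mid:
  assumes "bounded_derivs q \<phi> C"
  shows "dir_derivs k q (\<lambda>m b. mid u v k ^ m * \<phi> m (mid u v b))"
  unfolding dir_derivs_def mid_line
proof (intro allI impI)
  fix m b assume "m < q"
  have "((\<lambda>x. \<phi> m (mid u v b + x * mid u v k)) has_real_derivative \<phi> (Suc m) (mid u v b + 0 * mid u v k) * mid u v k) (at 0)"
    by (rule DERIV_chain2[OF bounded_derivsD(1)[OF assms \<open>m < q\<close>]]) (auto intro!: derivative_eq_intros)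
  from DERIV_cmult[OF this, of "mid u v k ^ m"]
  show "((\<lambda>x. mid u v k ^ m * \<phi> m (mid u v b + x * mid u v k)) has_real_derivative mid u v k ^ Suc m * \<phi> (Suc m) (mid u v b)) (at 0)"
    by (simp add: mult_ac)
qed

lemma dir_derivs_hermite:
  "dir_derivs k q (\<lambda>m b. incr n l k ^ m * (fact q / fact (q - m)) * hermite (q - m) (incr n l b))"
  unfolding dir_derivs_def incr_line
proof (intro allI impI)
  fix m b assume "m < q"
  then have q: "q - m = Suc (q - Suc m)" by simp
  have "((\<lambda>x. hermite (q - m) (incr n l b + x * incr n l k)) has_real_derivative
     (real (q - m) * hermite (q - m - 1) (incr n l b + 0 * incr n l k)) * incr n l k) (at 0)"
    by (rule DERIV_chain2[OF hermite_deriv]) (auto intro!: derivative_eq_intros)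
  from DERIV_cmult[OF this, of "incr n l k ^ m * (fact q / fact (q - m))"]
  show "((\<lambda>x. incr n l k ^ m * (fact q / fact (q - m)) * hermite (q - m) (incr n l b + x * incr n l k)) has_real_derivative
     incr n l k ^ Suc m * (fact q / fact (q - Suc m)) * hermite (q - Suc m) (incr n l b)) (at 0)"
    unfolding q by (simp add: mult_ac divide_simps)
qed

definition hermite_abs_moment :: "nat \<Rightarrow> real" where
  "hermite_abs_moment q = (\<integral>x. \<bar>hermite q x\<bar> \<partial>std_normal_distribution)"

lemma hermite_abs_moment_nonneg: "hermite_abs_moment q \<ge> 0"
  unfolding hermite_abs_moment_def by (intro integral_nonneg_AE) auto

lemma hermite_measurable[measurable]: "hermite q \<in> borel_measurable borel"
  using hermite_deriv by (intro borel_measurable_continuous_onI continuous_at_imp_continuous_on) (blast intro: DERIV_isCont)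

definition cq :: "nat \<Rightarrow> real" where
  "cq q = (\<Sum>i\<le>q. real (q choose i) * 2 ^ i * fact q * hermite_abs_moment i)"

lemma cq_term: "i \<le> q \<Longrightarrow> real (q choose i) * 2 ^ i * fact q * hermite_abs_moment i \<le> cq q"
  unfolding cq_def by (rule member_le_sum) (auto simp: hermite_abs_moment_nonneg)

lemma cq_nonneg: "cq q \<ge> 0"
  unfolding cq_def by (intro sum_nonneg mult_nonneg_nonneg hermite_abs_moment_nonneg) auto

section \<open>Second moments of weighted Hermite sums\<close>

context fbm10
begin

text \<open>\<open>hermite q\<close> of increment j is removed by q integrations by parts. If all
  derivatives fall on \<open>hermite q\<close> of increment l, they leave q!
  \<open>\<gamma>\<close>^q; each derivative that falls on a weight costs a factor
  \<open>\<kappa>\<close> instead of \<open>\<gamma>\<close>. The index i counts the latter.\<close>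

lemma hermite_pair_bound:
  fixes n q j l :: nat and \<phi> :: "nat \<Rightarrow> real \<Rightarrow> real" and u v u' v' C \<kappa> :: real
  assumes n: "n \<ge> 1" and \<phi>: "bounded_derivs q \<phi> C" and pos: "u \<ge> 0" "v \<ge> 0" "u' \<ge> 0" "v' \<ge> 0"
    and \<kappa>: "\<bar>mid u v (kxi n j)\<bar> \<le> \<kappa>" "\<bar>mid u' v' (kxi n j)\<bar> \<le> \<kappa>"
  defines "\<gamma> \<equiv> incr n l (kxi n j)"
  shows "\<bar>(\<integral>\<omega>. hermite q (incr n j (\<lambda>t. B t \<omega>)) * (\<phi> 0 (mid u v (\<lambda>t. B t \<omega>)) * \<phi> 0 (mid u' v' (\<lambda>t. B t \<omega>)) * hermite q (incr n l (\<lambda>t. B t \<omega>))) \<partial>M)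
     - fact q * \<gamma> ^ q * (\<integral>\<omega>. \<phi> 0 (mid u v (\<lambda>t. B t \<omega>)) * \<phi> 0 (mid u' v' (\<lambda>t. B t \<omega>)) \<partial>M)\<bar>
    \<le> C^2 * cq q * (\<Sum>i\<in>{1..q}. \<kappa> ^ i * \<bar>\<gamma>\<bar> ^ (q - i))"
proof -
  define I where "I = {u, v, u', v', real j / real n, real (Suc j) / real n, real l / real n, real (Suc l) / real n}"
  have I: "finite I" "I \<subseteq> {0..}" "real j / real n \<in> I" "real (Suc j) / real n \<in> I" unfolding I_def using pos by auto
  let ?k = "kxi n j"
  define f where "f m b = mid u v ?k ^ m * \<phi> m (mid u v b)" for m b
  define f' where "f' m b = mid u' v' ?k ^ m * \<phi> m (mid u' v' b)" for m b
  define h where "h m b = \<gamma> ^ m * (fact q / fact (q - m)) * hermite (q - m) (incr n l b)" for m b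
  define G where "G = leibniz f f'"
  define \<Phi> where "\<Phi> = leibniz G h"
  have C0: "C \<ge> 0" by (rule bounded_derivsD(4)[OF \<phi>])
  have \<kappa>0: "\<kappa> \<ge> 0" using \<kappa>(1) by linarith
  have af: "adm I (f m)" if "m \<le> q" for m
  proof -
    have "adm I (\<lambda>b. \<phi> m (mid u v b))"
      by (rule adm_compose_bounded[where g="\<phi> m" and C=C, OF adm_mid[OF I(1)] bounded_derivsD(3)[OF \<phi> that]])
         (simp_all add: I_def bounded_derivsD(2)[OF \<phi> that])
    then show ?thesis unfolding f_def[abs_def] by (rule adm_cmult)
  qed
  have af': "adm I (f' m)" if "m \<le> q" for m
  proof -
    have "adm I (\<lambda>b. \<phi> m (mid u' v' b))"
      by (rule adm_compose_bounded[where g="\<phi> m" and C=C, OF adm_mid[OF I(1)] bounded_derivsD(3)[OF \<phi> that]])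
         (simp_all add: I_def bounded_derivsD(2)[OF \<phi> that])
    then show ?thesis unfolding f'_def[abs_def] by (rule adm_cmult)
  qed
  have ail: "adm I (incr n l)" by (rule adm_incr[OF I(1)]) (auto simp: I_def)
  have ah: "adm I (h m)" for m
    unfolding h_def[abs_def] by (intro adm_cmult adm_hermite ail)
  have aG: "adm I (G m)" if "m \<le> q" for m unfolding G_def using that by (intro adm_leibniz af af') auto
  have a\<Phi>: "adm I (\<Phi> m)" if "m \<le> q" for m unfolding \<Phi>_def using that by (intro adm_leibniz aG ah) auto
  have "dir_derivs ?k q \<Phi>"
    unfolding \<Phi>_def G_def f_def[abs_def] f'_def[abs_def] h_def[abs_def] \<gamma>_def
    by (intro dir_derivs_leibniz dir_derivs_mid[OF \<phi>] dir_derivs_hermite)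
  then have d: "((\<lambda>x. \<Phi> r (\<lambda>t. b t + x * ?k t)) has_vector_derivative \<Phi> (Suc r) b) (at 0)" if "r < q" for r b
    using that unfolding dir_derivs_def has_real_derivative_iff_has_vector_derivative by blast
  have \<Phi>0: "\<Phi> 0 b = \<phi> 0 (mid u v b) * \<phi> 0 (mid u' v' b) * hermite q (incr n l b)" for b
    unfolding \<Phi>_def G_def leibniz_def f_def f'_def h_def by simp
  have "(\<integral>\<omega>. hermite q (incr n j (\<lambda>t. B t \<omega>)) *\<^sub>R \<Phi> 0 (\<lambda>t. B t \<omega>) \<partial>M) = (\<integral>\<omega>. \<Phi> q (\<lambda>t. B t \<omega>) \<partial>M)"
    by (rule incr_hermite_ibp[where q=q and \<Phi>=\<Phi>, OF n I a\<Phi> d])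
  then have ibp: "(\<integral>\<omega>. hermite q (incr n j (\<lambda>t. B t \<omega>)) * (\<phi> 0 (mid u v (\<lambda>t. B t \<omega>)) * \<phi> 0 (mid u' v' (\<lambda>t. B t \<omega>)) * hermite q (incr n l (\<lambda>t. B t \<omega>))) \<partial>M)
     = (\<integral>\<omega>. \<Phi> q (\<lambda>t. B t \<omega>) \<partial>M)" unfolding \<Phi>0 real_scaleR_def .
  have Gb: "\<bar>G m b\<bar> \<le> 2 ^ m * (C^2 * \<kappa> ^ m)" if "m \<le> q" for m b
  proof -
    have t: "\<bar>f i b * f' (m - i) b\<bar> \<le> C^2 * \<kappa> ^ m" if "i \<le> m" for i
    proof -
      have 1: "\<bar>f i b\<bar> \<le> \<kappa> ^ i * C"
        unfolding f_def abs_mult power_abs using \<open>m \<le> q\<close> that \<kappa> \<kappa>0 by (intro mult_mono power_mono bounded_derivsD(2)[OF \<phi>]) auto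
      have 2: "\<bar>f' (m - i) b\<bar> \<le> \<kappa> ^ (m - i) * C"
        unfolding f'_def abs_mult power_abs using \<open>m \<le> q\<close> that \<kappa> \<kappa>0 by (intro mult_mono power_mono bounded_derivsD(2)[OF \<phi>]) auto
      have "\<bar>f i b * f' (m - i) b\<bar> \<le> (\<kappa> ^ i * C) * (\<kappa> ^ (m - i) * C)"
        unfolding abs_mult using \<kappa>0 C0 by (intro mult_mono 1 2) auto
      also have "\<dots> = (\<kappa> ^ i * \<kappa> ^ (m - i)) * C^2" by (simp add: power2_eq_square)
      also have "\<kappa> ^ i * \<kappa> ^ (m - i) = \<kappa> ^ m" using that by (simp add: power_add[symmetric])
      finally show ?thesis by (simp add: mult.commute)
    qed
    have "\<bar>G m b\<bar> \<le> (\<Sum>i\<le>m. \<bar>real (m choose i) * (f i b * f' (m - i) b)\<bar>)" unfolding G_def leibniz_def by (rule sum_abs)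
    also have "\<dots> \<le> (\<Sum>i\<le>m. real (m choose i) * (C^2 * \<kappa> ^ m))"
      using t by (intro sum_mono) (simp add: abs_mult[of "real _"] mult_left_mono)
    also have "\<dots> = 2 ^ m * (C^2 * \<kappa> ^ m)"
      unfolding sum_distrib_right[symmetric] using choose_row_sum[of m] by (metis of_nat_numeral of_nat_power of_nat_sum)
    finally show ?thesis .
  qed
  have ie: "integrable M (\<lambda>\<omega>. \<Phi> q (\<lambda>t. B t \<omega>))" by (rule adm_integrable[OF I(1,2) a\<Phi>]) simp
  have aG0: "adm I (\<lambda>b. \<phi> 0 (mid u v b) * \<phi> 0 (mid u' v' b))"
    using aG[of 0] unfolding G_def leibniz_def f_def f'_def by simp
  have i0: "integrable M (\<lambda>\<omega>. \<phi> 0 (mid u v (\<lambda>t. B t \<omega>)) * \<phi> 0 (mid u' v' (\<lambda>t. B t \<omega>)))" by (rule adm_integrable[OF I(1,2) aG0])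
  have eqd: "(\<integral>\<omega>. \<Phi> q (\<lambda>t. B t \<omega>) \<partial>M) - fact q * \<gamma> ^ q * (\<integral>\<omega>. \<phi> 0 (mid u v (\<lambda>t. B t \<omega>)) * \<phi> 0 (mid u' v' (\<lambda>t. B t \<omega>)) \<partial>M)
     = (\<integral>\<omega>. \<Phi> q (\<lambda>t. B t \<omega>) - fact q * \<gamma> ^ q * (\<phi> 0 (mid u v (\<lambda>t. B t \<omega>)) * \<phi> 0 (mid u' v' (\<lambda>t. B t \<omega>))) \<partial>M)"
    using ie i0 by simp
  have "\<bar>(\<integral>\<omega>. \<Phi> q (\<lambda>t. B t \<omega>) \<partial>M) - fact q * \<gamma> ^ q * (\<integral>\<omega>. \<phi> 0 (mid u v (\<lambda>t. B t \<omega>)) * \<phi> 0 (mid u' v' (\<lambda>t. B t \<omega>)) \<partial>M)\<bar> \<le> (\<integral>\<omega>. (\<Sum>i\<in>{1..q}. (real (q choose i) * 2 ^ i * fact q * (C^2 * (\<kappa> ^ i * \<bar>\<gamma>\<bar> ^ (q - i)))) * \<bar>hermite i (incr n l (\<lambda>t. B t \<omega>))\<bar>) \<partial>M)"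
    unfolding eqd real_norm_def[symmetric]
  proof (rule expectation_norm_le[OF I(1,2)])
    show "adm I (\<lambda>b. \<Phi> q b - fact q * \<gamma> ^ q * (\<phi> 0 (mid u v b) * \<phi> 0 (mid u' v' b)))"
      by (intro adm_diff a\<Phi> adm_cmult[OF aG0]) simp
    show "adm I (\<lambda>b. \<Sum>i\<in>{1..q}. (real (q choose i) * 2 ^ i * fact q * (C^2 * (\<kappa> ^ i * norm \<gamma> ^ (q - i)))) * norm (hermite i (incr n l b)))"
      unfolding real_norm_def by (intro adm_sum adm_cmult adm_abs adm_hermite ail)
    fix b
    have h0: "h q b = fact q * \<gamma> ^ q" unfolding h_def by simp
    have G0: "G 0 b = \<phi> 0 (mid u v b) * \<phi> 0 (mid u' v' b)" unfolding G_def leibniz_def f_def f'_def by simp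
    have "{..q} = insert 0 {1..q}" by auto
    then have "\<Phi> q b = G 0 b * h q b + (\<Sum>i\<in>{1..q}. real (q choose i) * (G i b * h (q - i) b))"
      unfolding \<Phi>_def leibniz_def by simp
    then have "\<Phi> q b - fact q * \<gamma> ^ q * (\<phi> 0 (mid u v b) * \<phi> 0 (mid u' v' b)) = (\<Sum>i\<in>{1..q}. real (q choose i) * (G i b * h (q - i) b))"
      unfolding h0 G0 by simp
    also have "norm \<dots> \<le> (\<Sum>i\<in>{1..q}. (real (q choose i) * 2 ^ i * fact q * (C^2 * (\<kappa> ^ i * norm \<gamma> ^ (q - i)))) * norm (hermite i (incr n l b)))"
    proof (rule sum_norm_le)
      fix i assume i: "i \<in> {1..q}"
      have h: "\<bar>h (q - i) b\<bar> \<le> \<bar>\<gamma>\<bar> ^ (q - i) * fact q * \<bar>hermite i (incr n l b)\<bar>"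
      proof -
        have "q - (q - i) = i" using i by simp
        then have "\<bar>h (q - i) b\<bar> = \<bar>\<gamma>\<bar> ^ (q - i) * (fact q / fact i) * \<bar>hermite i (incr n l b)\<bar>"
          unfolding h_def by (simp add: abs_mult power_abs)
        also have "\<dots> \<le> \<bar>\<gamma>\<bar> ^ (q - i) * fact q * \<bar>hermite i (incr n l b)\<bar>"
        proof (intro mult_right_mono mult_left_mono)
          have "(1::real) \<le> fact i" by (rule fact_ge_1)
          then have "fact q / fact i \<le> fact q / (1::real)" by (intro divide_left_mono) auto
          then show "fact q / fact i \<le> (fact q :: real)" by simp
        qed auto
        finally show ?thesis .
      qed
      have "norm (real (q choose i) * (G i b * h (q - i) b)) = real (q choose i) * (\<bar>G i b\<bar> * \<bar>h (q - i) b\<bar>)" by (simp add: abs_mult)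
      also have "\<dots> \<le> real (q choose i) * ((2 ^ i * (C^2 * \<kappa> ^ i)) * (\<bar>\<gamma>\<bar> ^ (q - i) * fact q * \<bar>hermite i (incr n l b)\<bar>))"
        using i \<kappa>0 by (intro mult_left_mono mult_mono Gb h) auto
      finally show "norm (real (q choose i) * (G i b * h (q - i) b)) \<le> (real (q choose i) * 2 ^ i * fact q * (C^2 * (\<kappa> ^ i * norm \<gamma> ^ (q - i)))) * norm (hermite i (incr n l b))"
        by (simp add: mult_ac)
    qed
    finally show "norm (\<Phi> q b - fact q * \<gamma> ^ q * (\<phi> 0 (mid u v b) * \<phi> 0 (mid u' v' b)))
       \<le> (\<Sum>i\<in>{1..q}. (real (q choose i) * 2 ^ i * fact q * (C^2 * (\<kappa> ^ i * norm \<gamma> ^ (q - i)))) * norm (hermite i (incr n l b)))" .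
  qed
  also have "\<dots> = (\<Sum>i\<in>{1..q}. (real (q choose i) * 2 ^ i * fact q * (C^2 * (\<kappa> ^ i * \<bar>\<gamma>\<bar> ^ (q - i)))) * hermite_abs_moment i)"
  proof -
    have e: "(\<integral>\<omega>. \<bar>hermite i (incr n l (\<lambda>t. B t \<omega>))\<bar> \<partial>M) = hermite_abs_moment i" for i
      unfolding hermite_abs_moment_def by (rule incr_expectation[OF n]) measurable
    show ?thesis
      by (subst expectation_sum[OF I(1,2)]) (intro adm_cmult adm_abs adm_hermite ail, simp add: e)
  qed
  also have "\<dots> \<le> (\<Sum>i\<in>{1..q}. cq q * (C^2 * (\<kappa> ^ i * \<bar>\<gamma>\<bar> ^ (q - i))))"
  proof (rule sum_mono)
    fix i assume "i \<in> {1..q}"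
    then have "(real (q choose i) * 2 ^ i * fact q * hermite_abs_moment i) * (C^2 * (\<kappa> ^ i * \<bar>\<gamma>\<bar> ^ (q - i))) \<le> cq q * (C^2 * (\<kappa> ^ i * \<bar>\<gamma>\<bar> ^ (q - i)))"
      using \<kappa>0 by (intro mult_right_mono cq_term mult_nonneg_nonneg) auto
    then show "(real (q choose i) * 2 ^ i * fact q * (C^2 * (\<kappa> ^ i * \<bar>\<gamma>\<bar> ^ (q - i)))) * hermite_abs_moment i \<le> cq q * (C^2 * (\<kappa> ^ i * \<bar>\<gamma>\<bar> ^ (q - i)))"
      by (simp add: mult_ac)
  qed
  also have "\<dots> = C^2 * cq q * (\<Sum>i\<in>{1..q}. \<kappa> ^ i * \<bar>\<gamma>\<bar> ^ (q - i))" by (simp add: sum_distrib_left mult_ac)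
  finally show ?thesis unfolding ibp .
qed

end

text \<open>The weights are functions of \<open>B\<close> at the midpoints of \<open>pu True j\<close> and \<open>pv True j\<close>. With \<open>\<kappa> = 0\<close> these are the weights of
  the Taylor expansion, with \<open>\<kappa> = 1\<close> the difference from the weights frozen at the points \<open>pu False j = pv False j\<close>.\<close>
locale weighted_hermite = fbm10 M B for M :: "'a measure" and B +
  fixes n N q :: nat and \<phi> :: "nat \<Rightarrow> real \<Rightarrow> real" and C T D \<delta> \<kappa> :: real and pu pv :: "bool \<Rightarrow> nat \<Rightarrow> real"
  assumes n1: "n \<ge> 1" and \<phi>: "bounded_derivs q \<phi> C" and q: "q = 1 \<or> q \<ge> 3"
    and pu: "\<And>e j. 0 \<le> pu e j" "\<And>e j. pu e j \<le> T" and pv: "\<And>e j. 0 \<le> pv e j" "\<And>e j. pv e j \<le> T"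
    and NT: "real N / real n \<le> T" and \<kappa>: "\<bar>\<kappa>\<bar> \<le> 1" and D0: "D \<ge> 0"
    and diag: "(\<Sum>j<N. \<Sum>e\<in>UNIV. \<bar>mid (pu e j) (pv e j) (kxi n j)\<bar>) \<le> D / sn n"
    and \<delta>: "\<And>j. j < N \<Longrightarrow> (\<integral>\<omega>. (\<phi> 0 (mid (pu True j) (pv True j) (\<lambda>t. B t \<omega>)) - \<kappa> * \<phi> 0 (mid (pu False j) (pv False j) (\<lambda>t. B t \<omega>)))\<^sup>2 \<partial>M) \<le> \<delta>"
begin

definition ke where "ke e = (if e then 1 else - \<kappa>)"
definition U where "U e j b = \<phi> 0 (mid (pu e j) (pv e j) b)"
definition w where "w j b = U True j b - \<kappa> * U False j b"
text \<open>Bounds the covariance of increment j with the argument of the weight number l, for both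
  flags together.\<close>

definition x where "x j l = (\<Sum>e\<in>UNIV. \<bar>mid (pu e l) (pv e l) (kxi n j)\<bar>)"
definition g where "g j l = incr n l (kxi n j)"
definition II where "II = (\<lambda>j. real j / real n) ` {..N} \<union> (\<Union>j<N. \<Union>e. {pu e j, pv e j})"

lemma s0: "sn n > 0" "sn n \<le> 1" using sn_pos[OF n1] sn_le_1[OF n1] by auto

lemma II: "finite II" "II \<subseteq> {0..}"
  unfolding II_def using pu pv by auto

lemma w_sum: "w j b = (\<Sum>e\<in>UNIV. ke e * U e j b)"
  unfolding w_def ke_def by (simp add: UNIV_bool)

lemma adm_U: "j < N \<Longrightarrow> adm II (U e j)"
  unfolding U_def[abs_def]
  by (rule adm_compose_bounded[where g="\<phi> 0" and C=C, OF adm_mid[OF II(1)] bounded_derivsD(3)[OF \<phi>, of 0, OF le0]])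
     (auto simp: II_def bounded_derivsD(2)[OF \<phi>, of 0, OF le0])

lemma adm_w: "j < N \<Longrightarrow> adm II (w j)"
  unfolding w_def[abs_def] by (intro adm_diff adm_cmult adm_U)

lemma adm_incr_II: "l < N \<Longrightarrow> adm II (incr n l)"
  by (intro adm_incr II) (auto simp: II_def simp del: of_nat_Suc)

lemma g_eq: "g j l = rho10 (int j - int l) / 2" unfolding g_def by (rule incr_kxi[OF n1])
lemma g_le: "\<bar>g j l\<bar> \<le> 2" unfolding g_eq using rho10_abs_le[of "int j - int l"] by simp
lemma g_row: "(\<Sum>l<N. \<bar>g j l\<bar>) \<le> 2" and g_col: "(\<Sum>j<N. \<bar>g j l\<bar>) \<le> 2"
  unfolding g_eq using rho10_row_sum[where N=N and j=j] rho10_col_sum[where N=N and j=l]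
  by (simp_all add: abs_divide sum_divide_distrib[symmetric])

lemma g_power_le: "r \<ge> 1 \<Longrightarrow> \<bar>g j l\<bar> ^ r \<le> 2 ^ (r-1) * \<bar>g j l\<bar>"
proof -
  assume "r \<ge> 1"
  then have "\<bar>g j l\<bar> ^ r = \<bar>g j l\<bar> ^ (r-1) * \<bar>g j l\<bar>" by (cases r) auto
  also have "\<dots> \<le> 2 ^ (r-1) * \<bar>g j l\<bar>" by (intro mult_right_mono power_mono g_le) auto
  finally show ?thesis .
qed

lemma mid_abs_le: "\<bar>mid u v k\<bar> \<le> (\<bar>k u\<bar> + \<bar>k v\<bar>) / 2"
  unfolding mid_def by (simp add: abs_triangle_ineq)

lemma x_bounds: "0 \<le> x j l" "x j l \<le> 2 * sn n"
proof -
  show "0 \<le> x j l" unfolding x_def by (simp add: sum_nonneg)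
  have "\<bar>mid u v (kxi n j)\<bar> \<le> sn n" for u v
    by (rule order_trans[OF mid_abs_le]) (use add_mono[OF kxi_bound[OF n1, of j u] kxi_bound[OF n1, of j v]] in simp)
  from this[of "pu True l" "pv True l"] this[of "pu False l" "pv False l"]
  show "x j l \<le> 2 * sn n" unfolding x_def by (simp add: UNIV_bool)
qed

lemma x_col: "(\<Sum>j<N. x j l) \<le> 4 * T powr (1/5) / sn n"
proof -
  have e: "(\<Sum>j<N. \<bar>mid (pu e l) (pv e l) (kxi n j)\<bar>) \<le> 2 * T powr (1/5) / sn n" for e
  proof -
    have "(\<Sum>j<N. \<bar>mid (pu e l) (pv e l) (kxi n j)\<bar>) \<le> (\<Sum>j<N. (\<bar>kxi n j (pu e l)\<bar> + \<bar>kxi n j (pv e l)\<bar>) / 2)"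
      by (intro sum_mono mid_abs_le)
    also have "\<dots> = ((\<Sum>j<N. \<bar>kxi n j (pu e l)\<bar>) + (\<Sum>j<N. \<bar>kxi n j (pv e l)\<bar>)) / 2"
      by (simp only: sum_divide_distrib[symmetric] sum.distrib)
    also have "\<dots> \<le> 2 * T powr (1/5) / sn n"
      using kxi_sum_bound[OF n1 pu(1)[of e l] pu(2) NT] kxi_sum_bound[OF n1 pv(1)[of e l] pv(2) NT] by simp
    finally show ?thesis .
  qed
  have "(\<Sum>j<N. x j l) = (\<Sum>e\<in>UNIV. \<Sum>j<N. \<bar>mid (pu e l) (pv e l) (kxi n j)\<bar>)" unfolding x_def by (rule sum.swap)
  also have "\<dots> \<le> (\<Sum>e\<in>(UNIV::bool set). 2 * T powr (1/5) / sn n)" by (intro sum_mono e)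
  also have "\<dots> = 4 * T powr (1/5) / sn n" by simp
  finally show ?thesis .
qed

lemma x_diag: "(\<Sum>j<N. x j j) \<le> D / sn n"
  using diag unfolding x_def .

text \<open>\<open>hermite_pair_bound\<close> works with a single bound for the two weights of a
  pair, so the covariances of increment j with the weights j and l are added.\<close>

definition y where "y j l = x j j + x j l"

lemma y_bounds: "0 \<le> y j l" "y j l \<le> 4 * sn n"
  unfolding y_def using x_bounds[of j j] x_bounds[of j l] by auto

lemma y_sum: "(\<Sum>j<N. \<Sum>l<N. y j l) \<le> real N * ((D + 4 * T powr (1/5)) / sn n)"
proof -
  have "(\<Sum>j<N. \<Sum>l<N. y j l) = real N * (\<Sum>j<N. x j j) + (\<Sum>l<N. \<Sum>j<N. x j l)"
    unfolding y_def by (subst (2) sum.swap) (simp add: sum.distrib sum_distrib_left)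
  also have "\<dots> \<le> real N * (D / sn n) + (\<Sum>l<N. 4 * T powr (1/5) / sn n)"
    by (intro add_mono mult_left_mono x_diag sum_mono x_col) auto
  also have "\<dots> = real N * ((D + 4 * T powr (1/5)) / sn n)" by (simp add: add_divide_distrib distrib_left)
  finally show ?thesis .
qed

text \<open>The double sum of y has order \<open>N / sn n\<close> while y has order
  \<open>sn n\<close>, so the double sum of y^q has order N times \<open>sn n\<close> to the power q
  - 2. Degree 1 thus loses a factor, degrees from 3 on gain one.\<close>

definition \<epsilon> where "\<epsilon> = (if q = 1 then 1 / sn n else sn n)"

lemma \<epsilon>_ge: "sn n \<le> \<epsilon>" "\<epsilon> \<ge> 0"
proof -
  have "sn n \<le> 1 / sn n" using s0 by (simp add: pos_le_divide_eq mult_le_one)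
  then show "sn n \<le> \<epsilon>" "\<epsilon> \<ge> 0" unfolding \<epsilon>_def using s0 by auto
qed

text \<open>The term i = q contains no correlation g and rests on the total of y. For 1 <= i < q one
  factor y supplies \<open>sn n\<close> and one factor |g| makes the sum over l bounded.\<close>

lemma y_power_sum:
  "(\<Sum>j<N. \<Sum>l<N. \<Sum>i\<in>{1..q}. y j l ^ i * \<bar>g j l\<bar> ^ (q - i)) \<le> real N * (4 ^ q * (D + 4 * T powr (1/5) + 2 * real q) * \<epsilon>)"
proof -
  have q1: "q \<ge> 1" using q by auto
  have top: "y j l ^ q \<le> 4 ^ q * (\<epsilon> * sn n) * y j l" for j l
  proof (cases "q = 1")
    case True
    then show ?thesis using s0 y_bounds[of j l] unfolding \<epsilon>_def by simp
  next
    case False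
    then have q3: "q \<ge> 3" using q by auto
    then have "q = Suc (q - 1)" by simp
    then have "y j l ^ q = y j l ^ (q - 1) * y j l" by (metis power_Suc2)
    also have "\<dots> \<le> (4 * sn n) ^ (q - 1) * y j l" using y_bounds[of j l] by (intro mult_right_mono power_mono) auto
    also have "(4 * sn n) ^ (q - 1) \<le> 4 ^ q * sn n ^ 2"
      unfolding power_mult_distrib using q3 s0 by (intro mult_mono power_increasing power_decreasing) auto
    finally show ?thesis using False y_bounds[of j l] unfolding \<epsilon>_def by (simp add: power2_eq_square mult_right_mono)
  qed
  have low: "y j l ^ i * \<bar>g j l\<bar> ^ (q - i) \<le> 4 ^ q * \<epsilon> * \<bar>g j l\<bar>" if "1 \<le> i" "i < q" for i j l
  proof -
    have "y j l ^ i * \<bar>g j l\<bar> ^ (q - i) \<le> (4 ^ i * sn n) * (2 ^ (q - i - 1) * \<bar>g j l\<bar>)"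
    proof (rule mult_mono)
      have "y j l ^ i \<le> (4 * sn n) ^ i" using y_bounds[of j l] by (intro power_mono) auto
      also have "\<dots> = 4 ^ i * sn n ^ i" by (rule power_mult_distrib)
      also have "\<dots> \<le> 4 ^ i * sn n ^ 1" using s0 that by (intro mult_left_mono power_decreasing) auto
      finally show "y j l ^ i \<le> 4 ^ i * sn n" by simp
      show "\<bar>g j l\<bar> ^ (q - i) \<le> 2 ^ (q - i - 1) * \<bar>g j l\<bar>" using that by (intro g_power_le) auto
    qed (use s0 in auto)
    also have "\<dots> = (4 ^ i * 2 ^ (q - i - 1)) * (sn n * \<bar>g j l\<bar>)" by simp
    also have "\<dots> \<le> 4 ^ q * (\<epsilon> * \<bar>g j l\<bar>)"
    proof (rule mult_mono)
      have "(4::real) ^ i * 2 ^ (q - i - 1) \<le> 4 ^ i * 4 ^ (q - i - 1)" by (intro mult_left_mono power_mono) auto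
      also have "\<dots> = 4 ^ (i + (q - i - 1))" by (simp add: power_add)
      also have "\<dots> \<le> 4 ^ q" using that by (intro power_increasing) auto
      finally show "(4::real) ^ i * 2 ^ (q - i - 1) \<le> 4 ^ q" .
      show "sn n * \<bar>g j l\<bar> \<le> \<epsilon> * \<bar>g j l\<bar>" using \<epsilon>_ge by (intro mult_right_mono) auto
    qed (use s0 in auto)
    finally show ?thesis by simp
  qed
  have inner: "(\<Sum>i\<in>{1..q}. y j l ^ i * \<bar>g j l\<bar> ^ (q - i)) \<le> 4 ^ q * (\<epsilon> * sn n) * y j l + real q * (4 ^ q * \<epsilon> * \<bar>g j l\<bar>)" for j l
  proof -
    have "{1..q} = insert q {1..<q}" using q1 by auto
    then have "(\<Sum>i\<in>{1..q}. y j l ^ i * \<bar>g j l\<bar> ^ (q - i)) = y j l ^ q + (\<Sum>i\<in>{1..<q}. y j l ^ i * \<bar>g j l\<bar> ^ (q - i))" by simp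
    also have "(\<Sum>i\<in>{1..<q}. y j l ^ i * \<bar>g j l\<bar> ^ (q - i)) \<le> (\<Sum>i\<in>{1..<q}. 4 ^ q * \<epsilon> * \<bar>g j l\<bar>)"
      using low by (intro sum_mono) auto
    also have "\<dots> = real (q - 1) * (4 ^ q * \<epsilon> * \<bar>g j l\<bar>)" by simp
    also have "\<dots> \<le> real q * (4 ^ q * \<epsilon> * \<bar>g j l\<bar>)" using \<epsilon>_ge by (intro mult_right_mono) auto
    finally show ?thesis using top[of j l] by linarith
  qed
  have "(\<Sum>j<N. \<Sum>l<N. \<Sum>i\<in>{1..q}. y j l ^ i * \<bar>g j l\<bar> ^ (q - i)) \<le> (\<Sum>j<N. \<Sum>l<N. 4 ^ q * (\<epsilon> * sn n) * y j l + real q * (4 ^ q * \<epsilon> * \<bar>g j l\<bar>))"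
    by (intro sum_mono inner)
  also have "\<dots> = 4 ^ q * (\<epsilon> * sn n) * (\<Sum>j<N. \<Sum>l<N. y j l) + real q * (4 ^ q * \<epsilon>) * (\<Sum>j<N. \<Sum>l<N. \<bar>g j l\<bar>)"
    by (simp add: sum.distrib sum_distrib_left mult_ac)
  also have "\<dots> \<le> 4 ^ q * (\<epsilon> * sn n) * (real N * ((D + 4 * T powr (1/5)) / sn n)) + real q * (4 ^ q * \<epsilon>) * (\<Sum>j<N. 2)"
    using \<epsilon>_ge s0 by (intro add_mono mult_left_mono y_sum sum_mono g_row) auto
  also have "\<dots> = real N * (4 ^ q * (D + 4 * T powr (1/5) + 2 * real q) * \<epsilon>)"
    using s0 by (simp add: field_simps)
  finally show ?thesis .
qed

text \<open>Expanding both weights into their two parts gives four pairs with coefficients of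
  modulus at most 1, hence the factor 4.\<close>

lemma pair_expectation:
  assumes "j < N" "l < N"
  shows "\<bar>(\<integral>\<omega>. (w j (\<lambda>t. B t \<omega>) * hermite q (incr n j (\<lambda>t. B t \<omega>))) * (w l (\<lambda>t. B t \<omega>) * hermite q (incr n l (\<lambda>t. B t \<omega>))) \<partial>M)
     - fact q * g j l ^ q * (\<integral>\<omega>. w j (\<lambda>t. B t \<omega>) * w l (\<lambda>t. B t \<omega>) \<partial>M)\<bar>
    \<le> 4 * (C^2 * cq q) * (\<Sum>i\<in>{1..q}. y j l ^ i * \<bar>g j l\<bar> ^ (q - i))"
proof -
  define H where "H e e' b = hermite q (incr n j b) * (U e j b * U e' l b * hermite q (incr n l b))" for e e' b
  define W where "W e e' b = U e j b * U e' l b" for e e' b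
  have aH: "adm II (H e e')" and aW: "adm II (W e e')" for e e'
    unfolding H_def[abs_def] W_def[abs_def] using assms by (intro adm_mult adm_hermite adm_U adm_incr_II; simp)+
  have eqH: "(\<integral>\<omega>. (w j (\<lambda>t. B t \<omega>) * hermite q (incr n j (\<lambda>t. B t \<omega>))) * (w l (\<lambda>t. B t \<omega>) * hermite q (incr n l (\<lambda>t. B t \<omega>))) \<partial>M)
     = (\<Sum>e\<in>UNIV. \<Sum>e'\<in>UNIV. ke e * ke e' * (\<integral>\<omega>. H e e' (\<lambda>t. B t \<omega>) \<partial>M))"
  proof -
    have "(w j b * hermite q (incr n j b)) * (w l b * hermite q (incr n l b)) = (\<Sum>e\<in>UNIV. \<Sum>e'\<in>UNIV. ke e * ke e' * H e e' b)" for b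
      unfolding w_sum H_def by (simp add: UNIV_bool algebra_simps)
    then show ?thesis
      by (simp only:) (subst expectation_sum[OF II], (intro adm_sum adm_cmult aH), subst expectation_sum[OF II], (intro adm_cmult aH), simp)
  qed
  have eqW: "(\<integral>\<omega>. w j (\<lambda>t. B t \<omega>) * w l (\<lambda>t. B t \<omega>) \<partial>M)
     = (\<Sum>e\<in>UNIV. \<Sum>e'\<in>UNIV. ke e * ke e' * (\<integral>\<omega>. W e e' (\<lambda>t. B t \<omega>) \<partial>M))"
  proof -
    have "w j b * w l b = (\<Sum>e\<in>UNIV. \<Sum>e'\<in>UNIV. ke e * ke e' * W e e' b)" for b
      unfolding w_sum W_def by (simp add: UNIV_bool algebra_simps)
    then show ?thesis
      by (simp only:) (subst expectation_sum[OF II], (intro adm_sum adm_cmult aW), subst expectation_sum[OF II], (intro adm_cmult aW), simp)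
  qed
  let ?R = "C^2 * cq q * (\<Sum>i\<in>{1..q}. y j l ^ i * \<bar>g j l\<bar> ^ (q - i))"
  have R0: "?R \<ge> 0" using cq_nonneg y_bounds by (intro mult_nonneg_nonneg sum_nonneg) auto
  have hw: "\<bar>(\<integral>\<omega>. H e e' (\<lambda>t. B t \<omega>) \<partial>M) - fact q * g j l ^ q * (\<integral>\<omega>. W e e' (\<lambda>t. B t \<omega>) \<partial>M)\<bar> \<le> ?R" for e e'
    unfolding H_def W_def U_def g_def
  proof (rule hermite_pair_bound[OF n1 \<phi> pu(1) pv(1) pu(1) pv(1)])
    have xm: "\<bar>mid (pu e m) (pv e m) (kxi n j)\<bar> \<le> x j m" for e m
      unfolding x_def by (rule member_le_sum[of e UNIV "\<lambda>e. \<bar>mid (pu e m) (pv e m) (kxi n j)\<bar>"]) auto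
    show "\<bar>mid (pu e j) (pv e j) (kxi n j)\<bar> \<le> y j l" using xm[of e j] x_bounds(1)[of j l] unfolding y_def by linarith
    show "\<bar>mid (pu e' l) (pv e' l) (kxi n j)\<bar> \<le> y j l" using xm[of e' l] x_bounds(1)[of j j] unfolding y_def by linarith
  qed
  have eqd: "(\<Sum>e\<in>UNIV. \<Sum>e'\<in>UNIV. ke e * ke e' * (\<integral>\<omega>. H e e' (\<lambda>t. B t \<omega>) \<partial>M)) - fact q * g j l ^ q * (\<Sum>e\<in>UNIV. \<Sum>e'\<in>UNIV. ke e * ke e' * (\<integral>\<omega>. W e e' (\<lambda>t. B t \<omega>) \<partial>M))
     = (\<Sum>e\<in>UNIV. \<Sum>e'\<in>UNIV. ke e * ke e' * ((\<integral>\<omega>. H e e' (\<lambda>t. B t \<omega>) \<partial>M) - fact q * g j l ^ q * (\<integral>\<omega>. W e e' (\<lambda>t. B t \<omega>) \<partial>M)))"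
    by (simp add: UNIV_bool algebra_simps)
  have "\<bar>(\<Sum>e\<in>UNIV. \<Sum>e'\<in>UNIV. ke e * ke e' * (\<integral>\<omega>. H e e' (\<lambda>t. B t \<omega>) \<partial>M)) - fact q * g j l ^ q * (\<Sum>e\<in>UNIV. \<Sum>e'\<in>UNIV. ke e * ke e' * (\<integral>\<omega>. W e e' (\<lambda>t. B t \<omega>) \<partial>M))\<bar> \<le> (\<Sum>e\<in>(UNIV::bool set). \<Sum>e'\<in>(UNIV::bool set). ?R)"
    unfolding eqd
  proof (rule order_trans[OF sum_abs], rule sum_mono, rule order_trans[OF sum_abs], rule sum_mono)
    fix e e'
    have k1: "\<bar>ke e\<bar> \<le> 1" for e unfolding ke_def using \<kappa> by simp
    have "\<bar>ke e * ke e'\<bar> \<le> 1 * 1" unfolding abs_mult by (intro mult_mono k1) auto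
    then have "\<bar>ke e * ke e'\<bar> * \<bar>(\<integral>\<omega>. H e e' (\<lambda>t. B t \<omega>) \<partial>M) - fact q * g j l ^ q * (\<integral>\<omega>. W e e' (\<lambda>t. B t \<omega>) \<partial>M)\<bar> \<le> 1 * ?R"
      using R0 by (intro mult_mono hw) auto
    then show "\<bar>ke e * ke e' * ((\<integral>\<omega>. H e e' (\<lambda>t. B t \<omega>) \<partial>M) - fact q * g j l ^ q * (\<integral>\<omega>. W e e' (\<lambda>t. B t \<omega>) \<partial>M))\<bar> \<le> ?R"
      by (simp add: abs_mult)
  qed
  also have "\<dots> = 4 * (C^2 * cq q) * (\<Sum>i\<in>{1..q}. y j l ^ i * \<bar>g j l\<bar> ^ (q - i))" by simp
  finally show ?thesis unfolding eqH eqW .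
qed

text \<open>The main part of a pair is controlled by the second moments of the weights and by the
  summable powers of g, the rest by \<open>y_power_sum\<close>. Small weights therefore give a small
  sum up to the \<open>\<epsilon>\<close> term.\<close>

theorem weighted_hermite_L2:
  "(\<integral>\<omega>. (\<Sum>j<N. w j (\<lambda>t. B t \<omega>) * hermite q (incr n j (\<lambda>t. B t \<omega>)))\<^sup>2 \<partial>M)
   \<le> real N * (fact q * 2 ^ q * \<delta> + 4 * (C^2 * cq q) * (4 ^ q * (D + 4 * T powr (1/5) + 2 * real q) * \<epsilon>))"
proof -
  define z where "z j b = w j b * hermite q (incr n j b)" for j b
  have az: "adm II (z j)" if "j < N" for j
    unfolding z_def[abs_def] using that by (intro adm_mult adm_w adm_hermite adm_incr_II)
  have q1: "q \<ge> 1" using q by auto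
  have wl: "\<bar>\<integral>\<omega>. w j (\<lambda>t. B t \<omega>) * w l (\<lambda>t. B t \<omega>) \<partial>M\<bar> \<le> \<delta>" if "j < N" "l < N" for j l
  proof -
    have i: "integrable M (\<lambda>\<omega>. (w j (\<lambda>t. B t \<omega>))\<^sup>2)" if "j < N" for j
      by (rule adm_integrable[OF II]) (intro adm_power adm_w that)
    have "\<bar>\<integral>\<omega>. w j (\<lambda>t. B t \<omega>) * w l (\<lambda>t. B t \<omega>) \<partial>M\<bar> \<le> (\<integral>\<omega>. ((w j (\<lambda>t. B t \<omega>))\<^sup>2 + (w l (\<lambda>t. B t \<omega>))\<^sup>2) / 2 \<partial>M)"
      unfolding real_norm_def[symmetric]
    proof (rule expectation_norm_le[OF II])
      show "adm II (\<lambda>b. w j b * w l b)" using that by (intro adm_mult adm_w)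
      have "adm II (\<lambda>b. (1/2) * ((w j b)\<^sup>2 + (w l b)\<^sup>2))" using that by (intro adm_cmult adm_add adm_power adm_w)
      then show "adm II (\<lambda>b. ((w j b)\<^sup>2 + (w l b)\<^sup>2) / 2)" by simp
      fix b
      have "2 * \<bar>w j b\<bar> * \<bar>w l b\<bar> \<le> \<bar>w j b\<bar>\<^sup>2 + \<bar>w l b\<bar>\<^sup>2" by (rule sum_squares_bound)
      then show "norm (w j b * w l b) \<le> ((w j b)\<^sup>2 + (w l b)\<^sup>2) / 2" by (simp add: abs_mult)
    qed
    also have "\<dots> = ((\<integral>\<omega>. (w j (\<lambda>t. B t \<omega>))\<^sup>2 \<partial>M) + (\<integral>\<omega>. (w l (\<lambda>t. B t \<omega>))\<^sup>2 \<partial>M)) / 2"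
      using i that by simp
    also have "\<dots> \<le> \<delta>" using \<delta>[OF that(1)] \<delta>[OF that(2)] unfolding w_def U_def by simp
    finally show ?thesis .
  qed
  have "(\<integral>\<omega>. (\<Sum>j<N. z j (\<lambda>t. B t \<omega>))\<^sup>2 \<partial>M) = (\<integral>\<omega>. (\<Sum>j<N. \<Sum>l<N. z j (\<lambda>t. B t \<omega>) * z l (\<lambda>t. B t \<omega>)) \<partial>M)"
    unfolding power2_eq_square sum_product ..
  also have "\<dots> = (\<Sum>j<N. \<integral>\<omega>. (\<Sum>l<N. z j (\<lambda>t. B t \<omega>) * z l (\<lambda>t. B t \<omega>)) \<partial>M)"
    by (rule expectation_sum[OF II]) (intro adm_sum adm_mult az, auto)
  also have "\<dots> = (\<Sum>j<N. \<Sum>l<N. \<integral>\<omega>. z j (\<lambda>t. B t \<omega>) * z l (\<lambda>t. B t \<omega>) \<partial>M)"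
    by (intro sum.cong refl expectation_sum[OF II] adm_mult az) auto
  also have "\<dots> \<le> (\<Sum>j<N. \<Sum>l<N. fact q * \<delta> * (2 ^ (q-1) * \<bar>g j l\<bar>) + 4 * (C^2 * cq q) * (\<Sum>i\<in>{1..q}. y j l ^ i * \<bar>g j l\<bar> ^ (q - i)))"
  proof (intro sum_mono)
    fix j l assume jl: "j \<in> {..<N}" "l \<in> {..<N}"
    let ?E = "\<integral>\<omega>. z j (\<lambda>t. B t \<omega>) * z l (\<lambda>t. B t \<omega>) \<partial>M" and ?W = "\<integral>\<omega>. w j (\<lambda>t. B t \<omega>) * w l (\<lambda>t. B t \<omega>) \<partial>M"
    have p: "\<bar>?E - fact q * g j l ^ q * ?W\<bar> \<le> 4 * (C^2 * cq q) * (\<Sum>i\<in>{1..q}. y j l ^ i * \<bar>g j l\<bar> ^ (q - i))"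
      using pair_expectation[of j l] jl unfolding z_def by simp
    have d0: "\<delta> \<ge> 0" using wl[of j j] jl by (meson abs_ge_zero lessThan_iff order_trans)
    have "\<bar>fact q * g j l ^ q * ?W\<bar> = fact q * (\<bar>g j l\<bar> ^ q * \<bar>?W\<bar>)" by (simp add: abs_mult power_abs)
    also have "\<dots> \<le> fact q * ((2 ^ (q-1) * \<bar>g j l\<bar>) * \<delta>)"
      using wl[of j l] jl q1 by (intro mult_left_mono mult_mono g_power_le) auto
    finally have "\<bar>fact q * g j l ^ q * ?W\<bar> \<le> fact q * \<delta> * (2 ^ (q-1) * \<bar>g j l\<bar>)" by (simp add: mult_ac)
    then show "?E \<le> fact q * \<delta> * (2 ^ (q-1) * \<bar>g j l\<bar>) + 4 * (C^2 * cq q) * (\<Sum>i\<in>{1..q}. y j l ^ i * \<bar>g j l\<bar> ^ (q - i))"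
      using p by linarith
  qed
  also have "\<dots> = fact q * \<delta> * 2 ^ (q-1) * (\<Sum>j<N. \<Sum>l<N. \<bar>g j l\<bar>) + 4 * (C^2 * cq q) * (\<Sum>j<N. \<Sum>l<N. \<Sum>i\<in>{1..q}. y j l ^ i * \<bar>g j l\<bar> ^ (q - i))"
    by (simp only: sum.distrib sum_distrib_left mult.assoc)
  also have "\<dots> \<le> fact q * \<delta> * 2 ^ (q-1) * (real N * 2) + 4 * (C^2 * cq q) * (real N * (4 ^ q * (D + 4 * T powr (1/5) + 2 * real q) * \<epsilon>))"
  proof (rule add_mono)
    show "fact q * \<delta> * 2 ^ (q-1) * (\<Sum>j<N. \<Sum>l<N. \<bar>g j l\<bar>) \<le> fact q * \<delta> * 2 ^ (q-1) * (real N * 2)"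
    proof (cases "N = 0")
      case False
      then have "\<delta> \<ge> 0" using wl[of 0 0] by (meson abs_ge_zero order_trans not_gr_zero)
      moreover have "(\<Sum>j<N. \<Sum>l<N. \<bar>g j l\<bar>) \<le> (\<Sum>j<N. 2)" by (intro sum_mono g_row)
      ultimately show ?thesis by (intro mult_left_mono) auto
    qed simp
    show "4 * (C^2 * cq q) * (\<Sum>j<N. \<Sum>l<N. \<Sum>i\<in>{1..q}. y j l ^ i * \<bar>g j l\<bar> ^ (q - i)) \<le> 4 * (C^2 * cq q) * (real N * (4 ^ q * (D + 4 * T powr (1/5) + 2 * real q) * \<epsilon>))"
      using cq_nonneg by (intro mult_left_mono y_power_sum) auto
  qed
  also have "\<dots> = real N * (fact q * 2 ^ q * \<delta> + 4 * (C^2 * cq q) * (4 ^ q * (D + 4 * T powr (1/5) + 2 * real q) * \<epsilon>))"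
  proof -
    have "fact q * \<delta> * 2 ^ (q-1) * (real N * 2) = real N * (fact q * (2 ^ (q-1) * 2) * \<delta>)" by simp
    also have "2 ^ (q-1) * 2 = (2::real) ^ q" using q1 by (cases q) auto
    finally show ?thesis by (simp only: distrib_left mult.left_commute mult.assoc)
  qed
  finally show ?thesis unfolding z_def .
qed

end

section \<open>Truncation and Taylor expansion\<close>

text \<open>Continuous differentiability of order k on the line, with the derivative quantified
  existentially: closure under sums, products and composition is then a plain induction.\<close>

primrec ck :: "nat \<Rightarrow> (real \<Rightarrow> real) \<Rightarrow> bool" where
  "ck 0 g \<longleftrightarrow> continuous_on UNIV g"
| "ck (Suc k) g \<longleftrightarrow> (\<exists>g'. (\<forall>x. (g has_real_derivative g' x) (at x)) \<and> ck k g')"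

lemma ck_continuous: "ck k g \<Longrightarrow> continuous_on UNIV g"
proof (cases k)
  case (Suc m)
  assume "ck k g"
  then obtain g' where "\<forall>x. (g has_real_derivative g' x) (at x)" using Suc by auto
  then show ?thesis by (meson DERIV_isCont continuous_at_imp_continuous_on)
qed simp

lemma ck_Suc_D: "ck (Suc k) g \<Longrightarrow> ck k g"
proof (induction k arbitrary: g)
  case 0
  then show ?case using ck_continuous[of "Suc 0" g] by simp
next
  case (Suc k)
  then obtain g' where "\<forall>x. (g has_real_derivative g' x) (at x)" "ck (Suc k) g'" by auto
  with Suc.IH[of g'] show ?case by auto
qed

lemma ck_const: "ck k (\<lambda>_. c)"
proof (induction k arbitrary: c)
  case (Suc k)
  show ?case unfolding ck.simps by (intro exI[of _ "\<lambda>_. 0"] conjI allI Suc) simp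
qed simp

lemma ck_ident: "ck k (\<lambda>x. x)"
proof (cases k)
  case (Suc m)
  show ?thesis unfolding Suc ck.simps by (intro exI[of _ "\<lambda>_. 1"] conjI allI ck_const) simp
qed (simp add: continuous_on_id)

lemma ck_add: "ck k g \<Longrightarrow> ck k h \<Longrightarrow> ck k (\<lambda>x. g x + h x)"
proof (induction k arbitrary: g h)
  case (Suc k)
  then obtain g' h' where d: "\<forall>x. (g has_real_derivative g' x) (at x)" "ck k g'" "\<forall>x. (h has_real_derivative h' x) (at x)" "ck k h'" by auto
  have "\<forall>x. ((\<lambda>x. g x + h x) has_real_derivative g' x + h' x) (at x)" using d by (auto intro: DERIV_add)
  then show ?case using Suc.IH[OF d(2,4)] unfolding ck.simps by (intro exI conjI)
qed (auto intro: continuous_on_add)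

lemma ck_mult: "ck k g \<Longrightarrow> ck k h \<Longrightarrow> ck k (\<lambda>x. g x * h x)"
proof (induction k arbitrary: g h)
  case (Suc k)
  then obtain g' h' where d: "\<forall>x. (g has_real_derivative g' x) (at x)" "ck k g'" "\<forall>x. (h has_real_derivative h' x) (at x)" "ck k h'" by auto
  have "\<forall>x. ((\<lambda>x. g x * h x) has_real_derivative g' x * h x + h' x * g x) (at x)" using d by (auto intro: DERIV_mult)
  moreover have "ck k (\<lambda>x. g' x * h x + h' x * g x)"
    by (intro ck_add Suc.IH d ck_Suc_D[OF Suc.prems(1)] ck_Suc_D[OF Suc.prems(2)])
  ultimately show ?case unfolding ck.simps by (intro exI conjI)
qed (auto intro: continuous_on_mult)

lemma ck_compose: "ck k g \<Longrightarrow> ck k h \<Longrightarrow> ck k (\<lambda>x. g (h x))"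
proof (induction k arbitrary: g h)
  case 0
  then show ?case by (auto intro: continuous_on_compose2)
next
  case (Suc k)
  then obtain g' h' where d: "\<forall>x. (g has_real_derivative g' x) (at x)" "ck k g'" "\<forall>x. (h has_real_derivative h' x) (at x)" "ck k h'" by auto
  have "\<forall>x. ((\<lambda>x. g (h x)) has_real_derivative g' (h x) * h' x) (at x)" using d by (auto intro: DERIV_chain2)
  moreover have "ck k (\<lambda>x. g' (h x) * h' x)"
    by (rule ck_mult[OF Suc.IH[OF d(2) ck_Suc_D[OF Suc.prems(2)]] d(4)])
  ultimately show ?case unfolding ck.simps by (intro exI conjI)
qed

lemma ck_power: "ck k g \<Longrightarrow> ck k (\<lambda>x. g x ^ m)"
  by (induction m) (auto intro: ck_const ck_mult)

lemma ck_cmult: "ck k g \<Longrightarrow> ck k (\<lambda>x. c * g x)"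
  by (intro ck_mult ck_const)

lemma positive_part_power_deriv:
  "((\<lambda>y::real. max 0 y ^ Suc (Suc m)) has_real_derivative real (Suc (Suc m)) * max 0 y ^ Suc m) (at y)"
proof -
  consider "y < 0" | "y > 0" | "y = 0" by linarith
  then show ?thesis
  proof cases
    case 1
    have "((\<lambda>_::real. 0::real) has_real_derivative 0) (at y)" by simp
    then have "((\<lambda>y::real. max 0 y ^ Suc (Suc m)) has_real_derivative 0) (at y)"
      by (rule has_field_derivative_transform_within_open[of _ _ _ "{..<0}"]) (use 1 in auto)
    then show ?thesis using 1 by simp
  next
    case 2
    have "((\<lambda>y::real. y ^ Suc (Suc m)) has_real_derivative real (Suc (Suc m)) * y ^ Suc m) (at y)"
      using DERIV_pow[of "Suc (Suc m)" y] by simp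
    then have "((\<lambda>y::real. max 0 y ^ Suc (Suc m)) has_real_derivative real (Suc (Suc m)) * y ^ Suc m) (at y)"
      by (rule has_field_derivative_transform_within_open[of _ _ _ "{0<..}"]) (use 2 in auto)
    then show ?thesis using 2 by simp
  next
    case 3
    have "((\<lambda>h::real. (max 0 (0 + h) ^ Suc (Suc m) - max 0 0 ^ Suc (Suc m)) / h) \<longlongrightarrow> 0) (at 0)"
    proof (rule Lim_null_comparison)
      have "norm ((max 0 (0 + h) ^ Suc (Suc m) - max 0 0 ^ Suc (Suc m)) / h) \<le> \<bar>h\<bar> ^ Suc m" for h :: real
      proof (cases "h > 0")
        case True
        then show ?thesis by (simp add: abs_mult)
      next
        case False
        then have "max 0 (0 + h) = 0" by simp
        then have "(max 0 (0 + h) ^ Suc (Suc m) - max 0 0 ^ Suc (Suc m)) / h = 0" by (simp only:) simp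
        then show ?thesis by (simp only:) simp
      qed
      then show "\<forall>\<^sub>F h in at 0. norm ((max 0 (0 + h) ^ Suc (Suc m) - max 0 0 ^ Suc (Suc m)) / h) \<le> \<bar>h\<bar> ^ Suc m" for h :: real
        by simp
      have "((\<lambda>h::real. \<bar>h\<bar> ^ Suc m) \<longlongrightarrow> \<bar>0\<bar> ^ Suc m) (at 0)" by (intro tendsto_intros)
      then show "((\<lambda>h::real. \<bar>h\<bar> ^ Suc m) \<longlongrightarrow> 0) (at 0)" by simp
    qed
    then show ?thesis using 3 unfolding DERIV_def by simp
  qed
qed

text \<open>Each derivative of a power of the positive part is a multiple of the next lower power.
  These functions are the building blocks of the cutoff.\<close>

lemma ck_positive_part_power: "ck k (\<lambda>y::real. max 0 y ^ Suc k)"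
proof (induction k)
  case 0
  show ?case by (auto intro!: continuous_intros)
next
  case (Suc k)
  then have "ck k (\<lambda>y::real. real (Suc (Suc k)) * max 0 y ^ Suc k)" by (rule ck_cmult)
  then show ?case unfolding ck.simps by (intro exI[of _ "\<lambda>y. real (Suc (Suc k)) * max 0 y ^ Suc k"] conjI allI positive_part_power_deriv)
qed

lemma ck_smooth: "smooth_real f \<Longrightarrow> ck k ((deriv ^^ i) f)"
proof (induction k arbitrary: i)
  case 0
  then show ?case unfolding smooth_real_def
    by (auto intro!: continuous_at_imp_continuous_on differentiable_imp_continuous_within)
next
  case (Suc k)
  have "\<forall>x. (((deriv ^^ i) f) has_real_derivative ((deriv ^^ Suc i) f) x) (at x)"
    using Suc.prems unfolding smooth_real_def by (auto simp: DERIV_deriv_iff_real_differentiable)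
  then show ?case using Suc.IH[OF Suc.prems, of "Suc i"] unfolding ck.simps by (intro exI conjI)
qed

lemma ck_deriv_sequence:
  "ck q g \<Longrightarrow> \<exists>\<phi>. \<phi> 0 = g \<and> (\<forall>k<q. \<forall>x. (\<phi> k has_real_derivative \<phi> (Suc k) x) (at x)) \<and> (\<forall>k\<le>q. continuous_on UNIV (\<phi> k))"
proof (induction q arbitrary: g)
  case 0
  then show ?case by (intro exI[of _ "\<lambda>_. g"]) simp
next
  case (Suc q)
  from Suc.prems obtain g' where g': "\<forall>x. (g has_real_derivative g' x) (at x)" "ck q g'" by auto
  from Suc.IH[OF g'(2)] obtain \<phi> where \<phi>: "\<phi> 0 = g'" "\<forall>k<q. \<forall>x. (\<phi> k has_real_derivative \<phi> (Suc k) x) (at x)" "\<forall>k\<le>q. continuous_on UNIV (\<phi> k)" by blast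
  define \<psi> where "\<psi> k = (case k of 0 \<Rightarrow> g | Suc i \<Rightarrow> \<phi> i)" for k
  have "\<psi> 0 = g" unfolding \<psi>_def by simp
  moreover have "(\<psi> k has_real_derivative \<psi> (Suc k) x) (at x)" if "k < Suc q" for k x
    using that g' \<phi> unfolding \<psi>_def by (cases k) auto
  moreover have "continuous_on UNIV (\<psi> k)" if "k \<le> Suc q" for k
    using that \<phi> ck_continuous[OF Suc.prems] unfolding \<psi>_def by (cases k) auto
  ultimately show ?case by (intro exI[of _ \<psi>]) auto
qed

text \<open>f is multiplied by a cutoff of class C^q. Inside (-K, K) the derivatives are those of f,
  beyond K + 1 they vanish, and in between compactness bounds them.\<close>

lemma smooth_truncation:
  assumes f: "smooth_real f" and K: "K > 0"
  obtains \<phi> C where "bounded_derivs q \<phi> C" "\<And>k x. k \<le> q \<Longrightarrow> \<bar>x\<bar> < K \<Longrightarrow> \<phi> k x = (deriv ^^ k) f x"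
proof -
  \<comment> \<open>The inner positive part vanishes for |x| < K. For |x| > K + 1 it is at least 1,
    since then x^2 - K^2 >= 2K + 1, and the outer positive part cuts off.\<close>
  define \<eta> where "\<eta> x = max 0 (1 - max 0 (x\<^sup>2 - K\<^sup>2) ^ Suc q) ^ Suc q" for x :: real
  have "ck q (\<lambda>x. x\<^sup>2 + - (K\<^sup>2))" by (intro ck_add ck_power ck_ident ck_const)
  from ck_compose[OF ck_positive_part_power this]
  have "ck q (\<lambda>x. 1 + (-1) * max 0 (x\<^sup>2 + - (K\<^sup>2)) ^ Suc q)" by (intro ck_add ck_cmult ck_const)
  from ck_compose[OF ck_positive_part_power this]
  have "ck q \<eta>" unfolding \<eta>_def[abs_def] by simp
  moreover have "ck q f" using ck_smooth[OF f, of q 0] by simp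
  ultimately have "ck q (\<lambda>x. f x * \<eta> x)" by (intro ck_mult)
  from ck_deriv_sequence[OF this] obtain \<phi> where \<phi>: "\<phi> 0 = (\<lambda>x. f x * \<eta> x)"
    "\<And>k x. k < q \<Longrightarrow> (\<phi> k has_real_derivative \<phi> (Suc k) x) (at x)" "\<And>k. k \<le> q \<Longrightarrow> continuous_on UNIV (\<phi> k)" by blast
  define L where "L = K + 1"
  have \<eta>1: "\<eta> x = 1" if "\<bar>x\<bar> < K" for x
  proof -
    have "x\<^sup>2 \<le> K\<^sup>2" using that K by (intro abs_le_square_iff[THEN iffD1]) simp
    then show ?thesis unfolding \<eta>_def by simp
  qed
  have \<eta>0: "\<eta> x = 0" if "L < \<bar>x\<bar>" for x
  proof -
    have "L\<^sup>2 \<le> \<bar>x\<bar>\<^sup>2" using that K unfolding L_def by (intro power_mono) auto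
    moreover have "L\<^sup>2 = K\<^sup>2 + 2 * K + 1" unfolding L_def by (simp add: power2_sum)
    ultimately have "x\<^sup>2 - K\<^sup>2 \<ge> 1" using K by simp
    then have "max 0 (x\<^sup>2 - K\<^sup>2) ^ Suc q \<ge> 1" by (intro one_le_power) auto
    then show ?thesis unfolding \<eta>_def by simp
  qed
  have agree: "\<phi> k x = (deriv ^^ k) f x" if "k \<le> q" "\<bar>x\<bar> < K" for k x
    using that
  proof (induction k arbitrary: x)
    case 0
    then show ?case using \<phi>(1) \<eta>1 by simp
  next
    case (Suc k)
    have "(\<phi> k has_real_derivative \<phi> (Suc k) x) (at x)" using \<phi>(2) Suc.prems by simp
    then have "((deriv ^^ k) f has_real_derivative \<phi> (Suc k) x) (at x)"
      by (rule has_field_derivative_transform_within_open[of _ _ _ "{-K<..<K}"]) (use Suc in \<open>auto simp: abs_less_iff\<close>)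
    then show ?case using DERIV_imp_deriv by fastforce
  qed
  have zero: "\<phi> k x = 0" if "k \<le> q" "L < \<bar>x\<bar>" for k x
    using that
  proof (induction k arbitrary: x)
    case 0
    then show ?case using \<phi>(1) \<eta>0 by simp
  next
    case (Suc k)
    have o: "open {x. L < \<bar>x\<bar>}" by (intro open_Collect_less continuous_intros)
    have "(\<phi> k has_real_derivative \<phi> (Suc k) x) (at x)" using \<phi>(2) Suc.prems by simp
    then have "((\<lambda>_. 0) has_real_derivative \<phi> (Suc k) x) (at x)"
      by (rule has_field_derivative_transform_within_open[OF _ o]) (use Suc in auto)
    then show ?case using DERIV_unique[OF _ DERIV_const] by blast
  qed
  have "\<exists>C. \<forall>x. \<bar>\<phi> k x\<bar> \<le> C" if "k \<le> q" for k
  proof -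
    have "compact (\<phi> k ` {-L..L})"
      by (intro compact_continuous_image continuous_on_subset[OF \<phi>(3)[OF that]]) auto
    then obtain C where C: "\<forall>y\<in>\<phi> k ` {-L..L}. norm y \<le> C" using compact_imp_bounded bounded_iff by metis
    have "\<bar>\<phi> k x\<bar> \<le> max C 0" for x
    proof (cases "L < \<bar>x\<bar>")
      case True
      then show ?thesis using zero[OF that] by simp
    next
      case False
      then have "x \<in> {-L..L}" by auto
      then have "norm (\<phi> k x) \<le> C" using C by blast
      then show ?thesis by simp
    qed
    then show ?thesis by blast
  qed
  then have "\<forall>k\<in>{..q}. \<exists>C. \<forall>x. \<bar>\<phi> k x\<bar> \<le> C" by blast
  from bchoice[OF this] obtain C where C: "\<And>k x. k \<le> q \<Longrightarrow> \<bar>\<phi> k x\<bar> \<le> C k" by auto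
  have "\<bar>\<phi> k x\<bar> \<le> (\<Sum>k\<le>q. \<bar>C k\<bar>)" if "k \<le> q" for k x
  proof -
    have "\<bar>C k\<bar> \<le> (\<Sum>k\<le>q. \<bar>C k\<bar>)" using that by (intro member_le_sum) auto
    then show ?thesis using C[OF that, of x] by linarith
  qed
  then have "bounded_derivs q \<phi> (\<Sum>k\<le>q. \<bar>C k\<bar>)"
    unfolding bounded_derivs_def using \<phi> by blast
  then show thesis using agree by (rule that)
qed

section \<open>Taylor expansions about the midpoint\<close>

lemma bounded_derivs_taylor:
  assumes \<phi>: "bounded_derivs q \<phi> C" and kn: "k + n \<le> q"
  shows "\<bar>\<phi> k (m + x) - (\<Sum>i<n. \<phi> (k + i) m / fact i * x ^ i)\<bar> \<le> C * \<bar>x\<bar> ^ n"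
proof -
  have "\<exists>t. \<bar>t\<bar> \<le> \<bar>x\<bar> \<and> \<phi> k (m + x) = (\<Sum>i<n. \<phi> (k + i) (m + 0) / fact i * x ^ i) + \<phi> (k + n) (m + t) / fact n * x ^ n"
  proof (rule Maclaurin_bi_le[of "\<lambda>i t. \<phi> (k + i) (m + t)" "\<lambda>t. \<phi> k (m + t)"])
    show "\<forall>i t. i < n \<and> \<bar>t\<bar> \<le> \<bar>x\<bar> \<longrightarrow> ((\<lambda>t. \<phi> (k + i) (m + t)) has_real_derivative \<phi> (k + Suc i) (m + t)) (at t)"
    proof (intro allI impI)
      fix i t assume "i < n \<and> \<bar>t\<bar> \<le> \<bar>x\<bar>"
      then have "(\<phi> (k + i) has_real_derivative \<phi> (Suc (k + i)) (m + t)) (at (m + t))"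
        using kn by (intro bounded_derivsD(1)[OF \<phi>]) auto
      then show "((\<lambda>t. \<phi> (k + i) (m + t)) has_real_derivative \<phi> (k + Suc i) (m + t)) (at t)"
        using DERIV_shift[of "\<phi> (k + i)" "\<phi> (Suc (k + i)) (m + t)" t m] by (simp add: add.commute)
    qed
  qed simp
  then obtain t where "\<phi> k (m + x) = (\<Sum>i<n. \<phi> (k + i) (m + 0) / fact i * x ^ i) + \<phi> (k + n) (m + t) / fact n * x ^ n" by blast
  then have t: "\<phi> k (m + x) - (\<Sum>i<n. \<phi> (k + i) m / fact i * x ^ i) = \<phi> (k + n) (m + t) / fact n * x ^ n" by (simp only:) simp
  have "\<bar>\<phi> (k + n) (m + t) / fact n * x ^ n\<bar> = \<bar>\<phi> (k + n) (m + t)\<bar> / fact n * \<bar>x\<bar> ^ n" by (simp add: abs_mult power_abs)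
  also have "\<dots> \<le> C / 1 * \<bar>x\<bar> ^ n"
    using kn by (intro mult_right_mono frac_le bounded_derivsD(2,4)[OF \<phi>] fact_ge_1) auto
  finally show ?thesis unfolding t by simp
qed

lemma odd_power_steps: "x * (x::real)^2 = x^3" "x * x^4 = x^5" "x*x^6=x^7" "x*x^8=x^9"
  using power_Suc[of x 2] power_Suc[of x 4] power_Suc[of x 6] power_Suc[of x 8] by (simp_all del: power_Suc)
text \<open>Symmetry about the midpoint leaves odd powers of x, the cubic terms cancel as Simpson's
  rule is exact for cubics, and x^5 receives 1/36 - 1/60 = 1/90. With h = 2x this becomes 1 / (2^5 *
  90) = 1/2880; the constants for orders 7 and 9 arise alike.\<close>

lemma simpson_identity:
  fixes x d1 d3 d5 d7 d9 R1 R0 :: real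
  shows "(2*x)/6*(R1 + (2*d1 + d3*x^2 + d5/12*x^4 + d7/360*x^6 + d9/20160*x^8) + 4*d1) - (R0 + (2*d1*x + d3/3*x^3 + d5/60*x^5 + d7/2520*x^7 + d9/181440*x^9)) - (d5*(2*x)^5/2880 + ((1/2160 - 1/5040) / 64)*d7*(2*x)^7 + ((1/120960 - 1/362880) / 256)*d9*(2*x)^9) = x/3*R1 - R0"
proof -
  have e: "(2*x)/6*(R1 + (2*d1 + d3*x^2 + d5/12*x^4 + d7/360*x^6 + d9/20160*x^8) + 4*d1) = x/3*R1 + 2*d1*x + d3/3*(x*x^2) + d5/36*(x*x^4) + d7/1080*(x*x^6) + d9/60480*(x*x^8)"
    by (simp add: field_simps)
  show ?thesis unfolding e odd_power_steps power_mult_distrib by (simp add: algebra_simps)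
qed
definition simpson_c7 :: real where "simpson_c7 = (1/2160 - 1/5040) / 64"
definition simpson_c9 :: real where "simpson_c9 = (1/120960 - 1/362880) / 256"

text \<open>The expansion goes to order 11 because n terms of size \<open>sn n ^ 11\<close> add up
  to order \<open>sn n\<close>. The orders 7 and 9 are kept explicitly, since their absolute sums
  diverge and only Hermite cancellation handles them.\<close>

lemma simpson_taylor:
  assumes \<phi>: "bounded_derivs q \<phi> C" and "11 \<le> q"
  shows "\<bar>h / 6 * (\<phi> 1 (m - h/2) + 4 * \<phi> 1 m + \<phi> 1 (m + h/2)) - (\<phi> 0 (m + h/2) - \<phi> 0 (m - h/2))
     - (\<phi> 5 m * h^5 / 2880 + simpson_c7 * \<phi> 7 m * h^7 + simpson_c9 * \<phi> 9 m * h^9)\<bar> \<le> C * \<bar>h\<bar> ^ 11"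
proof -
  define x where "x = h / 2"
  have hx: "h = 2 * x" unfolding x_def by simp
  define r where "r k n y = \<phi> k (m + y) - (\<Sum>i<n. \<phi> (k + i) m / fact i * y ^ i)" for k n y
  have C0: "C \<ge> 0" by (rule bounded_derivsD(4)[OF \<phi>])
  have r0: "\<bar>r 0 11 y\<bar> \<le> C * \<bar>y\<bar> ^ 11" for y unfolding r_def using assms by (intro bounded_derivs_taylor[OF \<phi>]) auto
  have r1: "\<bar>r 1 10 y\<bar> \<le> C * \<bar>y\<bar> ^ 10" for y unfolding r_def using assms by (intro bounded_derivs_taylor[OF \<phi>]) auto
  have e0: "\<phi> 0 (m + y) = r 0 11 y + (\<phi> 0 m + \<phi> 1 m * y + \<phi> 2 m / 2 * y^2 + \<phi> 3 m / 6 * y^3 + \<phi> 4 m / 24 * y^4 + \<phi> 5 m / 120 * y^5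
     + \<phi> 6 m / 720 * y^6 + \<phi> 7 m / 5040 * y^7 + \<phi> 8 m / 40320 * y^8 + \<phi> 9 m / 362880 * y^9 + \<phi> 10 m / 3628800 * y^10)" for y
    unfolding r_def by (simp add: lessThan_nat_numeral fact_numeral numeral_2_eq_2[symmetric])
  have e1: "\<phi> 1 (m + y) = r 1 10 y + (\<phi> 1 m + \<phi> 2 m * y + \<phi> 3 m / 2 * y^2 + \<phi> 4 m / 6 * y^3 + \<phi> 5 m / 24 * y^4 + \<phi> 6 m / 120 * y^5
     + \<phi> 7 m / 720 * y^6 + \<phi> 8 m / 5040 * y^7 + \<phi> 9 m / 40320 * y^8 + \<phi> 10 m / 362880 * y^9)" for y
    unfolding r_def by (simp add: lessThan_nat_numeral fact_numeral numeral_2_eq_2[symmetric])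
  have eqd: "h / 6 * (\<phi> 1 (m - h/2) + 4 * \<phi> 1 m + \<phi> 1 (m + h/2)) - (\<phi> 0 (m + h/2) - \<phi> 0 (m - h/2))
     - (\<phi> 5 m * h^5 / 2880 + simpson_c7 * \<phi> 7 m * h^7 + simpson_c9 * \<phi> 9 m * h^9)
     = x / 3 * (r 1 10 (- x) + r 1 10 x) - (r 0 11 x - r 0 11 (- x))"
  proof -
    have a: "m + h/2 = m + x" "m - h/2 = m + (- x)" unfolding hx by simp_all
    have S1: "\<phi> 1 (m + (- x)) + \<phi> 1 (m + x) = (r 1 10 (- x) + r 1 10 x) + (2 * \<phi> 1 m + \<phi> 3 m * x^2 + \<phi> 5 m / 12 * x^4 + \<phi> 7 m / 360 * x^6 + \<phi> 9 m / 20160 * x^8)"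
      unfolding e1 by (simp add: algebra_simps)
    have S0: "\<phi> 0 (m + x) - \<phi> 0 (m + (- x)) = (r 0 11 x - r 0 11 (- x)) + (2 * \<phi> 1 m * x + \<phi> 3 m / 3 * x^3 + \<phi> 5 m / 60 * x^5 + \<phi> 7 m / 2520 * x^7 + \<phi> 9 m / 181440 * x^9)"
      unfolding e0 by (simp add: algebra_simps)
    have "\<phi> 1 (m + (- x)) + 4 * \<phi> 1 m + \<phi> 1 (m + x) = (\<phi> 1 (m + (- x)) + \<phi> 1 (m + x)) + 4 * \<phi> 1 m" by simp
    then show ?thesis
      unfolding a unfolding S0 hx simpson_c7_def simpson_c9_def
      using simpson_identity[of x "r 1 10 (- x) + r 1 10 x" "\<phi> 1 m" "\<phi> 3 m" "\<phi> 5 m" "\<phi> 7 m" "\<phi> 9 m" "r 0 11 x - r 0 11 (- x)"]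
      by (simp only: S1)
  qed
  have "\<bar>h / 6 * (\<phi> 1 (m - h/2) + 4 * \<phi> 1 m + \<phi> 1 (m + h/2)) - (\<phi> 0 (m + h/2) - \<phi> 0 (m - h/2))
     - (\<phi> 5 m * h^5 / 2880 + simpson_c7 * \<phi> 7 m * h^7 + simpson_c9 * \<phi> 9 m * h^9)\<bar> \<le> \<bar>x\<bar> / 3 * (\<bar>r 1 10 (- x)\<bar> + \<bar>r 1 10 x\<bar>) + (\<bar>r 0 11 x\<bar> + \<bar>r 0 11 (- x)\<bar>)"
  proof -
    have "\<bar>a * (b + c) - (d - e)\<bar> \<le> \<bar>a\<bar> * (\<bar>b\<bar> + \<bar>c\<bar>) + (\<bar>d\<bar> + \<bar>e\<bar>)" for a b c d e :: real
    proof -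
      have "\<bar>a * (b + c)\<bar> \<le> \<bar>a\<bar> * (\<bar>b\<bar> + \<bar>c\<bar>)" unfolding abs_mult by (intro mult_left_mono) auto
      then show ?thesis by linarith
    qed
    from this[of "x/3"] show ?thesis unfolding eqd by simp
  qed
  also have "\<dots> \<le> \<bar>x\<bar> / 3 * (C * \<bar>x\<bar> ^ 10 + C * \<bar>x\<bar> ^ 10) + (C * \<bar>x\<bar> ^ 11 + C * \<bar>x\<bar> ^ 11)"
    using r0[of x] r0[of "-x"] r1[of x] r1[of "-x"] by (intro add_mono mult_left_mono) auto
  also have "\<dots> = (8/3) * (C * \<bar>x\<bar> ^ 11)" by (simp add: eval_nat_numeral)
  also have "\<dots> \<le> 2 ^ 11 * (C * \<bar>x\<bar> ^ 11)" using C0 by (intro mult_right_mono) auto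
  also have "\<dots> = C * \<bar>h\<bar> ^ 11" unfolding hx by (simp add: abs_mult power_mult_distrib)
  finally show ?thesis .
qed

text \<open>For k = 4 this expresses the linear term with the fifth derivative by an increment of
  the fourth. The coefficients are 1 / (3! 2^2) and 1 / (5! 2^4); the remainder of order 7 together
  with \<open>sn n ^ 4\<close> reaches order 11 again.\<close>

lemma midpoint_taylor:
  assumes \<phi>: "bounded_derivs q \<phi> C" and "k + 7 \<le> q"
  shows "\<bar>\<phi> k (m + h/2) - \<phi> k (m - h/2) - (\<phi> (k+1) m * h + \<phi> (k+3) m * h^3 / 24 + \<phi> (k+5) m * h^5 / 1920)\<bar> \<le> C * \<bar>h\<bar> ^ 7"
proof -
  define x where "x = h / 2"
  have hx: "h = 2 * x" unfolding x_def by simp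
  define r where "r y = \<phi> k (m + y) - (\<Sum>i<7. \<phi> (k + i) m / fact i * y ^ i)" for y
  have C0: "C \<ge> 0" by (rule bounded_derivsD(4)[OF \<phi>])
  have r0: "\<bar>r y\<bar> \<le> C * \<bar>y\<bar> ^ 7" for y unfolding r_def using assms by (intro bounded_derivs_taylor[OF \<phi>]) auto
  have e0: "\<phi> k (m + y) = r y + (\<phi> k m + \<phi> (k+1) m * y + \<phi> (k+2) m / 2 * y^2 + \<phi> (k+3) m / 6 * y^3 + \<phi> (k+4) m / 24 * y^4 + \<phi> (k+5) m / 120 * y^5
     + \<phi> (k+6) m / 720 * y^6)" for y
    unfolding r_def by (simp add: lessThan_nat_numeral fact_numeral numeral_2_eq_2[symmetric])
  have eqd: "\<phi> k (m + h/2) - \<phi> k (m - h/2) - (\<phi> (k+1) m * h + \<phi> (k+3) m * h^3 / 24 + \<phi> (k+5) m * h^5 / 1920) = r x - r (- x)"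
  proof -
    have a: "m + h/2 = m + x" "m - h/2 = m + (- x)" unfolding hx by simp_all
    show ?thesis unfolding a e0 unfolding hx power_mult_distrib by (simp add: algebra_simps)
  qed
  have "\<bar>\<phi> k (m + h/2) - \<phi> k (m - h/2) - (\<phi> (k+1) m * h + \<phi> (k+3) m * h^3 / 24 + \<phi> (k+5) m * h^5 / 1920)\<bar> \<le> C * \<bar>x\<bar> ^ 7 + C * \<bar>x\<bar> ^ 7" unfolding eqd using r0[of x] r0[of "-x"] by simp
  also have "\<dots> = 2 * (C * \<bar>x\<bar> ^ 7)" by simp
  also have "\<dots> \<le> 2 ^ 7 * (C * \<bar>x\<bar> ^ 7)" using C0 by (intro mult_right_mono) auto
  also have "\<dots> = C * \<bar>h\<bar> ^ 7" unfolding hx by (simp add: abs_mult power_mult_distrib)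
  finally show ?thesis .
qed

section \<open>Expansion of the Simpson sums\<close>

lemma bounded_derivs_shift: "bounded_derivs Q \<phi> C \<Longrightarrow> k + q \<le> Q \<Longrightarrow> bounded_derivs q (\<lambda>i. \<phi> (k + i)) C"
  unfolding bounded_derivs_def by auto

text \<open>The cross-covariance of the two endpoints cancels and an increment of u^(1/5) is left,
  so the sum over j telescopes to order \<open>1 / sn n\<close>. With one endpoint alone each term
  would be of order \<open>sn n\<close> and the sum of order \<open>n * sn n\<close>.\<close>

lemma mid_kxi: "mid (real j / real n) (real (Suc j) / real n) (kxi n j) = ((real (Suc j) / real n) powr (1/5) - (real j / real n) powr (1/5)) / (2 * sn n)"
proof -
  define a where "a = real j / real n"
  define b where "b = real (Suc j) / real n"
  have K: "K10 a b = K10 b a" "K10 a a = a powr (1/5)" "K10 b b = b powr (1/5)"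
    using fbm_cov_sym[of "1/10" a b] by (simp_all add: K10_eq)
  have id: "((k - x) / s + (y - k) / s) / 2 = (y - x) / (2 * s)" for k x y s :: real
    by (simp add: add_divide_distrib[symmetric])
  show ?thesis unfolding mid_def kxi_def a_def[symmetric] b_def[symmetric] K id ..
qed

lemma mid_kxi_sum:
  assumes n: "n \<ge> 1" and N: "real N / real n \<le> T"
  shows "(\<Sum>j<N. \<bar>mid (real j / real n) (real (Suc j) / real n) (kxi n j)\<bar>) \<le> T powr (1/5) / (2 * sn n)"
proof -
  have "\<bar>mid (real j / real n) (real (Suc j) / real n) (kxi n j)\<bar> = ((real (Suc j) / real n) powr (1/5) - (real j / real n) powr (1/5)) / (2 * sn n)" for j
  proof -
    have "(real j / real n) powr (1/5) \<le> (real (Suc j) / real n) powr (1/5)"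
      by (intro powr_mono2 divide_right_mono) auto
    then show ?thesis unfolding mid_kxi using sn_pos[OF n] by (intro abs_of_nonneg divide_nonneg_nonneg) auto
  qed
  then have "(\<Sum>j<N. \<bar>mid (real j / real n) (real (Suc j) / real n) (kxi n j)\<bar>)
    = (\<Sum>j<N. ((real (Suc j) / real n) powr (1/5) - (real j / real n) powr (1/5))) / (2 * sn n)"
    by (simp only: sum_divide_distrib)
  also have "\<dots> = ((real N / real n) powr (1/5) - (real 0 / real n) powr (1/5)) / (2 * sn n)"
    by (simp only: sum_lessThan_telescope[of "\<lambda>j. (real j / real n) powr (1/5)" N])
  also have "\<dots> \<le> T powr (1/5) / (2 * sn n)"
  proof (rule divide_right_mono)
    have "(real N / real n) powr (1/5) \<le> T powr (1/5)" using N by (intro powr_mono2) auto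
    then show "(real N / real n) powr (1/5) - (real 0 / real n) powr (1/5) \<le> T powr (1/5)" by simp
  qed (use sn_pos[OF n] in auto)
  finally show ?thesis .
qed

lemma monomial_hermite:
  "x ^ 3 = hermite 3 x + 3 * hermite 1 x"
  "x ^ 5 = hermite 5 x + 10 * hermite 3 x + 15 * hermite 1 x"
  "x ^ 7 = hermite 7 x + 21 * hermite 5 x + 105 * hermite 3 x + 105 * hermite 1 x"
  "x ^ 9 = hermite 9 x + 36 * hermite 7 x + 378 * hermite 5 x + 1260 * hermite 3 x + 945 * hermite 1 x"
  by (simp_all add: eval_nat_numeral algebra_simps)

context fbm10
begin

text \<open>Convergence to 0 in L1. The index starts at 1 because \<open>sn 0 = 0\<close> makes the
  grid degenerate.\<close>

definition negligible :: "(nat \<Rightarrow> 'a \<Rightarrow> real) \<Rightarrow> bool" where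
  "negligible Y \<longleftrightarrow> (\<forall>n\<ge>1. integrable M (Y n)) \<and> (\<lambda>n. \<integral>\<omega>. \<bar>Y n \<omega>\<bar> \<partial>M) \<longlonglongrightarrow> 0"

lemma negligible_le:
  assumes "\<And>n. n \<ge> 1 \<Longrightarrow> integrable M (Y n)" "\<And>n. n \<ge> 1 \<Longrightarrow> (\<integral>\<omega>. \<bar>Y n \<omega>\<bar> \<partial>M) \<le> c n" "c \<longlonglongrightarrow> 0"
  shows "negligible Y"
  unfolding negligible_def
proof (intro conjI allI impI)
  show "(\<lambda>n. \<integral>\<omega>. \<bar>Y n \<omega>\<bar> \<partial>M) \<longlonglongrightarrow> 0"
  proof (rule Lim_null_comparison[OF _ assms(3)])
    show "\<forall>\<^sub>F n in sequentially. norm (\<integral>\<omega>. \<bar>Y n \<omega>\<bar> \<partial>M) \<le> c n"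
      using assms(2) by (intro eventually_sequentiallyI[of 1]) simp
  qed
qed (rule assms(1))

lemma negligible_cong:
  assumes "negligible Y" "\<And>n \<omega>. n \<ge> 1 \<Longrightarrow> Z n \<omega> = Y n \<omega>"
  shows "negligible Z"
proof (rule negligible_le[where c="\<lambda>n. \<integral>\<omega>. \<bar>Y n \<omega>\<bar> \<partial>M"])
  fix n :: nat assume "n \<ge> 1"
  then have "Z n = Y n" using assms(2) by blast
  then show "integrable M (Z n)" "(\<integral>\<omega>. \<bar>Z n \<omega>\<bar> \<partial>M) \<le> (\<integral>\<omega>. \<bar>Y n \<omega>\<bar> \<partial>M)"
    using assms(1) \<open>n \<ge> 1\<close> unfolding negligible_def by auto
qed (use assms(1) in \<open>simp add: negligible_def\<close>)

lemma negligible_add: "negligible Y \<Longrightarrow> negligible Z \<Longrightarrow> negligible (\<lambda>n \<omega>. Y n \<omega> + Z n \<omega>)"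
proof -
  assume Y: "negligible Y" and Z: "negligible Z"
  then have i: "\<And>n. n \<ge> 1 \<Longrightarrow> integrable M (Y n)" "\<And>n. n \<ge> 1 \<Longrightarrow> integrable M (Z n)" unfolding negligible_def by auto
  show ?thesis
  proof (rule negligible_le[where c="\<lambda>n. (\<integral>\<omega>. \<bar>Y n \<omega>\<bar> \<partial>M) + (\<integral>\<omega>. \<bar>Z n \<omega>\<bar> \<partial>M)"])
    fix n :: nat assume n: "n \<ge> 1"
    show "integrable M (\<lambda>\<omega>. Y n \<omega> + Z n \<omega>)" using i n by simp
    have "(\<integral>\<omega>. \<bar>Y n \<omega> + Z n \<omega>\<bar> \<partial>M) \<le> (\<integral>\<omega>. \<bar>Y n \<omega>\<bar> + \<bar>Z n \<omega>\<bar> \<partial>M)"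
      using i n by (intro integral_mono) auto
    then show "(\<integral>\<omega>. \<bar>Y n \<omega> + Z n \<omega>\<bar> \<partial>M) \<le> (\<integral>\<omega>. \<bar>Y n \<omega>\<bar> \<partial>M) + (\<integral>\<omega>. \<bar>Z n \<omega>\<bar> \<partial>M)" using i n by simp
  next
    show "(\<lambda>n. (\<integral>\<omega>. \<bar>Y n \<omega>\<bar> \<partial>M) + (\<integral>\<omega>. \<bar>Z n \<omega>\<bar> \<partial>M)) \<longlonglongrightarrow> 0"
      using Y Z unfolding negligible_def by (intro tendsto_add_zero) auto
  qed
qed

lemma negligible_mult:
  assumes Y: "negligible Y" and c: "\<And>n. n \<ge> 1 \<Longrightarrow> \<bar>c n\<bar> \<le> (K::real)"
  shows "negligible (\<lambda>n \<omega>. c n * Y n \<omega>)"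
proof (rule negligible_le[where c="\<lambda>n. K * (\<integral>\<omega>. \<bar>Y n \<omega>\<bar> \<partial>M)"])
  show "integrable M (\<lambda>\<omega>. c n * Y n \<omega>)" if "n \<ge> 1" for n using Y that unfolding negligible_def by simp
  show "(\<integral>\<omega>. \<bar>c n * Y n \<omega>\<bar> \<partial>M) \<le> K * (\<integral>\<omega>. \<bar>Y n \<omega>\<bar> \<partial>M)" if "n \<ge> 1" for n
    unfolding abs_mult using c[OF that] by (simp add: mult_right_mono)
  show "(\<lambda>n. K * (\<integral>\<omega>. \<bar>Y n \<omega>\<bar> \<partial>M)) \<longlonglongrightarrow> 0"
    using Y unfolding negligible_def by (intro tendsto_mult_right_zero) auto
qed

lemma negligible_cmult: "negligible Y \<Longrightarrow> negligible (\<lambda>n \<omega>. c * Y n \<omega>)"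
  by (rule negligible_mult[where K="\<bar>c\<bar>"]) auto

text \<open>In place of the Cauchy-Schwarz inequality, |y| <= (r + y^2 / r) / 2 with r the square
  root of \<open>sn n\<close> passes from second to first moments.\<close>

lemma negligible_L2:
  assumes m: "\<And>n. n \<ge> 1 \<Longrightarrow> Y n \<in> borel_measurable M" and i: "\<And>n. n \<ge> 1 \<Longrightarrow> integrable M (\<lambda>\<omega>. (Y n \<omega>)\<^sup>2)"
    and b: "\<And>n. n \<ge> 1 \<Longrightarrow> (\<integral>\<omega>. (Y n \<omega>)\<^sup>2 \<partial>M) \<le> c * sn n"
  shows "negligible Y"
proof (rule negligible_le[where c="\<lambda>n. sqrt (sn n) * (1 + c) / 2"])
  fix n :: nat assume n: "n \<ge> 1"
  note m[OF n, measurable]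
  define r where "r = sqrt (sn n)"
  have r: "r > 0" unfolding r_def using sn_pos[OF n] by simp
  have le: "\<bar>y\<bar> \<le> (r + y\<^sup>2 / r) / 2" for y :: real
  proof -
    have "2 * \<bar>y\<bar> * r \<le> \<bar>y\<bar>\<^sup>2 + r\<^sup>2" by (rule sum_squares_bound)
    then have "(2 * \<bar>y\<bar>) * r \<le> (r + y\<^sup>2 / r) * r" using r by (simp add: power2_eq_square distrib_right)
    then show ?thesis using r by (simp only: mult_le_cancel_right_pos) simp
  qed
  have ib: "integrable M (\<lambda>\<omega>. (r + (Y n \<omega>)\<^sup>2 / r) / 2)" using i[OF n] by simp
  show iY: "integrable M (Y n)"
    by (rule Bochner_Integration.integrable_bound[OF ib m[OF n]]) (intro AE_I2, simp only: real_norm_def, rule order_trans[OF le abs_ge_self])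
  have "(\<integral>\<omega>. \<bar>Y n \<omega>\<bar> \<partial>M) \<le> (\<integral>\<omega>. (r + (Y n \<omega>)\<^sup>2 / r) / 2 \<partial>M)"
    using iY ib le by (intro integral_mono) auto
  also have "\<dots> = (r + (\<integral>\<omega>. (Y n \<omega>)\<^sup>2 \<partial>M) / r) / 2" using i[OF n] by (simp add: prob_space)
  also have "\<dots> \<le> (r + (c * sn n) / r) / 2" using b[OF n] r by (intro divide_right_mono add_left_mono) auto
  also have "\<dots> = r * (1 + c) / 2"
  proof -
    have "sn n = r * r" unfolding r_def using sn_pos[OF n] by simp
    then show ?thesis using r by (simp add: distrib_left)
  qed
  finally show "(\<integral>\<omega>. \<bar>Y n \<omega>\<bar> \<partial>M) \<le> sqrt (sn n) * (1 + c) / 2" unfolding r_def .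
next
  have "(\<lambda>n. sqrt (sn n) * (1 + c) / 2) \<longlonglongrightarrow> sqrt 0 * (1 + c) / 2" by (intro tendsto_intros sn_tendsto_0) simp
  then show "(\<lambda>n. sqrt (sn n) * (1 + c) / 2) \<longlonglongrightarrow> 0" by simp
qed

definition midB :: "nat \<Rightarrow> nat \<Rightarrow> 'a \<Rightarrow> real" where
  "midB n j \<omega> = mid (real j / real n) (real (Suc j) / real n) (\<lambda>t. B t \<omega>)"

definition xi :: "nat \<Rightarrow> nat \<Rightarrow> 'a \<Rightarrow> real" where
  "xi n j \<omega> = incr n j (\<lambda>t. B t \<omega>)"

lemma xi_measurable[measurable]: "xi n j \<in> borel_measurable M"
  unfolding xi_def[abs_def] by (rule incr_measurable(2))

lemma midB_measurable[measurable]: "midB n j \<in> borel_measurable M"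
  unfolding midB_def[abs_def] mid_def using B_measurable by auto

lemma B_from_mid:
  assumes "n \<ge> 1"
  shows "B (real j / real n) \<omega> = midB n j \<omega> - (sn n * xi n j \<omega>) / 2" "B (real (Suc j) / real n) \<omega> = midB n j \<omega> + (sn n * xi n j \<omega>) / 2"
  using sn_pos[OF assms] unfolding midB_def mid_def xi_def incr_def by (simp_all add: field_simps)

lemma xi_moment:
  assumes "n \<ge> 1"
  shows "integrable M (\<lambda>\<omega>. \<bar>xi n j \<omega>\<bar> ^ p)" "(\<integral>\<omega>. \<bar>xi n j \<omega>\<bar> ^ p \<partial>M) = normal_abs_moment p"
  unfolding xi_def using centered_gaussian_moment[OF incr_gaussian[OF assms] incr_measurable(2)] by simp_all

end

text \<open>Twenty derivatives cover all estimates below: the most demanding one pairs the ninth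
  derivative with \<open>hermite 9\<close>, which takes eighteen.\<close>

locale truncated = fbm10 M B for M :: "'a measure" and B +
  fixes \<phi> :: "nat \<Rightarrow> real \<Rightarrow> real" and C t :: real
  assumes \<phi>: "bounded_derivs 20 \<phi> C" and t: "t \<ge> 0"
begin

definition T where "T = t + 1"
definition N where "N n = nat \<lfloor>real n * t\<rfloor>"

lemma C0: "C \<ge> 0" by (rule bounded_derivsD(4)[OF \<phi>])

lemma \<phi>_measurable: "k \<le> 20 \<Longrightarrow> \<phi> k \<in> borel_measurable borel"
  by (intro borel_measurable_continuous_onI bounded_derivsD(3)[OF \<phi>])

lemma N_le: "real (N n) \<le> real n * t"
  unfolding N_def using t by (auto simp: of_nat_nat)

lemma N_div: "n \<ge> 1 \<Longrightarrow> real (N n) / real n \<le> t"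
  using N_le[of n] by (simp add: divide_le_eq mult.commute)

lemma N_div_T: "n \<ge> 1 \<Longrightarrow> real (N n) / real n \<le> T"
  using N_div[of n] unfolding T_def by simp

lemma N_sn: "n \<ge> 1 \<Longrightarrow> real (N n) * sn n ^ 10 \<le> T"
  using N_div_T[of n] by (simp add: sn_10)

lemma grid_le: "n \<ge> 1 \<Longrightarrow> j < N n \<Longrightarrow> real (Suc j) / real n \<le> T" "n \<ge> 1 \<Longrightarrow> j < N n \<Longrightarrow> real j / real n \<le> T"
proof -
  assume n: "n \<ge> 1" and j: "j < N n"
  then have "real (Suc j) / real n \<le> real (N n) / real n" by (intro divide_right_mono) auto
  then show 1: "real (Suc j) / real n \<le> T" using N_div_T[OF n] by linarith
  have "real j / real n \<le> real (Suc j) / real n" by (intro divide_right_mono) auto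
  then show "real j / real n \<le> T" using 1 by linarith
qed

definition A where "A k q n \<omega> = (\<Sum>j<N n. \<phi> k (midB n j \<omega>) * hermite q (xi n j \<omega>))"

lemma adm_term:
  assumes "k \<le> 20"
  shows "adm {real j / real n, real (Suc j) / real n} (\<lambda>b. \<phi> k (mid (real j / real n) (real (Suc j) / real n) b))"
  by (rule adm_compose_bounded[where g="\<phi> k" and C=C, OF adm_mid bounded_derivsD(3)[OF \<phi> assms]])
     (simp_all add: bounded_derivsD(2)[OF \<phi> assms])

lemma A_integrable:
  assumes "n \<ge> 1" "k \<le> 20"
  shows "integrable M (\<lambda>\<omega>. (A k q n \<omega>)\<^sup>2)" "A k q n \<in> borel_measurable M"
proof -
  define I where "I = (\<lambda>j. real j / real n) ` {..N n}"
  have I: "finite I" "I \<subseteq> {0..}" unfolding I_def by auto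
  have "adm I (\<lambda>b. (\<Sum>j<N n. \<phi> k (mid (real j / real n) (real (Suc j) / real n) b) * hermite q (incr n j b))\<^sup>2)"
  proof (intro adm_power adm_sum adm_mult adm_hermite)
    fix j assume j: "j \<in> {..<N n}"
    have jI: "real j / real n \<in> I" "real (Suc j) / real n \<in> I" unfolding I_def using j by (auto simp del: of_nat_Suc)
    show "adm I (\<lambda>b. \<phi> k (mid (real j / real n) (real (Suc j) / real n) b))"
      by (rule adm_mono[OF adm_term[OF assms(2)] _ I(1)]) (use jI in simp)
    show "adm I (incr n j)" by (rule adm_incr[OF I(1) jI])
  qed
  from adm_integrable[OF I this] show "integrable M (\<lambda>\<omega>. (A k q n \<omega>)\<^sup>2)"
    unfolding A_def midB_def xi_def .
  note \<phi>_measurable[OF assms(2), measurable]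
  show "A k q n \<in> borel_measurable M" unfolding A_def[abs_def] by measurable
qed

lemma A_L2:
  assumes kq: "k + q \<le> 20" and q: "q = 1 \<or> q \<ge> 3" and n: "n \<ge> 1"
  shows "(\<integral>\<omega>. (A k q n \<omega>)\<^sup>2 \<partial>M) \<le> real (N n) * ((fact q * 2 ^ q * C\<^sup>2 + 4 * (C^2 * cq q) * (4 ^ q * (T powr (1/5) + 4 * T powr (1/5) + 2 * real q))) / sn n)"
proof -
  \<comment> \<open>The minimum with T is inactive for the intervals below \<open>N n\<close>; it
    keeps the points in [0, T] for all other j, over which the locale quantifies too.\<close>
  define pu where "pu = (\<lambda>(e::bool) j. min (real j / real n) T)"
  define pv where "pv = (\<lambda>(e::bool) j. min (real (Suc j) / real n) T)"
  have T1: "T \<ge> 0" unfolding T_def using t by simp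
  have puv: "pu e j = real j / real n" "pv e j = real (Suc j) / real n" if "j < N n" for e j
    unfolding pu_def pv_def using grid_le[OF n that] by (auto simp: min_def)
  interpret wh: weighted_hermite M B n "N n" q "\<lambda>i. \<phi> (k + i)" C T "T powr (1/5)" "C\<^sup>2" 0 pu pv
  proof
    show "bounded_derivs q (\<lambda>i. \<phi> (k + i)) C" by (rule bounded_derivs_shift[OF \<phi> kq])
    show "0 \<le> pu e j" "pu e j \<le> T" "0 \<le> pv e j" "pv e j \<le> T" for e j unfolding pu_def pv_def using T1 by auto
    show "real (N n) / real n \<le> T" by (rule N_div_T[OF n])
    show "(\<Sum>j<N n. \<Sum>e\<in>UNIV. \<bar>mid (pu e j) (pv e j) (kxi n j)\<bar>) \<le> T powr (1/5) / sn n"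
    proof -
      have "(\<Sum>j<N n. \<Sum>e\<in>UNIV. \<bar>mid (pu e j) (pv e j) (kxi n j)\<bar>) = (\<Sum>j<N n. 2 * \<bar>mid (real j / real n) (real (Suc j) / real n) (kxi n j)\<bar>)"
        by (intro sum.cong refl) (simp add: UNIV_bool puv del: of_nat_Suc)
      also have "\<dots> \<le> 2 * (T powr (1/5) / (2 * sn n))"
        unfolding sum_distrib_left[symmetric] by (intro mult_left_mono mid_kxi_sum[OF n N_div_T[OF n]]) simp
      finally show ?thesis by simp
    qed
    fix j assume j: "j < N n"
    have b: "(\<phi> k x)\<^sup>2 \<le> C\<^sup>2" for x using bounded_derivsD(2)[OF \<phi>, of k x] kq C0 by (intro abs_le_square_iff[THEN iffD1]) auto
    have i: "integrable M (\<lambda>\<omega>. (\<phi> k (mid (pu True j) (pv True j) (\<lambda>t. B t \<omega>)))\<^sup>2)"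
    proof (rule integrable_const_bound[where B="C\<^sup>2"])
      have [measurable]: "\<phi> k \<in> borel_measurable borel" using kq by (intro \<phi>_measurable) auto
      have "(\<lambda>\<omega>. (\<phi> k (midB n j \<omega>))\<^sup>2) \<in> borel_measurable M" by measurable
      then show "(\<lambda>\<omega>. (\<phi> k (mid (pu True j) (pv True j) (\<lambda>t. B t \<omega>)))\<^sup>2) \<in> borel_measurable M"
        unfolding puv[OF j] midB_def .
    qed (use b in auto)
    show "(\<integral>\<omega>. (\<phi> (k + 0) (mid (pu True j) (pv True j) (\<lambda>t. B t \<omega>)) - 0 * \<phi> (k + 0) (mid (pu False j) (pv False j) (\<lambda>t. B t \<omega>)))\<^sup>2 \<partial>M) \<le> C\<^sup>2"
      using integral_mono[OF i, of "\<lambda>_. C\<^sup>2"] b by (simp add: prob_space)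
  qed (use n q in auto)
  have \<epsilon>: "wh.\<epsilon> \<le> 1 / sn n"
  proof -
    have "sn n \<le> 1 / sn n" using sn_pos[OF n] sn_le_1[OF n] by (simp add: pos_le_divide_eq mult_le_one)
    then show ?thesis unfolding wh.\<epsilon>_def by simp
  qed
  have s1: "1 \<le> 1 / sn n" using sn_pos[OF n] sn_le_1[OF n] by simp
  have "(\<Sum>j<N n. wh.w j (\<lambda>t. B t \<omega>) * hermite q (incr n j (\<lambda>t. B t \<omega>))) = A k q n \<omega>" for \<omega>
    unfolding A_def midB_def xi_def by (intro sum.cong refl) (simp add: wh.w_def wh.U_def puv del: of_nat_Suc)
  with wh.weighted_hermite_L2
  have "(\<integral>\<omega>. (A k q n \<omega>)\<^sup>2 \<partial>M) \<le> real (N n) * (fact q * 2 ^ q * C\<^sup>2 + 4 * (C^2 * cq q) * (4 ^ q * (T powr (1/5) + 4 * T powr (1/5) + 2 * real q) * wh.\<epsilon>))" by simp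
  also have "\<dots> \<le> real (N n) * (fact q * 2 ^ q * C\<^sup>2 * (1 / sn n) + 4 * (C^2 * cq q) * (4 ^ q * (T powr (1/5) + 4 * T powr (1/5) + 2 * real q) * (1 / sn n)))"
  proof (intro mult_left_mono add_mono \<epsilon>)
    show "fact q * 2 ^ q * C\<^sup>2 \<le> fact q * 2 ^ q * C\<^sup>2 * (1 / sn n)" using mult_left_mono[OF s1, of "fact q * 2 ^ q * C\<^sup>2"] by simp
  qed (use cq_nonneg in auto)
  also have "\<dots> = real (N n) * ((fact q * 2 ^ q * C\<^sup>2 + 4 * (C^2 * cq q) * (4 ^ q * (T powr (1/5) + 4 * T powr (1/5) + 2 * real q))) / sn n)"
    by (simp add: add_divide_distrib)
  finally show ?thesis .
qed

text \<open>One power beyond the critical order is enough even for q = 1: \<open>sn n ^ 12\<close>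
  times N times \<open>1 / sn n\<close> is of order \<open>sn n\<close>.\<close>

lemma A_negligible:
  assumes kq: "k + q \<le> 20" and q: "q = 1 \<or> q \<ge> 3"
  shows "negligible (\<lambda>n \<omega>. sn n ^ 6 * A k q n \<omega>)"
proof -
  define G where "G = fact q * 2 ^ q * C\<^sup>2 + 4 * (C^2 * cq q) * (4 ^ q * (T powr (1/5) + 4 * T powr (1/5) + 2 * real q))"
  have G0: "G \<ge> 0" unfolding G_def using cq_nonneg[of q] by simp
  show ?thesis
  proof (rule negligible_L2[where c="T * G"])
    fix n :: nat assume n: "n \<ge> 1"
    have k: "k \<le> 20" using kq by simp
    note A_integrable[OF n k, measurable]
    show "(\<lambda>\<omega>. sn n ^ 6 * A k q n \<omega>) \<in> borel_measurable M" using A_integrable(2)[OF n k] by simp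
    show "integrable M (\<lambda>\<omega>. (sn n ^ 6 * A k q n \<omega>)\<^sup>2)" unfolding power_mult_distrib using A_integrable(1)[OF n k] by simp
    have "(\<integral>\<omega>. (sn n ^ 6 * A k q n \<omega>)\<^sup>2 \<partial>M) = (sn n ^ 6)\<^sup>2 * (\<integral>\<omega>. (A k q n \<omega>)\<^sup>2 \<partial>M)" unfolding power_mult_distrib by simp
    also have "\<dots> \<le> (sn n ^ 6)\<^sup>2 * (real (N n) * (G / sn n))" using A_L2[OF kq q n] unfolding G_def by (intro mult_left_mono) auto
    also have "\<dots> = (real (N n) * sn n ^ 10) * G * sn n" using sn_pos[OF n] by (simp add: eval_nat_numeral)
    also have "\<dots> \<le> T * G * sn n" using N_sn[OF n] G0 sn_pos[OF n] by (intro mult_right_mono) auto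
    finally show "(\<integral>\<omega>. (sn n ^ 6 * A k q n \<omega>)\<^sup>2 \<partial>M) \<le> T * G * sn n" .
  qed
qed

lemma monomial_negligible:
  assumes Q: "finite Q" "\<And>q. q \<in> Q \<Longrightarrow> k + q \<le> 20 \<and> (q = 1 \<or> q \<ge> 3)" and x: "\<And>x. x ^ p = (\<Sum>q\<in>Q. c q * hermite q x)" and a: "a \<ge> 6"
  shows "negligible (\<lambda>n \<omega>. sn n ^ a * (\<Sum>j<N n. \<phi> k (midB n j \<omega>) * xi n j \<omega> ^ p))"
proof -
  have s: "negligible (\<lambda>n \<omega>. \<Sum>q\<in>S. (c q * sn n ^ (a - 6)) * (sn n ^ 6 * A k q n \<omega>))" if "finite S" "S \<subseteq> Q" for S
    using that
  proof (induction S)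
    case empty
    show ?case unfolding negligible_def by simp
  next
    case (insert q S)
    have "negligible (\<lambda>n \<omega>. (c q * sn n ^ (a - 6)) * (sn n ^ 6 * A k q n \<omega>))"
    proof (rule negligible_mult[where K="\<bar>c q\<bar>"])
      show "negligible (\<lambda>n \<omega>. sn n ^ 6 * A k q n \<omega>)" using Q(2)[of q] insert by (intro A_negligible) auto
      fix n :: nat assume "n \<ge> 1"
      then have "sn n ^ (a-6) \<le> 1" "0 \<le> sn n ^ (a-6)" using sn_pos[of n] sn_le_1[of n] by (auto intro: power_le_one)
      then show "\<bar>c q * sn n ^ (a - 6)\<bar> \<le> \<bar>c q\<bar>" unfolding abs_mult by (simp add: mult_left_le)
    qed
    from negligible_add[OF this insert.IH] insert show ?case by simp
  qed
  have "sn n ^ a * (\<Sum>j<N n. \<phi> k (midB n j \<omega>) * xi n j \<omega> ^ p) = (\<Sum>q\<in>Q. (c q * sn n ^ (a - 6)) * (sn n ^ 6 * A k q n \<omega>))" for n \<omega>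
  proof -
    have sa: "sn n ^ a = sn n ^ (a - 6) * sn n ^ 6" using a by (simp add: power_add[symmetric])
    have "(\<Sum>j<N n. \<phi> k (midB n j \<omega>) * xi n j \<omega> ^ p) = (\<Sum>j<N n. \<Sum>q\<in>Q. c q * (\<phi> k (midB n j \<omega>) * hermite q (xi n j \<omega>)))"
      unfolding x by (intro sum.cong refl) (simp add: sum_distrib_left mult_ac)
    also have "\<dots> = (\<Sum>q\<in>Q. c q * A k q n \<omega>)" unfolding A_def sum_distrib_left by (rule sum.swap)
    finally show ?thesis unfolding sa by (simp add: sum_distrib_left mult_ac)
  qed
  then show ?thesis using s[OF Q(1) subset_refl] by (simp only:)
qed

text \<open>No cancellation is used: at most about n T terms of size \<open>sn n ^ 11\<close> with
  bounded moments give order \<open>sn n\<close>.\<close>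

lemma power_sum_negligible:
  assumes Y: "\<And>n. n \<ge> 1 \<Longrightarrow> Y n \<in> borel_measurable M" and b: "\<And>n \<omega>. n \<ge> 1 \<Longrightarrow> \<bar>Y n \<omega>\<bar> \<le> C * sn n ^ 11 * (\<Sum>j<N n. \<bar>xi n j \<omega>\<bar> ^ p)"
  shows "negligible Y"
proof (rule negligible_le[where c="\<lambda>n. C * T * normal_abs_moment p * sn n"])
  fix n :: nat assume n: "n \<ge> 1"
  have i: "integrable M (\<lambda>\<omega>. C * sn n ^ 11 * (\<Sum>j<N n. \<bar>xi n j \<omega>\<bar> ^ p))"
    using xi_moment(1)[OF n] by (intro integrable_mult_right Bochner_Integration.integrable_sum)
  show iY: "integrable M (Y n)"
    by (rule Bochner_Integration.integrable_bound[OF i Y[OF n]]) (use b[OF n] in \<open>auto intro!: AE_I2 order_trans[OF b[OF n] abs_ge_self]\<close>)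
  have "(\<integral>\<omega>. \<bar>Y n \<omega>\<bar> \<partial>M) \<le> (\<integral>\<omega>. C * sn n ^ 11 * (\<Sum>j<N n. \<bar>xi n j \<omega>\<bar> ^ p) \<partial>M)"
    using iY i b[OF n] by (intro integral_mono) auto
  also have "\<dots> = C * sn n ^ 11 * (real (N n) * normal_abs_moment p)"
    using xi_moment[OF n] by simp
  also have "\<dots> = C * normal_abs_moment p * sn n * (real (N n) * sn n ^ 10)" by (simp add: eval_nat_numeral)
  also have "\<dots> \<le> C * normal_abs_moment p * sn n * T"
    using C0 normal_abs_moment_nonneg sn_pos[OF n] by (intro mult_left_mono N_sn[OF n]) auto
  finally show "(\<integral>\<omega>. \<bar>Y n \<omega>\<bar> \<partial>M) \<le> C * T * normal_abs_moment p * sn n" by (simp add: mult_ac)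
next
  show "(\<lambda>n. C * T * normal_abs_moment p * sn n) \<longlonglongrightarrow> 0" by (rule tendsto_mult_right_zero[OF sn_tendsto_0])
qed

definition simpson where
  "simpson n \<omega> = (\<Sum>j<N n. (1/6) * (\<phi> 1 (B (real j / real n) \<omega>) + 4 * \<phi> 1 (midB n j \<omega>) + \<phi> 1 (B (real (Suc j) / real n) \<omega>))
     * (B (real (Suc j) / real n) \<omega> - B (real j / real n) \<omega>))"

definition Wf where "Wf n \<omega> = sn n ^ 5 * (\<Sum>j<N n. \<phi> 5 (midB n j \<omega>) * pd 0 (xi n j \<omega>))"

lemma B_telescope: "(\<Sum>j<N n. \<phi> k (B (real (Suc j) / real n) \<omega>) - \<phi> k (B (real j / real n) \<omega>)) = \<phi> k (B (real (N n) / real n) \<omega>) - \<phi> k (B 0 \<omega>)"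
  using sum_lessThan_telescope[of "\<lambda>j. \<phi> k (B (real j / real n) \<omega>)" "N n"] by simp

text \<open>Sum of \<open>simpson_taylor\<close> over the grid. At order 5, \<open>Wf\<close> is
  what remains after the component of degree 1 has been exchanged, through
  \<open>midpoint_taylor\<close>, for an increment of the fourth derivative over the whole time
  interval.\<close>

theorem simpson_expansion:
  "negligible (\<lambda>n \<omega>. simpson n \<omega> - (\<phi> 0 (B (real (N n) / real n) \<omega>) - \<phi> 0 (B 0 \<omega>)) - 1/2880 * Wf n \<omega>)"
proof -
  define h where "h n j \<omega> = sn n * xi n j \<omega>" for n j \<omega>
  define P where "P k p n \<omega> = (\<Sum>j<N n. \<phi> k (midB n j \<omega>) * xi n j \<omega> ^ p)" for k p n \<omega>
  define e1 where "e1 n j \<omega> = h n j \<omega> / 6 * (\<phi> 1 (midB n j \<omega> - h n j \<omega> / 2) + 4 * \<phi> 1 (midB n j \<omega>) + \<phi> 1 (midB n j \<omega> + h n j \<omega> / 2))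
     - (\<phi> 0 (midB n j \<omega> + h n j \<omega> / 2) - \<phi> 0 (midB n j \<omega> - h n j \<omega> / 2))
     - (\<phi> 5 (midB n j \<omega>) * h n j \<omega> ^ 5 / 2880 + simpson_c7 * \<phi> 7 (midB n j \<omega>) * h n j \<omega> ^ 7 + simpson_c9 * \<phi> 9 (midB n j \<omega>) * h n j \<omega> ^ 9)" for n j \<omega>
  define e2 where "e2 n j \<omega> = \<phi> 4 (midB n j \<omega> + h n j \<omega> / 2) - \<phi> 4 (midB n j \<omega> - h n j \<omega> / 2)
     - (\<phi> (4+1) (midB n j \<omega>) * h n j \<omega> + \<phi> (4+3) (midB n j \<omega>) * h n j \<omega> ^ 3 / 24 + \<phi> (4+5) (midB n j \<omega>) * h n j \<omega> ^ 5 / 1920)" for n j \<omega>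
  have [measurable]: "\<phi> 0 \<in> borel_measurable borel" "\<phi> 1 \<in> borel_measurable borel" "\<phi> 4 \<in> borel_measurable borel" "\<phi> 5 \<in> borel_measurable borel" "\<phi> 7 \<in> borel_measurable borel" "\<phi> 9 \<in> borel_measurable borel"
    by (intro \<phi>_measurable; simp)+
  have hm[measurable]: "h n j \<in> borel_measurable M" for n j unfolding h_def[abs_def] by measurable
  have e1b: "\<bar>e1 n j \<omega>\<bar> \<le> C * \<bar>h n j \<omega>\<bar> ^ 11" for n j \<omega> unfolding e1_def by (rule simpson_taylor[OF \<phi>]) simp
  have e2b: "\<bar>e2 n j \<omega>\<bar> \<le> C * \<bar>h n j \<omega>\<bar> ^ 7" for n j \<omega> unfolding e2_def by (rule midpoint_taylor[OF \<phi>]) simp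
  have hp: "C * \<bar>h n j \<omega>\<bar> ^ p = C * sn n ^ p * \<bar>xi n j \<omega>\<bar> ^ p" if "n \<ge> 1" for n j \<omega> p
    unfolding h_def using sn_pos[OF that] by (simp add: abs_mult power_mult_distrib)
  have n1: "negligible (\<lambda>n \<omega>. \<Sum>j<N n. e1 n j \<omega>)"
  proof (rule power_sum_negligible[where p=11])
    show "(\<lambda>\<omega>. \<Sum>j<N n. e1 n j \<omega>) \<in> borel_measurable M" for n unfolding e1_def by measurable
    show "\<bar>\<Sum>j<N n. e1 n j \<omega>\<bar> \<le> C * sn n ^ 11 * (\<Sum>j<N n. \<bar>xi n j \<omega>\<bar> ^ 11)" if "n \<ge> 1" for n \<omega>
      unfolding sum_distrib_left using e1b[of n _ \<omega>] unfolding hp[OF that] by (intro order_trans[OF sum_abs] sum_mono)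
  qed
  have n2: "negligible (\<lambda>n \<omega>. sn n ^ 4 * (\<Sum>j<N n. e2 n j \<omega>))"
  proof (rule power_sum_negligible[where p=7])
    show "(\<lambda>\<omega>. sn n ^ 4 * (\<Sum>j<N n. e2 n j \<omega>)) \<in> borel_measurable M" for n unfolding e2_def by (simp del: One_nat_def) measurable
    show "\<bar>sn n ^ 4 * (\<Sum>j<N n. e2 n j \<omega>)\<bar> \<le> C * sn n ^ 11 * (\<Sum>j<N n. \<bar>xi n j \<omega>\<bar> ^ 7)" if "n \<ge> 1" for n \<omega>
    proof -
      have "\<bar>\<Sum>j<N n. e2 n j \<omega>\<bar> \<le> C * sn n ^ 7 * (\<Sum>j<N n. \<bar>xi n j \<omega>\<bar> ^ 7)"
        unfolding sum_distrib_left using e2b[of n _ \<omega>] unfolding hp[OF that] by (intro order_trans[OF sum_abs] sum_mono)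
      then have "sn n ^ 4 * \<bar>\<Sum>j<N n. e2 n j \<omega>\<bar> \<le> sn n ^ 4 * (C * sn n ^ 7 * (\<Sum>j<N n. \<bar>xi n j \<omega>\<bar> ^ 7))"
        using sn_pos[OF that] by (intro mult_left_mono) auto
      also have "\<dots> = C * (sn n ^ 4 * sn n ^ 7) * (\<Sum>j<N n. \<bar>xi n j \<omega>\<bar> ^ 7)" by simp
      also have "sn n ^ 4 * sn n ^ 7 = sn n ^ 11" by (simp add: power_add[symmetric])
      finally show ?thesis using sn_pos[OF that] by (simp add: abs_mult)
    qed
  qed
  have p7: "negligible (\<lambda>n \<omega>. sn n ^ 7 * P 7 7 n \<omega>)" unfolding P_def
    by (rule monomial_negligible[where Q="{7,5,3,1}" and c="\<lambda>q. if q = 7 then 1 else if q = 5 then 21 else 105"]) (auto simp: monomial_hermite(3))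
  have p9: "negligible (\<lambda>n \<omega>. sn n ^ 9 * P 9 9 n \<omega>)" unfolding P_def
    by (rule monomial_negligible[where Q="{9,7,5,3,1}" and c="\<lambda>q. if q = 9 then 1 else if q = 7 then 36 else if q = 5 then 378 else if q = 3 then 1260 else 945"]) (auto simp: monomial_hermite(4))
  have p3: "negligible (\<lambda>n \<omega>. sn n ^ 7 * P 7 3 n \<omega>)" unfolding P_def
    by (rule monomial_negligible[where Q="{3,1}" and c="\<lambda>q. if q = 3 then 1 else 3"]) (auto simp: monomial_hermite(1))
  have p5: "negligible (\<lambda>n \<omega>. sn n ^ 9 * P 9 5 n \<omega>)" unfolding P_def
    by (rule monomial_negligible[where Q="{5,3,1}" and c="\<lambda>q. if q = 5 then 1 else if q = 3 then 10 else 15"]) (auto simp: monomial_hermite(2))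
  \<comment> \<open>The telescoped sum is at most 2 C in absolute value for every n, so the factor
    \<open>sn n ^ 4\<close> alone makes it negligible.\<close>
  define D4 where "D4 n \<omega> = \<phi> 4 (B (real (N n) / real n) \<omega>) - \<phi> 4 (B 0 \<omega>)" for n \<omega>
  have n4: "negligible (\<lambda>n \<omega>. sn n ^ 4 * D4 n \<omega>)"
  proof (rule negligible_le[where c="\<lambda>n. sn n ^ 4 * (2 * C)"])
    fix n :: nat assume n: "n \<ge> 1"
    have b: "\<bar>D4 n \<omega>\<bar> \<le> 2 * C" for \<omega>
      using bounded_derivsD(2)[OF \<phi>, of 4 "B (real (N n) / real n) \<omega>"] bounded_derivsD(2)[OF \<phi>, of 4 "B 0 \<omega>"] unfolding D4_def by simp
    have b': "\<bar>sn n ^ 4 * D4 n \<omega>\<bar> \<le> sn n ^ 4 * (2 * C)" for \<omega>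
      unfolding abs_mult using sn_pos[OF n] b[of \<omega>] by (simp add: mult_left_mono)
    have [measurable]: "B (real (N n) / real n) \<in> borel_measurable M" "B 0 \<in> borel_measurable M" by (intro B_measurable; simp)+
    show i: "integrable M (\<lambda>\<omega>. sn n ^ 4 * D4 n \<omega>)"
      by (rule integrable_const_bound[where B="sn n ^ 4 * (2 * C)"]) (use b' in \<open>auto simp: D4_def\<close>)
    show "(\<integral>\<omega>. \<bar>sn n ^ 4 * D4 n \<omega>\<bar> \<partial>M) \<le> sn n ^ 4 * (2 * C)"
      using integral_mono[OF integrable_abs[OF i], of "\<lambda>_. sn n ^ 4 * (2 * C)"] b' by (simp add: prob_space)
  next
    have "(\<lambda>n. sn n ^ 4 * (2 * C)) \<longlonglongrightarrow> 0 ^ 4 * (2 * C)" by (intro tendsto_intros sn_tendsto_0)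
    then show "(\<lambda>n. sn n ^ 4 * (2 * C)) \<longlonglongrightarrow> 0" by simp
  qed
  \<comment> \<open>1/192 is 15/2880, the weight of the linear part of x^5. Solving
    \<open>midpoint_taylor\<close> for that part divides it by 24 and 1920, whence 4608 = 192 * 24
    and 368640 = 192 * 1920.\<close>
  have eq: "simpson n \<omega> - (\<phi> 0 (B (real (N n) / real n) \<omega>) - \<phi> 0 (B 0 \<omega>)) - 1/2880 * Wf n \<omega>
    = (\<Sum>j<N n. e1 n j \<omega>) + (simpson_c7 * (sn n ^ 7 * P 7 7 n \<omega>) + (simpson_c9 * (sn n ^ 9 * P 9 9 n \<omega>)
      + (1/192 * (sn n ^ 4 * D4 n \<omega>) + ((-1/192) * (sn n ^ 4 * (\<Sum>j<N n. e2 n j \<omega>)) + ((-1/4608) * (sn n ^ 7 * P 7 3 n \<omega>) + (-1/368640) * (sn n ^ 9 * P 9 5 n \<omega>))))))"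
    if n: "n \<ge> 1" for n \<omega>
  proof -
    note Bm = B_from_mid[OF n, of _ \<omega>, folded h_def]
    have S1: "simpson n \<omega> - (\<phi> 0 (B (real (N n) / real n) \<omega>) - \<phi> 0 (B 0 \<omega>)) =
      (\<Sum>j<N n. e1 n j \<omega>) + (1/2880 * (sn n ^ 5 * P 5 5 n \<omega>) + simpson_c7 * (sn n ^ 7 * P 7 7 n \<omega>) + simpson_c9 * (sn n ^ 9 * P 9 9 n \<omega>))"
    proof -
      have "simpson n \<omega> - (\<phi> 0 (B (real (N n) / real n) \<omega>) - \<phi> 0 (B 0 \<omega>)) =
        (\<Sum>j<N n. e1 n j \<omega> + (1/2880 * (sn n ^ 5 * (\<phi> 5 (midB n j \<omega>) * xi n j \<omega> ^ 5)) + simpson_c7 * (sn n ^ 7 * (\<phi> 7 (midB n j \<omega>) * xi n j \<omega> ^ 7)) + simpson_c9 * (sn n ^ 9 * (\<phi> 9 (midB n j \<omega>) * xi n j \<omega> ^ 9))))"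
        unfolding simpson_def B_telescope[symmetric] sum_subtractf[symmetric]
      proof (rule sum.cong[OF refl])
        fix j
        have hpow: "h n j \<omega> ^ p = sn n ^ p * xi n j \<omega> ^ p" for p unfolding h_def by (rule power_mult_distrib)
        have "B (real (Suc j) / real n) \<omega> - B (real j / real n) \<omega> = h n j \<omega>" unfolding Bm(2)[of j] unfolding Bm(1)[of j] by simp
        then show "1 / 6 * (\<phi> 1 (B (real j / real n) \<omega>) + 4 * \<phi> 1 (midB n j \<omega>) + \<phi> 1 (B (real (Suc j) / real n) \<omega>)) * (B (real (Suc j) / real n) \<omega> - B (real j / real n) \<omega>)
          - (\<phi> 0 (B (real (Suc j) / real n) \<omega>) - \<phi> 0 (B (real j / real n) \<omega>))
          = e1 n j \<omega> + (1/2880 * (sn n ^ 5 * (\<phi> 5 (midB n j \<omega>) * xi n j \<omega> ^ 5)) + simpson_c7 * (sn n ^ 7 * (\<phi> 7 (midB n j \<omega>) * xi n j \<omega> ^ 7)) + simpson_c9 * (sn n ^ 9 * (\<phi> 9 (midB n j \<omega>) * xi n j \<omega> ^ 9)))"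
          unfolding e1_def Bm(2)[of j] unfolding Bm(1)[of j] hpow by (simp add: algebra_simps)
      qed
      then show ?thesis unfolding P_def by (simp only: sum.distrib sum_distrib_left)
    qed
    have S2: "D4 n \<omega> = (\<Sum>j<N n. e2 n j \<omega>) + (sn n * P 5 1 n \<omega> + (1/24) * (sn n ^ 3 * P 7 3 n \<omega>) + (1/1920) * (sn n ^ 5 * P 9 5 n \<omega>))"
    proof -
      have "D4 n \<omega> = (\<Sum>j<N n. e2 n j \<omega> + (sn n * (\<phi> 5 (midB n j \<omega>) * xi n j \<omega> ^ 1) + (1/24) * (sn n ^ 3 * (\<phi> 7 (midB n j \<omega>) * xi n j \<omega> ^ 3)) + (1/1920) * (sn n ^ 5 * (\<phi> 9 (midB n j \<omega>) * xi n j \<omega> ^ 5))))"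
        unfolding D4_def B_telescope[symmetric]
      proof (rule sum.cong[OF refl])
        fix j
        have hpow: "h n j \<omega> ^ p = sn n ^ p * xi n j \<omega> ^ p" for p unfolding h_def by (rule power_mult_distrib)
        have h1: "h n j \<omega> = sn n * xi n j \<omega>" unfolding h_def ..
        show "\<phi> 4 (B (real (Suc j) / real n) \<omega>) - \<phi> 4 (B (real j / real n) \<omega>) = e2 n j \<omega> + (sn n * (\<phi> 5 (midB n j \<omega>) * xi n j \<omega> ^ 1) + (1/24) * (sn n ^ 3 * (\<phi> 7 (midB n j \<omega>) * xi n j \<omega> ^ 3)) + (1/1920) * (sn n ^ 5 * (\<phi> 9 (midB n j \<omega>) * xi n j \<omega> ^ 5)))"
          unfolding e2_def Bm(2)[of j] unfolding Bm(1)[of j] hpow by (simp add: h1 algebra_simps)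
      qed
      then show ?thesis unfolding P_def by (simp only: sum.distrib sum_distrib_left)
    qed
    have S3: "sn n ^ 5 * P 5 5 n \<omega> = Wf n \<omega> + 15 * (sn n ^ 5 * P 5 1 n \<omega>)"
    proof -
      have "\<phi> 5 (midB n j \<omega>) * xi n j \<omega> ^ 5 = \<phi> 5 (midB n j \<omega>) * pd 0 (xi n j \<omega>) + 15 * (\<phi> 5 (midB n j \<omega>) * xi n j \<omega> ^ 1)" for j
        unfolding pd_def by (simp add: algebra_simps)
      then have "P 5 5 n \<omega> = (\<Sum>j<N n. \<phi> 5 (midB n j \<omega>) * pd 0 (xi n j \<omega>)) + 15 * P 5 1 n \<omega>"
        unfolding P_def by (simp only: sum.distrib sum_distrib_left)
      then show ?thesis unfolding Wf_def by (simp add: distrib_left)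
    qed
    have pw: "sn n ^ 5 = sn n ^ 4 * sn n" "sn n ^ 7 = sn n ^ 4 * sn n ^ 3" "sn n ^ 9 = sn n ^ 4 * sn n ^ 5" by (simp_all add: eval_nat_numeral)
    have S4: "sn n ^ 5 * P 5 1 n \<omega> = sn n ^ 4 * D4 n \<omega> - sn n ^ 4 * (\<Sum>j<N n. e2 n j \<omega>) - (1/24) * (sn n ^ 7 * P 7 3 n \<omega>) - (1/1920) * (sn n ^ 9 * P 9 5 n \<omega>)"
      unfolding S2 pw(2,3) unfolding pw(1) by (simp add: algebra_simps)
    show ?thesis unfolding S1 unfolding S3 unfolding S4 by (simp add: add_divide_distrib diff_divide_distrib)
  qed
  have "negligible (\<lambda>n \<omega>. (\<Sum>j<N n. e1 n j \<omega>) + (simpson_c7 * (sn n ^ 7 * P 7 7 n \<omega>) + (simpson_c9 * (sn n ^ 9 * P 9 9 n \<omega>)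
      + (1/192 * (sn n ^ 4 * D4 n \<omega>) + ((-1/192) * (sn n ^ 4 * (\<Sum>j<N n. e2 n j \<omega>)) + ((-1/4608) * (sn n ^ 7 * P 7 3 n \<omega>) + (-1/368640) * (sn n ^ 9 * P 9 5 n \<omega>)))))))"
    by (rule negligible_add[OF n1 negligible_add[OF negligible_cmult[OF p7] negligible_add[OF negligible_cmult[OF p9]
        negligible_add[OF negligible_cmult[OF n4] negligible_add[OF negligible_cmult[OF n2] negligible_add[OF negligible_cmult[OF p3] negligible_cmult[OF p5]]]]]]])
  then show ?thesis
    by (rule negligible_cong) (rule eq)
qed

end

section \<open>Freezing the weights along a coarse partition\<close>

context fbm10
begin

lemma B_difference_moment:
  assumes "u \<ge> 0" "v \<ge> 0"
  shows "integrable M (\<lambda>\<omega>. (B u \<omega> - B v \<omega>)\<^sup>2)" "(\<integral>\<omega>. (B u \<omega> - B v \<omega>)\<^sup>2 \<partial>M) = \<bar>u - v\<bar> powr (1/5) * normal_abs_moment 2"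
proof -
  have v: "K10 u u + K10 v v - 2 * K10 u v = \<bar>u - v\<bar> powr (1/5)"
    unfolding K10_eq abs_minus_commute[of v u] by (simp add: field_simps)
  have g: "centered_gaussian M (\<lambda>\<omega>. B u \<omega> - B v \<omega>) (\<bar>u - v\<bar> powr (1/5))"
  proof (cases "u = v")
    case True
    then show ?thesis unfolding centered_gaussian_def by simp
  next
    case False
    have "centered_gaussian M (\<lambda>\<omega>. \<Sum>t\<in>{u, v}. (if t = u then 1 else -1) * B t \<omega>)
       (\<Sum>s\<in>{u,v}. \<Sum>t\<in>{u,v}. (if s = u then 1 else -1) * (if t = u then 1 else -1) * K10 s t)"
      using assms by (intro gaussian_finite) auto
    moreover have "(\<Sum>s\<in>{u,v}. \<Sum>t\<in>{u,v}. (if s = u then 1 else -1) * (if t = u then 1 else -1) * K10 s t) = \<bar>u - v\<bar> powr (1/5)"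
      using False v fbm_cov_sym[of "1/10" u v] by simp
    moreover have "(\<lambda>\<omega>. \<Sum>t\<in>{u, v}. (if t = u then 1 else -1) * B t \<omega>) = (\<lambda>\<omega>. B u \<omega> - B v \<omega>)"
      using False by (simp add: fun_eq_iff)
    ultimately show ?thesis by simp
  qed
  have m: "(\<lambda>\<omega>. B u \<omega> - B v \<omega>) \<in> borel_measurable M" using B_measurable[OF assms(1)] B_measurable[OF assms(2)] by simp
  have "sqrt (\<bar>u - v\<bar> powr (1/5)) ^ 2 = \<bar>u - v\<bar> powr (1/5)" by simp
  then show "integrable M (\<lambda>\<omega>. (B u \<omega> - B v \<omega>)\<^sup>2)" "(\<integral>\<omega>. (B u \<omega> - B v \<omega>)\<^sup>2 \<partial>M) = \<bar>u - v\<bar> powr (1/5) * normal_abs_moment 2"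
    using centered_gaussian_moment[OF g m, of 2] by simp_all
qed

end

context truncated
begin

definition grid where "grid m n i = nat \<lfloor>real n * (real i * t / real m)\<rfloor>"
text \<open>The index of the coarse interval that contains the fine interval \<open>j\<close>.\<close>
definition block where "block m n j = (LEAST i. j < grid m n (Suc i))"
text \<open>For fixed m this is a continuous functional of finitely many values of \<open>B\<close>
  and \<open>V n\<close>, so the joint limit theorem applies to it; \<open>Zc\<close> is its
  counterpart with \<open>beta10 * W\<close> in place of \<open>V n\<close>.\<close>

definition Wc where "Wc m n \<omega> = (\<Sum>i<m. \<phi> 5 (B (real i * t / real m) \<omega>) * (V n (real (Suc i) * t / real m) \<omega> - V n (real i * t / real m) \<omega>))"

lemma grid_mono: "i \<le> i' \<Longrightarrow> grid m n i \<le> grid m n i'"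
  unfolding grid_def using t by (intro nat_mono floor_mono mult_left_mono divide_right_mono mult_right_mono) auto

lemma grid_0: "grid m n 0 = 0" and grid_m: "m \<ge> 1 \<Longrightarrow> grid m n m = N n"
  unfolding grid_def N_def by simp_all

lemma block_eq: "grid m n i \<le> j \<Longrightarrow> j < grid m n (Suc i) \<Longrightarrow> block m n j = i"
  unfolding block_def
proof (rule Least_equality)
  fix y assume "grid m n i \<le> j" "j < grid m n (Suc y)"
  then show "i \<le> y" using grid_mono[of "Suc y" i m n] by (cases "Suc y \<le> i") auto
qed

lemma block_bounds:
  assumes "m \<ge> 1" "j < N n"
  shows "block m n j < m" "grid m n (block m n j) \<le> j" "j < grid m n (Suc (block m n j))"
proof -
  have ex: "j < grid m n (Suc (m - 1))" using assms grid_m[OF assms(1)] by simp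
  show u: "j < grid m n (Suc (block m n j))" unfolding block_def by (rule LeastI[of "\<lambda>i. j < grid m n (Suc i)", OF ex])
  have "block m n j \<le> m - 1" unfolding block_def by (rule Least_le[of "\<lambda>i. j < grid m n (Suc i)", OF ex])
  then show "block m n j < m" using assms by simp
  show "grid m n (block m n j) \<le> j"
  proof (cases "block m n j")
    case 0
    then show ?thesis by (simp add: grid_0)
  next
    case (Suc i)
    then have "i < block m n j" by simp
    then have "\<not> j < grid m n (Suc i)" unfolding block_def by (rule not_less_Least)
    then show ?thesis using Suc by simp
  qed
qed

text \<open>Because of the floors in \<open>grid\<close>, a fine interval assigned to a block may
  start before the coarse point by up to one mesh width, hence the extra
  \<open>1 / real n\<close>.\<close>

lemma block_distance:
  assumes m: "m \<ge> 1" and n: "n \<ge> 1" and j: "j < N n"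
  shows "\<bar>real j / real n - real (block m n j) * t / real m\<bar> \<le> t / real m + 1 / real n"
    "\<bar>real (Suc j) / real n - real (block m n j) * t / real m\<bar> \<le> t / real m + 1 / real n"
proof -
  define i where "i = block m n j"
  note b = block_bounds[OF m j, folded i_def]
  have lo: "real n * (real i * t / real m) \<le> real j + 1"
  proof -
    have "real n * (real i * t / real m) < real_of_int \<lfloor>real n * (real i * t / real m)\<rfloor> + 1" by linarith
    also have "real_of_int \<lfloor>real n * (real i * t / real m)\<rfloor> \<le> real (grid m n i)" unfolding grid_def by simp
    also have "real (grid m n i) \<le> real j" using b(2) by simp
    finally show ?thesis by simp
  qed
  have hi: "real (Suc j) \<le> real n * (real (Suc i) * t / real m)"
  proof -
    have "real (Suc j) \<le> real (grid m n (Suc i))" using b(3) by simp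
    also have "\<dots> \<le> real n * (real (Suc i) * t / real m)"
      unfolding grid_def using t by (subst of_nat_nat) auto
    finally show ?thesis .
  qed
  have n0: "real n > 0" using n by simp
  have lo': "real i * t / real m \<le> real j / real n + 1 / real n"
    using lo n0 by (simp add: pos_le_divide_eq add_divide_distrib[symmetric] mult.commute)
  have hi': "real (Suc j) / real n \<le> real i * t / real m + t / real m"
  proof -
    have "real (Suc j) / real n \<le> real (Suc i) * t / real m"
      using hi n0 by (simp only: pos_divide_le_eq mult.commute)
    also have "\<dots> = real i * t / real m + t / real m" by (simp add: distrib_right add_divide_distrib)
    finally show ?thesis .
  qed
  have st: "real (Suc j) / real n = real j / real n + 1 / real n" by (simp add: add_divide_distrib)
  have p: "0 \<le> t / real m" "0 \<le> 1 / real n" using t by auto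
  have gen: "\<bar>a - c\<bar> \<le> d + e \<and> \<bar>(a + e) - c\<bar> \<le> d + e" if "c \<le> a + e" "a + e \<le> c + d" "0 \<le> d" "0 \<le> e" for a c d e :: real
    using that by auto
  from gen[OF lo' hi'[unfolded st] p] show "\<bar>real j / real n - real (block m n j) * t / real m\<bar> \<le> t / real m + 1 / real n"
    "\<bar>real (Suc j) / real n - real (block m n j) * t / real m\<bar> \<le> t / real m + 1 / real n"
    unfolding i_def st by blast+
qed

lemma Wc_eq:
  assumes m: "m \<ge> 1"
  shows "Wc m n \<omega> = sn n ^ 5 * (\<Sum>j<N n. \<phi> 5 (B (real (block m n j) * t / real m) \<omega>) * pd 0 (xi n j \<omega>))"
proof -
  have "(\<Sum>i<k. \<phi> 5 (B (real i * t / real m) \<omega>) * (V n (real (Suc i) * t / real m) \<omega> - V n (real i * t / real m) \<omega>))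
    = sn n ^ 5 * (\<Sum>j<grid m n k. \<phi> 5 (B (real (block m n j) * t / real m) \<omega>) * pd 0 (xi n j \<omega>))" for k
  proof (induction k)
    case 0
    then show ?case by (simp add: grid_0)
  next
    case (Suc k)
    have un: "{..<grid m n (Suc k)} = {..<grid m n k} \<union> {grid m n k..<grid m n (Suc k)}"
      using grid_mono[of k "Suc k" m n] by auto
    have split: "(\<Sum>j<grid m n (Suc k). y j) = (\<Sum>j<grid m n k. y j) + (\<Sum>j\<in>{grid m n k..<grid m n (Suc k)}. y j)" for y :: "nat \<Rightarrow> real"
      unfolding un by (rule sum.union_disjoint) auto
    have "V n (real (Suc k) * t / real m) \<omega> - V n (real k * t / real m) \<omega> = sn n ^ 5 * (\<Sum>j\<in>{grid m n k..<grid m n (Suc k)}. pd 0 (xi n j \<omega>))"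
      unfolding V_def grid_def[symmetric] xi_def[symmetric] split by (simp add: distrib_left)
    moreover have "(\<Sum>j\<in>{grid m n k..<grid m n (Suc k)}. \<phi> 5 (B (real (block m n j) * t / real m) \<omega>) * pd 0 (xi n j \<omega>))
       = \<phi> 5 (B (real k * t / real m) \<omega>) * (\<Sum>j\<in>{grid m n k..<grid m n (Suc k)}. pd 0 (xi n j \<omega>))"
      unfolding sum_distrib_left
    proof (intro sum.cong refl)
      fix j assume "j \<in> {grid m n k..<grid m n (Suc k)}"
      then have "block m n j = k" by (intro block_eq) auto
      then show "\<phi> 5 (B (real (block m n j) * t / real m) \<omega>) * pd 0 (xi n j \<omega>) = \<phi> 5 (B (real k * t / real m) \<omega>) * pd 0 (xi n j \<omega>)" by simp
    qed
    ultimately show ?case unfolding split using Suc by (simp add: distrib_left mult_ac)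
  qed
  from this[of m] show ?thesis unfolding Wc_def grid_m[OF m] .
qed

lemma lipschitz_\<phi>5: "\<bar>\<phi> 5 x - \<phi> 5 y\<bar> \<le> C * \<bar>x - y\<bar>"
proof -
  have "norm (\<phi> 5 x - \<phi> 5 y) \<le> C * norm (x - y)"
  proof (rule field_differentiable_bound[where S=UNIV and f'="\<phi> 6"])
    show "(\<phi> 5 has_field_derivative \<phi> 6 z) (at z within UNIV)" for z using bounded_derivsD(1)[OF \<phi>, of 5 z] by (simp add: eval_nat_numeral)
    show "norm (\<phi> 6 z) \<le> C" for z using bounded_derivsD(2)[OF \<phi>, of 6 z] by simp
  qed auto
  then show ?thesis by simp
qed

text \<open>\<open>weighted_hermite\<close> with \<open>\<kappa>\<close> = 1. The second moment of
  the weight differences is small because the fifth derivative is Lipschitz and B is mean-square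
  continuous; the covariance bound grows with m but is multiplied by \<open>sn n\<close>.\<close>

lemma coarse_weights:
  assumes m: "m \<ge> 1" and n: "n \<ge> 1" and q: "q = 3 \<or> q = 5"
  shows "(\<integral>\<omega>. (\<Sum>j<N n. (\<phi> 5 (midB n j \<omega>) - \<phi> 5 (B (real (block m n j) * t / real m) \<omega>)) * hermite q (xi n j \<omega>))\<^sup>2 \<partial>M)
    \<le> real (N n) * (fact q * 2 ^ q * (C\<^sup>2 * ((t / real m + 1 / real n) powr (1/5) * normal_abs_moment 2))
       + 4 * (C^2 * cq q) * (4 ^ q * (T powr (1/5) * (2 * real m + 1) + 4 * T powr (1/5) + 2 * real q) * sn n))"
proof -
  define c where "c j = real (block m n j) * t / real m" for j
  define pu where "pu = (\<lambda>(e::bool) j. min (if e then real j / real n else c j) T)"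
  define pv where "pv = (\<lambda>(e::bool) j. min (if e then real (Suc j) / real n else c j) T)"
  define \<delta> where "\<delta> = C\<^sup>2 * ((t / real m + 1 / real n) powr (1/5) * normal_abs_moment 2)"
  have T1: "T \<ge> 0" unfolding T_def using t by simp
  have c0: "c j \<ge> 0" for j unfolding c_def using t by simp
  have cT: "c j \<le> T" if "j < N n" for j
  proof -
    have "real (block m n j) * t / real m \<le> real m * t / real m"
      using block_bounds(1)[OF m that] t by (intro divide_right_mono mult_right_mono) auto
    then show ?thesis unfolding c_def T_def using m by simp
  qed
  have puv: "pu True j = real j / real n" "pv True j = real (Suc j) / real n" "pu False j = c j" "pv False j = c j" if "j < N n" for j
    unfolding pu_def pv_def using grid_le[OF n that] cT[OF that] by (auto simp: min_def)
  have mcc: "mid x x b = b x" for x b unfolding mid_def by simp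
  interpret wh: weighted_hermite M B n "N n" q "\<lambda>i. \<phi> (5 + i)" C T "T powr (1/5) * (2 * real m + 1)" \<delta> 1 pu pv
  proof
    show "bounded_derivs q (\<lambda>i. \<phi> (5 + i)) C" using q by (intro bounded_derivs_shift[OF \<phi>]) auto
    show "0 \<le> pu e j" "pu e j \<le> T" "0 \<le> pv e j" "pv e j \<le> T" for e j unfolding pu_def pv_def using T1 c0 by auto
    show "real (N n) / real n \<le> T" by (rule N_div_T[OF n])
    show "(\<Sum>j<N n. \<Sum>e\<in>UNIV. \<bar>mid (pu e j) (pv e j) (kxi n j)\<bar>) \<le> T powr (1/5) * (2 * real m + 1) / sn n"
    proof -
      have "(\<Sum>j<N n. \<Sum>e\<in>UNIV. \<bar>mid (pu e j) (pv e j) (kxi n j)\<bar>) = (\<Sum>j<N n. \<bar>kxi n j (c j)\<bar> + \<bar>mid (real j / real n) (real (Suc j) / real n) (kxi n j)\<bar>)"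
        by (intro sum.cong refl) (simp add: UNIV_bool puv mcc del: of_nat_Suc)
      also have "\<dots> \<le> (\<Sum>j<N n. (\<Sum>i<m. \<bar>kxi n j (real i * t / real m)\<bar>) + \<bar>mid (real j / real n) (real (Suc j) / real n) (kxi n j)\<bar>)"
      proof (intro sum_mono add_right_mono)
        fix j assume "j \<in> {..<N n}"
        then have "block m n j \<in> {..<m}" using block_bounds(1)[OF m] by simp
        then show "\<bar>kxi n j (c j)\<bar> \<le> (\<Sum>i<m. \<bar>kxi n j (real i * t / real m)\<bar>)"
          unfolding c_def by (rule member_le_sum) auto
      qed
      also have "\<dots> = (\<Sum>i<m. \<Sum>j<N n. \<bar>kxi n j (real i * t / real m)\<bar>) + (\<Sum>j<N n. \<bar>mid (real j / real n) (real (Suc j) / real n) (kxi n j)\<bar>)"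
        unfolding sum.distrib by (subst sum.swap) simp
      also have "\<dots> \<le> (\<Sum>i<m. 2 * T powr (1/5) / sn n) + T powr (1/5) / (2 * sn n)"
      proof (intro add_mono sum_mono mid_kxi_sum[OF n N_div_T[OF n]] kxi_sum_bound[OF n _ _ N_div_T[OF n]])
        fix i assume "i \<in> {..<m}"
        then have "real i * t / real m \<le> real m * t / real m" using t by (intro divide_right_mono mult_right_mono) auto
        then show "real i * t / real m \<le> T" unfolding T_def using m by simp
      qed (use t in auto)
      also have "\<dots> \<le> T powr (1/5) * (2 * real m + 1) / sn n"
        using sn_pos[OF n] by (simp add: field_simps)
      finally show ?thesis .
    qed
    fix j assume j: "j < N n"
    let ?a = "real j / real n" and ?b = "real (Suc j) / real n"
    have cc: "c j \<ge> 0" by (rule c0)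
    note ia = B_difference_moment[of ?a "c j", OF _ cc] and ib = B_difference_moment[of ?b "c j", OF _ cc]
    have le: "(\<phi> 5 (midB n j \<omega>) - 1 * \<phi> 5 (B (c j) \<omega>))\<^sup>2 \<le> C\<^sup>2 * (((B ?a \<omega> - B (c j) \<omega>)\<^sup>2 + (B ?b \<omega> - B (c j) \<omega>)\<^sup>2) / 2)" for \<omega>
    proof -
      have "\<bar>\<phi> 5 (midB n j \<omega>) - \<phi> 5 (B (c j) \<omega>)\<bar> \<le> \<bar>C * (midB n j \<omega> - B (c j) \<omega>)\<bar>"
        using lipschitz_\<phi>5[of "midB n j \<omega>" "B (c j) \<omega>"] C0 by (simp add: abs_mult)
      then have "(\<phi> 5 (midB n j \<omega>) - \<phi> 5 (B (c j) \<omega>))\<^sup>2 \<le> (C * (midB n j \<omega> - B (c j) \<omega>))\<^sup>2" by (rule abs_le_square_iff[THEN iffD1])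
      also have "\<dots> = C\<^sup>2 * (midB n j \<omega> - B (c j) \<omega>)\<^sup>2" by (rule power_mult_distrib)
      also have "\<dots> \<le> C\<^sup>2 * (((B ?a \<omega> - B (c j) \<omega>)\<^sup>2 + (B ?b \<omega> - B (c j) \<omega>)\<^sup>2) / 2)"
      proof (rule mult_left_mono)
        have "((x + y) / 2)\<^sup>2 \<le> (x\<^sup>2 + y\<^sup>2) / 2" for x y :: real
          using sum_squares_bound[of x y] by (simp add: power_divide power2_sum)
        from this[of "B ?a \<omega> - B (c j) \<omega>" "B ?b \<omega> - B (c j) \<omega>"]
        show "(midB n j \<omega> - B (c j) \<omega>)\<^sup>2 \<le> ((B ?a \<omega> - B (c j) \<omega>)\<^sup>2 + (B ?b \<omega> - B (c j) \<omega>)\<^sup>2) / 2"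
        proof -
          have "midB n j \<omega> - B (c j) \<omega> = ((B ?a \<omega> - B (c j) \<omega>) + (B ?b \<omega> - B (c j) \<omega>)) / 2"
            unfolding midB_def mid_def by (simp add: field_simps)
          then show ?thesis using \<open>(((B ?a \<omega> - B (c j) \<omega>) + (B ?b \<omega> - B (c j) \<omega>)) / 2)\<^sup>2 \<le> _\<close> by (simp only:)
        qed
      qed simp
      finally show ?thesis by simp
    qed
    have ir: "integrable M (\<lambda>\<omega>. C\<^sup>2 * (((B ?a \<omega> - B (c j) \<omega>)\<^sup>2 + (B ?b \<omega> - B (c j) \<omega>)\<^sup>2) / 2))"
      using ia(1) ib(1) by simp
    have [measurable]: "\<phi> 5 \<in> borel_measurable borel" by (rule \<phi>_measurable) simp
    have [measurable]: "B (c j) \<in> borel_measurable M" by (rule B_measurable[OF cc])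
    have il: "integrable M (\<lambda>\<omega>. (\<phi> 5 (midB n j \<omega>) - 1 * \<phi> 5 (B (c j) \<omega>))\<^sup>2)"
      by (rule Bochner_Integration.integrable_bound[OF ir], measurable, intro AE_I2, simp only: real_norm_def abs_power2, rule order_trans[OF le abs_ge_self])
    have "(\<integral>\<omega>. (\<phi> 5 (midB n j \<omega>) - 1 * \<phi> 5 (B (c j) \<omega>))\<^sup>2 \<partial>M) \<le> (\<integral>\<omega>. C\<^sup>2 * (((B ?a \<omega> - B (c j) \<omega>)\<^sup>2 + (B ?b \<omega> - B (c j) \<omega>)\<^sup>2) / 2) \<partial>M)"
      by (rule integral_mono[OF il ir le])
    also have "\<dots> = C\<^sup>2 * ((\<bar>?a - c j\<bar> powr (1/5) * normal_abs_moment 2 + \<bar>?b - c j\<bar> powr (1/5) * normal_abs_moment 2) / 2)"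
      using ia ib by simp
    also have "\<dots> \<le> \<delta>"
    proof -
      have "\<bar>?a - c j\<bar> powr (1/5) \<le> (t / real m + 1 / real n) powr (1/5)" "\<bar>?b - c j\<bar> powr (1/5) \<le> (t / real m + 1 / real n) powr (1/5)"
        using block_distance[OF m n j] unfolding c_def by (intro powr_mono2; simp)+
      then have "\<bar>?a - c j\<bar> powr (1/5) * normal_abs_moment 2 + \<bar>?b - c j\<bar> powr (1/5) * normal_abs_moment 2
        \<le> (t / real m + 1 / real n) powr (1/5) * normal_abs_moment 2 + (t / real m + 1 / real n) powr (1/5) * normal_abs_moment 2"
        using normal_abs_moment_nonneg by (intro add_mono mult_right_mono) auto
      note sm = this
      have half: "x / 2 \<le> y" if "x \<le> y + y" for x y :: real using that by simp
      show ?thesis unfolding \<delta>_def by (rule mult_left_mono[OF half[OF sm]]) simp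
    qed
    finally show "(\<integral>\<omega>. (\<phi> (5 + 0) (mid (pu True j) (pv True j) (\<lambda>t. B t \<omega>)) - 1 * \<phi> (5 + 0) (mid (pu False j) (pv False j) (\<lambda>t. B t \<omega>)))\<^sup>2 \<partial>M) \<le> \<delta>"
      unfolding puv[OF j] mcc midB_def by simp
  qed (use n q in auto)
  have eps: "wh.\<epsilon> = sn n" unfolding wh.\<epsilon>_def using q by auto
  have "(\<Sum>j<N n. wh.w j (\<lambda>t. B t \<omega>) * hermite q (incr n j (\<lambda>t. B t \<omega>)))
     = (\<Sum>j<N n. (\<phi> 5 (midB n j \<omega>) - \<phi> 5 (B (real (block m n j) * t / real m) \<omega>)) * hermite q (xi n j \<omega>))" for \<omega>
    unfolding midB_def xi_def by (intro sum.cong refl) (simp add: wh.w_def wh.U_def puv mcc c_def del: of_nat_Suc)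
  with wh.weighted_hermite_L2 show ?thesis unfolding eps \<delta>_def by simp
qed

text \<open>G does not depend on m while G2 may. For fixed m the G2 term vanishes as n grows, and
  the limit of the G term vanishes as m grows; this fixes the order of the two limits.\<close>

theorem coarse_approximation:
  obtains G where "G \<ge> 0" "\<And>m. m \<ge> 1 \<Longrightarrow> \<exists>G2\<ge>0. \<forall>n\<ge>1. integrable M (\<lambda>\<omega>. (Wf n \<omega> - Wc m n \<omega>)\<^sup>2) \<and>
     (\<integral>\<omega>. (Wf n \<omega> - Wc m n \<omega>)\<^sup>2 \<partial>M) \<le> G * (t / real m + 1 / real n) powr (1/5) + G2 * sn n"
proof -
  define Gq where "Gq q = fact q * 2 ^ q * (C\<^sup>2 * normal_abs_moment 2)" for q :: nat
  define Hq where "Hq m q = 4 * (C^2 * cq q) * (4 ^ q * (T powr (1/5) * (2 * real m + 1) + 4 * T powr (1/5) + 2 * real q))" for m q :: nat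
  define G where "G = T * (2 * Gq 5 + 200 * Gq 3)"
  have T0: "T \<ge> 0" unfolding T_def using t by simp
  have Gq0: "Gq q \<ge> 0" for q unfolding Gq_def using normal_abs_moment_nonneg[of 2] by simp
  have Hq0: "Hq m q \<ge> 0" for m q unfolding Hq_def using cq_nonneg[of q] by simp
  have "G \<ge> 0" unfolding G_def using T0 Gq0[of 5] Gq0[of 3] by (intro mult_nonneg_nonneg add_nonneg_nonneg) auto
  moreover have "\<exists>G2\<ge>0. \<forall>n\<ge>1. integrable M (\<lambda>\<omega>. (Wf n \<omega> - Wc m n \<omega>)\<^sup>2) \<and>
     (\<integral>\<omega>. (Wf n \<omega> - Wc m n \<omega>)\<^sup>2 \<partial>M) \<le> G * (t / real m + 1 / real n) powr (1/5) + G2 * sn n" if m: "m \<ge> 1" for m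
  proof (intro exI[of _ "T * (2 * Hq m 5 + 200 * Hq m 3)"] conjI allI impI)
    show "0 \<le> T * (2 * Hq m 5 + 200 * Hq m 3)" using T0 Hq0[of m 5] Hq0[of m 3] by (intro mult_nonneg_nonneg add_nonneg_nonneg) auto
    fix n :: nat assume n: "n \<ge> 1"
    define S where "S q \<omega> = (\<Sum>j<N n. (\<phi> 5 (midB n j \<omega>) - \<phi> 5 (B (real (block m n j) * t / real m) \<omega>)) * hermite q (xi n j \<omega>))" for q \<omega>
    have df: "Wf n \<omega> - Wc m n \<omega> = sn n ^ 5 * (S 5 \<omega> + 10 * S 3 \<omega>)" for \<omega>
    proof -
      have "Wf n \<omega> - Wc m n \<omega> = sn n ^ 5 * (\<Sum>j<N n. (\<phi> 5 (midB n j \<omega>) - \<phi> 5 (B (real (block m n j) * t / real m) \<omega>)) * pd 0 (xi n j \<omega>))"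
        unfolding Wf_def Wc_eq[OF m] right_diff_distrib[symmetric] sum_subtractf[symmetric] left_diff_distrib[symmetric] ..
      also have "\<dots> = sn n ^ 5 * (S 5 \<omega> + 10 * S 3 \<omega>)"
        unfolding S_def pd_hermite by (simp add: distrib_left sum.distrib sum_distrib_left mult.left_commute del: hermite.simps)
      finally show ?thesis .
    qed
    have iS: "integrable M (\<lambda>\<omega>. (S q \<omega>)\<^sup>2)" for q
    proof -
      define I where "I = (\<lambda>j. real j / real n) ` {..N n} \<union> (\<lambda>j. real (block m n j) * t / real m) ` {..N n}"
      have I: "finite I" "I \<subseteq> {0..}" unfolding I_def using t by auto
      have "adm I (\<lambda>b. (\<Sum>j<N n. (\<phi> 5 (mid (real j / real n) (real (Suc j) / real n) b) - \<phi> 5 (b (real (block m n j) * t / real m))) * hermite q (incr n j b))\<^sup>2)"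
      proof (intro adm_power adm_sum adm_mult adm_hermite adm_diff)
        fix j assume j: "j \<in> {..<N n}"
        have jI: "real j / real n \<in> I" "real (Suc j) / real n \<in> I" "real (block m n j) * t / real m \<in> I" unfolding I_def using j by (auto simp del: of_nat_Suc)
        show "adm I (\<lambda>b. \<phi> 5 (mid (real j / real n) (real (Suc j) / real n) b))"
          by (rule adm_mono[OF adm_term _ I(1)]) (use jI in simp_all)
        show "adm I (\<lambda>b. \<phi> 5 (b (real (block m n j) * t / real m)))"
          by (rule adm_compose_bounded[where g="\<phi> 5" and C=C, OF adm_coord[OF I(1) jI(3)] bounded_derivsD(3)[OF \<phi>]])
             (simp_all add: bounded_derivsD(2)[OF \<phi>])
        show "adm I (incr n j)" by (rule adm_incr[OF I(1) jI(1,2)])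
      qed
      from adm_integrable[OF I this] show ?thesis unfolding S_def midB_def xi_def .
    qed
    have [measurable]: "\<phi> 5 \<in> borel_measurable borel" by (rule \<phi>_measurable) simp
    have [measurable]: "B (real i * t / real m) \<in> borel_measurable M" for i using t by (intro B_measurable) simp
    have Sm: "S q \<in> borel_measurable M" for q unfolding S_def by measurable
    note Sm[measurable]
    have le: "(sn n ^ 5 * (S 5 \<omega> + 10 * S 3 \<omega>))\<^sup>2 \<le> sn n ^ 10 * (2 * (S 5 \<omega>)\<^sup>2 + 200 * (S 3 \<omega>)\<^sup>2)" for \<omega>
    proof -
      have aux: "(x + 10 * y)\<^sup>2 \<le> 2 * x\<^sup>2 + 200 * y\<^sup>2" for x y :: real
        using sum_squares_bound[of x "10 * y"] by (simp add: power2_sum power_mult_distrib)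
      have "(sn n ^ 5)\<^sup>2 = sn n ^ 10" by (simp add: power_mult[symmetric])
      then show ?thesis unfolding power_mult_distrib using mult_left_mono[OF aux[of "S 5 \<omega>" "S 3 \<omega>"], of "sn n ^ 10"] sn_pos[OF n] by simp
    qed
    have ir: "integrable M (\<lambda>\<omega>. sn n ^ 10 * (2 * (S 5 \<omega>)\<^sup>2 + 200 * (S 3 \<omega>)\<^sup>2))" using iS by simp
    show il: "integrable M (\<lambda>\<omega>. (Wf n \<omega> - Wc m n \<omega>)\<^sup>2)" unfolding df
      by (rule Bochner_Integration.integrable_bound[OF ir], measurable, intro AE_I2, simp only: real_norm_def abs_power2, rule order_trans[OF le abs_ge_self])
    have "(\<integral>\<omega>. (Wf n \<omega> - Wc m n \<omega>)\<^sup>2 \<partial>M) \<le> (\<integral>\<omega>. sn n ^ 10 * (2 * (S 5 \<omega>)\<^sup>2 + 200 * (S 3 \<omega>)\<^sup>2) \<partial>M)"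
      using integral_mono[OF il ir] le unfolding df by blast
    also have "\<dots> = sn n ^ 10 * (2 * (\<integral>\<omega>. (S 5 \<omega>)\<^sup>2 \<partial>M) + 200 * (\<integral>\<omega>. (S 3 \<omega>)\<^sup>2 \<partial>M))" using iS by simp
    also have "\<dots> \<le> sn n ^ 10 * (2 * (real (N n) * (Gq 5 * (t / real m + 1 / real n) powr (1/5) + Hq m 5 * sn n))
        + 200 * (real (N n) * (Gq 3 * (t / real m + 1 / real n) powr (1/5) + Hq m 3 * sn n)))"
    proof -
      have "(\<integral>\<omega>. (S q \<omega>)\<^sup>2 \<partial>M) \<le> real (N n) * (Gq q * (t / real m + 1 / real n) powr (1/5) + Hq m q * sn n)" if "q = 3 \<or> q = 5" for q
        using coarse_weights[OF m n that] unfolding S_def Gq_def Hq_def by (simp only: mult_ac)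
      from this[of 5] this[of 3] show ?thesis using sn_pos[OF n] by (intro mult_left_mono add_mono) auto
    qed
    also have "\<dots> = (real (N n) * sn n ^ 10) * ((2 * Gq 5 + 200 * Gq 3) * (t / real m + 1 / real n) powr (1/5) + (2 * Hq m 5 + 200 * Hq m 3) * sn n)"
      by (simp add: algebra_simps)
    also have "\<dots> \<le> T * ((2 * Gq 5 + 200 * Gq 3) * (t / real m + 1 / real n) powr (1/5) + (2 * Hq m 5 + 200 * Hq m 3) * sn n)"
      using Gq0 Hq0 sn_pos[OF n] by (intro mult_right_mono N_sn[OF n] add_nonneg_nonneg mult_nonneg_nonneg) auto
    also have "\<dots> = G * (t / real m + 1 / real n) powr (1/5) + T * (2 * Hq m 5 + 200 * Hq m 3) * sn n"
      unfolding G_def by (simp add: algebra_simps)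
    finally show "(\<integral>\<omega>. (Wf n \<omega> - Wc m n \<omega>)\<^sup>2 \<partial>M) \<le> G * (t / real m + 1 / real n) powr (1/5) + T * (2 * Hq m 5 + 200 * Hq m 3) * sn n" .
  qed
  ultimately show thesis by (rule that)
qed

end

section \<open>Convergence in law of the Simpson sums\<close>

lemma iexp_lipschitz: "norm (iexp x - iexp y) \<le> \<bar>x - y\<bar>"
proof -
  have "iexp x - iexp y = iexp y * (iexp (x - y) - 1)"
    by (simp add: right_diff_distrib exp_add[symmetric] algebra_simps)
  then have "norm (iexp x - iexp y) = norm (iexp (x - y) - 1)" by (simp add: norm_mult)
  also have "\<dots> \<le> \<bar>x - y\<bar>" using iexp_approx1[of "x - y" 0] by simp
  finally show ?thesis .
qed

lemma (in prob_space) iexp_integrable: "X \<in> borel_measurable M \<Longrightarrow> integrable M (\<lambda>\<omega>. iexp (X \<omega>))"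
  by (intro integrable_const_bound[where B=1]) auto

text \<open>On E the exponential is Lipschitz; off E two unimodular numbers differ by at most 2. An
  event of small probability on which f and its truncation disagree is thereby tolerated.\<close>

lemma (in prob_space) iexp_expectation_diff:
  fixes X Y Z :: "'a \<Rightarrow> real"
  assumes m[measurable]: "X \<in> borel_measurable M" "Y \<in> borel_measurable M" and Z: "integrable M Z" "\<And>\<omega>. Z \<omega> \<ge> 0"
    and E[measurable]: "E \<in> sets M" and le: "AE \<omega> in M. \<omega> \<in> E \<longrightarrow> \<bar>X \<omega> - Y \<omega>\<bar> \<le> Z \<omega>"
  shows "norm ((\<integral>\<omega>. iexp (X \<omega>) \<partial>M) - (\<integral>\<omega>. iexp (Y \<omega>) \<partial>M)) \<le> 2 * prob (space M - E) + (\<integral>\<omega>. Z \<omega> \<partial>M)"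
proof -
  have i: "integrable M (\<lambda>\<omega>. iexp (X \<omega>))" "integrable M (\<lambda>\<omega>. iexp (Y \<omega>))" by (intro iexp_integrable m)+
  have "norm ((\<integral>\<omega>. iexp (X \<omega>) \<partial>M) - (\<integral>\<omega>. iexp (Y \<omega>) \<partial>M)) = norm (\<integral>\<omega>. iexp (X \<omega>) - iexp (Y \<omega>) \<partial>M)" using i by simp
  also have "\<dots> \<le> (\<integral>\<omega>. norm (iexp (X \<omega>) - iexp (Y \<omega>)) \<partial>M)" by (rule integral_norm_bound)
  also have "\<dots> \<le> (\<integral>\<omega>. 2 * indicator (space M - E) \<omega> + Z \<omega> \<partial>M)"
  proof (rule integral_mono_AE)
    show "integrable M (\<lambda>\<omega>. norm (iexp (X \<omega>) - iexp (Y \<omega>)))" using i by simp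
    show "integrable M (\<lambda>\<omega>. 2 * indicator (space M - E) \<omega> + Z \<omega>)" using Z(1) by (simp add: emeasure_eq_measure)
    show "AE \<omega> in M. norm (iexp (X \<omega>) - iexp (Y \<omega>)) \<le> 2 * indicator (space M - E) \<omega> + Z \<omega>"
      using le AE_space
    proof eventually_elim
      case (elim \<omega>)
      show ?case
      proof (cases "\<omega> \<in> E")
        case True
        then show ?thesis using elim iexp_lipschitz[of "X \<omega>" "Y \<omega>"] by simp
      next
        case False
        have "norm (iexp (X \<omega>) - iexp (Y \<omega>)) \<le> norm (iexp (X \<omega>)) + norm (iexp (Y \<omega>))" by (rule norm_triangle_ineq4)
        then show ?thesis using False elim Z(2)[of \<omega>] by simp
      qed
    qed
  qed
  also have "\<dots> = 2 * prob (space M - E) + (\<integral>\<omega>. Z \<omega> \<partial>M)" using Z(1) by (simp add: emeasure_eq_measure)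
  finally show ?thesis .
qed

locale simpson_limit = fbm10 M B for M :: "'a measure" and B +
  fixes W :: "real \<Rightarrow> 'a \<Rightarrow> real" and f :: "real \<Rightarrow> real"
  assumes W: "fbm (1/2) M W" and indep: "indep_processes M B W"
    and B_continuous: "\<omega> \<in> space M \<Longrightarrow> continuous_on {0..} (\<lambda>t. B t \<omega>)" and smooth: "smooth_real f"
begin

lemma W_measurable: "t \<ge> 0 \<Longrightarrow> W t \<in> borel_measurable M"
  using W unfolding fbm_def by blast

lemma fbm_cov_half: "p \<ge> 0 \<Longrightarrow> q \<ge> 0 \<Longrightarrow> fbm_cov (1/2) p q = min p q"
  unfolding fbm_cov_def by (simp add: min_def abs_if)

text \<open>By independence the characteristic function factorises. The right side is the limit
  found in \<open>joint_char_limit\<close>, which identifies the limit of \<open>V n\<close> with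
  \<open>beta10 * W\<close>.\<close>

lemma joint_char_BW:
  assumes J: "finite J" "J \<subseteq> {0..}" and P: "finite P" "P \<subseteq> {0..}"
  shows "(\<integral>\<omega>. iexp ((\<Sum>t\<in>J. ac t * B t \<omega>) + (\<Sum>p\<in>P. \<nu> p * (beta10 * W p \<omega>))) \<partial>M) =
    complex_of_real (exp (- (beta10^2 * (\<Sum>p\<in>P. \<Sum>q\<in>P. \<nu> p * \<nu> q * min p q)) / 2)) * (\<integral>\<omega>. iexp (\<Sum>t\<in>J. ac t * B t \<omega>) \<partial>M)"
proof -
  interpret GW: gaussian_process M W "fbm_cov (1/2)" by (rule fbm_gaussian_process[OF W])
  define X where "X \<omega> = (\<Sum>t\<in>J. ac t * B t \<omega>)" for \<omega>
  define Y where "Y \<omega> = (\<Sum>p\<in>P. (\<nu> p * beta10) * W p \<omega>)" for \<omega>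
  have iv: "indep_var borel X borel Y"
  proof -
    have fm: "(\<lambda>x. \<Sum>t\<in>J. c t * x t) \<in> borel_measurable (Pi\<^sub>M {0..} (\<lambda>_. borel))" if "J \<subseteq> {0..}" for J :: "real set" and c :: "real \<Rightarrow> real"
      using that by (intro borel_measurable_sum borel_measurable_times borel_measurable_const measurable_component_singleton) auto
    have "indep_var borel ((\<lambda>x. \<Sum>t\<in>J. ac t * x t) \<circ> (\<lambda>\<omega>. \<lambda>t\<in>{0..}. B t \<omega>)) borel ((\<lambda>x. \<Sum>p\<in>P. (\<nu> p * beta10) * x p) \<circ> (\<lambda>\<omega>. \<lambda>t\<in>{0..}. W t \<omega>))"
      using indep unfolding indep_processes_def by (rule indep_var_compose) (intro fm J P)+
    moreover have "(\<lambda>x. \<Sum>t\<in>J. ac t * x t) \<circ> (\<lambda>\<omega>. \<lambda>t\<in>{0..}. B t \<omega>) = X"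
      unfolding X_def using J(2) by (auto simp: fun_eq_iff intro!: sum.cong)
    moreover have "(\<lambda>x. \<Sum>p\<in>P. (\<nu> p * beta10) * x p) \<circ> (\<lambda>\<omega>. \<lambda>t\<in>{0..}. W t \<omega>) = Y"
      unfolding Y_def using P(2) by (auto simp: fun_eq_iff intro!: sum.cong)
    ultimately show ?thesis by simp
  qed
  have Xm[measurable]: "X \<in> borel_measurable M" unfolding X_def by (rule B_lin_measurable[OF J(2)])
  have Ym[measurable]: "Y \<in> borel_measurable M" unfolding Y_def by (rule GW.B_lin_measurable[OF P(2)])
  have "(\<integral>\<omega>. iexp (X \<omega> + Y \<omega>) \<partial>M) = char (distr M borel (\<lambda>\<omega>. X \<omega> + Y \<omega>)) 1"
    unfolding char_def by (subst integral_distr) auto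
  also have "\<dots> = char (distr M borel X) 1 * char (distr M borel Y) 1" by (rule char_distr_add[OF iv])
  also have "\<dots> = (\<integral>\<omega>. iexp (X \<omega>) \<partial>M) * (\<integral>\<omega>. iexp (Y \<omega>) \<partial>M)"
    unfolding char_def by (subst (1 2) integral_distr) auto
  also have "(\<integral>\<omega>. iexp (Y \<omega>) \<partial>M) = complex_of_real (exp (- (\<Sum>p\<in>P. \<Sum>q\<in>P. (\<nu> p * beta10) * (\<nu> q * beta10) * fbm_cov (1/2) p q) / 2))"
    unfolding Y_def by (rule GW.iexp_finite[OF P])
  also have "(\<Sum>p\<in>P. \<Sum>q\<in>P. (\<nu> p * beta10) * (\<nu> q * beta10) * fbm_cov (1/2) p q) = beta10^2 * (\<Sum>p\<in>P. \<Sum>q\<in>P. \<nu> p * \<nu> q * min p q)"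
    unfolding sum_distrib_left
  proof (intro sum.cong refl)
    fix p q assume "p \<in> P" "q \<in> P"
    then have "fbm_cov (1/2) p q = min p q" using P(2) by (intro fbm_cov_half) auto
    then show "(\<nu> p * beta10) * (\<nu> q * beta10) * fbm_cov (1/2) p q = beta10^2 * (\<nu> p * \<nu> q * min p q)"
      by (simp add: power2_eq_square)
  qed
  finally have "(\<integral>\<omega>. iexp (X \<omega> + Y \<omega>) \<partial>M) = (\<integral>\<omega>. iexp (X \<omega>) \<partial>M) * complex_of_real (exp (- (beta10^2 * (\<Sum>p\<in>P. \<Sum>q\<in>P. \<nu> p * \<nu> q * min p q)) / 2))" .
  moreover have "Y \<omega> = (\<Sum>p\<in>P. \<nu> p * (beta10 * W p \<omega>))" for \<omega> unfolding Y_def by (simp only: mult.assoc)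
  ultimately show ?thesis unfolding X_def by (simp only: mult.commute)
qed

text \<open>The flag selects the process: \<open>True\<close> for \<open>B\<close>, \<open>False\<close> for \<open>V n\<close> and its limit.\<close>
definition XV :: "nat \<Rightarrow> bool \<times> real \<Rightarrow> 'a \<Rightarrow> real" where
  "XV n i = (if fst i then B (snd i) else V n (snd i))"

definition XW :: "bool \<times> real \<Rightarrow> 'a \<Rightarrow> real" where
  "XW i = (if fst i then B (snd i) else (\<lambda>\<omega>. beta10 * W (snd i) \<omega>))"

lemma joint_law_limit:
  fixes h :: "(bool \<times> real \<Rightarrow> real) \<Rightarrow> real" and H :: real
  assumes P: "finite P" "P \<subseteq> {0..}"
    and h: "continuous_on UNIV h" "depends_on (UNIV \<times> P) h" "\<And>x. \<bar>h x\<bar> \<le> H"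
  shows "(\<lambda>n. \<integral>\<omega>. h (\<lambda>i. XV n i \<omega>) \<partial>M) \<longlonglongrightarrow> (\<integral>\<omega>. h (\<lambda>i. XW i \<omega>) \<partial>M)"
proof (rule levy_continuity_functional[where I="UNIV \<times> P" and H=H and h=h and Xn=XV and X=XW])
  show "prob_space M" by (rule prob_space_axioms)
  show "continuous_on UNIV h" "depends_on (UNIV \<times> P) h" by (rule h)+
  show "\<bar>h x\<bar> \<le> H" for x by (rule h)
  show "finite ((UNIV::bool set) \<times> P)" using P by simp
  show "XV n i \<in> borel_measurable M" if "i \<in> UNIV \<times> P" for n i
    unfolding XV_def using that P B_measurable V_measurable by auto
  show "XW i \<in> borel_measurable M" if "i \<in> UNIV \<times> P" for i
    unfolding XW_def using that P B_measurable W_measurable by auto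
  fix u :: "bool \<times> real \<Rightarrow> real"
  have s: "(\<Sum>i\<in>UNIV \<times> P. g i) = (\<Sum>p\<in>P. g (True, p)) + (\<Sum>p\<in>P. g (False, p))" for g :: "bool \<times> real \<Rightarrow> real"
  proof -
    have "(\<Sum>i\<in>UNIV \<times> P. g i) = (\<Sum>e\<in>UNIV. \<Sum>p\<in>P. g (e, p))" by (simp add: sum.cartesian_product)
    then show ?thesis by (simp add: UNIV_bool)
  qed
  show "(\<lambda>n. \<integral>\<omega>. iexp (\<Sum>i\<in>UNIV \<times> P. u i * XV n i \<omega>) \<partial>M) \<longlonglongrightarrow> (\<integral>\<omega>. iexp (\<Sum>i\<in>UNIV \<times> P. u i * XW i \<omega>) \<partial>M)"
    unfolding s XV_def XW_def fst_conv snd_conv if_True if_False joint_char_BW[OF P P]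
    by (rule joint_char_limit[OF P P])
qed (rule prob_space_axioms)

lemma iexp_joint_law_limit:
  fixes h :: "(bool \<times> real \<Rightarrow> real) \<Rightarrow> real"
  assumes P: "finite P" "P \<subseteq> {0..}" and h: "continuous_on UNIV h" "depends_on (UNIV \<times> P) h"
  shows "(\<lambda>n. \<integral>\<omega>. iexp (h (\<lambda>i. XV n i \<omega>)) \<partial>M) \<longlonglongrightarrow> (\<integral>\<omega>. iexp (h (\<lambda>i. XW i \<omega>)) \<partial>M)"
proof -
  have XVm: "XV n i \<in> borel_measurable M" if "i \<in> UNIV \<times> P" for n i
    unfolding XV_def using that P B_measurable V_measurable by auto
  have XWm: "XW i \<in> borel_measurable M" if "i \<in> UNIV \<times> P" for i
    unfolding XW_def using that P B_measurable W_measurable by auto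
  have fP: "finite ((UNIV::bool set) \<times> P)" using P by simp
  have c: "(\<integral>\<omega>. iexp (Y \<omega>) \<partial>M) = Complex (\<integral>\<omega>. cos (Y \<omega>) \<partial>M) (\<integral>\<omega>. sin (Y \<omega>) \<partial>M)" if "Y \<in> borel_measurable M" for Y
    using integral_Re[OF iexp_integrable[OF that]] integral_Im[OF iexp_integrable[OF that]] by (simp add: complex_eq_iff Re_exp Im_exp)
  have cs: "continuous_on UNIV (\<lambda>x. g (h x))" "depends_on (UNIV \<times> P) (\<lambda>x. g (h x))" if "continuous_on UNIV g" for g :: "real \<Rightarrow> real"
  proof -
    show "continuous_on UNIV (\<lambda>x. g (h x))" by (rule continuous_on_compose2[OF that h(1)]) simp
    show "depends_on (UNIV \<times> P) (\<lambda>x. g (h x))" using h(2) unfolding depends_on_def by metis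
  qed
  have cV: "(\<integral>\<omega>. iexp (h (\<lambda>i. XV n i \<omega>)) \<partial>M) = Complex (\<integral>\<omega>. cos (h (\<lambda>i. XV n i \<omega>)) \<partial>M) (\<integral>\<omega>. sin (h (\<lambda>i. XV n i \<omega>)) \<partial>M)" for n
    by (rule c) (rule continuous_functional_measurable[OF fP h XVm])
  have cW: "(\<integral>\<omega>. iexp (h (\<lambda>i. XW i \<omega>)) \<partial>M) = Complex (\<integral>\<omega>. cos (h (\<lambda>i. XW i \<omega>)) \<partial>M) (\<integral>\<omega>. sin (h (\<lambda>i. XW i \<omega>)) \<partial>M)"
    by (rule c) (rule continuous_functional_measurable[OF fP h XWm])
  have cc: "continuous_on UNIV (cos :: real \<Rightarrow> real)" "continuous_on UNIV (sin :: real \<Rightarrow> real)" by (intro continuous_intros)+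
  show ?thesis
    unfolding cV cW
    by (intro tendsto_Complex joint_law_limit[OF P cs(1)[OF cc(1)] cs(2)[OF cc(1)], where H=1] joint_law_limit[OF P cs(1)[OF cc(2)] cs(2)[OF cc(2)], where H=1]) auto
qed

text \<open>Only rational times are tested, so the event is measurable; continuity of the paths
  extends the bound to all times in \<open>path_boundedD\<close>.\<close>

definition path_bounded :: "real \<Rightarrow> nat \<Rightarrow> 'a set" where
  "path_bounded T K = {\<omega>\<in>space M. \<forall>q\<in>\<rat> \<inter> {0..T}. \<bar>B q \<omega>\<bar> \<le> real K}"

lemma path_bounded_sets: "path_bounded T K \<in> sets M"
proof -
  have c: "countable (\<rat> \<inter> {0..T::real})" using countable_rat by (rule countable_subset[rotated]) auto
  have "(\<Union>q\<in>\<rat> \<inter> {0..T}. {\<omega>\<in>space M. \<not> \<bar>B q \<omega>\<bar> \<le> real K}) \<in> sets M"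
  proof (rule sets.countable_UN''[OF c])
    fix q assume "q \<in> \<rat> \<inter> {0..T}"
    then have [measurable]: "B q \<in> borel_measurable M" by (intro B_measurable) auto
    show "{\<omega>\<in>space M. \<not> \<bar>B q \<omega>\<bar> \<le> real K} \<in> sets M" by measurable
  qed
  moreover have "path_bounded T K = space M - (\<Union>q\<in>\<rat> \<inter> {0..T}. {\<omega>\<in>space M. \<not> \<bar>B q \<omega>\<bar> \<le> real K})"
    unfolding path_bounded_def by auto
  ultimately show ?thesis by auto
qed

lemma path_boundedD:
  assumes "\<omega> \<in> path_bounded T K" "0 \<le> s" "s \<le> T"
  shows "\<bar>B s \<omega>\<bar> \<le> real K"
proof (cases "T = 0")
  case True
  then show ?thesis using assms unfolding path_bounded_def by auto
next
  case False
  then have T: "0 < T" using assms by simp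
  have w: "\<omega> \<in> space M" using assms(1) unfolding path_bounded_def by simp
  have cl: "s \<in> closure (\<rat> \<inter> {0..T})"
  proof -
    have "\<exists>y\<in>\<rat> \<inter> {0..T}. dist y s < e" if "e > 0" for e
    proof -
      have "max 0 (s - e) < min T (s + e)" using that T assms by auto
      then obtain r where "r \<in> \<rat>" "max 0 (s - e) < r" "r < min T (s + e)" using Rats_dense_in_real by blast
      then show ?thesis by (intro bexI[of _ r]) (auto simp: dist_real_def)
    qed
    then show ?thesis unfolding closure_approachable by blast
  qed
  have "continuous_on (closure (\<rat> \<inter> {0..T})) (\<lambda>t. \<bar>B t \<omega>\<bar>)"
  proof (rule continuous_on_rabs, rule continuous_on_subset[OF B_continuous[OF w]])
    have "closure (\<rat> \<inter> {0..T}) \<subseteq> {0..T}" by (rule closure_minimal) auto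
    then show "closure (\<rat> \<inter> {0..T}) \<subseteq> {0..}" by auto
  qed
  from continuous_le_on_closure[OF this _ , of s "real K"] show ?thesis
    using assms(1) cl unfolding path_bounded_def by auto
qed

lemma path_bounded_prob:
  assumes "e > 0"
  obtains K where "K \<ge> 1" "prob (space M - path_bounded T K) < e"
proof -
  have "(\<lambda>K. prob (path_bounded T K)) \<longlonglongrightarrow> prob (\<Union>K. path_bounded T K)"
    by (rule finite_Lim_measure_incseq) (auto simp: incseq_def path_bounded_def intro!: path_bounded_sets[unfolded path_bounded_def] intro: order_trans)
  also have "(\<Union>K. path_bounded T K) = space M"
  proof
    show "space M \<subseteq> (\<Union>K. path_bounded T K)"
    proof
      fix \<omega> assume w: "\<omega> \<in> space M"
      have "compact ((\<lambda>t. B t \<omega>) ` {0..T})"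
        by (rule compact_continuous_image[OF continuous_on_subset[OF B_continuous[OF w]]]) auto
      then obtain b where b: "\<forall>y\<in>(\<lambda>t. B t \<omega>) ` {0..T}. norm y \<le> b" using compact_imp_bounded bounded_iff by metis
      obtain K :: nat where "b \<le> real K" using real_arch_simple by blast
      have "\<bar>B q \<omega>\<bar> \<le> real K" if "q \<in> \<rat> \<inter> {0..T}" for q
      proof -
        have "norm (B q \<omega>) \<le> b" using b that by blast
        then show ?thesis using \<open>b \<le> real K\<close> by simp
      qed
      then have "\<omega> \<in> path_bounded T K" using w unfolding path_bounded_def by blast
      then show "\<omega> \<in> (\<Union>K. path_bounded T K)" by blast
    qed
  qed (auto simp: path_bounded_def)
  finally have "(\<lambda>K. prob (path_bounded T K)) \<longlonglongrightarrow> 1" by (simp add: prob_space)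
  then have "\<forall>\<^sub>F K in sequentially. prob (path_bounded T K) > 1 - e" using assms by (intro order_tendstoD) auto
  then obtain K where K: "\<forall>k\<ge>K. prob (path_bounded T k) > 1 - e" unfolding eventually_sequentially by blast
  have "prob (space M - path_bounded T (max 1 K)) = 1 - prob (path_bounded T (max 1 K))" by (rule prob_compl[OF path_bounded_sets])
  also have "\<dots> < e" using K[rule_format, of "max 1 K"] by simp
  finally show thesis by (intro that[of "max 1 K"]) auto
qed

text \<open>The variance at time 0 is 0, so the path starts at 0 only almost surely. This allows
  \<open>f 0\<close> in the limit in place of f at the starting value.\<close>

lemma B_0: "AE \<omega> in M. B 0 \<omega> = 0"
proof -
  have "centered_gaussian M (\<lambda>\<omega>. \<Sum>t\<in>{0}. 1 * B t \<omega>) (\<Sum>s\<in>{0}. \<Sum>t\<in>{0}. 1 * 1 * K10 s t)" by (rule gaussian_finite) auto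
  then show ?thesis by (simp add: centered_gaussian_def K10_eq)
qed

end

section \<open>Distance in L1 between Simpson sums and frozen sums\<close>

context truncated
begin

lemma \<phi>_B_measurable: "k \<le> 20 \<Longrightarrow> s \<ge> 0 \<Longrightarrow> (\<lambda>\<omega>. \<phi> k (B s \<omega>)) \<in> borel_measurable M"
  by (rule measurable_compose[OF B_measurable \<phi>_measurable])

text \<open>The grid ends at most 1/n before t, and the mean-square increment of B over that gap is
  of order n^(-1/5), smaller than \<open>sn n\<close>.\<close>

lemma endpoint_negligible: "negligible (\<lambda>n \<omega>. \<phi> 0 (B (real (N n) / real n) \<omega>) - \<phi> 0 (B t \<omega>))"
proof (rule negligible_L2[where c="C\<^sup>2 * normal_abs_moment 2"])
  fix n :: nat assume n: "n \<ge> 1"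
  have pos: "real (N n) / real n \<ge> 0" by simp
  show m[measurable]: "(\<lambda>\<omega>. \<phi> 0 (B (real (N n) / real n) \<omega>) - \<phi> 0 (B t \<omega>)) \<in> borel_measurable M"
    by (intro borel_measurable_diff \<phi>_B_measurable pos t) auto
  have le: "(\<phi> 0 x - \<phi> 0 y)\<^sup>2 \<le> C\<^sup>2 * (x - y)\<^sup>2" for x y
  proof -
    have "\<bar>\<phi> 0 x - \<phi> 0 y\<bar> \<le> C * \<bar>x - y\<bar>"
    proof -
      have "norm (\<phi> 0 x - \<phi> 0 y) \<le> C * norm (x - y)"
      proof (rule field_differentiable_bound[of UNIV _ "\<phi> 1"])
        show "(\<phi> 0 has_field_derivative \<phi> 1 z) (at z within UNIV)" for z
          using bounded_derivsD(1)[OF \<phi>, of 0 z] by simp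
        show "norm (\<phi> 1 z) \<le> C" for z using bounded_derivsD(2)[OF \<phi>, of 1 z] by simp
      qed auto
      then show ?thesis by simp
    qed
    then have "\<bar>\<phi> 0 x - \<phi> 0 y\<bar>\<^sup>2 \<le> (C * \<bar>x - y\<bar>)\<^sup>2" by (rule power_mono) simp
    then show ?thesis by (simp add: power_mult_distrib)
  qed
  note i = B_difference_moment[OF pos t]
  show int: "integrable M (\<lambda>\<omega>. (\<phi> 0 (B (real (N n) / real n) \<omega>) - \<phi> 0 (B t \<omega>))\<^sup>2)"
  proof (rule Bochner_Integration.integrable_bound)
    show "integrable M (\<lambda>\<omega>. C\<^sup>2 * (B (real (N n) / real n) \<omega> - B t \<omega>)\<^sup>2)" using i(1) by simp
    show "AE \<omega> in M. norm ((\<phi> 0 (B (real (N n) / real n) \<omega>) - \<phi> 0 (B t \<omega>))\<^sup>2) \<le> norm (C\<^sup>2 * (B (real (N n) / real n) \<omega> - B t \<omega>)\<^sup>2)"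
      using le by (intro AE_I2) simp
  qed measurable
  have d: "\<bar>real (N n) / real n - t\<bar> \<le> 1 / real n"
  proof -
    have nt: "real n * t \<ge> 0" using t by simp
    have "real (N n) = of_int \<lfloor>real n * t\<rfloor>" unfolding N_def using nt by simp
    then have "\<bar>real (N n) - real n * t\<bar> \<le> 1" by linarith
    moreover have "real (N n) / real n - t = (real (N n) - real n * t) / real n" using n by (simp add: field_simps)
    ultimately show ?thesis using n by (simp add: divide_right_mono)
  qed
  have m0: "normal_abs_moment 2 \<ge> 0"
    unfolding xi_moment(2)[of 1 0 2, OF order_refl, symmetric] by (rule integral_nonneg_AE) simp
  have "(\<integral>\<omega>. (\<phi> 0 (B (real (N n) / real n) \<omega>) - \<phi> 0 (B t \<omega>))\<^sup>2 \<partial>M) \<le> (\<integral>\<omega>. C\<^sup>2 * (B (real (N n) / real n) \<omega> - B t \<omega>)\<^sup>2 \<partial>M)"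
    using i(1) le by (intro integral_mono int) auto
  also have "\<dots> = C\<^sup>2 * normal_abs_moment 2 * \<bar>real (N n) / real n - t\<bar> powr (1/5)" using i(2) by simp
  also have "\<dots> \<le> C\<^sup>2 * normal_abs_moment 2 * (1 / real n) powr (1/5)"
    using m0 d by (intro mult_left_mono powr_mono2) auto
  also have "\<dots> \<le> C\<^sup>2 * normal_abs_moment 2 * sn n"
  proof (rule mult_left_mono)
    have "(1 / real n) powr (1/5) = real n powr (-1/5)" using n by (simp add: powr_divide powr_minus_divide)
    also have "\<dots> \<le> real n powr (-1/10)" using n by (intro powr_mono) auto
    finally show "(1 / real n) powr (1/5) \<le> sn n" unfolding sn_def by simp
  qed (use m0 in auto)
  finally show "(\<integral>\<omega>. (\<phi> 0 (B (real (N n) / real n) \<omega>) - \<phi> 0 (B t \<omega>))\<^sup>2 \<partial>M) \<le> C\<^sup>2 * normal_abs_moment 2 * sn n" .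
qed

lemma simpson_measurable: "simpson n \<in> borel_measurable M"
proof -
  have p: "\<phi> 1 \<in> borel_measurable borel" by (rule \<phi>_measurable) simp
  have b: "B (real j / real n) \<in> borel_measurable M" for j by (rule B_measurable) simp
  note measurable_compose[OF b p, measurable] measurable_compose[OF midB_measurable p, measurable] b[measurable]
  show ?thesis unfolding simpson_def[abs_def] by measurable
qed

lemma Wc_measurable: "m \<ge> 1 \<Longrightarrow> Wc m n \<in> borel_measurable M"
  unfolding Wc_def[abs_def] using t
  by (intro borel_measurable_sum borel_measurable_times borel_measurable_diff \<phi>_B_measurable V_measurable) auto

text \<open>m is chosen so that the G term of \<open>coarse_approximation\<close> lies below the
  square of \<open>\<eta>\<close>; everything else vanishes as n grows with m fixed.\<close>

lemma simpson_coarse_L1: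
  assumes \<eta>: "\<eta> > 0"
  shows "\<exists>m0. \<forall>m\<ge>m0. \<forall>\<^sub>F n in sequentially.
    integrable M (\<lambda>\<omega>. simpson n \<omega> - (\<phi> 0 (B t \<omega>) - \<phi> 0 (B 0 \<omega>) + 1/2880 * Wc m n \<omega>)) \<and>
    (\<integral>\<omega>. \<bar>simpson n \<omega> - (\<phi> 0 (B t \<omega>) - \<phi> 0 (B 0 \<omega>) + 1/2880 * Wc m n \<omega>)\<bar> \<partial>M) \<le> \<eta>"
proof -
  define R where "R n \<omega> = simpson n \<omega> - (\<phi> 0 (B (real (N n) / real n) \<omega>) - \<phi> 0 (B 0 \<omega>)) - 1/2880 * Wf n \<omega> + (\<phi> 0 (B (real (N n) / real n) \<omega>) - \<phi> 0 (B t \<omega>))" for n \<omega>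
  have R: "negligible R" unfolding R_def[abs_def] by (rule negligible_add[OF simpson_expansion endpoint_negligible])
  obtain G where G: "G \<ge> 0" "\<And>m. m \<ge> 1 \<Longrightarrow> \<exists>G2\<ge>0. \<forall>n\<ge>1. integrable M (\<lambda>\<omega>. (Wf n \<omega> - Wc m n \<omega>)\<^sup>2) \<and>
     (\<integral>\<omega>. (Wf n \<omega> - Wc m n \<omega>)\<^sup>2 \<partial>M) \<le> G * (t / real m + 1 / real n) powr (1/5) + G2 * sn n"
    by (rule coarse_approximation) (rule that)
  have lim: "(\<lambda>m. G * (t / real m) powr (1/5)) \<longlonglongrightarrow> G * 0 powr (1/5)"
    using t by (intro tendsto_intros tendsto_powr' lim_const_over_n) auto
  have "\<forall>\<^sub>F m in sequentially. m \<ge> 1 \<and> G * (t / real m) powr (1/5) < \<eta>\<^sup>2"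
    using \<eta> by (intro eventually_conj eventually_ge_at_top order_tendstoD(2)[OF lim]) auto
  then obtain m0 where m0: "\<And>m. m \<ge> m0 \<Longrightarrow> m \<ge> 1 \<and> G * (t / real m) powr (1/5) < \<eta>\<^sup>2" unfolding eventually_sequentially by blast
  show ?thesis
  proof (intro exI[of _ m0] allI impI)
    fix m assume "m \<ge> m0"
    with m0 have m: "m \<ge> 1" and mG: "G * (t / real m) powr (1/5) < \<eta>\<^sup>2" by auto
    obtain G2 where G2: "G2 \<ge> 0" "\<And>n. n \<ge> 1 \<Longrightarrow> integrable M (\<lambda>\<omega>. (Wf n \<omega> - Wc m n \<omega>)\<^sup>2)"
      "\<And>n. n \<ge> 1 \<Longrightarrow> (\<integral>\<omega>. (Wf n \<omega> - Wc m n \<omega>)\<^sup>2 \<partial>M) \<le> G * (t / real m + 1 / real n) powr (1/5) + G2 * sn n"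
      using G(2)[OF m] by blast
    have l2: "(\<lambda>n. G * (t / real m + 1 / real n) powr (1/5) + G2 * sn n) \<longlonglongrightarrow> G * (t / real m + 0) powr (1/5) + G2 * 0"
      using t by (intro tendsto_intros tendsto_powr' lim_const_over_n sn_tendsto_0) auto
    have e1: "\<forall>\<^sub>F n in sequentially. G * (t / real m + 1 / real n) powr (1/5) + G2 * sn n < \<eta>\<^sup>2"
      using mG by (intro order_tendstoD(2)[OF l2]) simp
    have e2: "\<forall>\<^sub>F n in sequentially. (\<integral>\<omega>. \<bar>R n \<omega>\<bar> \<partial>M) < \<eta> / 2"
      using R \<eta> unfolding negligible_def by (intro order_tendstoD(2)[of _ 0]) auto
    show "\<forall>\<^sub>F n in sequentially. integrable M (\<lambda>\<omega>. simpson n \<omega> - (\<phi> 0 (B t \<omega>) - \<phi> 0 (B 0 \<omega>) + 1/2880 * Wc m n \<omega>)) \<and>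
      (\<integral>\<omega>. \<bar>simpson n \<omega> - (\<phi> 0 (B t \<omega>) - \<phi> 0 (B 0 \<omega>) + 1/2880 * Wc m n \<omega>)\<bar> \<partial>M) \<le> \<eta>"
      using e1 e2 eventually_ge_at_top[of 1]
    proof eventually_elim
      case (elim n)
      then have n: "n \<ge> 1" by simp
      have D: "simpson n \<omega> - (\<phi> 0 (B t \<omega>) - \<phi> 0 (B 0 \<omega>) + 1/2880 * Wc m n \<omega>) = R n \<omega> + 1/2880 * (Wf n \<omega> - Wc m n \<omega>)" for \<omega>
        unfolding R_def by (simp add: diff_divide_distrib)
      have Ri: "integrable M (R n)" using R n unfolding negligible_def by blast
      have Rm: "R n \<in> borel_measurable M" using Ri by simp
      have Dm: "(\<lambda>\<omega>. simpson n \<omega> - (\<phi> 0 (B t \<omega>) - \<phi> 0 (B 0 \<omega>) + 1/2880 * Wc m n \<omega>)) \<in> borel_measurable M"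
        using t by (intro borel_measurable_diff borel_measurable_add borel_measurable_times borel_measurable_const simpson_measurable Wc_measurable m \<phi>_B_measurable) auto
      \<comment> \<open>Young's inequality with parameter \<open>\<eta>\<close> converts a second
        moment below \<open>\<eta>\<close>^2 into a first moment below \<open>\<eta>\<close>; 5760
        is 2 * 2880.\<close>
      define Z where "Z \<omega> = \<bar>R n \<omega>\<bar> + (\<eta> + (Wf n \<omega> - Wc m n \<omega>)\<^sup>2 / \<eta>) / 5760" for \<omega>
      have y: "\<bar>y\<bar> \<le> (\<eta> + y\<^sup>2 / \<eta>) / 2" for y :: real
      proof -
        have "0 \<le> (\<bar>y\<bar> - \<eta>)\<^sup>2" by simp
        then have "2 * \<bar>y\<bar> * \<eta> \<le> \<eta>\<^sup>2 + y\<^sup>2" by (simp add: power2_diff)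
        then show ?thesis using \<eta> by (simp add: field_simps power2_eq_square)
      qed
      have le: "\<bar>simpson n \<omega> - (\<phi> 0 (B t \<omega>) - \<phi> 0 (B 0 \<omega>) + 1/2880 * Wc m n \<omega>)\<bar> \<le> Z \<omega>" for \<omega>
      proof -
        have "\<bar>r + 1/2880 * x\<bar> \<le> \<bar>r\<bar> + (\<eta> + x\<^sup>2 / \<eta>) / 5760" for r x :: real
        proof -
          have g: "p \<le> q + z / 2880 \<Longrightarrow> z \<le> w / 2 \<Longrightarrow> p \<le> q + w / 5760" for p q z w :: real by linarith
          have "\<bar>r + 1/2880 * x\<bar> \<le> \<bar>r\<bar> + \<bar>x\<bar> / 2880" using abs_triangle_ineq[of r "1/2880 * x"] by (simp add: abs_mult)
          from g[OF this y] show ?thesis .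
        qed
        then show ?thesis unfolding D Z_def by blast
      qed
      have Zi: "integrable M Z" unfolding Z_def[abs_def] using Ri G2(2)[OF n] by simp
      have int: "integrable M (\<lambda>\<omega>. simpson n \<omega> - (\<phi> 0 (B t \<omega>) - \<phi> 0 (B 0 \<omega>) + 1/2880 * Wc m n \<omega>))"
      proof (rule Bochner_Integration.integrable_bound[OF Zi Dm])
        show "AE \<omega> in M. norm (simpson n \<omega> - (\<phi> 0 (B t \<omega>) - \<phi> 0 (B 0 \<omega>) + 1/2880 * Wc m n \<omega>)) \<le> norm (Z \<omega>)"
          unfolding real_norm_def by (intro AE_I2) (rule order_trans[OF le abs_ge_self])
      qed
      have "(\<integral>\<omega>. \<bar>simpson n \<omega> - (\<phi> 0 (B t \<omega>) - \<phi> 0 (B 0 \<omega>) + 1/2880 * Wc m n \<omega>)\<bar> \<partial>M) \<le> (\<integral>\<omega>. Z \<omega> \<partial>M)"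
        by (rule integral_mono[OF integrable_abs[OF int] Zi le])
      also have "\<dots> = (\<integral>\<omega>. \<bar>R n \<omega>\<bar> \<partial>M) + (\<eta> + (\<integral>\<omega>. (Wf n \<omega> - Wc m n \<omega>)\<^sup>2 \<partial>M) / \<eta>) / 5760"
        unfolding Z_def using Ri G2(2)[OF n] by (simp add: prob_space)
      also have "\<dots> \<le> \<eta> / 2 + (\<eta> + \<eta>\<^sup>2 / \<eta>) / 5760"
        using elim(1,2) G2(3)[OF n] \<eta> by (intro add_mono divide_right_mono) auto
      also have "\<dots> \<le> \<eta>" using \<eta> by (simp add: power2_eq_square)
      finally show ?case using int by blast
    qed
  qed
qed

end

section \<open>Passage from frozen sums to the Ito integral\<close>

context simpson_limit
begin

definition Zc :: "(nat \<Rightarrow> real \<Rightarrow> real) \<Rightarrow> real \<Rightarrow> nat \<Rightarrow> 'a \<Rightarrow> real" where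
  "Zc \<phi> s m \<omega> = (\<Sum>i<m. \<phi> 5 (B (real i * s / real m) \<omega>) * (beta10 * W (real (Suc i) * s / real m) \<omega> - beta10 * W (real i * s / real m) \<omega>))"

lemma truncatedI: "bounded_derivs 20 \<phi> C \<Longrightarrow> s \<ge> 0 \<Longrightarrow> truncated M B \<phi> C s"
  by (intro truncated.intro fbm10_axioms truncated_axioms.intro)

text \<open>Both integrands are the same continuous functional \<open>H\<close> of finitely many
  coordinates, evaluated at (B, \<open>V n\<close>) and at (B, \<open>beta10 * W\<close>), so this
  is an instance of \<open>iexp_joint_law_limit\<close>.\<close>

lemma coarse_char_limit:
  fixes \<tau> a b :: "'k::finite \<Rightarrow> real"
  assumes \<phi>: "bounded_derivs 20 \<phi> C" and \<tau>: "\<And>k. \<tau> k \<ge> 0" and m: "m \<ge> 1"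
  shows "(\<lambda>n. \<integral>\<omega>. iexp (\<Sum>k\<in>UNIV. a k * B (\<tau> k) \<omega> + b k * (\<phi> 0 (B (\<tau> k) \<omega>) - \<phi> 0 (B 0 \<omega>) + 1/2880 * truncated.Wc B \<phi> (\<tau> k) m n \<omega>)) \<partial>M)
    \<longlonglongrightarrow> (\<integral>\<omega>. iexp (\<Sum>k\<in>UNIV. a k * B (\<tau> k) \<omega> + b k * (\<phi> 0 (B (\<tau> k) \<omega>) - \<phi> 0 (B 0 \<omega>) + 1/2880 * Zc \<phi> (\<tau> k) m \<omega>)) \<partial>M)"
proof -
  define H :: "(bool \<times> real \<Rightarrow> real) \<Rightarrow> real" where
    "H x = (\<Sum>k\<in>UNIV. a k * x (True, \<tau> k) + b k * (\<phi> 0 (x (True, \<tau> k)) - \<phi> 0 (x (True, 0)) + 1/2880 *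
       (\<Sum>i<m. \<phi> 5 (x (True, real i * \<tau> k / real m)) * (x (False, real (Suc i) * \<tau> k / real m) - x (False, real i * \<tau> k / real m)))))" for x
  define P where "P = insert 0 (range \<tau>) \<union> (\<Union>k. (\<lambda>i. real i * \<tau> k / real m) ` {..m})"
  have P: "finite P" "P \<subseteq> {0..}" unfolding P_def using \<tau> by auto
  have mem: "0 \<in> P" "\<tau> k \<in> P" "i \<le> m \<Longrightarrow> real i * \<tau> k / real m \<in> P" for k i unfolding P_def by blast+
  have c: "continuous_on UNIV (\<lambda>x::bool \<times> real \<Rightarrow> real. x i)" for i by (rule continuous_on_product_coordinates)
  have c\<phi>: "continuous_on UNIV (\<lambda>x::bool \<times> real \<Rightarrow> real. \<phi> k (x i))" if "k \<le> 20" for k i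
    by (rule continuous_on_compose2[OF bounded_derivsD(3)[OF \<phi> that] c]) simp
  have c0: "continuous_on UNIV (\<lambda>x::bool \<times> real \<Rightarrow> real. \<phi> 0 (x i))" for i by (rule c\<phi>) simp
  have c5: "continuous_on UNIV (\<lambda>x::bool \<times> real \<Rightarrow> real. \<phi> 5 (x i))" for i by (rule c\<phi>) simp
  have Hc: "continuous_on UNIV H"
    unfolding H_def[abs_def]
    by (intro continuous_on_sum continuous_on_add continuous_on_mult continuous_on_diff continuous_on_const c0 c5 c)
  have Hd: "depends_on (UNIV \<times> P) H"
    unfolding depends_on_def
  proof (intro allI impI)
    fix x y :: "bool \<times> real \<Rightarrow> real" assume "\<forall>i\<in>UNIV \<times> P. x i = y i"
    then have e: "x (e, p) = y (e, p)" if "p \<in> P" for e p using that by blast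
    have "(\<Sum>i<m. \<phi> 5 (x (True, real i * \<tau> k / real m)) * (x (False, real (Suc i) * \<tau> k / real m) - x (False, real i * \<tau> k / real m)))
      = (\<Sum>i<m. \<phi> 5 (y (True, real i * \<tau> k / real m)) * (y (False, real (Suc i) * \<tau> k / real m) - y (False, real i * \<tau> k / real m)))" for k
    proof (rule sum.cong[OF refl])
      fix i assume "i \<in> {..<m}"
      then have i: "i \<le> m" "Suc i \<le> m" by auto
      show "\<phi> 5 (x (True, real i * \<tau> k / real m)) * (x (False, real (Suc i) * \<tau> k / real m) - x (False, real i * \<tau> k / real m))
        = \<phi> 5 (y (True, real i * \<tau> k / real m)) * (y (False, real (Suc i) * \<tau> k / real m) - y (False, real i * \<tau> k / real m))"
        by (simp only: e[OF mem(3)[OF i(1)]] e[OF mem(3)[OF i(2)]])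
    qed
    then show "H x = H y" unfolding H_def by (simp only: e[OF mem(1)] e[OF mem(2)])
  qed
  have HV: "H (\<lambda>i. XV n i \<omega>) = (\<Sum>k\<in>UNIV. a k * B (\<tau> k) \<omega> + b k * (\<phi> 0 (B (\<tau> k) \<omega>) - \<phi> 0 (B 0 \<omega>) + 1/2880 * truncated.Wc B \<phi> (\<tau> k) m n \<omega>))" for n \<omega>
    unfolding H_def XV_def truncated.Wc_def[OF truncatedI[OF \<phi> \<tau>]] by (simp only: fst_conv snd_conv if_True if_False)
  have HW: "H (\<lambda>i. XW i \<omega>) = (\<Sum>k\<in>UNIV. a k * B (\<tau> k) \<omega> + b k * (\<phi> 0 (B (\<tau> k) \<omega>) - \<phi> 0 (B 0 \<omega>) + 1/2880 * Zc \<phi> (\<tau> k) m \<omega>))" for \<omega>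
    unfolding H_def XW_def Zc_def by (simp only: fst_conv snd_conv if_True if_False)
  show ?thesis using iexp_joint_law_limit[OF P Hc Hd] unfolding HV HW .
qed

text \<open>On this event all grid values up to T lie in [-K, K], and so do the means of two
  neighbours; there the truncated derivative coincides with that of f.\<close>

lemma simpson_sum_eq:
  assumes \<phi>: "bounded_derivs 20 \<phi> C" and agree: "\<And>k x. k \<le> 20 \<Longrightarrow> \<bar>x\<bar> < real K + 1 \<Longrightarrow> \<phi> k x = (deriv ^^ k) f x"
    and w: "\<omega> \<in> path_bounded T K" and s: "0 \<le> s" "s \<le> T" and n: "n \<ge> 1"
  shows "simpson_sum f B n s \<omega> = truncated.simpson B \<phi> s n \<omega>"
proof -
  have d: "deriv f x = \<phi> 1 x" if "\<bar>x\<bar> \<le> real K" for x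
    using agree[of 1 x] that by simp
  show ?thesis
    unfolding simpson_sum_def truncated.simpson_def[OF truncatedI[OF \<phi> s(1)]] truncated.N_def[OF truncatedI[OF \<phi> s(1)]]
  proof (rule sum.cong[OF refl])
    fix j assume "j \<in> {..<nat \<lfloor>real n * s\<rfloor>}"
    then have "int (Suc j) \<le> \<lfloor>real n * s\<rfloor>" by auto
    then have "real (Suc j) \<le> real n * s" by (simp add: le_floor_iff)
    then have "real (Suc j) / real n \<le> s" using n by (simp add: divide_le_eq mult.commute)
    then have j: "real (Suc j) / real n \<le> T" using s by linarith
    have "real j / real n \<le> real (Suc j) / real n" by (intro divide_right_mono) auto
    then have j': "real j / real n \<le> T" using j by linarith
    have b: "\<bar>B (real j / real n) \<omega>\<bar> \<le> real K" "\<bar>B (real (Suc j) / real n) \<omega>\<bar> \<le> real K"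
      by (rule path_boundedD[OF w _ j'], simp) (rule path_boundedD[OF w _ j], simp)
    have g: "\<bar>p\<bar> \<le> c \<Longrightarrow> \<bar>q\<bar> \<le> c \<Longrightarrow> \<bar>(p + q) / 2\<bar> \<le> c" for p q c :: real by (simp add: abs_le_iff)
    from d[OF g[OF b]] show "(1/6) * (deriv f (B (real j / real n) \<omega>) + 4 * deriv f ((B (real j / real n) \<omega> + B (real (Suc j) / real n) \<omega>) / 2)
         + deriv f (B (real (Suc j) / real n) \<omega>)) * (B (real (Suc j) / real n) \<omega> - B (real j / real n) \<omega>)
      = (1/6) * (\<phi> 1 (B (real j / real n) \<omega>) + 4 * \<phi> 1 (midB n j \<omega>) + \<phi> 1 (B (real (Suc j) / real n) \<omega>))
         * (B (real (Suc j) / real n) \<omega> - B (real j / real n) \<omega>)"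
      unfolding midB_def mid_def by (simp only: d[OF b(1)] d[OF b(2)])
  qed
qed

lemma Zc_eq:
  assumes agree: "\<And>k x. k \<le> 20 \<Longrightarrow> \<bar>x\<bar> < real K + 1 \<Longrightarrow> \<phi> k x = (deriv ^^ k) f x"
    and w: "\<omega> \<in> path_bounded T K" and s: "0 \<le> s" "s \<le> T"
  shows "Zc \<phi> s m \<omega> = beta10 * (\<Sum>i<m. (deriv ^^ 5) f (B (real i * s / real m) \<omega>) * (W (real (Suc i) * s / real m) \<omega> - W (real i * s / real m) \<omega>))"
  unfolding Zc_def sum_distrib_left
proof (rule sum.cong[OF refl])
  fix i assume i: "i \<in> {..<m}"
  have "real i * s / real m \<le> s"
  proof -
    have "real i * s \<le> real m * s" using i s by (intro mult_right_mono) auto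
    then show ?thesis using i by (simp add: divide_le_eq mult.commute)
  qed
  then have "\<bar>B (real i * s / real m) \<omega>\<bar> \<le> real K" using s by (intro path_boundedD[OF w]) auto
  then have "\<phi> 5 (B (real i * s / real m) \<omega>) = (deriv ^^ 5) f (B (real i * s / real m) \<omega>)" by (intro agree) auto
  then show "\<phi> 5 (B (real i * s / real m) \<omega>) * (beta10 * W (real (Suc i) * s / real m) \<omega> - beta10 * W (real i * s / real m) \<omega>)
    = beta10 * ((deriv ^^ 5) f (B (real i * s / real m) \<omega>) * (W (real (Suc i) * s / real m) \<omega> - W (real i * s / real m) \<omega>))"
    by (simp add: algebra_simps)
qed

lemma deriv_measurable: "(deriv ^^ k) f \<in> borel_measurable borel"
  by (rule borel_measurable_continuous_onI[OF ck_continuous[OF ck_smooth[OF smooth]]])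

lemma f_B_measurable: "s \<ge> 0 \<Longrightarrow> (\<lambda>\<omega>. (deriv ^^ k) f (B s \<omega>)) \<in> borel_measurable M"
  by (rule measurable_compose[OF B_measurable deriv_measurable])

lemma simpson_sum_measurable: "simpson_sum f B n s \<in> borel_measurable M"
proof -
  have p: "deriv f \<in> borel_measurable borel" using deriv_measurable[of 1] by simp
  have b: "B (real j / real n) \<in> borel_measurable M" for j by (rule B_measurable) simp
  note b[measurable]
  have mb: "(\<lambda>\<omega>. (B (real j / real n) \<omega> + B (real (Suc j) / real n) \<omega>) / 2) \<in> borel_measurable M" for j by measurable
  note measurable_compose[OF b p, measurable] measurable_compose[OF mb p, measurable]
  show ?thesis unfolding simpson_sum_def[abs_def] by measurable
qed

end

context simpson_limit
begin

text \<open>Three comparisons: Simpson sums with frozen sums in L1, frozen sums with their limit in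
  law, and Riemann sums with the Ito integral in probability. The choices depend on each other in
  the order K, truncation, m, n: the truncation is built from K, m must suit the truncation, and n
  must suit m.\<close>

lemma limit_char:
  fixes \<tau> a b :: "'k::finite \<Rightarrow> real"
  assumes \<tau>: "\<And>k. \<tau> k \<ge> 0"
    and ito: "\<And>k. is_ito_integral M (\<lambda>s \<omega>. (deriv ^^ 5) f (B s \<omega>)) W (\<tau> k) (I (\<tau> k))"
  shows "(\<lambda>n. \<integral>\<omega>. iexp (\<Sum>k\<in>UNIV. a k * B (\<tau> k) \<omega> + b k * simpson_sum f B n (\<tau> k) \<omega>) \<partial>M)
    \<longlonglongrightarrow> (\<integral>\<omega>. iexp (\<Sum>k\<in>UNIV. a k * B (\<tau> k) \<omega> + b k * (f (B (\<tau> k) \<omega>) - f 0 + beta10 / (2^5 * 90) * I (\<tau> k) \<omega>)) \<partial>M)"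
proof (rule LIMSEQ_I)
  fix e :: real assume e: "e > 0"
  define T where "T = Max (range \<tau>)"
  have T: "\<tau> k \<le> T" for k unfolding T_def by simp
  define bb where "bb = (\<Sum>k\<in>UNIV. \<bar>b k\<bar>) + 1"
  have bb0: "(\<Sum>k\<in>UNIV. \<bar>b k\<bar>) \<ge> 0" by (intro sum_nonneg) simp
  then have bb: "bb > 0" "(\<Sum>k\<in>UNIV. \<bar>b k\<bar>) \<le> bb" unfolding bb_def by linarith+
  \<comment> \<open>The three comparisons cost 3 d, d and 5 d, together less than e.\<close>
  define d where "d = e / 20"
  have d: "d > 0" unfolding d_def using e by simp
  \<comment> \<open>One tolerance for two uses: multiplied by the sum of |b k| it stays within d,
    with or without the factor from \<open>beta10\<close>. The added ones keep the denominator
    positive.\<close>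
  define \<eta> where "\<eta> = d / (bb * (1 + \<bar>beta10\<bar>))"
  have \<eta>: "\<eta> > 0" unfolding \<eta>_def using d bb(1) by (intro divide_pos_pos mult_pos_pos) auto
  have \<eta>_eq: "bb * (\<eta> * (1 + \<bar>beta10\<bar>)) = d"
  proof -
    have g: "p > 0 \<Longrightarrow> q > 0 \<Longrightarrow> p * (d / (p * q) * q) = d" for p q :: real by simp
    have "1 + \<bar>beta10\<bar> > 0" by linarith
    from g[OF bb(1) this] show ?thesis unfolding \<eta>_def .
  qed
  define d' where "d' = d / real CARD('k)"
  have d': "d' > 0" "real CARD('k) * d' = d" unfolding d'_def using d by auto
  obtain K where K: "K \<ge> 1" "prob (space M - path_bounded T K) < d" by (rule path_bounded_prob[OF d])
  obtain \<phi> C where \<phi>: "bounded_derivs 20 \<phi> C" and agree: "\<And>k x. k \<le> 20 \<Longrightarrow> \<bar>x\<bar> < real K + 1 \<Longrightarrow> \<phi> k x = (deriv ^^ k) f x"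
    by (rule smooth_truncation[OF smooth, of "real K + 1" 20]) (use that in auto)
  note tr = truncatedI[OF \<phi> \<tau>]
  define S where "S k n \<omega> = truncated.simpson B \<phi> (\<tau> k) n \<omega>" for k n \<omega>
  define D where "D k m n \<omega> = S k n \<omega> - (\<phi> 0 (B (\<tau> k) \<omega>) - \<phi> 0 (B 0 \<omega>) + 1/2880 * truncated.Wc B \<phi> (\<tau> k) m n \<omega>)" for k m n \<omega>
  define RS where "RS k m \<omega> = (\<Sum>i<m. (deriv ^^ 5) f (B (real i * \<tau> k / real m) \<omega>) * (W (real (Suc i) * \<tau> k / real m) \<omega> - W (real i * \<tau> k / real m) \<omega>))" for k m \<omega>
  have "\<exists>m0. \<forall>m\<ge>m0. \<forall>\<^sub>F n in sequentially. integrable M (D k m n) \<and> (\<integral>\<omega>. \<bar>D k m n \<omega>\<bar> \<partial>M) \<le> \<eta>" for k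
    unfolding D_def[abs_def] S_def by (rule truncated.simpson_coarse_L1[OF tr \<eta>])
  then obtain m0 where m0: "\<And>k m. m \<ge> m0 k \<Longrightarrow> \<forall>\<^sub>F n in sequentially. integrable M (D k m n) \<and> (\<integral>\<omega>. \<bar>D k m n \<omega>\<bar> \<partial>M) \<le> \<eta>" by metis
  have "(\<lambda>m. prob {\<omega>\<in>space M. \<bar>RS k m \<omega> - I (\<tau> k) \<omega>\<bar> > \<eta>}) \<longlonglongrightarrow> 0" for k
    using ito[of k] \<eta> unfolding is_ito_integral_def conv_in_prob_def RS_def by blast
  then have "\<forall>\<^sub>F m in sequentially. prob {\<omega>\<in>space M. \<bar>RS k m \<omega> - I (\<tau> k) \<omega>\<bar> > \<eta>} < d'" for k
    by (rule order_tendstoD(2)) (rule d')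
  then have "\<forall>\<^sub>F m in sequentially. \<forall>k. prob {\<omega>\<in>space M. \<bar>RS k m \<omega> - I (\<tau> k) \<omega>\<bar> > \<eta>} < d'"
    by (simp add: eventually_all_finite)
  moreover have "\<forall>\<^sub>F m in sequentially. m \<ge> max 1 (Max (range m0))" by (rule eventually_ge_at_top)
  ultimately have "\<forall>\<^sub>F m in sequentially. (\<forall>k. prob {\<omega>\<in>space M. \<bar>RS k m \<omega> - I (\<tau> k) \<omega>\<bar> > \<eta>} < d') \<and> m \<ge> max 1 (Max (range m0))"
    by (rule eventually_conj)
  then obtain m where m: "\<And>k. prob {\<omega>\<in>space M. \<bar>RS k m \<omega> - I (\<tau> k) \<omega>\<bar> > \<eta>} < d'" and mm: "m \<ge> max 1 (Max (range m0))"
    unfolding eventually_sequentially by blast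
  have m1: "m \<ge> 1" and mk: "m \<ge> m0 k" for k
  proof -
    show "m \<ge> 1" using mm by simp
    have "m0 k \<le> Max (range m0)" by simp
    then show "m \<ge> m0 k" using mm by simp
  qed
  have ev1: "\<forall>\<^sub>F n in sequentially. \<forall>k. integrable M (D k m n) \<and> (\<integral>\<omega>. \<bar>D k m n \<omega>\<bar> \<partial>M) \<le> \<eta>"
    using m0[OF mk] by (simp add: eventually_all_finite)
  define X where "X n \<omega> = (\<Sum>k\<in>UNIV. a k * B (\<tau> k) \<omega> + b k * simpson_sum f B n (\<tau> k) \<omega>)" for n \<omega>
  define X' where "X' n \<omega> = (\<Sum>k\<in>UNIV. a k * B (\<tau> k) \<omega> + b k * (\<phi> 0 (B (\<tau> k) \<omega>) - \<phi> 0 (B 0 \<omega>) + 1/2880 * truncated.Wc B \<phi> (\<tau> k) m n \<omega>))" for n \<omega>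
  define Y' where "Y' \<omega> = (\<Sum>k\<in>UNIV. a k * B (\<tau> k) \<omega> + b k * (\<phi> 0 (B (\<tau> k) \<omega>) - \<phi> 0 (B 0 \<omega>) + 1/2880 * Zc \<phi> (\<tau> k) m \<omega>))" for \<omega>
  define Y where "Y \<omega> = (\<Sum>k\<in>UNIV. a k * B (\<tau> k) \<omega> + b k * (f (B (\<tau> k) \<omega>) - f 0 + beta10 / (2^5 * 90) * I (\<tau> k) \<omega>))" for \<omega>
  have Im: "I (\<tau> k) \<in> borel_measurable M" for k using ito unfolding is_ito_integral_def by blast
  have Bm: "B (\<tau> k) \<in> borel_measurable M" for k by (rule B_measurable[OF \<tau>])
  have \<phi>m: "(\<lambda>\<omega>. \<phi> j (B s \<omega>)) \<in> borel_measurable M" if "j \<le> 20" "s \<ge> 0" for j s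
    by (rule truncated.\<phi>_B_measurable[OF truncatedI[OF \<phi> that(2)] that])
  have fm: "(\<lambda>\<omega>. f (B (\<tau> k) \<omega>)) \<in> borel_measurable M" for k using f_B_measurable[OF \<tau>[of k], of 0] by simp
  have grid0: "real i * \<tau> k / real m \<ge> 0" for i k using \<tau>[of k] by simp
  have RSm[measurable]: "RS k m \<in> borel_measurable M" for k
    unfolding RS_def[abs_def]
    by (intro borel_measurable_sum borel_measurable_times borel_measurable_diff f_B_measurable W_measurable grid0)
  have Zm: "Zc \<phi> (\<tau> k) m \<in> borel_measurable M" for k
    unfolding Zc_def[abs_def]
    by (intro borel_measurable_sum borel_measurable_times borel_measurable_diff borel_measurable_const \<phi>m W_measurable grid0) simp
  have Xm: "X n \<in> borel_measurable M" for n unfolding X_def[abs_def]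
    by (intro borel_measurable_sum borel_measurable_add borel_measurable_times borel_measurable_const simpson_sum_measurable Bm)
  have Xm': "X' n \<in> borel_measurable M" for n unfolding X'_def[abs_def]
    by (intro borel_measurable_sum borel_measurable_add borel_measurable_diff borel_measurable_times borel_measurable_const truncated.Wc_measurable[OF tr m1] Bm \<phi>m \<tau>) auto
  have Ym': "Y' \<in> borel_measurable M" unfolding Y'_def[abs_def]
    by (intro borel_measurable_sum borel_measurable_add borel_measurable_diff borel_measurable_times borel_measurable_const Zm Bm \<phi>m \<tau>) auto
  have Ym: "Y \<in> borel_measurable M" unfolding Y_def[abs_def]
    by (intro borel_measurable_sum borel_measurable_add borel_measurable_diff borel_measurable_times borel_measurable_const Im Bm fm)
  have ev2: "\<forall>\<^sub>F n in sequentially. dist (\<integral>\<omega>. iexp (X' n \<omega>) \<partial>M) (\<integral>\<omega>. iexp (Y' \<omega>) \<partial>M) < d"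
    unfolding X'_def Y'_def by (rule tendstoD[OF coarse_char_limit[OF \<phi> \<tau> m1, where a=a and b=b] d])
  define E where "E = path_bounded T K - (\<Union>k. {\<omega>\<in>space M. \<bar>RS k m \<omega> - I (\<tau> k) \<omega>\<bar> > \<eta>})"
  have bad: "{\<omega>\<in>space M. \<bar>RS k m \<omega> - I (\<tau> k) \<omega>\<bar> > \<eta>} \<in> sets M" for k using Im[of k] by measurable
  have E: "E \<in> sets M" unfolding E_def by (intro sets.Diff path_bounded_sets sets.finite_UN finite bad)
  have probE: "prob (space M - E) \<le> 2 * d"
  proof -
    have "space M - E \<subseteq> (space M - path_bounded T K) \<union> (\<Union>k. {\<omega>\<in>space M. \<bar>RS k m \<omega> - I (\<tau> k) \<omega>\<bar> > \<eta>})" unfolding E_def by blast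
    then have "prob (space M - E) \<le> prob ((space M - path_bounded T K) \<union> (\<Union>k. {\<omega>\<in>space M. \<bar>RS k m \<omega> - I (\<tau> k) \<omega>\<bar> > \<eta>}))"
      by (intro finite_measure_mono sets.Un sets.Diff path_bounded_sets sets.finite_UN finite bad sets.top)
    also have "\<dots> \<le> prob (space M - path_bounded T K) + prob (\<Union>k. {\<omega>\<in>space M. \<bar>RS k m \<omega> - I (\<tau> k) \<omega>\<bar> > \<eta>})"
      by (intro measure_Un_le sets.Diff path_bounded_sets sets.finite_UN finite bad sets.top)
    also have "prob (\<Union>k. {\<omega>\<in>space M. \<bar>RS k m \<omega> - I (\<tau> k) \<omega>\<bar> > \<eta>}) \<le> (\<Sum>k\<in>UNIV. prob {\<omega>\<in>space M. \<bar>RS k m \<omega> - I (\<tau> k) \<omega>\<bar> > \<eta>})"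
      using bad by (intro finite_measure_subadditive_finite finite) auto
    also have "\<dots> \<le> (\<Sum>k\<in>(UNIV::'k set). d')" by (intro sum_mono less_imp_le m)
    also have "\<dots> = d" using d'(2) by simp
    finally show ?thesis using K(2) by linarith
  qed
  have Y_close: "norm ((\<integral>\<omega>. iexp (Y' \<omega>) \<partial>M) - (\<integral>\<omega>. iexp (Y \<omega>) \<partial>M)) \<le> 2 * prob (space M - E) + (\<integral>\<omega>. d \<partial>M)"
  proof (rule iexp_expectation_diff[OF Ym' Ym _ _ E])
    show "AE \<omega> in M. \<omega> \<in> E \<longrightarrow> \<bar>Y' \<omega> - Y \<omega>\<bar> \<le> d"
      using B_0
    proof eventually_elim
      case (elim \<omega>)
      show ?case
      proof
        assume w: "\<omega> \<in> E"
        then have wp: "\<omega> \<in> path_bounded T K" unfolding E_def by blast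
        have r: "\<bar>RS k m \<omega> - I (\<tau> k) \<omega>\<bar> \<le> \<eta>" for k
        proof -
          have "\<omega> \<in> space M" using wp unfolding path_bounded_def by blast
          moreover have "\<omega> \<notin> {\<omega>\<in>space M. \<bar>RS k m \<omega> - I (\<tau> k) \<omega>\<bar> > \<eta>}" using w unfolding E_def by blast
          ultimately have "\<not> \<bar>RS k m \<omega> - I (\<tau> k) \<omega>\<bar> > \<eta>" by blast
          then show ?thesis by (rule leI)
        qed
        have f0: "\<phi> 0 (B s \<omega>) = f (B s \<omega>)" if "0 \<le> s" "s \<le> T" for s
          using agree[of 0 "B s \<omega>"] path_boundedD[OF wp that] by simp
        have f00: "\<phi> 0 (B 0 \<omega>) = f 0" using agree[of 0 0] elim by simp
        have "Y' \<omega> - Y \<omega> = (\<Sum>k\<in>UNIV. b k * (beta10 / 2880 * (RS k m \<omega> - I (\<tau> k) \<omega>)))"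
          unfolding Y'_def Y_def sum_subtractf[symmetric]
        proof (rule sum.cong[OF refl])
          fix k
          have z: "Zc \<phi> (\<tau> k) m \<omega> = beta10 * RS k m \<omega>" unfolding RS_def by (rule Zc_eq[OF agree wp \<tau> T])
          show "a k * B (\<tau> k) \<omega> + b k * (\<phi> 0 (B (\<tau> k) \<omega>) - \<phi> 0 (B 0 \<omega>) + 1/2880 * Zc \<phi> (\<tau> k) m \<omega>)
              - (a k * B (\<tau> k) \<omega> + b k * (f (B (\<tau> k) \<omega>) - f 0 + beta10 / (2^5 * 90) * I (\<tau> k) \<omega>))
            = b k * (beta10 / 2880 * (RS k m \<omega> - I (\<tau> k) \<omega>))"
            unfolding z f0[OF \<tau> T] f00 by (simp add: algebra_simps)
        qed
        then have "\<bar>Y' \<omega> - Y \<omega>\<bar> \<le> (\<Sum>k\<in>UNIV. \<bar>b k * (beta10 / 2880 * (RS k m \<omega> - I (\<tau> k) \<omega>))\<bar>)" by (simp only: sum_abs)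
        also have "\<dots> \<le> (\<Sum>k\<in>UNIV. \<bar>b k\<bar> * (\<eta> * (1 + \<bar>beta10\<bar>)))"
        proof (rule sum_mono)
          fix k
          have "\<bar>beta10 / 2880\<bar> * \<bar>RS k m \<omega> - I (\<tau> k) \<omega>\<bar> \<le> (1 + \<bar>beta10\<bar>) * \<eta>"
            using r by (intro mult_mono) auto
          then show "\<bar>b k * (beta10 / 2880 * (RS k m \<omega> - I (\<tau> k) \<omega>))\<bar> \<le> \<bar>b k\<bar> * (\<eta> * (1 + \<bar>beta10\<bar>))"
            unfolding abs_mult by (intro mult_left_mono) (simp_all only: mult.commute abs_ge_zero)
        qed
        also have "\<dots> = (\<Sum>k\<in>UNIV. \<bar>b k\<bar>) * (\<eta> * (1 + \<bar>beta10\<bar>))" by (rule sum_distrib_right[symmetric])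
        also have "\<dots> \<le> bb * (\<eta> * (1 + \<bar>beta10\<bar>))" using bb(2) \<eta> by (intro mult_right_mono) auto
        also have "\<dots> = d" by (rule \<eta>_eq)
        finally show "\<bar>Y' \<omega> - Y \<omega>\<bar> \<le> d" .
      qed
    qed
  qed (use d in auto)
  have Y_close': "norm ((\<integral>\<omega>. iexp (Y' \<omega>) \<partial>M) - (\<integral>\<omega>. iexp (Y \<omega>) \<partial>M)) \<le> 5 * d"
    using Y_close probE by (simp add: prob_space)
  have "\<forall>\<^sub>F n in sequentially. norm ((\<integral>\<omega>. iexp (X n \<omega>) \<partial>M) - (\<integral>\<omega>. iexp (Y \<omega>) \<partial>M)) < e"
    using ev1 ev2 eventually_ge_at_top[of 1]
  proof eventually_elim
    case (elim n)
    then have n: "n \<ge> 1" and Di: "\<And>k. integrable M (D k m n)" and DL: "\<And>k. (\<integral>\<omega>. \<bar>D k m n \<omega>\<bar> \<partial>M) \<le> \<eta>" by auto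
    define Z where "Z \<omega> = (\<Sum>k\<in>UNIV. \<bar>b k\<bar> * \<bar>D k m n \<omega>\<bar>)" for \<omega>
    have Zi: "integrable M Z" unfolding Z_def[abs_def]
      by (intro Bochner_Integration.integrable_sum integrable_mult_right integrable_abs Di)
    have "norm ((\<integral>\<omega>. iexp (X n \<omega>) \<partial>M) - (\<integral>\<omega>. iexp (X' n \<omega>) \<partial>M)) \<le> 2 * prob (space M - path_bounded T K) + (\<integral>\<omega>. Z \<omega> \<partial>M)"
    proof (rule iexp_expectation_diff[OF Xm Xm' Zi _ path_bounded_sets])
      show "Z \<omega> \<ge> 0" for \<omega> unfolding Z_def by (intro sum_nonneg) simp
      show "AE \<omega> in M. \<omega> \<in> path_bounded T K \<longrightarrow> \<bar>X n \<omega> - X' n \<omega>\<bar> \<le> Z \<omega>"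
      proof (intro AE_I2 impI)
        fix \<omega> assume w: "\<omega> \<in> path_bounded T K"
        have "X n \<omega> - X' n \<omega> = (\<Sum>k\<in>UNIV. b k * D k m n \<omega>)"
          unfolding X_def X'_def sum_subtractf[symmetric]
        proof (rule sum.cong[OF refl])
          fix k
          have s: "simpson_sum f B n (\<tau> k) \<omega> = S k n \<omega>" unfolding S_def by (rule simpson_sum_eq[OF \<phi> agree w \<tau> T n])
          show "a k * B (\<tau> k) \<omega> + b k * simpson_sum f B n (\<tau> k) \<omega>
             - (a k * B (\<tau> k) \<omega> + b k * (\<phi> 0 (B (\<tau> k) \<omega>) - \<phi> 0 (B 0 \<omega>) + 1/2880 * truncated.Wc B \<phi> (\<tau> k) m n \<omega>)) = b k * D k m n \<omega>"
            unfolding s D_def by (simp only: right_diff_distrib add_diff_cancel_left)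
        qed
        then show "\<bar>X n \<omega> - X' n \<omega>\<bar> \<le> Z \<omega>" unfolding Z_def abs_mult[symmetric] by (simp only: sum_abs)
      qed
    qed
    also have "(\<integral>\<omega>. Z \<omega> \<partial>M) = (\<Sum>k\<in>UNIV. \<bar>b k\<bar> * (\<integral>\<omega>. \<bar>D k m n \<omega>\<bar> \<partial>M))"
      unfolding Z_def using Di by (subst Bochner_Integration.integral_sum) auto
    also have "2 * prob (space M - path_bounded T K) + (\<Sum>k\<in>UNIV. \<bar>b k\<bar> * (\<integral>\<omega>. \<bar>D k m n \<omega>\<bar> \<partial>M)) \<le> 2 * d + d"
    proof (rule add_mono)
      have "(\<Sum>k\<in>UNIV. \<bar>b k\<bar> * (\<integral>\<omega>. \<bar>D k m n \<omega>\<bar> \<partial>M)) \<le> (\<Sum>k\<in>UNIV. \<bar>b k\<bar> * \<eta>)"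
        by (intro sum_mono mult_left_mono DL) simp
      also have "\<dots> = (\<Sum>k\<in>UNIV. \<bar>b k\<bar>) * \<eta>" by (rule sum_distrib_right[symmetric])
      also have "\<dots> \<le> bb * (\<eta> * (1 + \<bar>beta10\<bar>))"
      proof (rule mult_mono[OF bb(2)])
        have "\<eta> * 1 \<le> \<eta> * (1 + \<bar>beta10\<bar>)" using \<eta> by (intro mult_left_mono) auto
        then show "\<eta> \<le> \<eta> * (1 + \<bar>beta10\<bar>)" by simp
      qed (use bb \<eta> in auto)
      also have "\<dots> = d" by (rule \<eta>_eq)
      finally show "(\<Sum>k\<in>UNIV. \<bar>b k\<bar> * (\<integral>\<omega>. \<bar>D k m n \<omega>\<bar> \<partial>M)) \<le> d" .
    qed (use K(2) in simp)
    finally have 1: "norm ((\<integral>\<omega>. iexp (X n \<omega>) \<partial>M) - (\<integral>\<omega>. iexp (X' n \<omega>) \<partial>M)) \<le> 3 * d" by simp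
    have tri: "norm (p - s) < e" if "norm (p - q) \<le> 3 * d" "dist q r < d" "norm (r - s) \<le> 5 * d" for p q r s :: complex
    proof -
      have "dist p s \<le> dist p q + dist q r + dist r s" using dist_triangle[of p s q] dist_triangle[of q s r] by linarith
      then show ?thesis using that d unfolding dist_norm d_def by linarith
    qed
    show ?case by (rule tri[OF 1 elim(2) Y_close'])
  qed
  then show "\<exists>no. \<forall>n\<ge>no. norm ((\<integral>\<omega>. iexp (\<Sum>k\<in>UNIV. a k * B (\<tau> k) \<omega> + b k * simpson_sum f B n (\<tau> k) \<omega>) \<partial>M)
    - (\<integral>\<omega>. iexp (\<Sum>k\<in>UNIV. a k * B (\<tau> k) \<omega> + b k * (f (B (\<tau> k) \<omega>) - f 0 + beta10 / (2^5 * 90) * I (\<tau> k) \<omega>)) \<partial>M)) < e"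
    unfolding X_def Y_def eventually_sequentially .
qed

end

text \<open>The two vectors are merged into one family indexed by \<open>bool \<times> 'k\<close>,
  whose characteristic functions converge by \<open>limit_char\<close>;
  \<open>levy_continuity_functional\<close> then covers every bounded continuous test function. A
  one-element \<open>'k\<close> is the case of a single time.\<close>

theorem theorem3p3:
  fixes M :: "'a measure"
    and f :: "real \<Rightarrow> real"
    and B W I :: "real \<Rightarrow> 'a \<Rightarrow> real"
    and \<tau> :: "'k::finite \<Rightarrow> real"
  assumes smooth: "smooth_real f"
    and growth: "\<forall>k. moderate_growth ((deriv ^^ k) f)"
    and fBm: "fbm (1/10) M B"
    and BM: "fbm (1/2) M W"
    and indep: "indep_processes M B W"
    and ito: "\<forall>t\<ge>0. is_ito_integral M (\<lambda>s \<omega>. (deriv ^^ 5) f (B s \<omega>)) W t (I t)"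
    and tau: "\<forall>k. \<tau> k \<ge> 0"
  shows "conv_in_law M
           (\<lambda>n \<omega>. ((\<chi> k. B (\<tau> k) \<omega>) :: real^'k, (\<chi> k. simpson_sum f B n (\<tau> k) \<omega>) :: real^'k))
           (\<lambda>\<omega>. ((\<chi> k. B (\<tau> k) \<omega>) :: real^'k,
                  (\<chi> k. f (B (\<tau> k) \<omega>) - f 0 + beta10 / (2^5 * 90) * I (\<tau> k) \<omega>) :: real^'k))"
proof -
  interpret gaussian_process M B "fbm_cov (1/10)" by (rule fbm_gaussian_process[OF fBm])
  interpret simpson_limit M B W f
  proof unfold_locales
    show "continuous_on {0..} (\<lambda>t. B t \<omega>)" if "\<omega> \<in> space M" for \<omega> using fBm that unfolding fbm_def by blast
  qed (rule BM indep smooth)+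
  define XX where "XX n i = (if fst i then B (\<tau> (snd i)) else simpson_sum f B n (\<tau> (snd i)))" for n and i :: "bool \<times> 'k"
  define YY where "YY i = (if fst i then B (\<tau> (snd i)) else (\<lambda>\<omega>. f (B (\<tau> (snd i)) \<omega>) - f 0 + beta10 / (2^5 * 90) * I (\<tau> (snd i)) \<omega>))" for i :: "bool \<times> 'k"
  have \<tau>: "\<tau> k \<ge> 0" for k using tau by blast
  have itoI: "is_ito_integral M (\<lambda>s \<omega>. (deriv ^^ 5) f (B s \<omega>)) W (\<tau> k) (I (\<tau> k))" for k using ito \<tau> by blast
  have s: "(\<Sum>i\<in>UNIV. g i) = (\<Sum>k\<in>UNIV. g (True, k) + g (False, k))" for g :: "bool \<times> 'k \<Rightarrow> real"
  proof -
    have "(\<Sum>i\<in>UNIV. g i) = (\<Sum>e\<in>UNIV. \<Sum>k\<in>UNIV. g (e, k))" by (simp add: sum.cartesian_product)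
    then show ?thesis by (simp add: UNIV_bool sum.distrib)
  qed
  have Im: "I (\<tau> k) \<in> borel_measurable M" for k using itoI unfolding is_ito_integral_def by blast
  have fm: "(\<lambda>\<omega>. f (B (\<tau> k) \<omega>)) \<in> borel_measurable M" for k using f_B_measurable[OF \<tau>[of k], of 0] by simp
  show ?thesis
    unfolding conv_in_law_def
  proof (intro allI impI)
    fix h :: "(real^'k) \<times> (real^'k) \<Rightarrow> real" assume h: "continuous_on UNIV h \<and> bounded (range h)"
    then obtain H where H: "\<And>z. \<bar>h z\<bar> \<le> H" unfolding bounded_iff by auto
    define h' :: "(bool \<times> 'k \<Rightarrow> real) \<Rightarrow> real" where "h' x = h (\<chi> k. x (True, k), \<chi> k. x (False, k))" for x
    have hc: "continuous_on UNIV h'"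
      unfolding h'_def[abs_def]
      by (rule continuous_on_compose2[OF conjunct1[OF h]])
        (intro continuous_on_Pair continuous_on_vec_lambda continuous_on_product_coordinates, simp)
    have "(\<lambda>n. \<integral>\<omega>. h' (\<lambda>i. XX n i \<omega>) \<partial>M) \<longlonglongrightarrow> (\<integral>\<omega>. h' (\<lambda>i. YY i \<omega>) \<partial>M)"
    proof (rule levy_continuity_functional[where I=UNIV and H=H and h=h' and Xn=XX and X=YY])
      show "XX n i \<in> borel_measurable M" for n i
        unfolding XX_def by (cases "fst i") (simp_all add: simpson_sum_measurable B_measurable \<tau>)
      show "YY i \<in> borel_measurable M" for i
      proof -
        note fm[measurable] Im[measurable]
        have "(\<lambda>\<omega>. f (B (\<tau> k) \<omega>) - f 0 + beta10 / (2^5 * 90) * I (\<tau> k) \<omega>) \<in> borel_measurable M" for k by measurable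
        then show ?thesis unfolding YY_def using B_measurable[OF \<tau>] by (cases "fst i") simp_all
      qed
      show "continuous_on UNIV h'" by (rule hc)
      show "depends_on UNIV h'" unfolding depends_on_def by (metis UNIV_I ext)
      show "\<bar>h' x\<bar> \<le> H" for x unfolding h'_def by (rule H)
      fix u :: "bool \<times> 'k \<Rightarrow> real"
      show "(\<lambda>n. \<integral>\<omega>. iexp (\<Sum>i\<in>UNIV. u i * XX n i \<omega>) \<partial>M) \<longlonglongrightarrow> (\<integral>\<omega>. iexp (\<Sum>i\<in>UNIV. u i * YY i \<omega>) \<partial>M)"
        unfolding s XX_def YY_def fst_conv snd_conv if_True if_False
        by (rule limit_char[where \<tau>=\<tau> and I=I and a="\<lambda>k. u (True, k)" and b="\<lambda>k. u (False, k)", OF \<tau> itoI])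
    qed (simp_all add: prob_space_axioms)
    then show "(\<lambda>n. \<integral>\<omega>. h ((\<chi> k. B (\<tau> k) \<omega>), (\<chi> k. simpson_sum f B n (\<tau> k) \<omega>)) \<partial>M)
      \<longlonglongrightarrow> (\<integral>\<omega>. h ((\<chi> k. B (\<tau> k) \<omega>), (\<chi> k. f (B (\<tau> k) \<omega>) - f 0 + beta10 / (2^5 * 90) * I (\<tau> k) \<omega>)) \<partial>M)"
      unfolding h'_def XX_def YY_def by simp
  qed
qed

end
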